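(* For a process $u\in C^0_2(\Theta)$, the following are equivalent: (i) $u$ is a pathwise $\mathbb P_\sigma$-submartingale (resp. supermartingale); (ii) $u$ is a $\mathbb P_\sigma$-viscosity subsolution (resp. supersolution) of the path-dependent heat equation $-\mathcal Lu(t,\omega)=0$, $t<T$, $\omega\in\Omega$.
   Context: Setting. Fix $T>0$, $d\ge 1$. $\Omega=\{\omega\in C([0,T];\mathbb R^d):\omega_0=0\}$, $\Theta=[0,T]\times\Omega$, $B$ is the canonical process on $\Omega$, $\mathbb F=(\mathcal F_t)_{0\le t\le T}$ its canonical filtration. $\mathcal T$ is the set of $\mathbb F$-stopping times with values in $[0,T]$; for $\mathrm h\in\mathcal T$, $\mathcal T_{\mathrm h}$ (resp. $\mathcal T^+_{\mathrm h}$) is the set of $\tau\in\mathcal T$ with values in $[0,\mathrm h]$ (resp. $(0,\mathrm h]$). $\|\omega\|_t=\sup_{s\le t}|\omega_s|$, and $C^0(\Theta,E)$ is the set of $E$-valued processes continuous for the pseudo-distance $|t-t'|+\|\omega_{t\wedge\cdot}-\omega'_{t'\wedge\cdot}\|_T$ on $\Theta$ ($E=\mathbb R$ is omitted). $\mathbb L^0(\mathbb F)$: real-valued $\mathbb F$-progressively measurable processes. Shifts. $(\omega\otimes_t\omega')_s=\omega_s\mathbf 1_{[0,t]}(s)+(\omega_t+\omega'_{s-t})\mathbf 1_{(t,T]}(s)$; $X^{t,\omega}_s(\omega')=X_{t+s}(\omega\otimes_t\omega')$, $0\le s\le T-t$. Standing assumption on $\sigma$. $\sigma:\Theta\to\mathbb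 R^{d\times d}$ is continuous in $t$ and $|\sigma_t(\omega)-\sigma_t(\omega')|\le C\|\omega-\omega'\|_t$ for all $t,\omega,\omega'$, for some $C\ge0$. Measures. $\mathbb P_\sigma$ is the law on $\Omega$ of the unique strong solution $X$ of $dX_t=\sigma_t(X)dW_t$, $X_0=0$, $W$ a Brownian motion; $\mathbb P_{\sigma^{t,\omega}}$ is defined in the same way with the shifted coefficient $\sigma^{t,\omega}$ on the time interval $[0,T-t]$. Space $C^0_2(\Theta)$: all $u\in C^0(\Theta)$ such that for all $(t,\omega)\in\Theta$, $u^{t,\omega}\in\mathbb L^0(\mathbb F)$ is continuous in time $\mathbb P_{\sigma^{t,\omega}}$-a.s. and $\mathbb E^{\mathbb P_{\sigma^{t,\omega}}}[\sup_{0\le s\le T-t}|u^{t,\omega}_s|^2]<\infty$. Smooth processes. $u\in C^{1,2}(\Theta)$ if $u\in C^0(\Theta)$ and there are $\Lambda\in C^0(\Theta,\mathbb R)$, $Z\in C^0(\Theta,\mathbb R^d)$ such that for each $(t,\omega)$, $u^{t,\omega}_s-u_t(\omega)=\int_0^s\Lambda^{t,\omega}_rdr+\int_0^sZ^{t,\omega}_r\cdot dB_r$ for all $s\in[0,T-t]$, $\mathbb P_{\sigma^{t,\omega}}$-a.s.; then $\mathcal Lu:=\Lambda$, $\partial_\omega u:=Z$. $\mathbb P_\sigma$-viscosity solutions (the case $L=0$ of $\mathcal P_L$-viscosity solutions). $\underline{\mathcal A}_0u_t(\omega)$ (resp. $\overline{\mathcal A}_0u_t(\omega)$) is the set of $\varphi\in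 C^{1,2}(\Theta)$ such that, for some $\mathrm h\in\mathcal T^+_{T-t}$, $(\varphi-u)_t(\omega)$ equals $\min_{\tau\in\mathcal T_{\mathrm h}}\mathbb E^{\mathbb P_{\sigma^{t,\omega}}}[(\varphi-u)^{t,\omega}_\tau]$ (resp. $\max_{\tau\in\mathcal T_{\mathrm h}}\mathbb E^{\mathbb P_{\sigma^{t,\omega}}}[(\varphi-u)^{t,\omega}_\tau]$). $u\in C^0(\Theta)$ is a $\mathbb P_\sigma$-viscosity subsolution (resp. supersolution) of the heat equation if for every $(t,\omega)\in[0,T)\times\Omega$, $-\mathcal L\varphi_t(\omega)\le0$ for all $\varphi\in\underline{\mathcal A}_0u_t(\omega)$ (resp. $\ge0$ for all $\varphi\in\overline{\mathcal A}_0u_t(\omega)$). Pathwise semimartingales. $u$ is a pathwise $\mathbb P_\sigma$-submartingale (resp. supermartingale) if $u_t(\omega)\le$ (resp. $\ge$) $\mathbb E^{\mathbb P_{\sigma^{t,\omega}}}[u^{t,\omega}_\tau]$ for any $(t,\omega)\in\Theta$ and $\tau\in\mathcal T_{T-t}$. *)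

theory Defs
  imports "HOL-Probability.Probability"
begin

section \<open>Path space, canonical filtration, stopping times\<close>

type_synonym 'd path = "real \<Rightarrow> real ^ 'd"

text \<open>Paths are only relevant on [0,T]; membership in \<open>extensional\<close> makes each path of
  C([0,T]; R^d) have exactly one representative.\<close>

definition Omega :: "real \<Rightarrow> ('d::finite) path set" where
  "Omega T = {\<omega>. \<omega> \<in> extensional {0..T} \<and> continuous_on {0..T} \<omega> \<and> \<omega> 0 = 0}"

definition natural_filtration ::
    "'a set \<Rightarrow> real \<Rightarrow> (real \<Rightarrow> 'a \<Rightarrow> 'b::topological_space) \<Rightarrow> real \<Rightarrow> 'a measure" where
  "natural_filtration S T Y t =
     sigma S {Y s -` A \<inter> S | s A. 0 \<le> s \<and> s \<le> t \<and> s \<le> T \<and> A \<in> sets borel}"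

definition canonical_process :: "real \<Rightarrow> ('d::finite) path \<Rightarrow> real ^ 'd" where
  "canonical_process s \<omega> = \<omega> s"

definition canonical_filtration :: "real \<Rightarrow> real \<Rightarrow> ('d::finite) path measure" where
  "canonical_filtration T = natural_filtration (Omega T) T canonical_process"

definition stopping_times :: "real \<Rightarrow> (('d::finite) path \<Rightarrow> real) set" where
  "stopping_times T =
     {\<tau>. stopping_time (canonical_filtration T) \<tau> \<and> (\<forall>\<omega>\<in>Omega T. 0 \<le> \<tau> \<omega> \<and> \<tau> \<omega> \<le> T)}"

definition stopping_times_upto ::
    "real \<Rightarrow> (('d::finite) path \<Rightarrow> real) \<Rightarrow> ('d path \<Rightarrow> real) set" where
  "stopping_times_upto T h = {\<tau> \<in> stopping_times T. \<forall>\<omega>\<in>Omega T. \<tau> \<omega> \<le> h \<omega>}"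

definition pos_stopping_times_upto ::
    "real \<Rightarrow> (('d::finite) path \<Rightarrow> real) \<Rightarrow> ('d path \<Rightarrow> real) set" where
  "pos_stopping_times_upto T h =
     {\<tau> \<in> stopping_times T. \<forall>\<omega>\<in>Omega T. 0 < \<tau> \<omega> \<and> \<tau> \<omega> \<le> h \<omega>}"

section \<open>Continuity on Theta and shifts\<close>

definition path_norm :: "real \<Rightarrow> ('d::finite) path \<Rightarrow> real" where
  "path_norm t \<omega> = (SUP s\<in>{0..t}. norm (\<omega> s))"

definition theta_dist ::
    "real \<Rightarrow> real \<Rightarrow> ('d::finite) path \<Rightarrow> real \<Rightarrow> 'd path \<Rightarrow> real" where
  "theta_dist T t \<omega> t' \<omega>' = \<bar>t - t'\<bar> + path_norm T (\<lambda>s. \<omega> (min t s) - \<omega>' (min t' s))"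

definition C0 :: "real \<Rightarrow> (real \<Rightarrow> ('d::finite) path \<Rightarrow> 'e::real_normed_vector) set" where
  "C0 T = {u. \<forall>t\<in>{0..T}. \<forall>\<omega>\<in>Omega T. \<forall>\<epsilon>>0. \<exists>\<delta>>0. \<forall>t'\<in>{0..T}. \<forall>\<omega>'\<in>Omega T.
      theta_dist T t \<omega> t' \<omega>' < \<delta> \<longrightarrow> norm (u t \<omega> - u t' \<omega>') < \<epsilon>}"

definition concat_path ::
    "real \<Rightarrow> real \<Rightarrow> ('d::finite) path \<Rightarrow> 'd path \<Rightarrow> 'd path" where
  "concat_path T t \<omega> \<omega>' = (\<lambda>s\<in>{0..T}. if s \<le> t then \<omega> s else \<omega> t + \<omega>' (s - t))"

definition shift_process ::
    "real \<Rightarrow> real \<Rightarrow> ('d::finite) path \<Rightarrow> (real \<Rightarrow> 'd path \<Rightarrow> 'e) \<Rightarrow> real \<Rightarrow> 'd path \<Rightarrow> 'e" where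
  "shift_process T t \<omega> Y s \<omega>' = Y (t + s) (concat_path T t \<omega> \<omega>')"

definition admissible_coeff ::
    "real \<Rightarrow> (real \<Rightarrow> ('d::finite) path \<Rightarrow> real ^ 'd ^ 'd) \<Rightarrow> bool" where
  "admissible_coeff T \<sigma> \<longleftrightarrow>
     (\<forall>\<omega>\<in>Omega T. continuous_on {0..T} (\<lambda>t. \<sigma> t \<omega>)) \<and>
     (\<exists>C\<ge>0. \<forall>t\<in>{0..T}. \<forall>\<omega>\<in>Omega T. \<forall>\<omega>'\<in>Omega T.
        norm (\<sigma> t \<omega> - \<sigma> t \<omega>') \<le> C * path_norm t (\<lambda>s. \<omega> s - \<omega>' s))"

text \<open>\<open>Y\<close> is F-progressively measurable on the time interval [0,S].\<close>

definition progressive :: "real \<Rightarrow> real \<Rightarrow> (real \<Rightarrow> ('d::finite) path \<Rightarrow> real) \<Rightarrow> bool" where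
  "progressive T S Y \<longleftrightarrow> (\<forall>s\<in>{0..S}.
     (\<lambda>(r, \<omega>). Y r \<omega>) \<in> borel_measurable
        (restrict_space borel {0..s} \<Otimes>\<^sub>M canonical_filtration T s))"

section \<open>Brownian motion and stochastic integrals\<close>

definition brownian_motion ::
    "'a measure \<Rightarrow> real \<Rightarrow> (real \<Rightarrow> 'a \<Rightarrow> real ^ ('d::finite)) \<Rightarrow> bool" where
  "brownian_motion M T W \<longleftrightarrow>
     prob_space M \<and>
     (\<forall>t\<in>{0..T}. W t \<in> borel_measurable M) \<and>
     (\<forall>x\<in>space M. W 0 x = 0 \<and> continuous_on {0..T} (\<lambda>t. W t x)) \<and>
     (\<forall>s t. 0 \<le> s \<and> s < t \<and> t \<le> T \<longrightarrow>
        prob_space.indep_set M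
          (sets (natural_filtration (space M) T W s))
          (sets (vimage_algebra (space M) (\<lambda>x. W t x - W s x) borel)) \<and>
        prob_space.indep_vars M (\<lambda>_. borel) (\<lambda>i x. (W t x - W s x) $ i) UNIV \<and>
        (\<forall>i. distributed M lborel (\<lambda>x. (W t x - W s x) $ i) (normal_density 0 (sqrt (t - s)))))"

definition augmented_filtration ::
    "'a measure \<Rightarrow> real \<Rightarrow> (real \<Rightarrow> 'a \<Rightarrow> 'b::topological_space) \<Rightarrow> real \<Rightarrow> 'a measure" where
  "augmented_filtration M T W t =
     sigma (space M) (sets (natural_filtration (space M) T W t) \<union> null_sets M)"

text \<open>Convergence in probability of the supremum over \<open>J\<close> of the distance. The exceptional
  events are covered by measurable ones, so that no measurability of the supremum is presupposed.\<close>

definition ucp_tendsto ::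
    "'a measure \<Rightarrow> real set \<Rightarrow> (nat \<Rightarrow> real \<Rightarrow> 'a \<Rightarrow> 'e::real_normed_vector) \<Rightarrow>
     (real \<Rightarrow> 'a \<Rightarrow> 'e) \<Rightarrow> bool" where
  "ucp_tendsto M J Yn Y \<longleftrightarrow> (\<forall>\<epsilon>>0. \<exists>A.
     (\<forall>n. A n \<in> sets M \<and> {x \<in> space M. \<exists>s\<in>J. \<epsilon> < norm (Yn n s x - Y s x)} \<subseteq> A n) \<and>
     (\<lambda>n. measure M (A n)) \<longlonglongrightarrow> 0)"

definition simple_predictable ::
    "(real \<Rightarrow> 'a measure) \<Rightarrow> real \<Rightarrow> nat \<Rightarrow> (nat \<Rightarrow> real) \<Rightarrow> (nat \<Rightarrow> 'a \<Rightarrow> 'h::topological_space) \<Rightarrow> bool"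
  where
  "simple_predictable G S k p \<xi> \<longleftrightarrow>
     p 0 = 0 \<and> p k = S \<and> (\<forall>i<k. p i \<le> p (Suc i)) \<and> (\<forall>i<k. \<xi> i \<in> borel_measurable (G (p i)))"

definition simple_process ::
    "nat \<Rightarrow> (nat \<Rightarrow> real) \<Rightarrow> (nat \<Rightarrow> 'a \<Rightarrow> 'h::real_vector) \<Rightarrow> real \<Rightarrow> 'a \<Rightarrow> 'h" where
  "simple_process k p \<xi> r x = (\<Sum>i<k. if p i < r \<and> r \<le> p (Suc i) then \<xi> i x else 0)"

definition simple_integral ::
    "('h \<Rightarrow> 'x::real_vector \<Rightarrow> 'e::real_vector) \<Rightarrow> (real \<Rightarrow> 'a \<Rightarrow> 'x) \<Rightarrow> nat \<Rightarrow> (nat \<Rightarrow> real) \<Rightarrow> (nat \<Rightarrow> 'a \<Rightarrow> 'h) \<Rightarrow>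
     real \<Rightarrow> 'a \<Rightarrow> 'e" where
  "simple_integral prd B k p \<xi> s x =
     (\<Sum>i<k. prd (\<xi> i x) (B (min (p (Suc i)) s) x - B (min (p i) s) x))"

text \<open>\<open>I\<close> is a version with continuous paths of the stochastic integral, on [0,S], of \<open>H\<close>
  against the semimartingale \<open>B\<close> with respect to the filtration \<open>G\<close>. The integral is the
  continuous extension, for uniform convergence in probability, of the elementary integral of
  simple predictable processes. Every adapted \<open>H\<close> with continuous paths, the only case used
  below, is such a limit; \<open>I\<close> is then unique up to indistinguishability. The argument \<open>prd\<close> is
  the product of integrand and increment (\<open>(*v)\<close> for matrix-valued, \<open>inner\<close> for vector-valued
  integrands).\<close>

definition stoch_integral ::
    "('h::real_normed_vector \<Rightarrow> 'x::real_vector \<Rightarrow> 'e::real_normed_vector) \<Rightarrow> 'a measure \<Rightarrow>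
     (real \<Rightarrow> 'a measure) \<Rightarrow> real \<Rightarrow> (real \<Rightarrow> 'a \<Rightarrow> 'x) \<Rightarrow> (real \<Rightarrow> 'a \<Rightarrow> 'h) \<Rightarrow>
     (real \<Rightarrow> 'a \<Rightarrow> 'e) \<Rightarrow> bool" where
  "stoch_integral prd M G S B H I \<longleftrightarrow>
     (\<forall>s\<in>{0..S}. I s \<in> borel_measurable M) \<and>
     (\<forall>x\<in>space M. continuous_on {0..S} (\<lambda>s. I s x)) \<and>
     (\<exists>k p \<xi>. (\<forall>n. simple_predictable G S (k n) (p n) (\<xi> n)) \<and>
        ucp_tendsto M {0<..S} (\<lambda>n. simple_process (k n) (p n) (\<xi> n)) H \<and>
        ucp_tendsto M {0..S} (\<lambda>n. simple_integral prd B (k n) (p n) (\<xi> n)) I)"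

text \<open>\<open>X\<close> is a strong solution of dX = \<sigma>(X) dW, X_0 = 0, on the time interval [0,S]. As all laws
  are to live on the same space \<open>Omega T\<close>, the solution is kept constant on [S,T]. Nothing below
  depends on this choice: stopping times with values in [0,S], and adapted processes
  on [0,S], only see the path on [0,S].\<close>

definition strong_solution ::
    "'a measure \<Rightarrow> (real \<Rightarrow> 'a \<Rightarrow> real ^ 'd) \<Rightarrow> real \<Rightarrow> real \<Rightarrow>
     (real \<Rightarrow> ('d::finite) path \<Rightarrow> real ^ 'd ^ 'd) \<Rightarrow> ('a \<Rightarrow> 'd path) \<Rightarrow> bool" where
  "strong_solution M W T S \<sigma> X \<longleftrightarrow>
     X \<in> measurable M (canonical_filtration T T) \<and>
     (\<forall>s\<in>{0..S}. (\<lambda>x. X x s) \<in> borel_measurable (augmented_filtration M T W s)) \<and>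
     stoch_integral (*v) M (augmented_filtration M T W) S W (\<lambda>r x. \<sigma> r (X x)) (\<lambda>s x. X x s) \<and>
     (\<forall>x\<in>space M. \<forall>s\<in>{S..T}. X x s = X x S)"

section \<open>Smooth processes, viscosity solutions, pathwise semimartingales\<close>

text \<open>In the following, \<open>P t \<omega>\<close> is the law on \<open>Omega T\<close> associated with the coefficient shifted
  by \<open>(t, \<omega>)\<close>.\<close>

type_synonym 'd law_family = "real \<Rightarrow> 'd path \<Rightarrow> 'd path measure"

definition C02 :: "real \<Rightarrow> ('d::finite) law_family \<Rightarrow> (real \<Rightarrow> 'd path \<Rightarrow> real) set" where
  "C02 T P = {u \<in> C0 T. \<forall>t\<in>{0..T}. \<forall>\<omega>\<in>Omega T.
      progressive T (T - t) (shift_process T t \<omega> u) \<and>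
      (AE \<omega>' in P t \<omega>. continuous_on {0..T - t} (\<lambda>s. shift_process T t \<omega> u s \<omega>')) \<and>
      (\<integral>\<^sup>+ \<omega>'. (SUP s\<in>{0..T - t}. ennreal (\<bar>shift_process T t \<omega> u s \<omega>'\<bar>\<^sup>2)) \<partial>P t \<omega>) < \<infinity>}"

definition smooth_decomp ::
    "real \<Rightarrow> ('d::finite) law_family \<Rightarrow> (real \<Rightarrow> 'd path \<Rightarrow> real) \<Rightarrow>
     (real \<Rightarrow> 'd path \<Rightarrow> real) \<Rightarrow> (real \<Rightarrow> 'd path \<Rightarrow> real ^ 'd) \<Rightarrow> bool" where
  "smooth_decomp T P u \<Lambda> Z \<longleftrightarrow>
     \<Lambda> \<in> C0 T \<and> Z \<in> C0 T \<and>
     (\<forall>t\<in>{0..T}. \<forall>\<omega>\<in>Omega T. \<exists>I.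
        stoch_integral inner (P t \<omega>) (canonical_filtration T) (T - t)
          canonical_process (shift_process T t \<omega> Z) I \<and>
        (AE \<omega>' in P t \<omega>. \<forall>s\<in>{0..T - t}.
           shift_process T t \<omega> u s \<omega>' - u t \<omega> = integral {0..s} (\<lambda>r. shift_process T t \<omega> \<Lambda> r \<omega>') + I s \<omega>'))"

definition C12 :: "real \<Rightarrow> ('d::finite) law_family \<Rightarrow> (real \<Rightarrow> 'd path \<Rightarrow> real) set" where
  "C12 T P = {u \<in> C0 T. \<exists>\<Lambda> Z. smooth_decomp T P u \<Lambda> Z}"

text \<open>The drift is uniquely determined on [0,T] \<times> \<open>Omega T\<close>, so that the choice is immaterial
  there.\<close>

definition heat_op ::
    "real \<Rightarrow> ('d::finite) law_family \<Rightarrow> (real \<Rightarrow> 'd path \<Rightarrow> real) \<Rightarrow> real \<Rightarrow> 'd path \<Rightarrow> real" where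
  "heat_op T P u = (SOME \<Lambda>. \<exists>Z. smooth_decomp T P u \<Lambda> Z)"

definition stopped_value ::
    "real \<Rightarrow> real \<Rightarrow> ('d::finite) path \<Rightarrow> (real \<Rightarrow> 'd path \<Rightarrow> real) \<Rightarrow> ('d path \<Rightarrow> real) \<Rightarrow>
     'd path \<Rightarrow> real" where
  "stopped_value T t \<omega> Y \<tau> \<omega>' = shift_process T t \<omega> Y (\<tau> \<omega>') \<omega>'"

text \<open>Integrability is required explicitly in the following definitions because the Bochner
  integral of a non-integrable function is 0.\<close>

definition lower_tests ::
    "real \<Rightarrow> ('d::finite) law_family \<Rightarrow> (real \<Rightarrow> 'd path \<Rightarrow> real) \<Rightarrow> real \<Rightarrow> 'd path \<Rightarrow>
     (real \<Rightarrow> 'd path \<Rightarrow> real) set" where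
  "lower_tests T P u t \<omega> = {\<phi> \<in> C12 T P. \<exists>h \<in> pos_stopping_times_upto T (\<lambda>_. T - t).
     let D = (\<lambda>s \<omega>'. \<phi> s \<omega>' - u s \<omega>'); E = (\<lambda>\<tau>. integral\<^sup>L (P t \<omega>) (stopped_value T t \<omega> D \<tau>)) in
       (\<forall>\<tau>\<in>stopping_times_upto T h. integrable (P t \<omega>) (stopped_value T t \<omega> D \<tau>)) \<and>
       (\<exists>\<tau>\<in>stopping_times_upto T h. D t \<omega> = E \<tau>) \<and>
       (\<forall>\<tau>\<in>stopping_times_upto T h. D t \<omega> \<le> E \<tau>)}"

definition upper_tests ::
    "real \<Rightarrow> ('d::finite) law_family \<Rightarrow> (real \<Rightarrow> 'd path \<Rightarrow> real) \<Rightarrow> real \<Rightarrow> 'd path \<Rightarrow>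
     (real \<Rightarrow> 'd path \<Rightarrow> real) set" where
  "upper_tests T P u t \<omega> = {\<phi> \<in> C12 T P. \<exists>h \<in> pos_stopping_times_upto T (\<lambda>_. T - t).
     let D = (\<lambda>s \<omega>'. \<phi> s \<omega>' - u s \<omega>'); E = (\<lambda>\<tau>. integral\<^sup>L (P t \<omega>) (stopped_value T t \<omega> D \<tau>)) in
       (\<forall>\<tau>\<in>stopping_times_upto T h. integrable (P t \<omega>) (stopped_value T t \<omega> D \<tau>)) \<and>
       (\<exists>\<tau>\<in>stopping_times_upto T h. D t \<omega> = E \<tau>) \<and>
       (\<forall>\<tau>\<in>stopping_times_upto T h. E \<tau> \<le> D t \<omega>)}"

definition viscosity_subsolution ::
    "real \<Rightarrow> ('d::finite) law_family \<Rightarrow> (real \<Rightarrow> 'd path \<Rightarrow> real) \<Rightarrow> bool" where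
  "viscosity_subsolution T P u \<longleftrightarrow> u \<in> C0 T \<and>
     (\<forall>t\<in>{0..<T}. \<forall>\<omega>\<in>Omega T. \<forall>\<phi>\<in>lower_tests T P u t \<omega>. - heat_op T P \<phi> t \<omega> \<le> 0)"

definition viscosity_supersolution ::
    "real \<Rightarrow> ('d::finite) law_family \<Rightarrow> (real \<Rightarrow> 'd path \<Rightarrow> real) \<Rightarrow> bool" where
  "viscosity_supersolution T P u \<longleftrightarrow> u \<in> C0 T \<and>
     (\<forall>t\<in>{0..<T}. \<forall>\<omega>\<in>Omega T. \<forall>\<phi>\<in>upper_tests T P u t \<omega>. - heat_op T P \<phi> t \<omega> \<ge> 0)"

definition pathwise_submartingale ::
    "real \<Rightarrow> ('d::finite) law_family \<Rightarrow> (real \<Rightarrow> 'd path \<Rightarrow> real) \<Rightarrow> bool" where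
  "pathwise_submartingale T P u \<longleftrightarrow>
     (\<forall>t\<in>{0..T}. \<forall>\<omega>\<in>Omega T. \<forall>\<tau>\<in>stopping_times_upto T (\<lambda>_. T - t).
        integrable (P t \<omega>) (stopped_value T t \<omega> u \<tau>) \<and>
        u t \<omega> \<le> integral\<^sup>L (P t \<omega>) (stopped_value T t \<omega> u \<tau>))"

definition pathwise_supermartingale ::
    "real \<Rightarrow> ('d::finite) law_family \<Rightarrow> (real \<Rightarrow> 'd path \<Rightarrow> real) \<Rightarrow> bool" where
  "pathwise_supermartingale T P u \<longleftrightarrow>
     (\<forall>t\<in>{0..T}. \<forall>\<omega>\<in>Omega T. \<forall>\<tau>\<in>stopping_times_upto T (\<lambda>_. T - t).
        integrable (P t \<omega>) (stopped_value T t \<omega> u \<tau>) \<and>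
        u t \<omega> \<ge> integral\<^sup>L (P t \<omega>) (stopped_value T t \<omega> u \<tau>))"

end

theory Submission
  imports Defs
begin

text \<open>If \<open>u\<close> is a submartingale and \<open>f - u\<close> has its least stopped expectation at \<open>(t, w)\<close>, then \<open>f\<close> at
 \<open>(t, w)\<close> is at most its expectation at every stopping time up to some \<open>h > 0\<close>. Stopping before the path and
 the coefficients have moved by a fixed amount makes the stochastic integral in the decomposition of \<open>f\<close> a
 bounded martingale, and what remains forces the drift of \<open>f\<close> to be nonnegative.

 Conversely, if \<open>u\<close> is a viscosity subsolution and \<open>c > 0\<close>, then the linear process \<open>- c s\<close> is never a test
 process, so from every \<open>(t, w)\<close> with \<open>t < T\<close> some stopping time strictly improves the expectation of
 \<open>u + c s\<close>. An increasing sequence of nearly optimal stopping times below a given \<open>R\<close> has a limit. Where this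
 limit is less than \<open>R\<close> it could be improved again, by the strong Markov property, a countable dense family
 of stopping times taking the place of measurable selection; so the limit is \<open>R\<close>. Hence \<open>u + c s\<close> is a
 submartingale, and \<open>c\<close> tends to \<open>0\<close>.\<close>

text \<open>The stochastic integral is given only as a limit, uniform in probability, of simple
  integrals, and the solutions \<open>X t w\<close> are an arbitrary family, with no measurability
  in \<open>w\<close>. What is required of them is therefore recovered along dyadic grids. Riemann
  sums converge to the integral by a discrete Doob inequality, and the Euler scheme converges to the
  solution by a discrete Gronwall argument. The scheme is a fixed measurable function of the initial
  path and finitely many increments: the limit of its laws gives a measurable kernel, and restarting
  it at a stopping time rounded up to the grid, with fresh increments, gives the strong Markov
  property. Exceptional events over an interval of times need not be measurable, hence the outer
  probabilities; limits of expectations rest on second moments bounded over all stopping times,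
  which is what \<open>C02\<close> provides. The filtration is raw, neither augmented nor
  right-continuous, so stopping times are recognised by Galmarino's test.\<close>

abbreviation paths :: "real => ('d::finite) path measure" where "paths T \<equiv> canonical_filtration T T"

section \<open>Convergence in outer probability\<close>

abbreviation small :: "'a measure => real => 'a set => bool" where
 "small M d E \<equiv> (\<exists>A\<in>sets M. E \<subseteq> A \<and> emeasure M A < ennreal d)"

text \<open>Convergence to zero of outer probability. The exceptional events below quantify over a
  whole interval of times and need not be measurable, so each is covered by a measurable set of
  small measure.\<close>

definition vanishing :: "'a measure => (nat => 'a set) => bool" where
 "vanishing M E \<longleftrightarrow> (\<forall>d>0. \<exists>N. \<forall>n\<ge>N. small M d (E n))"

lemma vanishingI:
 assumes "!!d. d > 0 ==> \<exists>N. \<forall>n\<ge>N. small M d (E n)"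
 shows "vanishing M E"
 using assms by (auto simp: vanishing_def)

lemma vanishingD:
 assumes "vanishing M E" "d > 0"
 obtains N where "!!n. n \<ge> N ==> small M d (E n)"
 using assms unfolding vanishing_def by meson

lemma vanishing_mono:
 assumes "vanishing M E" and "!!n. n \<ge> N0 ==> F n \<subseteq> E n"
 shows "vanishing M F"
proof (rule vanishingI)
 fix d :: real assume "d > 0"
 then obtain N where N: "!!n. n \<ge> N ==> small M d (E n)"
  using assms(1) vanishingD by blast
 show "\<exists>N. \<forall>n\<ge>N. small M d (F n)"
 proof (intro exI[of _ "max N N0"] allI impI)
  fix n assume "max N N0 <= n"
  then show "small M d (F n)"
   using N[of n] assms(2)[of n] by (meson max.boundedE order_trans)
 qed
qed

lemma vanishing_Un:
 assumes "vanishing M E" and "vanishing M F"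
 shows "vanishing M (%n. E n \<union> F n)"
proof (rule vanishingI)
 fix d :: real assume "d > 0"
 then have r: "d/2 > 0" by simp
 obtain N1 where N1: "!!n. n \<ge> N1 ==> small M (d/2) (E n)"
  using assms(1) r vanishingD by blast
 obtain N2 where N2: "!!n. n \<ge> N2 ==> small M (d/2) (F n)"
  using assms(2) r vanishingD by blast
 show "\<exists>N. \<forall>n\<ge>N. small M d (E n \<union> F n)"
 proof (intro exI[of _ "max N1 N2"] allI impI)
  fix n assume n: "max N1 N2 <= n"
  obtain A where A: "A \<in> sets M" "E n \<subseteq> A" "emeasure M A < ennreal (d/2)"
   using N1[of n] n by auto
  obtain B where B: "B \<in> sets M" "F n \<subseteq> B" "emeasure M B < ennreal (d/2)"
   using N2[of n] n by auto
  have "emeasure M (A \<union> B) <= emeasure M A + emeasure M B"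
   by (rule emeasure_subadditive[OF A(1) B(1)])
  also have "... < ennreal (d/2) + ennreal (d/2)"
   using A(3) B(3) by (rule add_strict_mono)
  also have "... = ennreal d" using `d > 0` by (simp flip: ennreal_plus)
  finally show "small M d (E n \<union> F n)"
   using A B by (intro bexI[of _ "A \<union> B"]) auto
 qed
qed

lemma (in finite_measure) vanishing_sets:
 assumes "!!n. A n \<in> sets M" "!!n. E n \<subseteq> A n" "(%n. measure M (A n)) \<longlonglongrightarrow> 0"
 shows "vanishing M E"
proof (rule vanishingI)
 fix d :: real assume "d > 0"
 then obtain N where "!!n. n \<ge> N ==> measure M (A n) < d"
  using order_tendstoD(2)[OF assms(3)] unfolding eventually_sequentially by blast
 then show "\<exists>N. \<forall>n\<ge>N. small M d (E n)"
  using assms(1,2) `d > 0` by (intro exI[of _ N] allI impI bexI[of _ "A _"])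
   (auto simp: emeasure_eq_measure intro!: ennreal_lessI)
qed

lemma (in finite_measure) vanishing_decseq:
 assumes "!!n. A n \<in> sets M" "!!n. E n \<subseteq> A n" "decseq A" "(\<Inter>n. A n) = {}"
 shows "vanishing M E"
proof (rule vanishing_sets[of A])
 have "(%n. measure M (A n)) \<longlonglongrightarrow> measure M (\<Inter>n. A n)"
  by (rule finite_Lim_measure_decseq) (use assms in auto)
 then show "(%n. measure M (A n)) \<longlonglongrightarrow> 0" using assms(4) by simp
qed (use assms in auto)

text \<open>The unions over all later indices of the exceptional events are measurable, decrease,
  and have empty intersection by pointwise convergence; continuity from above does the rest.\<close>

lemma (in finite_measure) vanishing_pointwise:
 fixes f :: "nat => 'a => 'b::{second_countable_topology,real_normed_vector}"
 assumes [measurable]: "!!n. f n \<in> borel_measurable M" "g \<in> borel_measurable M"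
  and lim: "!!x. x \<in> space M ==> (%n. f n x) \<longlonglongrightarrow> g x" and "e > 0"
 shows "vanishing M (%n. {x \<in> space M. e < norm (f n x - g x)})"
proof (rule vanishing_decseq)
 let ?A = "%n. \<Union>m\<in>{n..}. {x \<in> space M. e < norm (f m x - g x)}"
 show "?A n \<in> sets M" for n by measurable
 show "{x \<in> space M. e < norm (f n x - g x)} \<subseteq> ?A n" for n by auto
 show "decseq ?A"
  unfolding decseq_def by (intro allI impI UN_mono) auto
 show "(\<Inter>n. ?A n) = {}"
 proof safe
  fix x assume x: "x \<in> (\<Inter>n. ?A n)"
  then have xs: "x \<in> space M" by auto
  have "(%n. norm (f n x - g x)) \<longlonglongrightarrow> 0"
   using lim[OF xs] by (simp add: LIM_zero tendsto_norm_zero)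
  from order_tendstoD(2)[OF this `e > 0`]
  obtain N where N: "!!n. n \<ge> N ==> norm (f n x - g x) < e"
   unfolding eventually_sequentially by blast
  have "x \<in> ?A N" using x by blast
  then obtain m where "m \<ge> N" "e < norm (f m x - g x)" by auto
  with N[of m] show "x \<in> {}" by simp
 qed
qed

lemma vanishing_ucp:
 assumes "ucp_tendsto M J Yn Y" "e > 0" "finite_measure M"
 shows "vanishing M (%n. {x \<in> space M. \<exists>s\<in>J. e < norm (Yn n s x - Y s x)})"
proof -
 interpret finite_measure M by fact
 have "\<exists>A. (\<forall>n. A n \<in> sets M \<and> {x \<in> space M. \<exists>s\<in>J. e < norm (Yn n s x - Y s x)} \<subseteq> A n) \<and>
    (%n. measure M (A n)) \<longlonglongrightarrow> 0"
  using assms(1,2) unfolding ucp_tendsto_def by simp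
 then obtain A where A: "\<forall>n. A n \<in> sets M \<and> {x \<in> space M. \<exists>s\<in>J. e < norm (Yn n s x - Y s x)} \<subseteq> A n"
  "(%n. measure M (A n)) \<longlonglongrightarrow> 0" by (elim exE conjE)
 show ?thesis by (rule vanishing_sets[of A]) (use A in auto)
qed

text \<open>Replaces uniform integrability arguments.\<close>

lemma (in prob_space) expectation_abs_split:
 fixes Y :: "'a => real"
 assumes Y: "Y \<in> borel_measurable M" "integrable M (%x. (Y x)^2)"
  and A: "A \<in> sets M" "!!x. x \<in> space M ==> x \<notin> A ==> \<bar>Y x\<bar> <= e"
  and "e \<ge> 0" "l > 0"
 shows "integrable M Y" "expectation (%x. \<bar>Y x\<bar>) <= e + l * expectation (%x. (Y x)^2) + prob A / (4 * l)"
proof -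
 have i: "integrable M (%x. e + l * (Y x)^2 + indicator A x / (4 * l))"
  using Y(2) A(1) by (intro Bochner_Integration.integrable_add integrable_mult_right
    integrable_divide) (auto simp: integrable_real_indicator emeasure_eq_measure)
 have b: "\<bar>Y x\<bar> <= e + l * (Y x)^2 + indicator A x / (4 * l)" if "x \<in> space M" for x
 proof (cases "x \<in> A")
  case True
  \<comment> \<open>Young's inequality \<open>\<bar>Y\<bar> <= l * Y^2 + 1 / (4 * l)\<close>,
    obtained from a square. It is applied on \<open>A\<close> only, so that the constant
    \<open>1 / (4 * l)\<close> carries the small weight \<open>prob A\<close>.\<close>
  have "0 <= (2 * l * \<bar>Y x\<bar> - 1)^2" by simp
  then have "4 * l * \<bar>Y x\<bar> <= 4 * l * (l * (Y x)^2) + 1"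
   by (simp add: power2_diff power_mult_distrib algebra_simps power2_eq_square)
  then have "\<bar>Y x\<bar> <= l * (Y x)^2 + 1 / (4 * l)"
   using `l > 0` by (simp add: field_simps)
  then show ?thesis using True `e \<ge> 0` by simp
 next
  case False
  then have "\<bar>Y x\<bar> <= e" using A(2) that by blast
  moreover have "0 <= l * (Y x)^2" using `l > 0` by simp
  ultimately show ?thesis using False by simp
 qed
 show "integrable M Y"
  by (rule Bochner_Integration.integrable_bound[OF i Y(1)]) (use b in "fastforce intro!: AE_I2")
 then have "expectation (%x. \<bar>Y x\<bar>) <= expectation (%x. e + l * (Y x)^2 + indicator A x / (4 * l))"
  using b by (intro integral_mono i) auto
 also have "... = e + l * expectation (%x. (Y x)^2) + prob A / (4 * l)"
 proof -
  have "integrable M (%x. e + l * (Y x)^2)" using Y(2) by simp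
  moreover have "integrable M (%x. indicator A x / (4 * l))" "expectation (indicator A) = prob A"
   using A(1) by (auto simp: integrable_real_indicator emeasure_eq_measure)
  ultimately show ?thesis using Y(2) by (simp add: prob_space)
 qed
 finally show "expectation (%x. \<bar>Y x\<bar>) <= e + l * expectation (%x. (Y x)^2) + prob A / (4 * l)" .
qed

lemma (in prob_space) bounded_convergence_in_probability:
 fixes f :: "nat => 'a => real"
 assumes f: "!!n. f n \<in> borel_measurable M" "g \<in> borel_measurable M"
  and bd: "!!n x. x \<in> space M ==> \<bar>f n x\<bar> <= K" "!!x. x \<in> space M ==> \<bar>g x\<bar> <= K"
  and van: "!!e. e > 0 ==> vanishing M (%n. {x \<in> space M. e < \<bar>f n x - g x\<bar>})"
 shows "(%n. expectation (f n)) \<longlonglongrightarrow> expectation g"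
proof (rule LIMSEQ_I)
 fix r :: real assume "r > 0"
 have K: "K \<ge> 0" using bd(2) not_empty by (metis abs_ge_zero equals0I order_trans)
 \<comment> \<open>The bound \<open>2 * K * d <= r / 4\<close> is wanted; \<open>K + 1\<close> in
   the denominator covers \<open>K = 0\<close>. The same device recurs below with other
   constants.\<close>
 define d where "d = r / (8 * (K + 1))"
 have d: "d > 0" using K `r > 0` by (simp add: d_def)
 obtain N where N: "!!n. n \<ge> N ==> small M d {x \<in> space M. r/4 < \<bar>f n x - g x\<bar>}"
  using vanishingD[OF van d, of "r/4"] `r > 0` by auto
 have int: "integrable M (f n)" "integrable M g" for n
  by (rule integrable_const_bound[of _ K]; use f bd in simp)+
 show "\<exists>no. \<forall>n\<ge>no. norm (expectation (f n) - expectation g) < r"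
 proof (intro exI[of _ N] allI impI)
  fix n assume "n \<ge> N"
  then obtain A where A: "A \<in> sets M" "{x \<in> space M. r/4 < \<bar>f n x - g x\<bar>} \<subseteq> A" "emeasure M A < ennreal d"
   using N by blast
  have pA: "prob A < d" using A(3) d by (simp add: emeasure_eq_measure ennreal_less_iff)
  have "norm (expectation (f n) - expectation g) = \<bar>expectation (%x. f n x - g x)\<bar>"
   using int by simp
  also have "... <= expectation (%x. \<bar>f n x - g x\<bar>)" by simp
  also have "... <= expectation (%x. r/4 + 2 * K * indicator A x)"
  proof (rule integral_mono)
   show "integrable M (%x. \<bar>f n x - g x\<bar>)" using int by auto
   show "integrable M (%x. r/4 + 2 * K * indicator A x)"
    using A(1) by (auto simp: integrable_real_indicator emeasure_eq_measure)
   fix x assume x: "x \<in> space M"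
   show "\<bar>f n x - g x\<bar> <= r/4 + 2 * K * indicator A x"
    using A(2) x bd(1)[OF x, of n] bd(2)[OF x] `r > 0` by (cases "x \<in> A") (auto simp: not_less)
  qed
  also have "... = r/4 + 2 * K * prob A"
   using A(1) by (subst Bochner_Integration.integral_add)
    (auto simp: integrable_real_indicator emeasure_eq_measure prob_space)
  also have "... <= r/4 + 2 * K * d" using pA K by (intro add_left_mono mult_left_mono) auto
  also have "... < r"
  proof -
   have "2 * K * d <= r / 4" using K `r > 0` by (simp add: d_def field_simps)
   then show ?thesis using `r > 0` by simp
  qed
  finally show "norm (expectation (f n) - expectation g) < r" .
 qed
qed

text \<open>A bound in L2 makes the sequence uniformly integrable, so convergence in outer
  probability is enough for Fatou's inequality and for convergence of expectations against bounded
  weights. Limits of Riemann sums and of stopped values are both taken through it.\<close>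

lemma (in prob_space) L2_limit:
 fixes J :: "nat => 'a => real"
 assumes J: "!!n. J n \<in> borel_measurable M" "!!n. integrable M (%x. (J n x)^2)"
   "!!n. expectation (%x. (J n x)^2) <= K"
  and I: "I \<in> borel_measurable M"
  and van: "!!\<epsilon>. \<epsilon> > 0 ==> vanishing M (%n. {x \<in> space M. \<epsilon> < \<bar>J n x - I x\<bar>})"
 shows "integrable M (%x. (I x)^2)" "expectation (%x. (I x)^2) <= K"
  "!!g c. g \<in> borel_measurable M ==> (!!x. x \<in> space M ==> \<bar>g x\<bar> <= c) ==>
   (%n. expectation (%x. g x * J n x)) \<longlonglongrightarrow> expectation (%x. g x * I x)"
proof -
 let ?m = "%n x. min ((I x)^2) ((real (Suc n))^2)" and ?d = "%n x. J n x - I x"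
 note [measurable] = J(1) I
 have K0: "0 <= K" by (rule order_trans[OF _ J(3)[of 0]]) (simp add: integral_nonneg)
 \<comment> \<open>Squares truncated at \<open>c^2\<close> are bounded and Lipschitz with constant
   \<open>2 * c\<close>, so their expectations converge; letting \<open>c\<close> run through the
   positive integers then gives Fatou's inequality by monotone convergence.\<close>
 have trunc: "expectation (%x. min ((I x)^2) (c^2)) <= K" if "c > 0" for c :: real
 proof -
  have lip: "\<bar>min (a^2) (c^2) - min (b^2) (c^2)\<bar> <= 2 * c * \<bar>a - b\<bar>" for a b :: real
  proof -
   have m: "min (a^2) (c^2) = (min \<bar>a\<bar> c)^2" for a
    using that by (auto simp: min_def abs_le_square_iff[symmetric])
   have "\<bar>(min \<bar>a\<bar> c)^2 - (min \<bar>b\<bar> c)^2\<bar> = \<bar>min \<bar>a\<bar> c + min \<bar>b\<bar> c\<bar> * \<bar>min \<bar>a\<bar> c - min \<bar>b\<bar> c\<bar>"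
    by (simp add: abs_mult[symmetric] power2_eq_square algebra_simps)
   also have "... <= (2 * c) * \<bar>a - b\<bar>"
    using that by (intro mult_mono) (auto simp: min_def abs_if)
   finally show ?thesis by (simp add: m)
  qed
  have "(%n. expectation (%x. min ((J n x)^2) (c^2))) \<longlonglongrightarrow> expectation (%x. min ((I x)^2) (c^2))"
  proof (rule bounded_convergence_in_probability[of _ _ "c^2"])
   fix \<epsilon> :: real assume e: "\<epsilon> > 0"
   show "vanishing M (%n. {x \<in> space M. \<epsilon> < \<bar>min ((J n x)^2) (c^2) - min ((I x)^2) (c^2)\<bar>})"
   proof (rule vanishing_mono[OF van[of "\<epsilon> / (2 * c)"]])
    show "\<epsilon> / (2 * c) > 0" using e that by simp
    show "{x \<in> space M. \<epsilon> < \<bar>min ((J n x)^2) (c^2) - min ((I x)^2) (c^2)\<bar>}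
     \<subseteq> {x \<in> space M. \<epsilon> / (2 * c) < \<bar>?d n x\<bar>}" for n
     using lip that by (auto simp: field_simps intro: less_le_trans)
   qed
  qed auto
  then show ?thesis
  proof (rule LIMSEQ_le_const2, intro exI allI impI)
   fix n
   have "expectation (%x. min ((J n x)^2) (c^2)) <= expectation (%x. (J n x)^2)"
    by (rule integral_mono[OF integrable_const_bound[of _ "c^2"] J(2)]) auto
   then show "expectation (%x. min ((J n x)^2) (c^2)) <= K" using J(3)[of n] by simp
  qed
 qed
 have nn: "(\<integral>\<^sup>+ x. ennreal ((I x)^2) \<partial>M) <= ennreal K"
 proof -
  have s: "ennreal ((I x)^2) = (SUP n. ennreal (?m n x))" for x
  proof (rule antisym)
   obtain n where "\<bar>I x\<bar> <= real n" using real_arch_simple by blast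
   then have "(I x)^2 <= (real (Suc n))^2" by (simp add: abs_le_square_iff[symmetric])
   then have "?m n x = (I x)^2" by simp
   then show "ennreal ((I x)^2) <= (SUP n. ennreal (?m n x))"
    by (intro SUP_upper2[of n]) simp_all
   show "(SUP n. ennreal (?m n x)) <= ennreal ((I x)^2)"
    by (rule SUP_least) (auto intro!: ennreal_leI)
  qed
  have "(\<integral>\<^sup>+ x. ennreal ((I x)^2) \<partial>M) = (\<integral>\<^sup>+ x. (SUP n. ennreal (?m n x)) \<partial>M)"
   by (simp only: s)
  also have "... = (SUP n. \<integral>\<^sup>+ x. ennreal (?m n x) \<partial>M)"
  proof (rule nn_integral_monotone_convergence_SUP)
   show "incseq (%n x. ennreal (?m n x))"
    unfolding incseq_def le_fun_def by (intro allI impI ennreal_leI min.mono order_refl power_mono) auto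
  qed measurable
  also have "... <= ennreal K"
  proof (rule SUP_least)
   fix n
   have "integrable M (%x. ?m n x)"
    by (rule integrable_const_bound[of _ "(real (Suc n))^2"]) auto
   then have "(\<integral>\<^sup>+ x. ennreal (?m n x) \<partial>M)
    = ennreal (expectation (%x. ?m n x))"
    by (intro nn_integral_eq_integral) auto
   also have "... <= ennreal K" using trunc[of "real (Suc n)"] by (intro ennreal_leI) auto
   finally show "(\<integral>\<^sup>+ x. ennreal (?m n x) \<partial>M) <= ennreal K" .
  qed
  finally show ?thesis .
 qed
 show int: "integrable M (%x. (I x)^2)"
  by (rule integrableI_bounded) (use nn in "auto simp: order_le_less_trans")
 have "ennreal (expectation (%x. (I x)^2)) <= ennreal K"
  using nn by (subst nn_integral_eq_integral[symmetric]) (use int in auto)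
 then show IK: "expectation (%x. (I x)^2) <= K" using K0 by simp
 fix g :: "'a => real" and c
 assume z[measurable]: "g \<in> borel_measurable M" and zc: "!!x. x \<in> space M ==> \<bar>g x\<bar> <= c"
 have c0: "c \<ge> 0" using zc not_empty by (metis abs_ge_zero equals0I order_trans)
 have dint: "integrable M (%x. (?d n x)^2)" "expectation (%x. (?d n x)^2) <= 4 * K" for n
 proof -
  have b: "(?d n x)^2 <= 2 * (J n x)^2 + 2 * (I x)^2" for x
   using sum_squares_bound[of "J n x" "- I x"] by (simp add: power2_diff)
  have i: "integrable M (%x. 2 * (J n x)^2 + 2 * (I x)^2)" using J(2)[of n] int by simp
  show d: "integrable M (%x. (?d n x)^2)"
   by (rule Bochner_Integration.integrable_bound[OF i]) (use b in auto)
  have "expectation (%x. (?d n x)^2) <= expectation (%x. 2 * (J n x)^2 + 2 * (I x)^2)"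
   by (rule integral_mono[OF d i]) (rule b)
  also have "... = 2 * expectation (%x. (J n x)^2) + 2 * expectation (%x. (I x)^2)"
   using J(2)[of n] int by simp
  finally show "expectation (%x. (?d n x)^2) <= 4 * K" using J(3)[of n] IK by simp
 qed
 have inti: "integrable M (J n)" "integrable M I" for n
  by (rule expectation_abs_split(1)[where A="space M" and e=0 and l=1]; use J int I in simp)+
 have zint: "integrable M (%x. g x * f x)" if "integrable M f" for f
 proof -
  show ?thesis
  proof (rule Bochner_Integration.integrable_bound[of _ "%x. c * f x"])
   show "AE x in M. norm (g x * f x) <= norm (c * f x)"
    using zc c0 by (intro AE_I2) (simp add: abs_mult mult_right_mono)
  qed (use that in auto)
 qed
 show "(%n. expectation (%x. g x * J n x)) \<longlonglongrightarrow> expectation (%x. g x * I x)"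
 proof (rule LIMSEQ_I)
  fix r :: real assume r: "r > 0"
  define q where "q = r / (8 * (c + 1))"
  have q: "q > 0" using r c0 by (simp add: q_def)
  \<comment> \<open>With this \<open>l\<close> the second moment term is at most \<open>q\<close>,
    and an exceptional set of probability below \<open>4 * l * q\<close> costs at most another
    \<open>q\<close>; the total \<open>3 * c * q\<close> stays below \<open>r\<close>.\<close>
  define l where "l = q / (4 * K + 1)"
  have l: "l > 0" using q K0 by (simp add: l_def)
  obtain N where N: "!!n. n \<ge> N ==> small M (4 * l * q) {x \<in> space M. q < \<bar>?d n x\<bar>}"
   by (rule vanishingD[OF van[OF q], of "4 * l * q"]) (use l q in auto)
  show "\<exists>no. \<forall>n\<ge>no. norm (expectation (%x. g x * J n x) - expectation (%x. g x * I x)) < r"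
  proof (intro exI[of _ N] allI impI)
   fix n assume "n \<ge> N"
   then obtain A where A: "A \<in> sets M" "{x \<in> space M. q < \<bar>?d n x\<bar>} \<subseteq> A" "emeasure M A < ennreal (4 * l * q)"
    using N by blast
   have pA: "prob A <= 4 * l * q" using A(3) l q by (simp add: emeasure_eq_measure ennreal_less_iff)
   have "norm (expectation (%x. g x * J n x) - expectation (%x. g x * I x)) = \<bar>expectation (%x. g x * (?d n x))\<bar>"
    using zint[OF inti(1)[of n]] zint[OF inti(2)] by (simp add: right_diff_distrib)
   also have "... <= expectation (%x. \<bar>g x * (?d n x)\<bar>)" by simp
   also have "... <= expectation (%x. c * \<bar>?d n x\<bar>)"
   proof (rule integral_mono)
    have "integrable M (%x. g x * (?d n x))"
     by (rule zint) (use inti(1)[of n] inti(2) in simp)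
    then show "integrable M (%x. \<bar>g x * (?d n x)\<bar>)" by (rule integrable_abs)
    show "integrable M (%x. c * \<bar>?d n x\<bar>)" using inti(1)[of n] inti(2) by simp
    show "\<bar>g x * (?d n x)\<bar> <= c * \<bar>?d n x\<bar>" if "x \<in> space M" for x
     using zc[OF that] by (simp add: abs_mult mult_right_mono)
   qed
   also have "... = c * expectation (%x. \<bar>?d n x\<bar>)" by simp
   also have "... <= c * (q + l * expectation (%x. (?d n x)^2) + prob A / (4 * l))"
    by (intro mult_left_mono c0 expectation_abs_split(2)[OF _ dint(1) A(1)])
     (use A(2) q l in "auto simp: not_less")
   also have "... <= c * (q + q + q)"
   proof (intro mult_left_mono c0 add_mono order_refl)
    have "l * expectation (%x. (?d n x)^2) <= l * (4 * K + 1)"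
     using dint(2)[of n] l by (intro mult_left_mono) auto
    also have "... = q" using K0 by (simp add: l_def)
    finally show "l * expectation (%x. (?d n x)^2) <= q" .
    show "prob A / (4 * l) <= q" using pA l by (simp add: field_simps)
   qed
   also have "... < r"
   proof -
    have "c * q <= r / 8" using c0 r by (simp add: q_def field_simps)
    then show ?thesis using r by (simp add: algebra_simps)
   qed
   finally show "norm (expectation (%x. g x * J n x) - expectation (%x. g x * I x)) < r" .
  qed
 qed
qed

section \<open>Path space and stopping times\<close>

lemma space_canonical_filtration [simp]: "space (canonical_filtration T s) = Omega T"
 by (auto simp: canonical_filtration_def natural_filtration_def intro!: space_measure_of)

lemma sets_canonical_filtration:
 "sets (canonical_filtration T s) = sigma_sets (Omega T)
  {canonical_process r -` A \<inter> Omega T | r A. 0 <= r \<and> r <= s \<and> r <= T \<and> A \<in> sets borel}"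
 unfolding canonical_filtration_def natural_filtration_def by (rule sets_measure_of) auto

lemma measurable_into_path_space:
 fixes f :: "'a => ('d::finite) path"
 assumes "!!x. x \<in> space N ==> f x \<in> Omega T"
  and "!!r. 0 <= r ==> r <= s ==> r <= T ==> (%x. f x r) \<in> borel_measurable N"
 shows "f \<in> measurable N (canonical_filtration T s)"
 unfolding canonical_filtration_def natural_filtration_def
proof (rule measurable_measure_of)
 show "f \<in> space N \<rightarrow> Omega T" using assms(1) by auto
 fix y :: "'d path set" assume "y \<in> {canonical_process r -` A \<inter> Omega T |r A. 0 <= r \<and> r <= s \<and> r <= T \<and> A \<in> sets borel}"
 then obtain r A where y: "y = canonical_process r -` A \<inter> Omega T" "0 <= r" "r <= s" "r <= T" "A \<in> sets borel"
  by auto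
 have "f -` y \<inter> space N = (%x. f x r) -` A \<inter> space N"
  using assms(1) by (auto simp: y(1) canonical_process_def)
 also have "... \<in> sets N" using assms(2)[OF y(2-4)] y(5) by (rule measurable_sets)
 finally show "f -` y \<inter> space N \<in> sets N" .
qed auto

lemma coordinate_measurable:
 assumes "0 <= r" "r <= s" "r <= T"
 shows "(%w. w r) \<in> borel_measurable (canonical_filtration T s)"
proof (rule measurableI)
 fix A :: "(real ^ 'a) set" assume "A \<in> sets borel"
 then have "canonical_process r -` A \<inter> Omega T \<in> sets (canonical_filtration T s)"
  unfolding sets_canonical_filtration using assms by (intro sigma_sets.Basic) auto
 moreover have "canonical_process r -` A \<inter> Omega T = (%w. w r) -` A \<inter> space (canonical_filtration T s)"
  by (auto simp: canonical_process_def)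
 ultimately show "(%w. w r) -` A \<inter> space (canonical_filtration T s) \<in> sets (canonical_filtration T s)"
  by simp
qed auto

lemma sets_canonical_filtration_mono:
 "s <= s' ==> sets (canonical_filtration T s) \<subseteq> sets (canonical_filtration T s')"
 unfolding sets_canonical_filtration by (rule sigma_sets_mono') force

lemma canonical_filtration_le:
 "sets (canonical_filtration T s) \<subseteq> sets (paths T)"
 unfolding sets_canonical_filtration by (rule sigma_sets_mono') force

lemma measurable_canonical_le:
 assumes "f \<in> measurable (canonical_filtration T s) N"
 shows "f \<in> measurable (paths T) N"
 using assms measurable_mono[of N N "canonical_filtration T s" "paths T"]
  canonical_filtration_le by auto

text \<open>Easy half of Galmarino's test: the property holds for the generating events and passes
  to complements and countable unions.\<close>

lemma galmarino_sets:
 assumes "A \<in> sets (canonical_filtration T s)" "w \<in> Omega T" "w' \<in> Omega T"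
  and "!!r. 0 <= r ==> r <= s ==> r <= T ==> w r = w' r"
 shows "w \<in> A \<longleftrightarrow> w' \<in> A"
 using assms(1) unfolding sets_canonical_filtration
proof (induction rule: sigma_sets.induct)
 case (Basic a)
 then show ?case using assms(2-4) by (auto simp: canonical_process_def)
next
 case (Compl a)
 then show ?case using assms(2,3) by auto
qed auto

lemma OmegaD:
 assumes "w \<in> Omega T"
 shows "continuous_on {0..T} w" "w 0 = 0" "!!r. r \<notin> {0..T} ==> w r = undefined"
 using assms by (auto simp: Omega_def extensional_def)

lemma Omega_eqI:
 assumes "w \<in> Omega T" "w' \<in> Omega T" "!!r. 0 <= r ==> r <= T ==> w r = w' r"
 shows "w = w'"
 using assms by (intro extensionalityI[of w "{0..T}"]) (auto simp: Omega_def)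

lemma zero_in_Omega: "(\<lambda>r\<in>{0..T}. 0 :: real ^ ('a::finite)) \<in> Omega T" if "T \<ge> 0"
proof -
 have "continuous_on {0..T} (\<lambda>r\<in>{0..T}. 0 :: real ^ 'a)"
  by (rule continuous_on_eq[OF continuous_on_const]) auto
 then show ?thesis using that by (auto simp: Omega_def)
qed

text \<open>Rounded down to multiples of \<open>1 / Suc m\<close>, the time takes countably many
  values, for which measurability is a countable case distinction; continuity in time handles the
  limit.\<close>

lemma measurable_at_random_time:
 fixes f :: "real => 'a => 'b::{metric_space}"
 assumes f: "!!s. 0 <= s ==> s <= T ==> f s \<in> borel_measurable N"
  and cont: "!!x. x \<in> space N ==> continuous_on {0..T} (%s. f s x)"
  and R[measurable]: "R \<in> borel_measurable N"
  and range: "!!x. x \<in> space N ==> 0 <= R x \<and> R x <= T"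
 shows "(%x. f (R x) x) \<in> borel_measurable N"
proof (cases "T \<ge> 0")
 case True
 define a where "a m x = real_of_int \<lfloor>R x * real (Suc m)\<rfloor> / real (Suc m)" for m x
 have a: "0 <= a m x" "a m x <= R x" "R x - 1 / real (Suc m) <= a m x" if "x \<in> space N" for m x
 proof -
  show "0 <= a m x" using range[OF that] by (simp add: a_def)
  show "a m x <= R x" by (simp add: a_def field_simps)
  have "R x * real (Suc m) - 1 <= real_of_int \<lfloor>R x * real (Suc m)\<rfloor>" by linarith
  then have "(R x * real (Suc m) - 1) / real (Suc m) <= a m x"
   unfolding a_def by (rule divide_right_mono) simp
  then show "R x - 1 / real (Suc m) <= a m x" by (simp add: diff_divide_distrib)
 qed
 define g where "g m (i::int) x = f (min T (max 0 (real_of_int i / real (Suc m)))) x" for m i x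
 have g: "g m i \<in> borel_measurable N" for m i
  unfolding g_def by (rule f) (use True in auto)
 show ?thesis
 proof (rule borel_measurable_LIMSEQ_metric[of "%m x. g m \<lfloor>R x * real (Suc m)\<rfloor> x"])
  show "(%x. g m \<lfloor>R x * real (Suc m)\<rfloor> x) \<in> borel_measurable N" for m
   by (rule measurable_compose_countable[OF g]) measurable
  fix x assume x: "x \<in> space N"
  have eq: "g m \<lfloor>R x * real (Suc m)\<rfloor> x = f (a m x) x" for m
   using a[OF x, of m] range[OF x] by (simp add: g_def a_def)
  have "(%m. a m x) \<longlonglongrightarrow> R x"
  proof (rule tendsto_sandwich)
   show "\<forall>\<^sub>F m in sequentially. R x - 1 / real (Suc m) <= a m x" using a[OF x] by simp
   show "\<forall>\<^sub>F m in sequentially. a m x <= R x" using a[OF x] by simp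
   show "(%m. R x - 1 / real (Suc m)) \<longlonglongrightarrow> R x"
    using tendsto_diff[OF tendsto_const LIMSEQ_inverse_real_of_nat, of "R x"] by (simp add: inverse_eq_divide)
  qed simp
  then show "(%m. g m \<lfloor>R x * real (Suc m)\<rfloor> x) \<longlonglongrightarrow> f (R x) x"
   unfolding eq
   by (intro continuous_on_tendsto_compose[OF cont[OF x]])
    (use a[OF x] range[OF x] in "auto intro!: always_eventually intro: order_trans")
 qed
next
 case False
 then have "space N = {}" using range by fastforce
 then show ?thesis by (simp add: measurable_def)
qed

section \<open>Frozen paths, tails and concatenation\<close>

definition freeze :: "real => real => ('d::finite) path => 'd path" where
 "freeze T s w = (\<lambda>r\<in>{0..T}. w (min s r))"

text \<open>The increments after \<open>s\<close>; glued to the path up to \<open>s\<close> they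
  give the path back (\<open>concat_path_tail\<close>). The cap at \<open>T\<close> extends the tail
  by a constant, since every member of \<open>Omega T\<close> lives on all of
  \<open>[0,T]\<close>.\<close>

definition tail :: "real => real => ('d::finite) path => 'd path" where
 "tail T s w = (\<lambda>r\<in>{0..T}. w (min (s + r) T) - w s)"

lemma freeze_in_Omega: "0 <= s ==> w \<in> Omega T ==> freeze T s w \<in> Omega T"
proof -
 assume s: "0 <= s" and w: "w \<in> Omega T"
 have "continuous_on {0..T} (%r. w (min s r))"
  by (rule continuous_on_compose2[OF OmegaD(1)[OF w]]) (use s in "auto intro!: continuous_intros")
 then have "continuous_on {0..T} (freeze T s w)"
  by (rule continuous_on_eq) (auto simp: freeze_def)
 moreover have "freeze T s w 0 = 0"
  using s OmegaD(2,3)[OF w] w by (cases "T \<ge> 0") (auto simp: freeze_def Omega_def extensional_def)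
 ultimately show ?thesis by (auto simp: Omega_def freeze_def)
qed

lemma tail_in_Omega: "0 <= s ==> s <= T ==> w \<in> Omega T ==> tail T s w \<in> Omega T"
proof -
 assume s: "0 <= s" "s <= T" and w: "w \<in> Omega T"
 have "continuous_on {0..T} (%r. w (min (s + r) T) - w s)"
  by (intro continuous_on_diff continuous_on_const continuous_on_compose2[OF OmegaD(1)[OF w]])
   (use s in "auto intro!: continuous_intros")
 then have "continuous_on {0..T} (tail T s w)"
  by (rule continuous_on_eq) (auto simp: tail_def)
 moreover have "tail T s w 0 = 0" using s by (auto simp: tail_def)
 ultimately show ?thesis by (auto simp: Omega_def tail_def)
qed

lemma concat_path_in_Omega:
 assumes t: "0 <= t" "t <= T" and w: "w \<in> Omega T" "w' \<in> Omega T"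
 shows "concat_path T t w w' \<in> Omega T"
proof -
 have eq: "(if s <= t then w s else w t + w' (s - t)) = w (min s t) + w' (max 0 (s - t))" if "s \<in> {0..T}" for s
  using w(2) by (auto simp: OmegaD(2))
 have "continuous_on {0..T} (%s. w (min s t) + w' (max 0 (s - t)))"
  by (intro continuous_on_add continuous_on_compose2[OF OmegaD(1)[OF w(1)]]
    continuous_on_compose2[OF OmegaD(1)[OF w(2)]])
   (use t in "auto intro!: continuous_intros")
 then have "continuous_on {0..T} (concat_path T t w w')"
  by (rule continuous_on_eq) (simp add: concat_path_def OmegaD(2)[OF w(2)] min_def max_def)
 then show ?thesis using t w by (auto simp: Omega_def concat_path_def)
qed

text \<open>The flow property of shifts: a shifted process, shifted once more, is the process
  shifted by the concatenated path. The Markov property and the comparison of restarted coefficients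
  both rest on it.\<close>

lemma concat_path_assoc:
 assumes "0 <= t" "0 <= s" "t + s <= T" "w \<in> Omega T"
 shows "concat_path T t w0 (concat_path T s w w') = concat_path T (t + s) (concat_path T t w0 w) w'"
 using assms OmegaD(2)[OF assms(4)]
 by (intro ext) (auto simp: concat_path_def restrict_def algebra_simps)

lemma concat_path_tail:
 assumes "0 <= s" "s <= T" "w \<in> Omega T"
 shows "concat_path T s w (tail T s w) = w"
proof (rule Omega_eqI)
 show "concat_path T s w (tail T s w) \<in> Omega T"
  using assms by (intro concat_path_in_Omega tail_in_Omega)
qed (use assms in "auto simp: concat_path_def tail_def min_def")

lemma concat_path_cong:
 assumes "!!r. 0 <= r ==> r <= s ==> w r = w1 r" "0 <= s"
 shows "concat_path T s w w' = concat_path T s w1 w'"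
 using assms by (intro ext) (auto simp: concat_path_def restrict_def)

lemma path_at_random_time:
 assumes Z: "Z \<in> measurable N (paths T)"
  and R: "R \<in> borel_measurable N" "!!x. x \<in> space N ==> 0 <= R x \<and> R x <= T"
 shows "(%x. Z x (R x)) \<in> borel_measurable N"
proof (rule measurable_at_random_time[of T "%s x. Z x s", OF _ _ R])
 show "(%x. Z x s) \<in> borel_measurable N" if "0 <= s" "s <= T" for s
  using measurable_compose[OF Z coordinate_measurable[OF that(1,2)]] that by simp
 show "continuous_on {0..T} (%s. Z x s)" if "x \<in> space N" for x
  using measurable_space[OF Z that] OmegaD(1) by auto
qed

lemma concat_path_measurable:
 assumes Z: "Z \<in> measurable N (paths T)" "Z' \<in> measurable N (paths T)"
  and R[measurable]: "R \<in> borel_measurable N" and R': "!!x. x \<in> space N ==> 0 <= R x \<and> R x <= T"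
 shows "(%x. concat_path T (R x) (Z x) (Z' x)) \<in> measurable N (paths T)"
proof (rule measurable_into_path_space)
 show "concat_path T (R x) (Z x) (Z' x) \<in> Omega T" if "x \<in> space N" for x
  using measurable_space[OF Z(1) that] measurable_space[OF Z(2) that] R'[OF that]
  by (intro concat_path_in_Omega) auto
 fix r assume r: "0 <= r" "r <= T"
 have [measurable]: "(%x. Z x r) \<in> borel_measurable N"
  using path_at_random_time[OF Z(1), of "%_. r"] r by simp
 have [measurable]: "(%x. Z x (R x)) \<in> borel_measurable N"
  by (rule path_at_random_time[OF Z(1) R R'])
 have [measurable]: "(%x. Z' x (max 0 (r - R x))) \<in> borel_measurable N"
  by (rule path_at_random_time[OF Z(2)]) (measurable, use R' r in force)
 have "(%x. if r <= R x then Z x r else Z x (R x) + Z' x (max 0 (r - R x))) \<in> borel_measurable N"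
  by measurable
 then show "(%x. concat_path T (R x) (Z x) (Z' x) r) \<in> borel_measurable N"
  by (rule measurable_cong[THEN iffD1, rotated]) (use r in "auto simp: concat_path_def max_def")
qed

lemma freeze_measurable:
 assumes Z: "Z \<in> measurable N (paths T)"
  and R[measurable]: "R \<in> borel_measurable N" and R': "!!x. x \<in> space N ==> 0 <= R x"
 shows "(%x. freeze T (R x) (Z x)) \<in> measurable N (paths T)"
proof (rule measurable_into_path_space)
 show "freeze T (R x) (Z x) \<in> Omega T" if "x \<in> space N" for x
  using measurable_space[OF Z(1) that] R'[OF that] by (intro freeze_in_Omega) auto
 fix r assume r: "0 <= r" "r <= T"
 have "(%x. Z x (min (R x) r)) \<in> borel_measurable N"
  by (rule path_at_random_time[OF Z(1)]) (measurable, use R' r in force)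
 then show "(%x. freeze T (R x) (Z x) r) \<in> borel_measurable N"
  using r by (simp add: freeze_def)
qed

lemma tail_measurable:
 assumes Z: "Z \<in> measurable N (paths T)"
  and R[measurable]: "R \<in> borel_measurable N" and R': "!!x. x \<in> space N ==> 0 <= R x \<and> R x <= T"
 shows "(%x. tail T (R x) (Z x)) \<in> measurable N (paths T)"
proof (rule measurable_into_path_space)
 show "tail T (R x) (Z x) \<in> Omega T" if "x \<in> space N" for x
  using measurable_space[OF Z(1) that] R'[OF that] by (intro tail_in_Omega) auto
 fix r assume r: "0 <= r" "r <= T"
 have "(%x. Z x (min (R x + r) T) - Z x (R x)) \<in> borel_measurable N"
  by (intro borel_measurable_diff path_at_random_time[OF Z(1)]) (measurable, use R' r in force)+
 then show "(%x. tail T (R x) (Z x) r) \<in> borel_measurable N"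
  using r by (simp add: tail_def)
qed

lemma freeze_adapted:
 assumes "0 <= s"
 shows "freeze T s \<in> measurable (canonical_filtration T s) (paths T)"
proof (rule measurable_into_path_space)
 show "freeze T s x \<in> Omega T" if "x \<in> space (canonical_filtration T s)" for x
  using that assms by (intro freeze_in_Omega) auto
 fix r assume r: "0 <= r" "r <= T"
 show "(%x. freeze T s x r) \<in> borel_measurable (canonical_filtration T s)"
  using coordinate_measurable[of "min s r" s T] r assms by (simp add: freeze_def min.coboundedI2)
qed

text \<open>Converse half of Galmarino's test: such an \<open>f\<close> is unchanged by composition
  with \<open>freeze T s\<close>, which is measurable from the sigma-algebra at time
  \<open>s\<close>.\<close>

lemma nonanticipative_measurable:
 assumes f: "f \<in> measurable (paths T) N" and s: "0 <= s"
  and na: "!!w w'. w \<in> Omega T ==> w' \<in> Omega T ==> (!!r. 0 <= r ==> r <= s ==> r <= T ==> w r = w' r) ==> f w = f w'"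
 shows "f \<in> measurable (canonical_filtration T s) N"
proof -
 have "(%w. f (freeze T s w)) \<in> measurable (canonical_filtration T s) N"
  by (rule measurable_compose[OF freeze_adapted[OF s] f])
 then show ?thesis
 proof (rule measurable_cong[THEN iffD1, rotated])
  fix w :: "'a path" assume "w \<in> space (canonical_filtration T s)"
  then show "f (freeze T s w) = f w"
   by (intro na freeze_in_Omega s) (auto simp: freeze_def)
 qed
qed

text \<open>Galmarino's characterisation: with values determined by the path up to the value itself,
  the event \<open>R w <= t\<close> depends on the path up to \<open>t\<close>. All stopping times
  constructed below are recognised in this way.\<close>

lemma stopping_timesI:
 assumes meas: "R \<in> borel_measurable (paths T)"
  and range: "!!w. w \<in> Omega T ==> 0 <= R w \<and> R w <= T"
  and na: "!!w w'. w \<in> Omega T ==> w' \<in> Omega T ==> (!!r. 0 <= r ==> r <= R w ==> w r = w' r) ==> R w' = R w"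
 shows "R \<in> stopping_times T"
 unfolding stopping_times_def stopping_time_def
proof (intro CollectI conjI allI)
 fix t
 show "Measurable.pred (canonical_filtration T t) (%w. R w <= t)"
 proof (cases "t \<ge> 0")
  case True
  show ?thesis
  proof (rule nonanticipative_measurable[OF _ True])
   note [measurable] = meas
   show "(%w. R w <= t) \<in> measurable (paths T) (count_space UNIV)" by measurable
   fix w w' :: "'a path" assume w: "w \<in> Omega T" "w' \<in> Omega T" and eq: "!!r. 0 <= r ==> r <= t ==> r <= T ==> w r = w' r"
   show "(R w <= t) = (R w' <= t)"
   proof
    assume t: "R w <= t"
    have "R w' = R w" by (rule na[OF w]) (use t range[OF w(1)] eq in auto)
    then show "R w' <= t" using t by simp
   next
    assume t: "R w' <= t"
    have "R w = R w'" by (rule na[OF w(2,1)]) (use t range[OF w(2)] eq in auto)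
    then show "R w <= t" using t by simp
   qed
  qed
 next
  case False
  have "Measurable.pred (canonical_filtration T t) (%w. False)" by simp
  then show ?thesis
   by (rule measurable_cong[THEN iffD1, rotated]) (use False range in force)
 qed
qed (use range in auto)

lemma stopping_timesD:
 assumes "R \<in> stopping_times T"
 shows "R \<in> borel_measurable (paths T)"
  and "!!w. w \<in> Omega T ==> 0 <= R w \<and> R w <= T"
  and "!!w w'. w \<in> Omega T ==> w' \<in> Omega T ==> (!!r. 0 <= r ==> r <= R w ==> w r = w' r) ==> R w' = R w"
  and "!!s. {w \<in> Omega T. R w <= s} \<in> sets (canonical_filtration T s)"
proof -
 have st: "Measurable.pred (canonical_filtration T s) (%w. R w <= s)" for s
  using assms by (auto simp: stopping_times_def stopping_time_def)
 show le: "{w \<in> Omega T. R w <= s} \<in> sets (canonical_filtration T s)" for s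
  using st[of s] by (simp add: pred_def)
 show "R \<in> borel_measurable (paths T)"
  unfolding borel_measurable_iff_le
 proof
  fix a
  show "{w \<in> space (paths T). R w <= a} \<in> sets (paths T)"
   using subsetD[OF canonical_filtration_le le[of a]] by simp
 qed
 show range: "0 <= R w \<and> R w <= T" if "w \<in> Omega T" for w
  using assms that by (auto simp: stopping_times_def)
 fix w w' :: "'a path" assume w: "w \<in> Omega T" "w' \<in> Omega T" and eq: "!!r. 0 <= r ==> r <= R w ==> w r = w' r"
 have 1: "R w' <= R w"
  using galmarino_sets[OF le[of "R w"] w] eq w by auto
 have 2: "R w <= R w'"
  using galmarino_sets[OF le[of "R w'"] w] eq w 1 by auto
 from 1 2 show "R w' = R w" by simp
qed

section \<open>Piecewise linear interpolation\<close>

definition grid :: "real => nat => nat => real" where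
 "grid T n i = real i * T / 2 ^ n"

definition hat :: "real => real" where
 "hat y = max 0 (1 - \<bar>y\<bar>)"

text \<open>Hat functions centred at the grid points form a partition of unity. This formula,
  instead of a case distinction on the cell, makes continuity in time and measurable dependence on
  the nodes immediate.\<close>

definition interp :: "real => nat => (nat => real ^ ('d::finite)) => 'd path" where
 "interp T n x = (\<lambda>s\<in>{0..T}. \<Sum>i\<le>2^n. hat (s * 2^n / T - real i) *\<^sub>R x i)"

lemma grid_simps [simp]: "grid T n 0 = 0" "grid T n (2^n) = T"
 by (simp_all add: grid_def)

lemma grid_mono: "T \<ge> 0 ==> i <= j ==> grid T n i <= grid T n j"
 by (auto simp: grid_def intro!: divide_right_mono mult_right_mono)

lemma grid_Suc: "grid T n (Suc i) = grid T n i + T / 2^n"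
 by (simp add: grid_def field_simps)

lemma grid_nonneg: "T \<ge> 0 ==> 0 <= grid T n i"
 by (simp add: grid_def)

lemma grid_le: "T \<ge> 0 ==> i <= 2^n ==> grid T n i <= T"
 using grid_mono[of T i "2^n" n] by simp

lemma grid_add: "grid T n (i + j) = grid T n i + grid T n j"
 by (simp add: grid_def field_simps)

lemma grid_less_iff: "T > 0 ==> grid T n i < grid T n j \<longleftrightarrow> i < j"
 by (auto simp: grid_def divide_less_cancel)

lemma grid_le_iff: "T > 0 ==> grid T n i <= grid T n j \<longleftrightarrow> i <= j"
 by (auto simp: grid_def divide_le_cancel)

lemma mesh_tendsto_0: "(%n. T / 2^n) \<longlonglongrightarrow> (0::real)"
proof -
 have "(%n. T * (1/2)^n) \<longlonglongrightarrow> T * 0"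
  by (intro tendsto_mult tendsto_const LIMSEQ_power_zero) simp
 then show ?thesis by (simp add: power_one_over)
qed

lemma hat_nonneg: "0 <= hat y" by (simp add: hat_def)

lemma hat_partition_of_unity: "0 <= y ==> y <= real N ==> (\<Sum>i\<le>N. hat (y - real i)) = 1"
proof (induction N)
 case 0
 then show ?case by (simp add: hat_def)
next
 case (Suc N)
 show ?case
 proof (cases "y <= real N")
  case True
  then show ?thesis using Suc by (simp add: hat_def)
 next
  case False
  have "(\<Sum>i\<le>N. hat (y - real i)) = (\<Sum>i\<in>{N}. hat (y - real i))"
   by (rule sum.mono_neutral_right) (use False in "auto simp: hat_def")
  then show ?thesis using False Suc.prems by (simp add: hat_def)
 qed
qed

text \<open>The value is a convex combination of the nodes at distance less than one mesh from
  \<open>s\<close>, so only those have to be close to \<open>c\<close>.\<close>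

lemma interp_close:
 assumes T: "T > 0" and s: "0 <= s" "s <= T"
  and close: "!!j. j <= 2^n ==> \<bar>s - grid T n j\<bar> < T / 2^n ==> norm (x j - c) <= a"
 shows "norm (interp T n x s - c) <= a"
proof -
 define h where "h i = hat (s * 2^n / T - real i)" for i
 have h1: "(\<Sum>i\<le>2^n. h i) = 1"
  unfolding h_def by (rule hat_partition_of_unity[where N="2^n"]) (use s T in "auto simp: field_simps")
 have h0: "0 <= h i" for i by (simp add: h_def hat_nonneg)
 have "interp T n x s - c = (\<Sum>i\<le>2^n. h i *\<^sub>R x i) - (\<Sum>i\<le>2^n. h i) *\<^sub>R c"
  using s by (simp add: interp_def h_def h1[unfolded h_def])
 also have "... = (\<Sum>i\<le>2^n. h i *\<^sub>R (x i - c))"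
  by (simp add: scaleR_diff_right sum_subtractf scaleR_sum_left)
 also have "norm ... <= (\<Sum>i\<le>2^n. h i * a)"
 proof (rule sum_norm_le)
  fix i :: nat assume i: "i \<in> {..2^n}"
  show "norm (h i *\<^sub>R (x i - c)) <= h i * a"
  proof (cases "h i = 0")
   case False
   then have "\<bar>s * 2^n / T - real i\<bar> < 1" by (auto simp: h_def hat_def max_def split: if_splits)
   then have "\<bar>s * 2^n / T - real i\<bar> * (T / 2^n) < 1 * (T / 2^n)"
    by (rule mult_strict_right_mono) (use T in simp)
   moreover have e: "s - grid T n i = (s * 2^n / T - real i) * (T / 2^n)"
    using T by (simp add: grid_def field_simps)
   have "\<bar>s - grid T n i\<bar> = \<bar>s * 2^n / T - real i\<bar> * (T / 2^n)"
    unfolding e abs_mult using T by simp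
   ultimately have "norm (x i - c) <= a" using i by (intro close) (simp_all only: mult_1 atMost_iff)
   then show ?thesis using h0[of i] by (simp add: mult_left_mono)
  qed simp
 qed
 also have "... = a" using h1 by (simp flip: sum_distrib_right)
 finally show ?thesis .
qed

lemma interp_in_Omega:
 assumes "T > 0" "x 0 = 0"
 shows "interp T n x \<in> Omega T"
proof -
 have "continuous_on {0..T} (%s. \<Sum>i\<le>2^n. hat (s * 2^n / T - real i) *\<^sub>R x i)"
  using assms(1) unfolding hat_def by (intro continuous_intros) auto
 then have "continuous_on {0..T} (interp T n x)"
  by (rule continuous_on_eq) (simp add: interp_def)
 moreover have "interp T n x 0 = 0"
 proof -
  have "norm (interp T n x 0 - 0) <= 0"
  proof (rule interp_close)
   fix j assume "\<bar>0 - grid T n j\<bar> < T / 2^n"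
   then have "grid T n j < grid T n (Suc 0)"
    using grid_nonneg[of T n j] assms(1) unfolding grid_Suc by simp
   then have "j = 0" using grid_less_iff[OF assms(1)] by simp
   then show "norm (x j - 0) <= 0" using assms(2) by simp
  qed (use assms in auto)
  then show ?thesis by simp
 qed
 ultimately show ?thesis by (auto simp: Omega_def interp_def)
qed

lemma interp_close_path:
 assumes T: "T > 0" and s: "0 <= s" "s <= grid T n i" and i: "i <= 2^n"
  and x: "!!j. j <= i ==> norm (x j - f (grid T n j)) <= a"
  and osc: "!!r r'. 0 <= r ==> r <= grid T n i ==> 0 <= r' ==> r' <= grid T n i ==>
    \<bar>r - r'\<bar> <= T / 2^n ==> norm (f r - f r') <= b"
 shows "norm (interp T n x s - f s) <= a + b"
proof (rule interp_close[OF T])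
 show "s <= T" using s grid_le[of T i n] T i by simp
 fix j assume j: "j <= 2^n" "\<bar>s - grid T n j\<bar> < T / 2^n"
 \<comment> \<open>A node that influences the value at \<open>s <= grid T n i\<close> has index at
   most \<open>i\<close>, so the comparison up to this time uses no later node.\<close>
 then have "grid T n j < grid T n (Suc i)" using s by (simp add: grid_Suc abs_less_iff)
 then have ji: "j <= i" using grid_less_iff[OF T] by simp
 have "norm (f (grid T n j) - f s) <= b"
  using j s ji grid_nonneg[of T n j] grid_mono[of T j i n] T by (intro osc) (auto simp: abs_minus_commute)
 then have "norm (x j - f (grid T n j)) + norm (f (grid T n j) - f s) <= a + b"
  using x[OF ji] by simp
 then show "norm (x j - f s) <= a + b"
  using norm_triangle_ineq[of "x j - f (grid T n j)" "f (grid T n j) - f s"] by simp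
qed (use s in auto)

lemma modulus_of_continuity:
 fixes f :: "real => 'b::real_normed_vector"
 assumes "continuous_on {0..T} f" "e > 0"
 obtains c where "c > 0" "!!r r'. r \<in> {0..T} ==> r' \<in> {0..T} ==> \<bar>r - r'\<bar> <= c ==> norm (f r - f r') < e"
proof -
 have "uniformly_continuous_on {0..T} f"
  using assms(1) by (intro compact_uniformly_continuous) auto
 then obtain d where d: "d > 0" "!!x x'. x \<in> {0..T} ==> x' \<in> {0..T} ==> dist x' x < d ==> dist (f x') (f x) < e"
  unfolding uniformly_continuous_on_def using assms(2) by metis
 show thesis
 proof (rule that[of "d/2"])
  fix r r' assume r: "r \<in> {0..T}" "r' \<in> {0..T}" "\<bar>r - r'\<bar> <= d/2"
  then have "dist r r' < d" using d(1) by (simp add: dist_real_def)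
  then show "norm (f r - f r') < e" using d(2)[OF r(2,1)] by (simp add: dist_norm)
 qed (use d in simp)
qed

text \<open>A functional that is continuous for the uniform norm is the limit of its values at
 interpolated paths, which depend continuously on finitely many coordinates.\<close>

lemma path_continuous_measurable:
 fixes f :: "('d::finite) path => 'e::metric_space"
 assumes T: "T > 0" and p: "0 <= p" "p <= T"
  and cont: "!!w e. w \<in> Omega T ==> e > 0 ==>
   \<exists>g>0. \<forall>w'\<in>Omega T. (\<forall>r\<in>{0..p}. norm (w r - w' r) < g) \<longrightarrow> dist (f w) (f w') < e"
 shows "f \<in> borel_measurable (canonical_filtration T p)"
proof (rule nonanticipative_measurable[OF _ p(1)])
 \<comment> \<open>Node 0 is reset to 0 so that every sequence whatsoever yields a path of
   \<open>Omega T\<close>; the composition with \<open>f\<close> is then continuous on the whole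
   sequence space.\<close>
 define L where "L n x = interp T n (x(0 := 0))" for n and x :: "nat => real ^ 'd"
 have L: "L n x \<in> Omega T" for n x
  unfolding L_def by (rule interp_in_Omega) (use T in auto)
 have "continuous_on UNIV (%x. f (L n x))" for n
  unfolding continuous_on_sequentially
 proof (intro allI ballI impI)
  fix X :: "nat => nat => real ^ 'd" and a assume "(\<forall>m. X m \<in> UNIV) \<and> X \<longlonglongrightarrow> a"
  then have lim: "(%m. X m i) \<longlonglongrightarrow> a i" for i
   using continuous_on_tendsto_compose[OF continuous_on_product_coordinates[of i], of X a sequentially] by simp
  show "((%x. f (L n x)) \<circ> X) \<longlonglongrightarrow> f (L n a)"
  proof (rule metric_LIMSEQ_I)
   fix e :: real assume "e > 0"
   then obtain d where d: "d > 0" "\<forall>w'\<in>Omega T. (\<forall>r\<in>{0..p}. norm (L n a r - w' r) < d) \<longrightarrow> dist (f (L n a)) (f w') < e"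
    using cont[OF L `e > 0`, of n a] by blast
   have "\<forall>\<^sub>F m in sequentially. \<forall>i\<in>{..2^n}. norm (X m i - a i) < d/2"
   proof (rule eventually_ball_finite)
    show "\<forall>i\<in>{..2^n}. \<forall>\<^sub>F m in sequentially. norm (X m i - a i) < d/2"
     using lim d(1) by (auto intro!: order_tendstoD(2)[of _ 0] tendsto_norm_zero LIM_zero)
   qed simp
   then obtain N where N: "!!m i. m \<ge> N ==> i <= 2^n ==> norm (X m i - a i) < d/2"
    by (auto simp: eventually_sequentially)
   show "\<exists>no. \<forall>m\<ge>no. dist (((%x. f (L n x)) \<circ> X) m) (f (L n a)) < e"
   proof (intro exI allI impI)
    fix m assume m: "m \<ge> N"
    have "norm (L n a r - L n (X m) r) < d" if r: "r \<in> {0..p}" for r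
    proof -
     have eq: "L n a r - L n (X m) r = interp T n ((%i. a i - X m i)(0 := 0)) r - 0"
      using r p by (auto simp: L_def interp_def sum_subtractf[symmetric] scaleR_diff_right[symmetric]
       intro!: sum.cong)
     have "norm (interp T n ((%i. a i - X m i)(0 := 0)) r - 0) <= d/2"
      by (rule interp_close[OF T]) (use r p N[OF m] d(1) in "auto simp: norm_minus_commute less_imp_le")
     then show ?thesis using d(1) unfolding eq by linarith
    qed
    then have "dist (f (L n a)) (f (L n (X m))) < e" using d(2) L by blast
    then show "dist (((%x. f (L n x)) \<circ> X) m) (f (L n a)) < e"
     by (simp add: dist_commute)
   qed
  qed
 qed
 then have [measurable]: "(%x. f (L n x)) \<in> borel_measurable borel" for n
  by (rule borel_measurable_continuous_onI)
 define c where "c n w i = w (min T (grid T n i))" for n i and w :: "'d path"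
 have c: "c n \<in> borel_measurable (paths T)" for n
  unfolding c_def
  by (rule measurable_coordinatewise_then_product, rule coordinate_measurable)
   (use T grid_nonneg[of T n] in auto)
 show "f \<in> borel_measurable (paths T)"
 proof (rule borel_measurable_LIMSEQ_metric[of "%n w. f (L n (c n w))"])
  show "(%w. f (L n (c n w))) \<in> borel_measurable (paths T)" for n
   by (rule measurable_compose[OF c]) measurable
  fix w :: "'d path" assume "w \<in> space (paths T)"
  then have w: "w \<in> Omega T" by simp
  show "(%n. f (L n (c n w))) \<longlonglongrightarrow> f w"
  proof (rule metric_LIMSEQ_I)
   fix e :: real assume "e > 0"
   then obtain d where d: "d > 0" "\<forall>w'\<in>Omega T. (\<forall>r\<in>{0..p}. norm (w r - w' r) < d) \<longrightarrow> dist (f w) (f w') < e"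
    using cont[OF w `e > 0`] by blast
   obtain g where g: "g > 0" "!!r r'. r \<in> {0..T} ==> r' \<in> {0..T} ==> \<bar>r - r'\<bar> <= g ==> norm (w r - w r') < d/2"
    using modulus_of_continuity[OF OmegaD(1)[OF w], of "d/2"] d(1) by auto
   have "\<forall>\<^sub>F n in sequentially. T / 2^n < g"
    using order_tendstoD(2)[OF mesh_tendsto_0 g(1)] .
   then obtain N where N: "!!n. n \<ge> N ==> T / 2^n < g" by (auto simp: eventually_sequentially)
   show "\<exists>no. \<forall>n\<ge>no. dist (f (L n (c n w))) (f w) < e"
   proof (intro exI allI impI)
    fix n assume n: "n \<ge> N"
    have "norm (w r - L n (c n w) r) < d" if r: "r \<in> {0..p}" for r
    proof -
     have "norm (L n (c n w) r - w r) <= d/2"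
      unfolding L_def
     proof (rule interp_close[OF T])
      fix j assume j: "j <= 2^n" "\<bar>r - grid T n j\<bar> < T / 2^n"
      have "norm (w (grid T n j) - w r) < d/2"
       using j N[OF n] r p T grid_nonneg[of T n j] grid_le[of T j n] by (intro g(2)) auto
      then show "norm (((c n w)(0 := 0)) j - w r) <= d/2"
       using grid_le[of T j n] j T OmegaD(2)[OF w] by (auto simp: c_def)
     qed (use r p in auto)
     then show ?thesis using d(1) by (simp add: norm_minus_commute)
    qed
    then have "dist (f w) (f (L n (c n w))) < e" using d(2) L by blast
    then show "dist (f (L n (c n w))) (f w) < e"
     by (simp add: dist_commute)
   qed
  qed
 qed
next
 fix w w' :: "'d path" assume w: "w \<in> Omega T" "w' \<in> Omega T" and eq: "!!r. 0 <= r ==> r <= p ==> r <= T ==> w r = w' r"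
 have "dist (f w) (f w') < e" if e: "e > 0" for e
  using cont[OF w(1) e] w(2) eq p by force
 then have "\<not> 0 < dist (f w) (f w')" by blast
 then show "f w = f w'" by simp
qed

section \<open>Continuous adapted processes\<close>

text \<open>Adaptedness is split into measurability at the terminal time and dependence on the path
  up to \<open>t\<close>; \<open>nonanticipative_measurable\<close> recombines the two. The horizon
  \<open>S\<close> of the process is separate from \<open>T\<close> because shifted processes live
  on \<open>[0, T - t]\<close> while all paths live on \<open>[0, T]\<close>.\<close>

definition continuous_adapted :: "real => real => (real => ('d::finite) path => 'e::topological_space) => bool" where
 "continuous_adapted T S Y \<longleftrightarrow>
  (\<forall>t\<in>{0..S}. Y t \<in> borel_measurable (paths T)) \<and>
  (\<forall>w\<in>Omega T. continuous_on {0..S} (%t. Y t w)) \<and>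
  (\<forall>t\<in>{0..S}. \<forall>w\<in>Omega T. \<forall>w'\<in>Omega T. (\<forall>r\<in>{0..t}. w r = w' r) \<longrightarrow> Y t w = Y t w')"

lemma continuous_adaptedD:
 assumes "continuous_adapted T S Y"
 shows "!!t. 0 <= t ==> t <= S ==> Y t \<in> borel_measurable (paths T)"
  "!!w. w \<in> Omega T ==> continuous_on {0..S} (%t. Y t w)"
  "!!t w w'. 0 <= t ==> t <= S ==> w \<in> Omega T ==> w' \<in> Omega T ==> (!!r. 0 <= r ==> r <= t ==> w r = w' r) ==> Y t w = Y t w'"
 using assms unfolding continuous_adapted_def by (simp, simp, meson atLeastAtMost_iff)

lemma continuous_adapted_measurable:
 assumes Y: "continuous_adapted T S Y" and t: "0 <= t" "t <= S" "S <= T"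
 shows "Y t \<in> borel_measurable (canonical_filtration T t)"
 by (rule nonanticipative_measurable[OF continuous_adaptedD(1)[OF Y t(1,2)] t(1)],
   rule continuous_adaptedD(3)[OF Y t(1,2)]) (use t in auto)

lemma continuous_adapted_stopped_measurable:
 fixes Y :: "real => ('d::finite) path => 'e::metric_space"
 assumes Y: "continuous_adapted T S Y"
  and "R \<in> borel_measurable (paths T)" "!!w. w \<in> Omega T ==> 0 <= R w \<and> R w <= S"
 shows "(%w. Y (R w) w) \<in> borel_measurable (paths T)"
 by (rule measurable_at_random_time[of S])
  (use assms continuous_adaptedD(1,2)[OF Y] in auto)

lemma continuous_adapted_shift:
 assumes Y: "continuous_adapted T T Y" and t: "0 <= t" "t <= T" and w: "w \<in> Omega T"
 shows "continuous_adapted T (T - t) (shift_process T t w Y)"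
 unfolding continuous_adapted_def
proof (intro conjI ballI impI)
 have conc: "(%w'. concat_path T t w w') \<in> measurable (paths T) (paths T)"
  by (rule concat_path_measurable) (use t w in auto)
 fix s assume s: "s \<in> {0..T - t}"
 show "shift_process T t w Y s \<in> borel_measurable (paths T)"
  unfolding shift_process_def
  by (rule measurable_compose[OF conc continuous_adaptedD(1)[OF Y]]) (use s t in auto)
 fix w1 w2 :: "'a path" assume w12: "w1 \<in> Omega T" "w2 \<in> Omega T" "\<forall>r\<in>{0..s}. w1 r = w2 r"
 show "shift_process T t w Y s w1 = shift_process T t w Y s w2"
  unfolding shift_process_def
 proof (rule continuous_adaptedD(3)[OF Y _ _ concat_path_in_Omega concat_path_in_Omega])
  show "concat_path T t w w1 r = concat_path T t w w2 r" if "0 <= r" "r <= t + s" for r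
   using that w12 by (auto simp: concat_path_def restrict_def)
 qed (use s t w w12 in auto)
next
 fix w1 :: "'a path" assume w1: "w1 \<in> Omega T"
 show "continuous_on {0..T - t} (%s. shift_process T t w Y s w1)"
  unfolding shift_process_def
  by (rule continuous_on_compose2[OF continuous_adaptedD(2)[OF Y concat_path_in_Omega[OF t w w1]]])
   (use t in "auto intro!: continuous_intros")
qed

lemma path_norm_le:
 assumes "t \<ge> 0" "!!s. 0 <= s ==> s <= t ==> norm (g s) <= a"
 shows "path_norm t g <= a"
 unfolding path_norm_def by (rule cSUP_least) (use assms in auto)

lemma C0D:
 assumes "u \<in> C0 T" "0 <= t" "t <= T" "w \<in> Omega T" "e > 0"
 obtains d where "d > 0" "\<forall>t'\<in>{0..T}. \<forall>w'\<in>Omega T. theta_dist T t w t' w' < d \<longrightarrow> norm (u t w - u t' w') < e"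
proof -
 have *: "\<forall>t\<in>{0..T}. \<forall>w\<in>Omega T. \<forall>e>0. \<exists>d>0. \<forall>t'\<in>{0..T}. \<forall>w'\<in>Omega T.
   theta_dist T t w t' w' < d \<longrightarrow> norm (u t w - u t' w') < e"
  using assms(1) unfolding C0_def by (rule CollectD)
 have "t \<in> {0..T}" using assms(2,3) by simp
 from *[THEN bspec, OF this, THEN bspec, OF assms(4), THEN spec, THEN mp, OF assms(5)]
 show thesis using that by blast
qed

text \<open>The pseudo-distance of \<open>(t, w)\<close> and \<open>(t, w')\<close> involves the
  paths only up to \<open>t\<close>, so continuity in \<open>w\<close> at fixed \<open>t\<close>
  gives measurability and adaptedness at once. Continuity in \<open>t\<close> comes from the modulus
  of continuity of the path.\<close>

lemma C0_continuous_adapted: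
 fixes u :: "real => ('d::finite) path => 'e::real_normed_vector"
 assumes T: "T > 0" and u: "u \<in> C0 T"
 shows "continuous_adapted T T u"
proof -
 have cont: "\<exists>c>0. \<forall>w'\<in>Omega T. (\<forall>r\<in>{0..t}. norm (w r - w' r) < c) \<longrightarrow> dist (u t w) (u t w') < e"
  if t: "0 <= t" "t <= T" and w: "w \<in> Omega T" and e: "e > 0" for t w e
 proof -
  obtain d where d: "d > 0" "\<forall>t'\<in>{0..T}. \<forall>w'\<in>Omega T. theta_dist T t w t' w' < d \<longrightarrow> norm (u t w - u t' w') < e"
   using C0D[OF u _ _ w e, of t] t by auto
  have "theta_dist T t w t w' < d" if "\<forall>r\<in>{0..t}. norm (w r - w' r) < d/2" for w'
  proof -
   have "path_norm T (%s. w (min t s) - w' (min t s)) <= d/2"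
    by (rule path_norm_le) (use that t in "auto intro!: less_imp_le")
   then show ?thesis using d(1) by (simp add: theta_dist_def)
  qed
  then show ?thesis using d t by (intro exI[of _ "d/2"]) (auto simp: dist_norm)
 qed
 show ?thesis
  unfolding continuous_adapted_def
 proof (intro conjI ballI impI)
  fix t assume t: "t \<in> {0..T}"
  show "u t \<in> borel_measurable (paths T)"
   by (rule measurable_canonical_le, rule path_continuous_measurable[of T t]) (use T t cont in auto)
  fix w w' :: "'d path" assume w: "w \<in> Omega T" "w' \<in> Omega T" "\<forall>r\<in>{0..t}. w r = w' r"
  have "dist (u t w) (u t w') < e" if e: "e > 0" for e
   using cont[of t w e] w t e by force
  then have "\<not> 0 < dist (u t w) (u t w')" by blast
  then show "u t w = u t w'" by simp
 next
  fix w :: "'d path" assume w: "w \<in> Omega T"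
  show "continuous_on {0..T} (%t. u t w)"
   unfolding continuous_on_iff
  proof (intro ballI allI impI)
   fix t e :: real assume t: "t \<in> {0..T}" and e: "0 < e"
   obtain d where d: "d > 0" "\<forall>t'\<in>{0..T}. \<forall>w'\<in>Omega T. theta_dist T t w t' w' < d \<longrightarrow> norm (u t w - u t' w') < e"
    using C0D[OF u _ _ w e, of t] t by auto
   obtain c where c: "c > 0" "!!r r'. r \<in> {0..T} ==> r' \<in> {0..T} ==> \<bar>r - r'\<bar> <= c ==> norm (w r - w r') < d/2"
    using modulus_of_continuity[OF OmegaD(1)[OF w], of "d/2"] d(1) by auto
   show "\<exists>d'>0. \<forall>x'\<in>{0..T}. dist x' t < d' \<longrightarrow> dist (u x' w) (u t w) < e"
   proof (intro exI[of _ "min c (d/2)"] conjI ballI impI)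
    fix t' assume t': "t' \<in> {0..T}" "dist t' t < min c (d/2)"
    have "path_norm T (%s. w (min t s) - w (min t' s)) <= d/2"
    proof (rule path_norm_le)
     fix s assume s: "0 <= s" "s <= T"
     have "\<bar>min t s - min t' s\<bar> <= c" using t'(2) c(1) by (simp add: dist_real_def) linarith
     then show "norm (w (min t s) - w (min t' s)) <= d/2"
      using s t t' by (intro less_imp_le[OF c(2)]) auto
    qed (use T in simp)
    then have "theta_dist T t w t' w < d" using t' by (simp add: theta_dist_def dist_real_def abs_minus_commute)
    then show "dist (u t' w) (u t w) < e"
     using d(2) t' w by (simp add: dist_norm norm_minus_commute)
   qed (use c d in auto)
  qed
 qed
qed

lemma admissible_coeffD:
 assumes "admissible_coeff T \<sigma>"
 obtains C where "C \<ge> 0"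
  "!!t w w' a. 0 <= t ==> t <= T ==> w \<in> Omega T ==> w' \<in> Omega T ==>
   (!!s. 0 <= s ==> s <= t ==> norm (w s - w' s) <= a) ==> norm (\<sigma> t w - \<sigma> t w') <= C * a"
proof -
 obtain C where C: "C \<ge> 0" "\<forall>t\<in>{0..T}. \<forall>w\<in>Omega T. \<forall>w'\<in>Omega T.
    norm (\<sigma> t w - \<sigma> t w') <= C * path_norm t (%s. w s - w' s)"
  using assms by (auto simp: admissible_coeff_def)
 show thesis
 proof (rule that[OF C(1)])
  fix t a and w w' :: "'a path" assume *: "0 <= t" "t <= T" "w \<in> Omega T" "w' \<in> Omega T"
   "!!s. 0 <= s ==> s <= t ==> norm (w s - w' s) <= a"
  have "path_norm t (%s. w s - w' s) <= a" by (rule path_norm_le) (use * in auto)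
  then show "norm (\<sigma> t w - \<sigma> t w') <= C * a"
   using C * by (meson atLeastAtMost_iff mult_left_mono order_trans)
 qed
qed

lemma admissible_continuous_adapted:
 fixes \<sigma> :: "real => ('d::finite) path => real ^ 'd ^ 'd"
 assumes T: "T > 0" and \<sigma>: "admissible_coeff T \<sigma>"
 shows "continuous_adapted T T \<sigma>"
proof -
 obtain C where C: "C \<ge> 0"
  "!!t w w' a. 0 <= t ==> t <= T ==> w \<in> Omega T ==> w' \<in> Omega T ==>
   (!!s. 0 <= s ==> s <= t ==> norm (w s - w' s) <= a) ==> norm (\<sigma> t w - \<sigma> t w') <= C * a"
  using admissible_coeffD[OF \<sigma>] by blast
 show ?thesis
  unfolding continuous_adapted_def
 proof (intro conjI ballI impI)
  fix t assume t: "t \<in> {0..T}"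
  show "\<sigma> t \<in> borel_measurable (paths T)"
  proof (rule measurable_canonical_le, rule path_continuous_measurable[of T t])
   fix w :: "'d path" and e :: real assume w: "w \<in> Omega T" and e: "e > 0"
   show "\<exists>d>0. \<forall>w'\<in>Omega T. (\<forall>r\<in>{0..t}. norm (w r - w' r) < d) \<longrightarrow> dist (\<sigma> t w) (\<sigma> t w') < e"
   proof (intro exI[of _ "e / (C + 1)"] conjI ballI impI)
    fix w' :: "'d path" assume w': "w' \<in> Omega T" "\<forall>r\<in>{0..t}. norm (w r - w' r) < e / (C + 1)"
    have "norm (\<sigma> t w - \<sigma> t w') <= C * (e / (C + 1))"
     by (rule C(2)) (use t w w' in "auto intro!: less_imp_le")
    also have "... < e" using C(1) e by (simp add: field_simps)
    finally show "dist (\<sigma> t w) (\<sigma> t w') < e" by (simp add: dist_norm)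
   qed (use C(1) e in simp)
  qed (use T t in auto)
  fix w w' :: "'d path" assume w: "w \<in> Omega T" "w' \<in> Omega T" "\<forall>r\<in>{0..t}. w r = w' r"
  have "norm (\<sigma> t w - \<sigma> t w') <= C * 0"
   by (rule C(2)) (use t w in auto)
  then show "\<sigma> t w = \<sigma> t w'" by simp
 next
  fix w :: "'d path" assume "w \<in> Omega T"
  then show "continuous_on {0..T} (%t. \<sigma> t w)" using \<sigma> by (auto simp: admissible_coeff_def)
 qed
qed

section \<open>Brownian increments\<close>

lemma norm_matrix_vector_mult_le:
 fixes A :: "real ^ 'n ^ 'm"
 shows "norm (A *v x) <= norm A * norm x"
proof -
 have "norm (A *v x) = L2_set (%i. norm (inner (A $ i) x)) UNIV"
  by (simp add: norm_vec_def matrix_mult_dot)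
 also have "... <= L2_set (%i. norm (A $ i) * norm x) UNIV"
  by (intro L2_set_mono) (use Cauchy_Schwarz_ineq2 in auto)
 also have "... = norm A * norm x"
  unfolding norm_vec_def[of A] by (rule L2_set_left_distrib[symmetric]) simp
 finally show ?thesis .
qed

lemma integrable_mult_L2:
 fixes f g :: "'a => real"
 assumes [measurable]: "f \<in> borel_measurable M" "g \<in> borel_measurable M"
  and "integrable M (%x. (f x)^2)" "integrable M (%x. (g x)^2)"
 shows "integrable M (%x. f x * g x)"
proof (rule Bochner_Integration.integrable_bound)
 show "integrable M (%x. (f x)^2 + (g x)^2)" using assms by simp
 have "\<bar>a * b\<bar> <= \<bar>a^2 + b^2\<bar>" for a b :: real
  using sum_squares_bound[of "\<bar>a\<bar>" "\<bar>b\<bar>"] sum_squares_ge_zero[of a b] abs_ge_zero[of "a * b"]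
  unfolding abs_mult power2_abs power2_eq_square by linarith
 then show "AE x in M. norm (f x * g x) <= norm ((f x)^2 + (g x)^2)" by simp
qed simp

lemma borel_measurable_matrix_vector_mult:
 fixes A :: "'a => real ^ 'n::finite ^ 'm::finite"
 assumes [measurable]: "A \<in> borel_measurable N" "v \<in> borel_measurable N"
 shows "(%x. A x *v v x) \<in> borel_measurable N"
proof -
 have "continuous_on UNIV (%(a :: real ^ 'n ^ 'm, w). a *v w)"
  unfolding split_beta matrix_mult_dot by (intro continuous_intros)
 then have "(%(a :: real ^ 'n ^ 'm, w). a *v w) \<in> borel_measurable borel"
  by (rule borel_measurable_continuous_onI)
 then have "(%(a :: real ^ 'n ^ 'm, w). a *v w) \<in> borel_measurable (borel \<Otimes>\<^sub>M borel)"
  by (simp add: borel_prod)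
 then have "(%x. (%(a, w). a *v w) (A x, v x)) \<in> borel_measurable N"
  by (rule measurable_compose[rotated]) measurable
 then show ?thesis by simp
qed

lemma borel_measurable_vector_matrix_mult:
 fixes A :: "'a => real ^ 'n::finite ^ 'm::finite"
 assumes [measurable]: "A \<in> borel_measurable N" "v \<in> borel_measurable N"
 shows "(%x. v x v* A x) \<in> borel_measurable N"
proof -
 have "continuous_on UNIV (%(w, a :: real ^ 'n ^ 'm). w v* a)"
  unfolding split_beta vector_matrix_mult_def by (intro continuous_intros)
 then have "(%(w, a :: real ^ 'n ^ 'm). w v* a) \<in> borel_measurable borel"
  by (rule borel_measurable_continuous_onI)
 then have "(%(w, a :: real ^ 'n ^ 'm). w v* a) \<in> borel_measurable (borel \<Otimes>\<^sub>M borel)"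
  by (simp add: borel_prod)
 then have "(%x. (%(w, a). w v* a) (v x, A x)) \<in> borel_measurable N"
  by (rule measurable_compose[rotated]) measurable
 then show ?thesis by simp
qed

lemma norm_vector_matrix_mult_le:
 fixes A :: "real ^ 'n ^ 'm"
 shows "norm (v v* A) <= norm A * norm v"
proof (cases "v v* A = 0")
 case False
 have "norm (v v* A) * norm (v v* A) = inner (v v* A) (v v* A)"
  by (simp add: dot_square_norm power2_eq_square)
 also have "... = inner v (A *v (v v* A))" by (rule dot_lmul_matrix)
 also have "... <= norm v * norm (A *v (v v* A))" by (rule norm_cauchy_schwarz)
 also have "... <= norm v * (norm A * norm (v v* A))"
  by (intro mult_left_mono norm_matrix_vector_mult_le) auto
 finally have "norm (v v* A) * norm (v v* A) <= (norm A * norm v) * norm (v v* A)" by (simp add: ac_simps)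
 then show ?thesis using False by simp
qed simp

lemma measurable_vec_nth:
 "f \<in> borel_measurable N ==> (%x. f x $ i) \<in> borel_measurable N" for f :: "'a => 'b::real_normed_vector ^ 'n"
 by (rule borel_measurable_continuous_on[of "%v. v $ i"]) (auto intro!: continuous_intros)

locale brownian = prob_space M for M :: "'a measure" +
 fixes T :: real and W :: "real => 'a => real ^ ('d::finite)"
 assumes T_pos: "T > 0" and bm: "brownian_motion M T W"
begin

abbreviation G :: "real => 'a measure" where
 "G \<equiv> augmented_filtration M T W"

abbreviation "hist \<equiv> natural_filtration (space M) T W"

lemma W_measurable: "0 <= t ==> t <= T ==> W t \<in> borel_measurable M"
 using bm by (auto simp: brownian_motion_def)

lemma natural_sets:
 "sets (hist s) = sigma_sets (space M)
  {W r -` A \<inter> space M | r A. 0 <= r \<and> r <= s \<and> r <= T \<and> A \<in> sets borel}"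
 unfolding natural_filtration_def by (rule sets_measure_of) auto

lemma natural_le: "sets (hist s) \<subseteq> sets M"
 unfolding natural_sets
proof (rule sets.sigma_sets_subset, safe)
 fix r and A :: "(real ^ 'd) set" assume "0 <= r" "r <= T" "A \<in> sets borel"
 then show "W r -` A \<inter> space M \<in> sets M" using measurable_sets[OF W_measurable] by auto
qed

lemma G_generator: "sets (hist s) \<union> null_sets M \<subseteq> sets M"
 using natural_le by auto

lemma G_generator_Pow: "sets (hist s) \<union> null_sets M \<subseteq> Pow (space M)"
 using G_generator sets.space_closed[of M] by (rule subset_trans)

lemma G_sets: "sets (G s) = sigma_sets (space M) (sets (hist s) \<union> null_sets M)"
 unfolding augmented_filtration_def
 by (rule sets_measure_of[OF G_generator_Pow])

lemma G_space [simp]: "space (G s) = space M"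
 unfolding augmented_filtration_def
 by (rule space_measure_of[OF G_generator_Pow])

lemma G_le: "sets (G s) \<subseteq> sets M"
 unfolding G_sets by (rule sets.sigma_sets_subset[OF G_generator])

lemma G_mono: "s <= t ==> sets (G s) \<subseteq> sets (G t)"
proof -
 assume st: "s <= t"
 have "sets (hist s) \<subseteq> sets (hist t)"
  unfolding natural_sets by (rule sigma_sets_mono') (use st in force)
 then have "sets (hist s) \<union> null_sets M
   \<subseteq> sets (hist t) \<union> null_sets M" by blast
 then show ?thesis unfolding G_sets by (rule sigma_sets_mono')
qed

lemma measurable_G_M: "f \<in> measurable (G s) N ==> f \<in> measurable M N"
 using measurable_mono[of N N "G s" M] G_le by auto

lemma measurable_G_mono: "f \<in> measurable (G s) N ==> s <= t ==> f \<in> measurable (G t) N"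
 using measurable_mono[of N N "G s" "G t"] G_mono by auto

lemma W_G: "0 <= r ==> r <= s ==> r <= T ==> W r \<in> borel_measurable (G s)"
proof (rule measurableI)
 fix A :: "(real ^ 'd) set" assume r: "0 <= r" "r <= s" "r <= T" and A: "A \<in> sets borel"
 then have "W r -` A \<inter> space M \<in> sets (hist s)"
  unfolding natural_sets by (intro sigma_sets.Basic) auto
 then show "W r -` A \<inter> space (G s) \<in> sets (G s)"
  unfolding G_sets by (auto intro: sigma_sets.Basic)
qed auto

text \<open>Sets that agree with a set of the natural filtration off a null set form a
  sigma-algebra. Independence of the increments, assumed for the natural filtration, is thereby
  carried over to the augmented one, to which the solutions are adapted.\<close>

lemma G_approx: "A \<in> sets (G s) ==>
 \<exists>B\<in>sets (hist s). \<exists>N\<in>null_sets M. A - N = B - N"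
 unfolding G_sets
proof (induction rule: sigma_sets.induct)
 case (Basic a)
 then show ?case
 proof
  assume "a \<in> null_sets M"
  then show ?thesis by (intro bexI[of _ "{}"] bexI[of _ a]) auto
 qed (intro bexI[of _ a] bexI[of _ "{}"]; auto)
next
 case Empty
 show ?case by (intro bexI[of _ "{}"]) auto
next
 case (Compl a)
 then obtain B N where BN: "B \<in> sets (hist s)" "N \<in> null_sets M" "a - N = B - N"
  by auto
 have sp: "space (hist s) = space M"
  unfolding natural_filtration_def by (rule space_measure_of) auto
 have "space M - B \<in> sets (hist s)"
  using sets.compl_sets[OF BN(1)] sp by simp
 moreover have "(space M - a) - N = (space M - B) - N" using BN(3) by blast
 ultimately show ?case using BN(2) by blast
next
 case (Union a)
 have "\<forall>i. \<exists>B N. B \<in> sets (hist s) \<and> N \<in> null_sets M \<and> a i - N = B - N"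
  using Union.IH by blast
 from choice[OF this] obtain B where
  "\<forall>i. \<exists>N. B i \<in> sets (hist s) \<and> N \<in> null_sets M \<and> a i - N = B i - N" ..
 from choice[OF this] obtain N where
  *: "\<forall>i. B i \<in> sets (hist s) \<and> N i \<in> null_sets M \<and> a i - N i = B i - N i" ..
 then have BN: "!!i. B i \<in> sets (hist s)" "!!i. N i \<in> null_sets M"
  "!!i. a i - N i = B i - N i" by simp_all
 have "(\<Union>i. N i) \<in> null_sets M" using BN(2) by (intro null_sets_UN) auto
 moreover have "(\<Union>i. a i) - (\<Union>i. N i) = (\<Union>i. B i) - (\<Union>i. N i)" using BN(3) by blast
 moreover have "(\<Union>i. B i) \<in> sets (hist s)" using BN(1) by auto
 ultimately show ?case by blast
qed

lemma increment_measurable: "0 <= s ==> s <= t ==> t <= T ==> (%x. W t x - W s x) \<in> borel_measurable M"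
 using W_measurable[of s] W_measurable[of t] by auto

lemma increment_indep_sets:
 assumes st: "0 <= s" "s < t" "t <= T" and a: "a \<in> sets (G s)" and C: "C \<in> sets borel"
 shows "prob (a \<inter> ((%x. W t x - W s x) -` C \<inter> space M)) = prob a * prob ((%x. W t x - W s x) -` C \<inter> space M)"
proof -
 define b where "b = (%x. W t x - W s x) -` C \<inter> space M"
 have i0: "indep_set (sets (hist s))
     (sets (vimage_algebra (space M) (%x. W t x - W s x) borel))"
  using bm st by (auto simp: brownian_motion_def)
 have bV: "b \<in> sets (vimage_algebra (space M) (%x. W t x - W s x) borel)"
  unfolding b_def sets_vimage_algebra by (rule sigma_sets.Basic) (use C in auto)
 have bE: "b \<in> events" using indep_setD_ev2[OF i0] bV by auto
 obtain B N' where BN: "B \<in> sets (hist s)" "N' \<in> null_sets M" "a - N' = B - N'"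
  using G_approx[OF a] by blast
 have aE: "a \<in> events" by (rule subsetD[OF G_le a])
 have BE: "B \<in> events" by (rule subsetD[OF natural_le BN(1)])
 have "prob (a \<inter> b) = prob (B \<inter> b)"
 proof (rule finite_measure_eq_AE)
  show "AE x in M. x \<in> a \<inter> b \<longleftrightarrow> x \<in> B \<inter> b"
   using AE_not_in[OF BN(2)] by eventually_elim (use BN(3) in blast)
 qed (use aE bE BE in auto)
 moreover have "prob a = prob B"
 proof (rule finite_measure_eq_AE)
  show "AE x in M. x \<in> a \<longleftrightarrow> x \<in> B"
   using AE_not_in[OF BN(2)] by eventually_elim (use BN(3) in blast)
 qed (use aE BE in auto)
 moreover have "prob (B \<inter> b) = prob B * prob b" by (rule indep_setD[OF i0 BN(1) bV])
 ultimately show ?thesis unfolding b_def by simp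
qed

lemma increment_indep_var:
 assumes st: "0 <= s" "s < t" "t <= T" and Y: "Y \<in> measurable (G s) N" and f: "f \<in> measurable borel N'"
 shows "indep_var N Y N' (%x. f (W t x - W s x))"
 unfolding indep_var_eq
proof (intro conjI)
 have Wm: "(%x. W t x - W s x) \<in> borel_measurable M" using increment_measurable st by simp
 show "random_variable N Y" using measurable_G_M[OF Y] .
 show rf: "random_variable N' (%x. f (W t x - W s x))" by (rule measurable_compose[OF Wm f])
 have a: "sigma_sets (space M) {Y -` A \<inter> space M |A. A \<in> sets N} = {Y -` A \<inter> space M |A. A \<in> sets N}"
  using sigma_sets_vimage_commute[of Y "space M" "space N" "sets N"] measurable_space[OF Y]
  by (simp add: sets.sigma_sets_eq)
 have b: "sigma_sets (space M) {(%x. f (W t x - W s x)) -` A \<inter> space M |A. A \<in> sets N'}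
   = {(%x. f (W t x - W s x)) -` A \<inter> space M |A. A \<in> sets N'}"
  using sigma_sets_vimage_commute[of "%x. f (W t x - W s x)" "space M" "space N'" "sets N'"] measurable_space[OF rf]
  by (simp add: sets.sigma_sets_eq)
 show "indep_set (sigma_sets (space M) {Y -` A \<inter> space M |A. A \<in> sets N})
  (sigma_sets (space M) {(%x. f (W t x - W s x)) -` A \<inter> space M |A. A \<in> sets N'})"
  unfolding indep_sets2_eq a b
 proof (intro conjI ballI)
  have YG: "Y -` A \<inter> space M \<in> sets (G s)" if "A \<in> sets N" for A
   using measurable_sets[OF Y that] by simp
  show "{Y -` A \<inter> space M |A. A \<in> sets N} \<subseteq> events" using YG G_le by blast
  show "{(%x. f (W t x - W s x)) -` A \<inter> space M |A. A \<in> sets N'} \<subseteq> events"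
   using measurable_sets[OF rf] by blast
  fix a b assume "a \<in> {Y -` A \<inter> space M |A. A \<in> sets N}"
   and "b \<in> {(%x. f (W t x - W s x)) -` A \<inter> space M |A. A \<in> sets N'}"
  then obtain A B where AB: "A \<in> sets N" "a = Y -` A \<inter> space M" "B \<in> sets N'"
   "b = (%x. f (W t x - W s x)) -` B \<inter> space M" by blast
  have "b = (%x. W t x - W s x) -` (f -` B) \<inter> space M" unfolding AB(4) by auto
  moreover have "f -` B \<in> sets borel" using measurable_sets[OF f AB(3)] by simp
  ultimately show "prob (a \<inter> b) = prob a * prob b"
   using increment_indep_sets[OF st YG[OF AB(1)]] AB(2) by simp
 qed
qed

text \<open>The law of an increment is determined by its coordinates, hence depends only on its length.\<close>

lemma increment_law:
 assumes st: "0 <= s" "s < t" "t <= T" and st': "0 <= s'" "s' < t'" "t' <= T" and eq: "t - s = t' - s'"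
 shows "distr M borel (%x. W t x - W s x) = distr M borel (%x. W t' x - W s' x)"
proof -
 let ?L = "\<Pi>\<^sub>M i\<in>(UNIV :: 'd set). density lborel (normal_density 0 (sqrt (t - s)))"
 have *: "distr M borel (%x. W t x - W s x) = distr ?L borel (%f. \<chi> i. f i)"
  if st: "0 <= s" "s < t" "t <= T" and L: "t - s = h" "L = (\<Pi>\<^sub>M i\<in>(UNIV :: 'd set). density lborel (normal_density 0 (sqrt h)))"
   "?L = L" for s t h L
 proof -
  have ind: "indep_vars (%_. borel) (%i x. (W t x - W s x) $ i) UNIV"
   and dis: "distributed M lborel (%x. (W t x - W s x) $ i) (normal_density 0 (sqrt (t - s)))" for i
   using bm st by (auto simp: brownian_motion_def)
  have Wm: "(%x. W t x - W s x) \<in> borel_measurable M" using increment_measurable st by simp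
  have rv: "random_variable borel (%x. (W t x - W s x) $ i)" for i
   using Wm by (rule measurable_vec_nth)
  have "distr M (\<Pi>\<^sub>M i\<in>UNIV. borel) (%x. \<lambda>i\<in>UNIV. (W t x - W s x) $ i)
    = (\<Pi>\<^sub>M i\<in>UNIV. distr M borel (%x. (W t x - W s x) $ i))"
   using indep_vars_iff_distr_eq_PiM[where I=UNIV and M'="%_. borel" and X="%i x. (W t x - W s x) $ i"] ind rv by auto
  also have "... = L"
  proof -
   have "distr M borel (%x. (W t x - W s x) $ i) = density lborel (normal_density 0 (sqrt h))" for i
    using distributed_distr_eq_density[OF dis[of i]] L(1) by (simp cong: distr_cong)
   then show ?thesis by (simp add: L(2))
  qed
  finally have PiM: "distr M (\<Pi>\<^sub>M i\<in>UNIV. borel) (%x. \<lambda>i\<in>UNIV. (W t x - W s x) $ i) = L" .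
  have vm: "(%f. \<chi> i. f i) \<in> borel_measurable (\<Pi>\<^sub>M i\<in>(UNIV::'d set). (borel :: real measure))"
  proof -
   have "(%f::'d => real. \<chi> i. f i) = (%f. \<Sum>i\<in>UNIV. f i *\<^sub>R axis i 1)"
    by (auto simp: vec_eq_iff axis_def if_distrib cong: if_cong)
   then show ?thesis by simp
  qed
  have "distr L borel (%f. \<chi> i. f i) = distr M borel ((%f. \<chi> i. f i) \<circ> (%x. \<lambda>i\<in>UNIV. (W t x - W s x) $ i))"
   unfolding PiM[symmetric] by (rule distr_distr[OF vm]) (use rv in "auto intro!: measurable_restrict")
  also have "(%f. \<chi> i. f i) \<circ> (%x. \<lambda>i\<in>UNIV. (W t x - W s x) $ i) = (%x. W t x - W s x)"
   by (auto simp: vec_eq_iff)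
  finally show ?thesis using L(3) by simp
 qed
 show ?thesis
  using *[OF st refl refl refl] *[OF st' refl refl] eq by simp
qed

lemma increment_moments:
 assumes st: "0 <= s" "s < t" "t <= T"
 shows "integrable M (%x. (W t x - W s x) $ i)" "expectation (%x. (W t x - W s x) $ i) = 0"
  "integrable M (%x. ((W t x - W s x) $ i)^2)" "expectation (%x. ((W t x - W s x) $ i)^2) = t - s"
proof -
 let ?X = "%x. (W t x - W s x) $ i" and ?f = "normal_density 0 (sqrt (t - s))"
 have dis: "distributed M lborel ?X ?f" using bm st by (auto simp: brownian_motion_def)
 have p: "0 < sqrt (t - s)" using st by simp
 have "integrable lborel (%y. ?f y * y)" using integrable_normal_moment[OF p, of 0 1] by simp
 then show "integrable M ?X"
  using distributed_integrable[OF dis, of "%y. y"] by simp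
 show "expectation ?X = 0"
  using distributed_integral[OF dis, of "%y. y"] integral_normal_moment_nz_1[OF p, of 0] by simp
 have "integrable lborel (%y. ?f y * y^2)" using integrable_normal_moment[OF p, of 0 2] by simp
 then show "integrable M (%x. (?X x)^2)"
  using distributed_integrable[OF dis, of "%y. y^2"] by simp
 show "expectation (%x. (?X x)^2) = t - s"
  using distributed_integral[OF dis, of "%y. y^2"] integral_normal_moment_even[OF p, of 0 1] st
  by (simp add: fact_numeral)
qed

lemma increment_norm_moment:
 assumes st: "0 <= s" "s < t" "t <= T"
 shows "integrable M (%x. (norm (W t x - W s x))^2)"
  "expectation (%x. (norm (W t x - W s x))^2) = real CARD('d) * (t - s)"
proof -
 have eq: "(norm (W t x - W s x))^2 = (\<Sum>i\<in>UNIV. ((W t x - W s x) $ i)^2)" for x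
  by (simp add: norm_vec_def L2_set_def sum_nonneg)
 show "integrable M (%x. (norm (W t x - W s x))^2)"
  unfolding eq by (intro Bochner_Integration.integrable_sum increment_moments st)
 have "expectation (%x. (norm (W t x - W s x))^2) = (\<Sum>i\<in>(UNIV::'d set). expectation (%x. ((W t x - W s x) $ i)^2))"
  unfolding eq by (intro Bochner_Integration.integral_sum increment_moments st)
 then show "expectation (%x. (norm (W t x - W s x))^2) = real CARD('d) * (t - s)"
  using increment_moments(4)[OF st] by simp
qed

text \<open>The martingale property without conditional expectations: coordinate by coordinate,
  \<open>g\<close> and the increment are independent and the increment has mean zero.\<close>

lemma increment_orthogonal:
 fixes g :: "'a => real ^ 'd"
 assumes st: "0 <= s" "s <= t" "t <= T" and z: "g \<in> borel_measurable (G s)" "integrable M g"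
 shows "integrable M (%x. inner (g x) (W t x - W s x))"
  "expectation (%x. inner (g x) (W t x - W s x)) = 0"
proof -
 let ?z = "%x. inner (g x) (W t x - W s x)"
 have "integrable M ?z \<and> expectation ?z = 0"
 proof (cases "s = t")
  case False
  then have st': "0 <= s" "s < t" "t <= T" using st by auto
  have zi: "integrable M (%x. g x $ i)" for i
   using integrable_bounded_linear[OF bounded_linear_vec_nth z(2)] .
  have iv: "indep_var borel (%x. g x $ i) borel (%x. (W t x - W s x) $ i)" for i
   by (rule increment_indep_var[OF st']) (use z(1) in "auto intro: measurable_vec_nth")
  have eq: "inner (g x) (W t x - W s x) = (\<Sum>i\<in>UNIV. g x $ i * (W t x - W s x) $ i)" for x
   by (simp add: inner_vec_def)
  have int: "integrable M (%x. g x $ i * (W t x - W s x) $ i)" for i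
   by (rule indep_var_integrable[OF iv zi increment_moments(1)[OF st']])
  have "expectation (%x. g x $ i * (W t x - W s x) $ i) = 0" for i
   using indep_var_lebesgue_integral[OF iv zi increment_moments(1)[OF st']] increment_moments(2)[OF st'] by simp
  then show ?thesis unfolding eq using int by (simp add: Bochner_Integration.integral_sum)
 qed simp
 then show "integrable M ?z"
  "expectation ?z = 0" by auto
qed

text \<open>An upper bound in place of Ito's isometry. Submultiplicativity of the norm separates the
  matrix from the increment, which are independent; the dimension comes from the second moment of
  the norm of the increment.\<close>

lemma increment_isometry:
 fixes J :: "'a => real ^ 'd ^ 'd"
 assumes st: "0 <= s" "s <= t" "t <= T" and J: "J \<in> borel_measurable (G s)" "integrable M (%x. (norm (J x))^2)"
 shows "integrable M (%x. (norm (J x *v (W t x - W s x)))^2)"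
  "expectation (%x. (norm (J x *v (W t x - W s x)))^2) <= real CARD('d) * (t - s) * expectation (%x. (norm (J x))^2)"
proof -
 let ?w = "%x. W t x - W s x" and ?n = "%x. (norm (J x))^2" and ?D = "%x. (norm (J x *v (W t x - W s x)))^2"
 have "integrable M ?D \<and>
  expectation ?D <= real CARD('d) * (t - s) * expectation ?n"
 proof (cases "s = t")
  case False
  then have st': "0 <= s" "s < t" "t <= T" using st by auto
  have [measurable]: "J \<in> borel_measurable M" "?w \<in> borel_measurable M"
   using measurable_G_M[OF J(1)] increment_measurable st by auto
  have iv: "indep_var borel ?n borel (%x. (norm (?w x))^2)"
   by (rule increment_indep_var[OF st']) (use J(1) in auto)
  have int: "integrable M (%x. ?n x * (norm (?w x))^2)"
   by (rule indep_var_integrable[OF iv J(2) increment_norm_moment(1)[OF st']])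
  have le: "?D x <= ?n x * (norm (?w x))^2" for x
   using power_mono[OF norm_matrix_vector_mult_le[of "J x" "?w x"], of 2] by (simp add: power_mult_distrib)
  have i1: "integrable M ?D"
  proof (rule Bochner_Integration.integrable_bound[OF int])
   show "?D \<in> borel_measurable M"
    using borel_measurable_matrix_vector_mult[of J M ?w] by simp
   show "AE x in M. norm (?D x) <= norm (?n x * (norm (?w x))^2)"
    using le by (intro AE_I2) simp
  qed
  have "expectation ?D <= expectation (%x. ?n x * (norm (?w x))^2)"
   by (rule integral_mono[OF i1 int le])
  also have "... = expectation ?n * (real CARD('d) * (t - s))"
   using indep_var_lebesgue_integral[OF iv J(2) increment_norm_moment(1)[OF st']] increment_norm_moment(2)[OF st'] by simp
  finally show ?thesis using i1 by (simp add: ac_simps)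
 qed simp
 then show "integrable M ?D"
  "expectation ?D <= real CARD('d) * (t - s) * expectation ?n"
  by auto
qed

end

section \<open>Discrete martingale transforms\<close>

primrec runmax :: "(nat => real) => nat => real" where
 "runmax s 0 = s 0"
| "runmax s (Suc n) = max (runmax s n) (s (Suc n))"

lemma runmax_ge: "j <= n ==> s j <= runmax s n"
 by (induction n) (auto simp: le_Suc_eq max_def intro: order_trans)

lemma runmax_le: "(!!j. j <= n ==> s j <= a) ==> runmax s n <= a"
 by (induction n) auto

lemma runmax_cong: "(!!j. j <= n ==> s j = s' j) ==> runmax s n = runmax s' n"
 by (induction n) auto

lemma runmax_measurable:
 fixes D :: "nat => 'a => real"
 shows "(!!j. j <= n ==> D j \<in> borel_measurable N) ==> (%x. runmax (%j. D j x) n) \<in> borel_measurable N"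
 by (induction n) auto

text \<open>The sum is a martingale transform when \<open>s\<close> is a martingale, and then has mean zero.\<close>

lemma pathwise_doob:
 fixes s :: "nat => real"
 assumes "s 0 = 0"
 shows "(runmax s n)^2 <= 4 * (s n)^2 - 4 * (\<Sum>k<n. runmax s k * (s (Suc k) - s k))"
proof -
 \<comment> \<open>The form that an induction can carry: a step without a new maximum preserves it,
   and a new maximum \<open>y > a\<close> is paid for by \<open>(y - a)^2 >= 0\<close>.\<close>
 have "2 * (\<Sum>k<n. runmax s k * (s (Suc k) - s k)) + (runmax s n)^2 <= 2 * runmax s n * s n" for n
 proof (induction n)
  case 0
  then show ?case using assms by simp
 next
  case (Suc n)
  define a where "a = runmax s n"
  define y where "y = s (Suc n)"
  have IH: "2 * (\<Sum>k<n. runmax s k * (s (Suc k) - s k)) + a^2 <= 2 * a * s n"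
   using Suc by (simp add: a_def)
  have "2 * a * y + (max a y)^2 - a^2 <= 2 * max a y * y"
  proof (cases "y <= a")
   case False
   have "0 <= (y - a)^2" by simp
   then show ?thesis using False by (simp add: max_def power2_eq_square algebra_simps)
  qed (simp add: max_def)
  then show ?case using IH by (simp add: a_def[symmetric] y_def[symmetric] algebra_simps)
 qed
 from this[of n] have "4 * (\<Sum>k<n. runmax s k * (s (Suc k) - s k)) + 2 * (runmax s n)^2 <= 4 * runmax s n * s n" by simp
 \<comment> \<open>Completing the square removes the mixed product of the maximum and the final
   value.\<close>
 moreover have "0 <= (2 * s n - runmax s n)^2" by simp
 ultimately show ?thesis by (simp add: power2_eq_square algebra_simps)
qed

context brownian
begin

definition transform :: "(nat => real) => (nat => 'a => real ^ 'd ^ 'd) => nat => 'a => real ^ 'd" where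
 "transform r J k x = (\<Sum>l<k. J l x *v (W (r (Suc l)) x - W (r l) x))"

lemma transform_simps [simp]:
 "transform r J 0 x = 0"
 "transform r J (Suc k) x = transform r J k x + J k x *v (W (r (Suc k)) x - W (r k) x)"
 by (simp_all add: transform_def)

definition time_grid :: "(nat => real) => nat => bool" where
 "time_grid r N \<longleftrightarrow> 0 <= r 0 \<and> r N <= T \<and> (\<forall>l<N. r l <= r (Suc l))"

lemma time_gridD:
 assumes "time_grid r N"
 shows "!!l. l < N ==> r l <= r (Suc l)" "!!k l. k <= l ==> l <= N ==> r k <= r l"
  "!!l. l <= N ==> 0 <= r l" "!!l. l <= N ==> r l <= T"
proof -
 show s: "r l <= r (Suc l)" if "l < N" for l using assms that by (simp add: time_grid_def)
 show m: "r k <= r l" if "k <= l" "l <= N" for k l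
  using that by (induction l rule: dec_induct) (use s in "auto intro: order_trans")
 show "0 <= r l" if "l <= N" for l using m[of 0 l] that assms by (simp add: time_grid_def)
 show "r l <= T" if "l <= N" for l using m[of l N] that assms by (simp add: time_grid_def)
qed

lemma transform_G:
 assumes r: "time_grid r N" and J: "!!l. l < N ==> J l \<in> borel_measurable (G (r l))" and k: "k <= N"
 shows "transform r J k \<in> borel_measurable (G (r k))"
 using k
proof (induction k)
 case 0
 show ?case by (simp add: transform_def[abs_def])
next
 case (Suc k)
 have m: "transform r J k \<in> borel_measurable (G (r (Suc k)))" "J k \<in> borel_measurable (G (r (Suc k)))"
  using Suc J[of k] time_gridD(1)[OF r, of k] by (auto intro: measurable_G_mono)
 have w: "W (r (Suc k)) \<in> borel_measurable (G (r (Suc k)))" "W (r k) \<in> borel_measurable (G (r (Suc k)))"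
  using Suc.prems time_gridD[OF r] by (auto intro!: W_G)
 show ?case
  unfolding transform_simps(2)[abs_def]
  by (intro borel_measurable_add borel_measurable_diff borel_measurable_matrix_vector_mult m w)
qed

text \<open>Pythagoras: the new term is orthogonal to the past sum \<open>D\<close>. Writing the
  cross term as \<open>inner (D x v* J k x) (w x)\<close> moves the matrix to the past, where
  \<open>increment_orthogonal\<close> applies.\<close>

lemma transform_L2:
 assumes r: "time_grid r N" and J: "!!l. l < N ==> J l \<in> borel_measurable (G (r l))"
   "!!l. l < N ==> integrable M (%x. (norm (J l x))^2)" and k: "k <= N"
 shows "integrable M (%x. (norm (transform r J k x))^2) \<and>
  expectation (%x. (norm (transform r J k x))^2) <= (\<Sum>l<k. real CARD('d) * (r (Suc l) - r l) * expectation (%x. (norm (J l x))^2))"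
 using k
proof (induction k)
 case 0
 show ?case by simp
next
 case (Suc k)
 then have kN: "k < N" and IH: "integrable M (%x. (norm (transform r J k x))^2)"
  "expectation (%x. (norm (transform r J k x))^2) <= (\<Sum>l<k. real CARD('d) * (r (Suc l) - r l) * expectation (%x. (norm (J l x))^2))"
  by auto
 have st: "0 <= r k" "r k <= r (Suc k)" "r (Suc k) <= T"
  using time_gridD[OF r] kN by auto
 define w where "w x = W (r (Suc k)) x - W (r k) x" for x
 define D where "D = transform r J k"
 have DG: "D \<in> borel_measurable (G (r k))" unfolding D_def using transform_G[OF r J(1)] kN by simp
 have [measurable]: "D \<in> borel_measurable M" "J k \<in> borel_measurable M" "w \<in> borel_measurable M"
  using measurable_G_M[OF DG] measurable_G_M[OF J(1)[OF kN]] increment_measurable[OF st] by (auto simp: w_def[abs_def])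
 have Jw [measurable]: "(%x. J k x *v w x) \<in> borel_measurable M"
  by (rule borel_measurable_matrix_vector_mult) measurable
 have iso: "integrable M (%x. (norm (J k x *v w x))^2)"
  "expectation (%x. (norm (J k x *v w x))^2) <= real CARD('d) * (r (Suc k) - r k) * expectation (%x. (norm (J k x))^2)"
  using increment_isometry[OF st J[OF kN]] by (simp_all add: w_def)
 define g where "g x = D x v* J k x" for x
 have zG: "g \<in> borel_measurable (G (r k))"
  unfolding g_def[abs_def] by (rule borel_measurable_vector_matrix_mult[OF J(1)[OF kN] DG])
 have zi: "integrable M g"
 proof (rule Bochner_Integration.integrable_bound)
  show "integrable M (%x. norm (J k x) * norm (D x))"
   by (rule integrable_mult_L2) (use J(2)[OF kN] IH(1)[folded D_def] in auto)
  show "g \<in> borel_measurable M" by (rule measurable_G_M[OF zG])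
  show "AE x in M. norm (g x) <= norm (norm (J k x) * norm (D x))"
   using norm_vector_matrix_mult_le by (intro AE_I2) (auto simp: g_def)
 qed
 have orth: "integrable M (%x. inner (g x) (w x))" "expectation (%x. inner (g x) (w x)) = 0"
  using increment_orthogonal[OF st zG zi] by (simp_all add: w_def)
 have eq: "(norm (transform r J (Suc k) x))^2 = (norm (D x))^2 + 2 * inner (g x) (w x) + (norm (J k x *v w x))^2" for x
 proof -
  have "inner (D x) (J k x *v w x) = inner (g x) (w x)" by (simp add: g_def dot_lmul_matrix)
  then show ?thesis by (simp add: D_def w_def power2_norm_eq_inner inner_add_left inner_add_right inner_commute)
 qed
 have "expectation (%x. (norm (transform r J (Suc k) x))^2) = expectation (%x. (norm (D x))^2) + expectation (%x. (norm (J k x *v w x))^2)"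
  unfolding eq using IH(1) orth iso(1) by (simp add: D_def)
 then show ?case unfolding eq using IH iso orth(1) by (simp add: D_def eq[unfolded transform_simps])
qed

text \<open>\<open>pathwise_doob\<close> is applied to the norms of the partial sums. Their
  increments are bounded below by the increments of the sums in the direction
  \<open>sgn (D k x)\<close>, and the transform that results has mean zero.\<close>

lemma doob_L2:
 assumes r: "time_grid r N" and J: "!!l. l < N ==> J l \<in> borel_measurable (G (r l))"
   "!!l. l < N ==> integrable M (%x. (norm (J l x))^2)" and n: "n <= N"
 shows "integrable M (%x. (runmax (%k. norm (transform r J k x)) n)^2)"
  "expectation (%x. (runmax (%k. norm (transform r J k x)) n)^2) <= 4 * (\<Sum>l<n. real CARD('d) * (r (Suc l) - r l) * expectation (%x. (norm (J l x))^2))"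
proof -
 define D where "D = transform r J"
 define m where "m k x = runmax (%k. norm (D k x)) k" for k x
 have DG: "D k \<in> borel_measurable (G (r l))" if "k <= l" "l <= N" for k l
  unfolding D_def using transform_G[OF r J(1), of k] time_gridD(2)[OF r that] that
  by (auto intro: measurable_G_mono)
 have mG: "m k \<in> borel_measurable (G (r k))" if "k <= N" for k
  unfolding m_def[abs_def] by (rule runmax_measurable) (use DG that in auto)
 have mM: "m k \<in> borel_measurable M" if "k <= N" for k using measurable_G_M mG that by blast
 have DM: "D k \<in> borel_measurable M" if "k <= N" for k using measurable_G_M DG[of k k] that by blast
 have D2: "integrable M (%x. (norm (D k x))^2)" if "k <= N" for k
  using transform_L2[OF r J that] by (simp add: D_def)
 have m_nn: "0 <= m k x" for k x
  unfolding m_def using runmax_ge[of 0 k "%k. norm (D k x)"] norm_ge_zero[of "D 0 x"] by linarith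
 have m2: "integrable M (%x. (m k x)^2)" if "k <= N" for k
 proof (rule Bochner_Integration.integrable_bound)
  show "integrable M (%x. \<Sum>j\<le>k. (norm (D j x))^2)"
   by (intro Bochner_Integration.integrable_sum D2) (use that in auto)
  show "(%x. (m k x)^2) \<in> borel_measurable M" using mM[OF that] by simp
  have "(m k x)^2 <= (\<Sum>j\<le>k. (norm (D j x))^2)" for x
  proof -
   have "m k x <= sqrt (\<Sum>j\<le>k. (norm (D j x))^2)"
    unfolding m_def
   proof (rule runmax_le)
    fix j assume "j <= k"
    then have "(norm (D j x))^2 <= (\<Sum>j\<le>k. (norm (D j x))^2)"
     by (intro member_le_sum) auto
    then show "norm (D j x) <= sqrt (\<Sum>j\<le>k. (norm (D j x))^2)" by (rule real_le_rsqrt)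
   qed
   then have "(m k x)^2 <= (sqrt (\<Sum>j\<le>k. (norm (D j x))^2))^2" using m_nn by (intro power_mono) auto
   then show ?thesis by (simp add: sum_nonneg)
  qed
  then show "AE x in M. norm ((m k x)^2) <= norm (\<Sum>j\<le>k. (norm (D j x))^2)"
   by (intro AE_I2) (auto intro: order_trans[OF _ abs_ge_self])
 qed
 define w where "w k x = W (r (Suc k)) x - W (r k) x" for k x
 \<comment> \<open>Integrand of that transform: running maximum times direction, with the matrix
   moved over from the increment. It is measurable at time \<open>r k\<close>.\<close>
 define g where "g k x = m k x *\<^sub>R (sgn (D k x) v* J k x)" for k x
 let ?z = "%k x. inner (g k x) (w k x)"
 have orth: "integrable M (%x. ?z k x)" "expectation (%x. ?z k x) = 0" if "k < N" for k
 proof -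
  have st: "0 <= r k" "r k <= r (Suc k)" "r (Suc k) <= T"
   using time_gridD[OF r] that by auto
  have sg: "(%x. sgn (D k x)) \<in> borel_measurable (G (r k))"
   unfolding sgn_div_norm using DG[of k k] that by (intro borel_measurable_scaleR borel_measurable_inverse borel_measurable_norm) auto
  have zG: "g k \<in> borel_measurable (G (r k))"
   unfolding g_def[abs_def] using mG[of k] that
   by (intro borel_measurable_scaleR borel_measurable_vector_matrix_mult[OF J(1)[OF that] sg]) auto
  have zi: "integrable M (g k)"
  proof (rule Bochner_Integration.integrable_bound)
   show "integrable M (%x. m k x * norm (J k x))"
    by (rule integrable_mult_L2) (use J(2)[OF that] m2[of k] mM[of k] measurable_G_M[OF J(1)[OF that]] that in auto)
   show "g k \<in> borel_measurable M" by (rule measurable_G_M[OF zG])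
   have "norm (g k x) <= m k x * norm (J k x)" for x
   proof -
    have "norm (sgn (D k x) v* J k x) <= norm (J k x) * norm (sgn (D k x))"
     by (rule norm_vector_matrix_mult_le)
    also have "... <= norm (J k x) * 1" by (intro mult_left_mono) (auto simp: norm_sgn)
    finally show ?thesis using m_nn[of k x] by (simp add: g_def mult_left_mono)
   qed
   then show "AE x in M. norm (g k x) <= norm (m k x * norm (J k x))" using m_nn by (intro AE_I2) (simp add: abs_mult)
  qed
  show "integrable M (%x. ?z k x)" "expectation (%x. ?z k x) = 0"
   using increment_orthogonal[OF st zG zi] by (simp_all add: w_def)
 qed
 have bound: "(m n x)^2 <= 4 * (norm (D n x))^2 - 4 * (\<Sum>k<n. ?z k x)" for x
 proof -
  have "?z k x <= m k x * (norm (D (Suc k) x) - norm (D k x))" for k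
  proof -
   have "inner (sgn (D k x)) (D k x) = norm (D k x)"
    by (cases "D k x = 0") (auto simp: sgn_div_norm dot_square_norm power2_eq_square)
   moreover have "inner (sgn (D k x)) (D (Suc k) x) <= norm (D (Suc k) x)"
   proof -
    have "inner (sgn (D k x)) (D (Suc k) x) <= norm (sgn (D k x)) * norm (D (Suc k) x)" by (rule norm_cauchy_schwarz)
    also have "... <= 1 * norm (D (Suc k) x)" by (intro mult_right_mono) (auto simp: norm_sgn)
    finally show ?thesis by simp
   qed
   moreover have "inner (sgn (D k x) v* J k x) (w k x) = inner (sgn (D k x)) (D (Suc k) x) - inner (sgn (D k x)) (D k x)"
    by (simp add: D_def w_def dot_lmul_matrix inner_add_right)
   ultimately have "inner (sgn (D k x) v* J k x) (w k x) <= norm (D (Suc k) x) - norm (D k x)" by simp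
   then show ?thesis using m_nn[of k x] by (simp add: g_def mult_left_mono)
  qed
  then have "(\<Sum>k<n. ?z k x) <= (\<Sum>k<n. m k x * (norm (D (Suc k) x) - norm (D k x)))"
   by (intro sum_mono)
  then show ?thesis
   using pathwise_doob[of "%k. norm (D k x)" n] by (simp add: m_def D_def)
 qed
 show "integrable M (%x. (runmax (%k. norm (transform r J k x)) n)^2)"
  using m2[OF n] by (simp add: m_def D_def)
 have "expectation (%x. (m n x)^2) <= expectation (%x. 4 * (norm (D n x))^2 - 4 * (\<Sum>k<n. ?z k x))"
  by (intro integral_mono m2 n bound Bochner_Integration.integrable_diff integrable_mult_right
    Bochner_Integration.integrable_sum D2 orth) (use n in auto)
 also have "... = 4 * expectation (%x. (norm (D n x))^2)"
 proof -
  have "integrable M (%x. \<Sum>k<n. ?z k x)"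
   by (intro Bochner_Integration.integrable_sum orth) (use n in auto)
  moreover have "expectation (%x. \<Sum>k<n. ?z k x) = (\<Sum>k<n. expectation (%x. ?z k x))"
   by (intro Bochner_Integration.integral_sum orth) (use n in auto)
  ultimately show ?thesis using D2[OF n] orth(2) n by simp
 qed
 also have "... <= 4 * (\<Sum>l<n. real CARD('d) * (r (Suc l) - r l) * expectation (%x. (norm (J l x))^2))"
  using transform_L2[OF r J n] by (simp add: D_def)
 finally show "expectation (%x. (runmax (%k. norm (transform r J k x)) n)^2) <= 4 * (\<Sum>l<n. real CARD('d) * (r (Suc l) - r l) * expectation (%x. (norm (J l x))^2))"
  by (simp add: m_def D_def)
qed

text \<open>A Gronwall estimate for transforms whose integrand is controlled by their own running
  maximum up to an error \<open>e\<close>. Where the error is small, Doob's inequality with factor 4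
  and \<open>(x + y)^2 <= 2 * x^2 + 2 * y^2\<close> give a recursion for the second moments of the
  maximum, whence the constant 8; Markov's inequality concludes.\<close>

lemma transform_stability:
 assumes r: "time_grid r N" and J: "!!l. l < N ==> J l \<in> borel_measurable (G (r l))"
  and e: "!!l. l < N ==> e l \<in> borel_measurable (G (r l))"
  and bound: "!!l x. l < N ==> x \<in> space M ==>
   norm (J l x) <= C * runmax (%k. norm (transform r J k x)) l + e l x"
  and C: "C \<ge> 0" and eps: "g > 0" and eta: "h > 0"
 shows "prob {x \<in> space M. \<exists>k\<le>N. h < norm (transform r J k x)} <=
  prob {x \<in> space M. \<exists>l<N. g < e l x}
   + 8 * real CARD('d) * T * exp (8 * real CARD('d) * C^2 * T) * (g / h)^2"
proof -
 define q where "q = 8 * real CARD('d)"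
 have q: "q \<ge> 0" by (simp add: q_def)
 \<comment> \<open>The integrand is switched off from the first time at which the error exceeds
   \<open>g\<close>. This decision is adapted, makes second moments finite, and changes nothing
   outside the event that some error exceeds \<open>g\<close>.\<close>
 define J' where "J' l x = (if \<forall>j\<le>l. e j x <= g then J l x else 0)" for l x
 define m where "m k x = runmax (%k. norm (transform r J' k x)) k" for k x
 let ?B = "{x \<in> space M. \<exists>l<N. g < e l x}" and ?M = "{x \<in> space M. h^2 <= (m N x)^2}" and ?n = "%l x. (norm (J' l x))^2"
 have J'G: "J' l \<in> borel_measurable (G (r l))" if l: "l < N" for l
 proof -
  have ej: "e j \<in> borel_measurable (G (r l))" if "j <= l" for j
   using e[of j] that l time_gridD(2)[OF r that] by (auto intro: measurable_G_mono)
  have "{x \<in> space (G (r l)). \<forall>j\<in>{..l}. e j x <= g} \<in> sets (G (r l))"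
  proof (rule sets.sets_Collect_finite_All)
   fix j assume "j \<in> {..l}"
   then have "e j \<in> borel_measurable (G (r l))" using ej by simp
   then show "{x \<in> space (G (r l)). e j x <= g} \<in> sets (G (r l))" by measurable
  qed simp
  then have "{x \<in> space (G (r l)). \<forall>j\<le>l. e j x <= g} \<in> sets (G (r l))" by (simp only: Ball_def atMost_iff)
  then show ?thesis
   unfolding J'_def[abs_def] by (rule measurable_If[OF J[OF l] borel_measurable_const])
 qed
 have agree: "transform r J' k x = transform r J k x" if "!!j. j < k ==> e j x <= g" for k x
  using that unfolding transform_def by (intro sum.cong) (auto simp: J'_def)
 have J'b: "norm (J' l x) <= C * m l x + g" if l: "l < N" and x: "x \<in> space M" for l x
 proof (cases "\<forall>j\<le>l. e j x <= g")
  case True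
  have "runmax (%k. norm (transform r J k x)) l = m l x"
   unfolding m_def by (rule runmax_cong) (use agree True in auto)
  then show ?thesis using bound[OF l x] True l by (auto simp: J'_def intro: order_trans)
 next
  case False
  have "0 <= m l x" unfolding m_def using runmax_ge[of 0 l "%k. norm (transform r J' k x)"] by simp
  moreover have "J' l x = 0" using False unfolding J'_def by (rule if_not_P)
  ultimately show ?thesis using C eps by simp
 qed
 have J'sq: "?n l x <= 2 * C^2 * (m l x)^2 + 2 * g^2" if l: "l < N" and x: "x \<in> space M" for l x
 proof -
  have "?n l x <= (C * m l x + g)^2" using J'b[OF that] by (intro power_mono) auto
  also have "... <= 2 * (C * m l x)^2 + 2 * g^2"
   using sum_squares_bound[of "C * m l x" g] by (simp add: power2_sum)
  finally show ?thesis by (simp add: power_mult_distrib)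
 qed
 \<comment> \<open>Strong induction: \<open>J' l\<close> is bounded through the maximum of the sums
   up to \<open>l\<close>, and these involve only \<open>J'\<close> at smaller indices.\<close>
 have J'2: "integrable M (%x. ?n l x)" if "l < N" for l
  using that
 proof (induction l rule: less_induct)
  case (less l)
  have rl: "time_grid r l"
   using time_gridD[OF r] less.prems unfolding time_grid_def by auto
  have "integrable M (%x. (m l x)^2)"
   unfolding m_def by (rule doob_L2(1)[OF rl]) (use J'G less in auto)
  then have i: "integrable M (%x. 2 * C^2 * (m l x)^2 + 2 * g^2)" by simp
  show ?case
  proof (rule Bochner_Integration.integrable_bound[OF i])
   show "(%x. ?n l x) \<in> borel_measurable M"
    using measurable_G_M[OF J'G[OF less.prems]] by simp
   show "AE x in M. norm (?n l x) <= norm (2 * C^2 * (m l x)^2 + 2 * g^2)"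
    using J'sq[OF less.prems] by (intro AE_I2) (auto intro: order_trans[OF _ abs_ge_self])
  qed
 qed
 have m2: "integrable M (%x. (m k x)^2)" if "k <= N" for k
  unfolding m_def by (rule doob_L2(1)[OF r J'G J'2 that])
 define a where "a k = expectation (%x. (m k x)^2)" for k
 define dr where "dr l = r (Suc l) - r l" for l
 have dr: "0 <= dr l" if "l < N" for l using time_gridD(1)[OF r that] by (simp add: dr_def)
 have EJ: "expectation (%x. ?n l x) <= 2 * (C^2 * a l + g^2)" if l: "l < N" for l
 proof -
  have "expectation (%x. ?n l x) <= expectation (%x. 2 * C^2 * (m l x)^2 + 2 * g^2)"
   using m2[of l] l by (intro integral_mono J'2 l J'sq) auto
  also have "... = 2 * (C^2 * a l + g^2)" using m2[of l] l by (simp add: a_def prob_space algebra_simps)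
  finally show ?thesis .
 qed
 have a_le: "a k <= (\<Sum>l<k. q * dr l * (C^2 * a l + g^2))" if k: "k <= N" for k
 proof -
  have "a k <= 4 * (\<Sum>l<k. real CARD('d) * (r (Suc l) - r l) * expectation (%x. ?n l x))"
   unfolding a_def m_def by (rule doob_L2(2)[OF r J'G J'2 k])
  also have "... = (\<Sum>l<k. 4 * real CARD('d) * dr l * expectation (%x. ?n l x))"
   by (simp add: sum_distrib_left dr_def mult.assoc)
  also have "... <= (\<Sum>l<k. 4 * real CARD('d) * dr l * (2 * (C^2 * a l + g^2)))"
   using k EJ dr by (intro sum_mono mult_left_mono mult_nonneg_nonneg) auto
  finally show ?thesis by (simp add: q_def mult.assoc mult.left_commute)
 qed
 define c where "c = q * C^2"
 have c: "c \<ge> 0" using q by (simp add: c_def)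
 \<comment> \<open>Discrete Gronwall: \<open>1 + x <= exp x\<close> lets the sum telescope.\<close>
 have exp_sum: "(\<Sum>l<k. c * dr l * exp (c * (r l - r 0))) <= exp (c * (r k - r 0)) - 1" if "k <= N" for k
  using that
 proof (induction k)
  case (Suc k)
  have "exp (c * (r k - r 0)) * (1 + c * dr k) <= exp (c * (r k - r 0)) * exp (c * dr k)"
   by (intro mult_left_mono) (auto intro: exp_ge_add_one_self)
  also have "... = exp (c * (r (Suc k) - r 0))" by (simp add: exp_add[symmetric] dr_def algebra_simps)
  finally show ?case using Suc by (simp add: algebra_simps)
 qed simp
 have gron: "C^2 * a k + g^2 <= g^2 * exp (c * (r k - r 0))" if "k <= N" for k
  using that
 proof (induction k rule: less_induct)
  case (less k)
  have "C^2 * a k <= C^2 * (\<Sum>l<k. q * dr l * (C^2 * a l + g^2))"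
   by (intro mult_left_mono a_le less.prems) auto
  also have "... <= C^2 * (\<Sum>l<k. q * dr l * (g^2 * exp (c * (r l - r 0))))"
   using less q dr by (intro mult_left_mono sum_mono mult_nonneg_nonneg) auto
  also have "... = g^2 * (\<Sum>l<k. c * dr l * exp (c * (r l - r 0)))"
   by (simp add: sum_distrib_left c_def mult_ac)
  also have "... <= g^2 * (exp (c * (r k - r 0)) - 1)"
   using less.prems by (intro mult_left_mono exp_sum) auto
  finally show ?case by (simp add: algebra_simps)
 qed
 have aN: "a N <= q * T * exp (c * T) * g^2"
 proof -
  have "a N <= (\<Sum>l<N. q * dr l * (g^2 * exp (c * T)))"
  proof (rule order_trans[OF a_le[OF order_refl]], intro sum_mono mult_left_mono)
   fix l assume l: "l \<in> {..<N}"
   have "C^2 * a l + g^2 <= g^2 * exp (c * (r l - r 0))" using l by (intro gron) auto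
   also have "... <= g^2 * exp (c * T)"
   proof (intro mult_left_mono)
    have "r l - r 0 <= T" using time_gridD(4)[OF r, of l] time_gridD(3)[OF r, of 0] l by simp
    then show "exp (c * (r l - r 0)) <= exp (c * T)" using c by (simp add: mult_left_mono)
   qed simp
   finally show "C^2 * a l + g^2 <= g^2 * exp (c * T)" .
   show "0 <= q * dr l" using q dr l by simp
  qed
  also have "... = q * (r N - r 0) * (g^2 * exp (c * T))"
  proof -
   have "(\<Sum>l<N. dr l) = r N - r 0" unfolding dr_def by (rule sum_lessThan_telescope)
   then show ?thesis by (simp add: sum_distrib_left[symmetric] sum_distrib_right[symmetric])
  qed
  also have "... <= q * T * (g^2 * exp (c * T))"
   using time_gridD(4)[OF r, of N] time_gridD(3)[OF r, of 0] q
   by (intro mult_right_mono mult_left_mono) auto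
  finally show ?thesis by (simp add: mult_ac)
 qed
 have eM: "e l \<in> borel_measurable M" if "l < N" for l using measurable_G_M[OF e[OF that]] .
 have mM [measurable]: "m N \<in> borel_measurable M"
  unfolding m_def[abs_def]
  by (rule runmax_measurable) (use measurable_G_M[OF transform_G[OF r J'G]] in auto)
 have E: "?B \<in> events"
 proof -
  have "{x \<in> space M. \<exists>l\<in>{..<N}. g < e l x} \<in> events"
   by (intro sets.sets_Collect_finite_Ex) (use eM in auto)
  then show ?thesis by (simp only: Bex_def lessThan_iff)
 qed
 have F: "?M \<in> events" by measurable
 have "prob {x \<in> space M. \<exists>k\<le>N. h < norm (transform r J k x)}
  <= prob (?B \<union> ?M)"
 proof (rule finite_measure_mono)
  show "{x \<in> space M. \<exists>k\<le>N. h < norm (transform r J k x)}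
   \<subseteq> ?B \<union> ?M"
  proof
   fix x assume "x \<in> {x \<in> space M. \<exists>k\<le>N. h < norm (transform r J k x)}"
   then obtain k where x: "x \<in> space M" and k: "k <= N" "h < norm (transform r J k x)" by auto
   show "x \<in> ?B \<union> ?M"
   proof (cases "\<exists>l<N. g < e l x")
    case False
    then have "e j x <= g" if "j < k" for j
     using that k by (meson not_less order_less_le_trans)
    then have "transform r J' k x = transform r J k x" by (rule agree)
    then have "h <= m N x"
     unfolding m_def using k runmax_ge[OF k(1), of "%k. norm (transform r J' k x)"] by simp
    then have "h^2 <= (m N x)^2" using eta by (intro power_mono) auto
    then show ?thesis using x by simp
   qed (use x in simp)
  qed
 qed (rule sets.Un[OF E F])
 also have "... <= prob ?B + prob ?M"
  by (rule measure_Un_le[OF E F])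
 also have "prob ?M <= a N / h^2"
  unfolding a_def by (rule integral_Markov_inequality_measure[OF m2[OF order_refl], of "space M"]) (use eta in auto)
 also have "a N / h^2 <= q * T * exp (c * T) * g^2 / h^2"
  by (rule divide_right_mono[OF aN]) simp
 finally show ?thesis by (simp add: q_def c_def power_divide mult_ac)
qed

end

section \<open>Riemann sums of stochastic integrals\<close>

definition fractions :: "real set" where
 "fractions = range (%(j, m). real j / real (Suc m))"

lemma countable_fractions: "countable fractions"
 unfolding fractions_def by simp

text \<open>Approximation from below keeps the approximating time inside any interval that starts at
  0 and contains \<open>r\<close>.\<close>

lemma fractions_dense:
 assumes "0 <= r" "d > 0"
 obtains q where "q \<in> fractions" "0 <= q" "q <= r" "r - q < d"
proof -
 obtain m where m: "1 / real (Suc m) < d" using nat_approx_posE[OF assms(2)] by metis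
 define j where "j = nat \<lfloor>r * real (Suc m)\<rfloor>"
 have j: "real j <= r * real (Suc m)" "r * real (Suc m) < real j + 1"
  using assms(1) by (auto simp: j_def)
 show thesis
 proof (rule that)
  show "real j / real (Suc m) \<in> fractions" unfolding fractions_def by auto
  show "real j / real (Suc m) <= r" using j(1) by (simp add: divide_le_eq)
  have "r < (real j + 1) / real (Suc m)" using j(2) by (simp add: less_divide_eq)
  then show "r - real j / real (Suc m) < d" using m by (simp add: add_divide_distrib)
 qed simp
qed

text \<open>By continuity the event is covered by a countable union over rational pairs of times,
  which is measurable; these unions decrease and, each path being uniformly continuous, have empty
  intersection.\<close>

lemma (in finite_measure) vanishing_oscillation:
 fixes H :: "real => 'a => 'b::{second_countable_topology, real_normed_vector}"
 assumes H: "!!s. 0 <= s ==> s <= S ==> H s \<in> borel_measurable M"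
  and cont: "!!x. x \<in> space M ==> continuous_on {0..S} (%s. H s x)" and c: "c > 0" and eps: "e > 0"
 shows "vanishing M (%n. {x \<in> space M. \<exists>r\<in>{0..S}. \<exists>r'\<in>{0..S}. \<bar>r - r'\<bar> <= c / 2^n \<and> e < norm (H r x - H r' x)})"
proof -
 \<comment> \<open>The mesh is doubled because replacing two times by rational ones below them may
   increase their distance, by less than \<open>c / 2^n\<close>.\<close>
 define Q where "Q n = {(q, q'). q \<in> fractions \<inter> {0..S} \<and> q' \<in> fractions \<inter> {0..S} \<and> \<bar>q - q'\<bar> < 2 * (c / 2^n)}" for n :: nat
 define A where "A n = (\<Union>(q, q')\<in>Q n. {x \<in> space M. e < norm (H q x - H q' x)})" for n
 show ?thesis
 proof (rule vanishing_decseq[of A])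
  have cQ: "countable (Q n)" for n
   by (rule countable_subset[of _ "fractions \<times> fractions"]) (auto simp: Q_def countable_fractions)
  show "A n \<in> sets M" for n
   unfolding A_def
  proof (rule sets.countable_UN''[OF cQ], safe)
   fix q q' assume "(q, q') \<in> Q n"
   then have [measurable]: "H q \<in> borel_measurable M" "H q' \<in> borel_measurable M"
    using H by (auto simp: Q_def)
   show "{x \<in> space M. e < norm (H q x - H q' x)} \<in> sets M" by measurable
  qed
  show "decseq A"
   unfolding decseq_def A_def
  proof (intro allI impI UN_mono order_refl)
   fix m n :: nat assume "m <= n"
   then have "c / 2^n <= c / 2^m" using c by (intro divide_left_mono) auto
   then show "Q n \<subseteq> Q m" by (auto simp: Q_def)
  qed
  show "(\<Inter>n. A n) = {}"
  proof (rule equals0I)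
   fix x assume x: "x \<in> (\<Inter>n. A n)"
   then have xs: "x \<in> space M" by (auto simp: A_def)
   obtain v where v: "v > 0" "!!r r'. r \<in> {0..S} ==> r' \<in> {0..S} ==> \<bar>r - r'\<bar> <= v ==> norm (H r x - H r' x) < e"
    using modulus_of_continuity[OF cont[OF xs] eps] by blast
   have "(%n. 2 * (c / 2^n)) \<longlonglongrightarrow> 2 * 0" by (intro tendsto_mult tendsto_const mesh_tendsto_0)
   then have "\<forall>\<^sub>F n in sequentially. 2 * (c / 2^n) < v" using v(1) by (intro order_tendstoD(2)) auto
   then obtain n where n: "2 * (c / 2^n) < v" by (auto simp: eventually_sequentially)
   have "x \<in> A n" using x by blast
   then obtain z where z: "z \<in> Q n" "x \<in> (case z of (q, q') => {x \<in> space M. e < norm (H q x - H q' x)})"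
    unfolding A_def by blast
   obtain q q' where "z = (q, q')" by (cases z)
   with z have q: "(q, q') \<in> Q n" "e < norm (H q x - H q' x)" by auto
   then show False using v(2)[of q q'] n by (auto simp: Q_def)
  qed
  show "{x \<in> space M. \<exists>r\<in>{0..S}. \<exists>r'\<in>{0..S}. \<bar>r - r'\<bar> <= c / 2^n \<and> e < norm (H r x - H r' x)} \<subseteq> A n" for n
  proof safe
   fix x r r' assume x: "x \<in> space M" and r: "r \<in> {0..S}" "r' \<in> {0..S}" "\<bar>r - r'\<bar> <= c / 2^n" "e < norm (H r x - H r' x)"
   define g where "g = (norm (H r x - H r' x) - e) / 2"
   have g: "g > 0" using r(4) by (simp add: g_def)
   obtain v where v: "v > 0" "!!r r'. r \<in> {0..S} ==> r' \<in> {0..S} ==> \<bar>r - r'\<bar> <= v ==> norm (H r x - H r' x) < g"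
    using modulus_of_continuity[OF cont[OF x] g] by blast
   define d where "d = min v (c / 2^n / 2)"
   have d: "d > 0" using v(1) c by (simp add: d_def)
   obtain q where q: "q \<in> fractions" "0 <= q" "q <= r" "r - q < d" using fractions_dense[OF _ d, of r] r by auto
   obtain q' where q': "q' \<in> fractions" "0 <= q'" "q' <= r'" "r' - q' < d" using fractions_dense[OF _ d, of r'] r by auto
   have "norm (H r x - H q x) < g" using q r d_def by (intro v(2)) auto
   moreover have "norm (H q' x - H r' x) < g" using q' r d_def by (intro v(2)) auto
   moreover have "norm (H r x - H r' x) <= norm (H r x - H q x) + norm (H q x - H q' x) + norm (H q' x - H r' x)"
    using norm_triangle_ineq[of "H r x - H q x" "H q x - H q' x"] norm_triangle_ineq[of "H r x - H q' x" "H q' x - H r' x"] by simp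
   ultimately have "e < norm (H q x - H q' x)" by (simp add: g_def field_simps)
   moreover have "\<bar>q - q'\<bar> < 2 * (c / 2^n)" using q q' r(3) by (simp add: d_def) linarith
   then have "(q, q') \<in> Q n" using q q' r by (auto simp: Q_def)
   ultimately show "x \<in> A n" using x by (auto simp: A_def)
  qed
 qed
qed

lemma partition_cell:
 fixes p :: "nat => real"
 shows "p 0 < v ==> v <= p k ==> \<exists>i<k. p i < v \<and> v <= p (Suc i)"
proof (induction k)
 case (Suc k)
 then show ?case by (cases "v <= p k") (auto intro: less_SucI)
qed simp

lemma partition_mono:
 fixes p :: "nat => real"
 assumes "\<forall>i<k. p i <= p (Suc i)" "i <= j" "j <= k"
 shows "p i <= p j"
 using assms(2,3) by (induction j rule: dec_induct) (use assms(1) in "auto intro: order_trans")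

lemma simple_process_eq:
 fixes p :: "nat => real"
 assumes p: "\<forall>i<k. p i <= p (Suc i)" and i: "i < k" "p i < r" "r <= p (Suc i)"
 shows "simple_process k p y r x = y i x"
proof -
 have "simple_process k p y r x = (\<Sum>j<k. if j = i then y i x else 0)"
  unfolding simple_process_def
 proof (rule sum.cong)
  fix j assume j: "j \<in> {..<k}"
  have "\<not> (p j < r \<and> r <= p (Suc j))" if "j \<noteq> i"
  proof (cases "j < i")
   case True
   then have "p (Suc j) <= p i" using i by (intro partition_mono[OF p]) auto
   then show ?thesis using i by simp
  next
   case False
   then have "p (Suc i) <= p j" using that j by (intro partition_mono[OF p]) auto
   then show ?thesis using i by simp
  qed
  then show "(if p j < r \<and> r <= p (Suc j) then y j x else 0) = (if j = i then y i x else 0)"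
   using i by auto
 qed simp
 then show ?thesis using i by simp
qed

text \<open>Simple processes are left-continuous: without partition points inside the interval, the
  value at the right end is the value throughout.\<close>

lemma simple_integral_increment:
 fixes p :: "nat => real" and y :: "nat => 'a => real ^ 'n::finite ^ 'm::finite"
 assumes uv: "u <= v" and no: "!!i. i <= k ==> \<not> (u < p i \<and> p i < v)" and p: "\<forall>i<k. p i <= p (Suc i)"
 shows "simple_integral (*v) B k p y v x - simple_integral (*v) B k p y u x = simple_process k p y v x *v (B v x - B u x)"
proof (cases "u = v")
 case False
 have "simple_integral (*v) B k p y v x - simple_integral (*v) B k p y u x
  = (\<Sum>i<k. y i x *v (B (min (p (Suc i)) v) x - B (min (p i) v) x - (B (min (p (Suc i)) u) x - B (min (p i) u) x)))"
  unfolding simple_integral_def sum_subtractf[symmetric]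
  by (intro sum.cong refl) (simp add: matrix_vector_mult_diff_distrib)
 also have "... = (\<Sum>i<k. (if p i < v \<and> v <= p (Suc i) then y i x else 0) *v (B v x - B u x))"
 proof (rule sum.cong)
  fix i assume i: "i \<in> {..<k}"
  have c: "p i <= u \<or> v <= p i" "p (Suc i) <= u \<or> v <= p (Suc i)" "p i <= p (Suc i)"
   using no[of i] no[of "Suc i"] i p by auto
  show "y i x *v (B (min (p (Suc i)) v) x - B (min (p i) v) x - (B (min (p (Suc i)) u) x - B (min (p i) u) x))
   = (if p i < v \<and> v <= p (Suc i) then y i x else 0) *v (B v x - B u x)"
  proof (cases "v <= p i")
   case True
   then have "min (p i) v = v" "min (p (Suc i)) v = v" "min (p i) u = u" "min (p (Suc i)) u = u"
    using c(3) uv by auto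
   then show ?thesis using True by simp
  next
   case v: False
   then have pu: "p i <= u" "p i < v" using c by auto
   show ?thesis
   proof (cases "p (Suc i) <= u")
    case True
    then show ?thesis using pu uv False by (simp add: min_absorb1)
   next
    case False
    then have "v <= p (Suc i)" using c by auto
    then show ?thesis using pu uv by (simp add: min_absorb1 min_absorb2)
   qed
  qed
 qed simp
 also have "... = simple_process k p y v x *v (B v x - B u x)"
  unfolding simple_process_def
  by (induction k) (auto simp: matrix_vector_mult_add_rdistrib)
 finally show ?thesis .
qed simp

context brownian
begin

text \<open>Left-point sum over the dyadic grid of \<open>[0,T]\<close>. Cells that reach beyond
  \<open>S\<close> are left out, so that \<open>H\<close> is evaluated on \<open>[0,S]\<close>
  only.\<close>

definition riemann :: "real => (real => 'a => real ^ 'd ^ 'd) => nat => nat => 'a => real ^ 'd" where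
 "riemann S H n = transform (grid T n) (%i x. if grid T n (Suc i) <= S then H (grid T n i) x else 0)"

lemma simple_integral_0:
 "p 0 = 0 ==> \<forall>i<k. p i <= p (Suc i) ==> simple_integral (*v) B k p y 0 x = 0"
 unfolding simple_integral_def
proof (rule sum.neutral, rule ballI)
 fix i assume p: "p 0 = 0" "\<forall>i<k. p i <= p (Suc i)" and i: "i \<in> {..<k}"
 have "p 0 <= p i" "p 0 <= p (Suc i)" using i by (auto intro!: partition_mono[OF p(2)])
 then show "y i x *v (B (min (p (Suc i)) 0) x - B (min (p i) 0) x) = 0" using p(1) by (simp add: min_def)
qed

lemma simple_process_measurable:
 fixes y :: "nat => 'a => real ^ 'd ^ 'd"
 assumes "!!i. i < k ==> p i < v ==> y i \<in> borel_measurable N"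
 shows "simple_process k p y v \<in> borel_measurable N"
 unfolding simple_process_def[abs_def]
proof (rule borel_measurable_sum)
 fix i assume "i \<in> {..<k}"
 then show "(%x. if p i < v \<and> v <= p (Suc i) then y i x else 0) \<in> borel_measurable N"
  using assms[of i] by (cases "p i < v \<and> v <= p (Suc i)") auto
qed

text \<open>One simple process is fixed that is close to \<open>H\<close> and has an integral close
  to \<open>X\<close>. On the common refinement of its partition with the grid, its integral and the
  Riemann sum differ by a transform with small integrand, which \<open>transform_stability\<close>
  controls. Any integral in the sense of \<open>stoch_integral\<close> thus becomes a limit of
  explicit sums.\<close>

lemma riemann_converges:
 fixes H :: "real => 'a => real ^ 'd ^ 'd"
 assumes S: "0 <= S" "S <= T"
  and H: "!!s. 0 <= s ==> s <= S ==> H s \<in> borel_measurable (G s)"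
  and cont: "!!x. x \<in> space M ==> continuous_on {0..S} (%s. H s x)"
  and int: "stoch_integral (*v) M G S W H X" and eta: "b > 0"
 shows "vanishing M (%n. {x \<in> space M. \<exists>k. grid T n k <= S \<and> b < norm (riemann S H n k x - X (grid T n k) x)})"
proof (rule vanishingI)
 fix d :: real assume rho: "d > 0"
 define K where "K = 8 * real CARD('d) * T"
 have K: "K \<ge> 0" using T_pos by (simp add: K_def)
 \<comment> \<open>Bound for the integrand that makes the deviation estimate at level
   \<open>b / 2\<close> at most \<open>d / 8\<close>, see \<open>Kd\<close>.\<close>
 define c where "c = (b / 2) * sqrt (d / (8 * (K + 1)))"
 have d: "c > 0" using eta rho K by (simp add: c_def)
 have Kd: "K * (c / (b / 2))^2 <= d / 8"
 proof -
  have "(c / (b / 2))^2 = d / (8 * (K + 1))" using eta rho K by (simp add: c_def power_mult_distrib)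
  moreover have "K * (d / (8 * (K + 1))) <= d / 8" using K rho by (simp add: field_simps)
  ultimately show ?thesis by (simp only:)
 qed
 have r8: "d / 8 > 0" using rho by simp
 obtain k p y where sp: "!!m. simple_predictable G S (k m) (p m) (y m)"
  and u1: "ucp_tendsto M {0<..S} (%m. simple_process (k m) (p m) (y m)) H"
  and u2: "ucp_tendsto M {0..S} (%m. simple_integral (*v) W (k m) (p m) (y m)) X"
  using int unfolding stoch_integral_def by blast
 have "vanishing M (%n. {x \<in> space M. \<exists>r\<in>{0..S}. \<exists>r'\<in>{0..S}. \<bar>r - r'\<bar> <= T / 2^n \<and> c/2 < norm (H r x - H r' x)})"
  using measurable_G_M[OF H] cont T_pos d by (intro vanishing_oscillation) auto
 then obtain N where N:
  "!!n. n \<ge> N ==> small M (d/8) ({x \<in> space M. \<exists>r\<in>{0..S}. \<exists>r'\<in>{0..S}. \<bar>r - r'\<bar> <= T / 2^n \<and> c/2 < norm (H r x - H r' x)})"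
  by (rule vanishingD[OF _ r8]) blast
 have "vanishing M (%m. {x \<in> space M. \<exists>s\<in>{0<..S}. c/2 < norm (simple_process (k m) (p m) (y m) s x - H s x)} \<union>
   {x \<in> space M. \<exists>s\<in>{0..S}. b/2 < norm (simple_integral (*v) W (k m) (p m) (y m) s x - X s x)})"
  using d eta by (intro vanishing_Un vanishing_ucp[OF u1] vanishing_ucp[OF u2] finite_measure_axioms) auto
 then obtain N' where N':
  "!!m. m \<ge> N' ==> \<exists>A\<in>sets M. {x \<in> space M. \<exists>s\<in>{0<..S}. c/2 < norm (simple_process (k m) (p m) (y m) s x - H s x)} \<union>
   {x \<in> space M. \<exists>s\<in>{0..S}. b/2 < norm (simple_integral (*v) W (k m) (p m) (y m) s x - X s x)} \<subseteq> A \<and> emeasure M A < ennreal (d/8)"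
  by (rule vanishingD[OF _ r8]) blast
 \<comment> \<open>The approximating simple process is chosen once, independently of the mesh
   \<open>n\<close>.\<close>
 define k0 p0 y0 where "k0 = k N'" and "p0 = p N'" and "y0 = y N'"
 have p0: "p0 0 = 0" "p0 k0 = S" "\<forall>i<k0. p0 i <= p0 (Suc i)" "!!i. i < k0 ==> y0 i \<in> borel_measurable (G (p0 i))"
  using sp[of N'] by (auto simp: simple_predictable_def k0_def p0_def y0_def)
  let ?H0 = "simple_process k0 p0 y0" and ?I0 = "simple_integral (*v) W k0 p0 y0" and ?R = "%n k x. norm (riemann S H n k x - X (grid T n k) x)"
 obtain A2 where A2: "A2 \<in> sets M" "emeasure M A2 < ennreal (d/8)"
  "!!x s. x \<in> space M ==> x \<notin> A2 ==> 0 < s ==> s <= S ==> norm (?H0 s x - H s x) <= c/2"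
  "!!x s. x \<in> space M ==> x \<notin> A2 ==> 0 <= s ==> s <= S ==> norm (?I0 s x - X s x) <= b/2"
 proof -
  obtain A where A: "A \<in> sets M" "{x \<in> space M. \<exists>s\<in>{0<..S}. c/2 < norm (?H0 s x - H s x)} \<union>
   {x \<in> space M. \<exists>s\<in>{0..S}. b/2 < norm (?I0 s x - X s x)} \<subseteq> A" "emeasure M A < ennreal (d/8)"
   using N'[OF order_refl] unfolding k0_def p0_def y0_def by blast
  show thesis
  proof (rule that[OF A(1,3)])
   fix x s assume "x \<in> space M" "x \<notin> A" "0 < s" "s <= S"
   then show "norm (?H0 s x - H s x) <= c/2" using A(2) by (force simp: not_less)
  next
   fix x s assume "x \<in> space M" "x \<notin> A" "0 <= s" "s <= S"
   then show "norm (?I0 s x - X s x) <= b/2" using A(2) by (force simp: not_less)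
  qed
 qed
 show "\<exists>N. \<forall>n\<ge>N. small M d {x \<in> space M. \<exists>k. grid T n k <= S \<and> b < ?R n k x}"
 proof (intro exI[of _ N] allI impI)
  fix n assume "n \<ge> N"
  then obtain A1 where A1: "A1 \<in> sets M" "emeasure M A1 < ennreal (d/8)"
   "!!x r r'. x \<in> space M ==> x \<notin> A1 ==> r \<in> {0..S} ==> r' \<in> {0..S} ==> \<bar>r - r'\<bar> <= T / 2^n ==> norm (H r x - H r' x) <= c/2"
   using N[of n] by (force simp: not_less)
  define j where "j = nat \<lfloor>S * 2^n / T\<rfloor>"
  have jS: "grid T n i <= S \<longleftrightarrow> i <= j" for i
  proof -
   have "grid T n i <= S \<longleftrightarrow> real i <= S * 2^n / T" using T_pos by (simp add: grid_def field_simps)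
   also have "... \<longleftrightarrow> i <= j" unfolding j_def using S T_pos by (simp add: le_nat_iff le_floor_iff)
   finally show ?thesis .
  qed
  define q where "q = grid T n"
  have q: "\<forall>i<j. q i <= q (Suc i)" "q 0 = 0" unfolding q_def using grid_mono T_pos by auto
  define U where "U i = H (q i)" for i
  let ?Hq = "simple_process j q U" and ?Iq = "simple_integral (*v) W j q U" and ?r = "%l. r (Suc l)"
  have rie: "riemann S H n i x = ?Iq (q i) x" if i: "i <= j" for i x
  proof -
   have "?Iq (q i) x = (\<Sum>l<j. if l < i then U l x *v (W (q (Suc l)) x - W (q l) x) else 0)"
    unfolding simple_integral_def
   proof (rule sum.cong)
    fix l assume "l \<in> {..<j}"
    show "U l x *v (W (min (q (Suc l)) (q i)) x - W (min (q l) (q i)) x) = (if l < i then U l x *v (W (q (Suc l)) x - W (q l) x) else 0)"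
    proof (cases "l < i")
     case True
     then have "q l <= q i" "q (Suc l) <= q i" using T_pos by (auto simp: q_def intro!: grid_mono)
     then show ?thesis using True by (simp add: min_def)
    next
     case False
     then have "q i <= q l" "q i <= q (Suc l)" using T_pos by (auto simp: q_def intro!: grid_mono)
     then show ?thesis using False by (simp add: min_absorb2)
    qed
   qed simp
   also have "... = (\<Sum>l<i. U l x *v (W (q (Suc l)) x - W (q l) x))"
    using i by (intro sum.mono_neutral_cong_right) auto
   also have "... = riemann S H n i x"
    unfolding riemann_def transform_def q_def[symmetric]
    by (intro sum.cong) (use jS i in "auto simp: q_def U_def")
   finally show ?thesis by simp
  qed
  \<comment> \<open>Common refinement, cut off at the last grid point \<open>q j\<close> not beyond
    \<open>S\<close>: the Riemann sum ends there.\<close>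
  define F where "F = p0 ` {i. i <= k0 \<and> p0 i <= q j} \<union> q ` {..j}"
  have finF: "finite F" unfolding F_def by auto
  have qF: "q i \<in> F" if "i <= j" for i using that by (auto simp: F_def)
  have F0: "0 \<in> F" using qF[of 0] q(2) by simp
  have Fle: "v <= q j" if "v \<in> F" for v
   using that T_pos grid_mono[of T _ j n] by (auto simp: F_def q_def)
  have Fge: "0 <= v" if "v \<in> F" for v
  proof -
   have "0 <= p0 i" if "i <= k0" for i using partition_mono[OF p0(3), of 0 i] that p0(1) by simp
   moreover have "0 <= q i" for i using grid_nonneg[of T n i] T_pos by (simp add: q_def)
   ultimately show ?thesis using that by (auto simp: F_def)
  qed
  define L where "L = sorted_list_of_set F"
  define NN where "NN = card F - 1"
  have L: "set L = F" "length L = Suc NN" "sorted_wrt (<) L"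
  proof -
   show "set L = F" "sorted_wrt (<) L" using finF by (simp_all add: L_def)
   have "card F > 0" using finF F0 by (auto simp: card_gt_0_iff)
   then show "length L = Suc NN" using finF by (simp add: L_def NN_def)
  qed
  define r where "r l = L ! l" for l
  let ?r = "%l. r (Suc l)" and ?w = "%l x. W (r (Suc l)) x - W (r l) x"
  have rF: "r l \<in> F" if "l <= NN" for l using that L by (auto simp: r_def intro!: nth_mem[of l L, simplified L(1)])
  have rless: "r l < r l'" if "l < l'" "l' <= NN" for l l'
   using that L unfolding r_def by (intro sorted_wrt_nth_less[of "(<)"]) auto
  have rsurj: "\<exists>l\<le>NN. v = r l" if "v \<in> F" for v
   using that L by (metis in_set_conv_nth less_Suc_eq_le r_def)
  have gap: "\<not> (r l < v \<and> v < r (Suc l))" if lv: "l < NN" "v \<in> F" for l v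
  proof
   assume a: "r l < v \<and> v < r (Suc l)"
   obtain l' where l': "l' <= NN" "v = r l'" using rsurj[OF lv(2)] by blast
   consider "l' <= l" | "Suc l <= l'" by linarith
   then show False
   proof cases
    case 1
    then show ?thesis using rless[of l' l] a l' lv by (cases "l' = l") auto
   next
    case 2
    then show ?thesis using rless[of "Suc l" l'] a l' by (cases "l' = Suc l") auto
   qed
  qed
  have r0: "r 0 = 0"
  proof -
   obtain l where l: "l <= NN" "0 = r l" using rsurj[OF F0] by blast
   show ?thesis using rless[of 0 l] l Fge[OF rF[of 0]] by (cases "l = 0") auto
  qed
  have qjS: "q j <= S" using jS by (simp add: q_def)
  have tg: "time_grid r NN"
   unfolding time_grid_def using r0 rless rF[of NN] Fle qjS S by (force intro: less_imp_le)
  \<comment> \<open>At the right end of a cell both left-continuous step processes show the value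
    they have on the whole cell. That value is already known at the left end, which is
    \<open>JG\<close>.\<close>
  define J where "J l x = ?Hq (?r l) x - ?H0 (?r l) x" for l x
  have below: "v <= r l" if "l < NN" "v \<in> F" "v < r (Suc l)" for l v
   using gap[OF that(1,2)] that(3) by auto
  have rS: "0 < r (Suc l)" "r (Suc l) <= q j" if "l < NN" for l
   using rless[of 0 "Suc l"] r0 Fle[OF rF[of "Suc l"]] that by auto
  have JG: "J l \<in> borel_measurable (G (r l))" if l: "l < NN" for l
   unfolding J_def[abs_def]
  proof (intro borel_measurable_diff simple_process_measurable)
   fix i assume i: "i < j" "q i < r (Suc l)"
   then have "q i <= r l" using below[OF l qF[of i]] by simp
   moreover have "U i \<in> borel_measurable (G (q i))"
    unfolding U_def using i jS[of i] grid_nonneg[of T n i] T_pos by (intro H) (auto simp: q_def)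
   ultimately show "U i \<in> borel_measurable (G (r l))" by (rule measurable_G_mono[rotated])
  next
   fix i assume i: "i < k0" "p0 i < r (Suc l)"
   then have "p0 i \<in> F" using rS(2)[OF l] by (auto simp: F_def)
   then have "p0 i <= r l" using below[OF l] i by simp
   then show "y0 i \<in> borel_measurable (G (r l))" using p0(4)[OF i(1)] by (rule measurable_G_mono[rotated])
  qed
  have tr: "transform r J l x = ?Iq (r l) x - ?I0 (r l) x" if "l <= NN" for l x
   using that
  proof (induction l)
   case 0
   then show ?case using r0 simple_integral_0[of q j W U x] simple_integral_0[of p0 k0 W y0 x] q p0 by simp
  next
   case (Suc l)
   have l: "l < NN" using Suc by simp
   have le: "r l <= r (Suc l)" using rless[of l "Suc l"] l by simp
   have 1: "?Iq (?r l) x - ?Iq (r l) x = ?Hq (?r l) x *v ?w l x"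
    by (rule simple_integral_increment[OF le _ q(1)]) (use gap[OF l] qF in auto)
   have 2: "?I0 (?r l) x - ?I0 (r l) x = ?H0 (?r l) x *v ?w l x"
   proof (rule simple_integral_increment[OF le _ p0(3)])
    fix i assume i: "i <= k0"
    show "\<not> (r l < p0 i \<and> p0 i < r (Suc l))"
    proof
     assume a: "r l < p0 i \<and> p0 i < r (Suc l)"
     then have "p0 i \<in> F" using i rS(2)[OF l] by (auto simp: F_def)
     then show False using gap[OF l] a by blast
    qed
   qed
   have 3: "J l x *v ?w l x = ?Hq (?r l) x *v ?w l x
     - ?H0 (?r l) x *v ?w l x"
    unfolding J_def by (rule matrix_vector_mult_diff_rdistrib)
   have 4: "transform r J l x = ?Iq (r l) x - ?I0 (r l) x"
    by (rule Suc.IH) (use l in simp)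
   show ?case unfolding transform_simps(2) 3 4 1[symmetric] 2[symmetric] by simp
  qed
  have Jsmall: "norm (J l x) <= c" if x: "x \<in> space M" "x \<notin> A1" "x \<notin> A2" and l: "l < NN" for l x
  proof -
   have v: "0 < r (Suc l)" "r (Suc l) <= q j" "r (Suc l) <= S" using rS[OF l] qjS by auto
   obtain i where i: "i < j" "q i < r (Suc l)" "r (Suc l) <= q (Suc i)"
    using partition_cell[of q "r (Suc l)" j] v q(2) by auto
   have "?Hq (?r l) x = H (q i) x"
    using simple_process_eq[OF q(1) i, of U x] by (simp add: U_def)
   moreover have "norm (H (q i) x - H (?r l) x) <= c/2"
    using i v grid_nonneg[of T n i] T_pos by (intro A1(3) x) (auto simp: q_def grid_Suc)
   moreover have "norm (?H0 (?r l) x - H (?r l) x) <= c/2"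
    using v by (intro A2(3) x) auto
   ultimately show ?thesis
    using norm_triangle_ineq4[of "H (q i) x - H (?r l) x" "?H0 (?r l) x - H (?r l) x"]
    by (simp add: J_def)
  qed
  define B where "B = {x \<in> space M. \<exists>l\<le>NN. b/2 < norm (transform r J l x)}"
  have Bm: "B \<in> sets M"
  proof -
   have "{x \<in> space M. \<exists>l\<in>{..NN}. b/2 < norm (transform r J l x)} \<in> sets M"
   proof (rule sets.sets_Collect_finite_Ex)
    fix l assume "l \<in> {..NN}"
    then have [measurable]: "transform r J l \<in> borel_measurable M"
     using measurable_G_M[OF transform_G[OF tg JG]] by simp
    show "{x \<in> space M. b/2 < norm (transform r J l x)} \<in> sets M" by measurable
   qed simp
   then show ?thesis unfolding B_def by (simp only: Bex_def atMost_iff)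
  qed
  \<comment> \<open>\<open>transform_stability\<close> with \<open>C = 0\<close>, the norm of the
    integrand serving as its own error.\<close>
  have "prob B <= prob {x \<in> space M. \<exists>l<NN. c < norm (J l x)} + 8 * real CARD('d) * T * exp (8 * real CARD('d) * 0^2 * T) * (c / (b/2))^2"
   unfolding B_def
   by (rule transform_stability[OF tg JG]) (use JG d eta in auto)
  also have "... <= prob (A1 \<union> A2) + d/8"
  proof (rule add_mono)
   show "prob {x \<in> space M. \<exists>l<NN. c < norm (J l x)} <= prob (A1 \<union> A2)"
   proof (rule finite_measure_mono)
    show "{x \<in> space M. \<exists>l<NN. c < norm (J l x)} \<subseteq> A1 \<union> A2"
    proof
     fix x assume "x \<in> {x \<in> space M. \<exists>l<NN. c < norm (J l x)}"
     then obtain l where "x \<in> space M" "l < NN" "c < norm (J l x)" by blast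
     then show "x \<in> A1 \<union> A2" using Jsmall[of x l] by auto
    qed
   qed (use A1(1) A2(1) in auto)
   show "8 * real CARD('d) * T * exp (8 * real CARD('d) * 0^2 * T) * (c / (b/2))^2 <= d/8"
    using Kd by (simp add: K_def)
  qed
  also have "prob (A1 \<union> A2) <= prob A1 + prob A2" by (rule measure_Un_le[OF A1(1) A2(1)])
  also have "prob A1 < d/8" using A1(2) rho by (simp add: emeasure_eq_measure ennreal_less_iff)
  also have pA2: "prob A2 < d/8" using A2(2) rho by (simp add: emeasure_eq_measure ennreal_less_iff)
  finally have pB: "prob B < d/8 + d/8 + d/8" by simp
  have "prob (B \<union> A2) <= prob B + prob A2" by (rule measure_Un_le[OF Bm A2(1)])
  also have "... < d" using pB pA2 rho by simp
  finally have pBA: "emeasure M (B \<union> A2) < ennreal d" using rho by (simp add: emeasure_eq_measure ennreal_less_iff)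
  have sub: "{x \<in> space M. \<exists>k. grid T n k <= S \<and> b < ?R n k x} \<subseteq> B \<union> A2"
  proof
   fix x assume "x \<in> {x \<in> space M. \<exists>k. grid T n k <= S \<and> b < ?R n k x}"
   then obtain i where x: "x \<in> space M" and i: "q i <= S" "b < norm (riemann S H n i x - X (q i) x)"
    by (auto simp: q_def)
   have ij: "i <= j" using i jS by (simp add: q_def)
   obtain l where l: "l <= NN" "q i = r l" using rsurj[OF qF[OF ij]] by blast
   show "x \<in> B \<union> A2"
   proof (rule ccontr)
    assume nx: "x \<notin> B \<union> A2"
    have "norm (transform r J l x) <= b/2" using nx x l by (auto simp: B_def not_less)
    moreover have "norm (?I0 (q i) x - X (q i) x) <= b/2"
     using nx x i grid_nonneg[of T n i] T_pos by (intro A2(4)) (auto simp: q_def)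
    moreover have "norm (riemann S H n i x - X (q i) x) <= norm (transform r J l x) + norm (?I0 (q i) x - X (q i) x)"
    proof -
     have "riemann S H n i x - X (q i) x = transform r J l x + (?I0 (q i) x - X (q i) x)"
      using rie[OF ij] tr[OF l(1)] l(2) by simp
     then show ?thesis by (simp only: norm_triangle_ineq)
    qed
    ultimately show False using i(2) by linarith
   qed
  qed
  show "small M d {x \<in> space M. \<exists>k. grid T n k <= S \<and> b < ?R n k x}"
   using sub pBA Bm A2(1) by (intro bexI[of _ "B \<union> A2"]) auto
 qed
qed

end

section \<open>The Euler scheme\<close>

text \<open>Stage \<open>i\<close> is an entire sequence of nodes, constant from index
  \<open>i\<close> on, so that its interpolation is a path at which the coefficient
  \<open>c i\<close> can be evaluated without knowledge of later increments.\<close>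

primrec euler :: "real => nat => (nat => ('d::finite) path => real ^ 'd ^ 'd) => (nat => real ^ 'd) => nat => nat => real ^ 'd" where
 "euler T n c u 0 = (%j. 0)"
| "euler T n c u (Suc i) = (%j. if j <= i then euler T n c u i j
  else euler T n c u i i + c i (interp T n (euler T n c u i)) *v u i)"

lemma euler_past: "j <= i ==> euler T n c u i j = euler T n c u j j"
 by (induction i) (auto simp: le_Suc_eq)

lemma euler_0 [simp]: "euler T n c u i 0 = 0"
 using euler_past[of 0 i T n c u] by simp

lemma euler_const_after:
 assumes "!!i z. m <= i ==> i < k ==> c i z = 0" "m <= k"
 shows "euler T n c u k k = euler T n c u m m"
 using assms(2,1) by (induction k rule: dec_induct) auto

text \<open>Zero as soon as the next step would leave \<open>[0,T]\<close>; the scheme then stands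
  still, as the solutions do after \<open>T - t\<close>.\<close>

definition euler_coeff :: "real => nat => (real => ('d::finite) path => real ^ 'd ^ 'd) => real => 'd path => nat => 'd path => real ^ 'd ^ 'd" where
 "euler_coeff T n \<sigma> t w i z = (if t + grid T n (Suc i) <= T then shift_process T t w \<sigma> (grid T n i) z else 0)"

text \<open>A deterministic function of starting time, initial path and increments. Its
  measurability in the last two is the property that the given solutions do not come with.\<close>

definition euler_path :: "real => nat => (real => ('d::finite) path => real ^ 'd ^ 'd) => real => 'd path => (nat => real ^ 'd) => 'd path" where
 "euler_path T n \<sigma> t w u = interp T n (euler T n (euler_coeff T n \<sigma> t w) u (2^n))"

lemma euler_coeff_cong:
 assumes "!!r. 0 <= r ==> r <= t ==> w r = w' r" "0 <= t"
 shows "euler_coeff T n \<sigma> t w = euler_coeff T n \<sigma> t w'"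
 using concat_path_cong[of t w w' T] assms by (intro ext) (auto simp: euler_coeff_def shift_process_def)

lemma euler_path_in_Omega: "T > 0 ==> euler_path T n \<sigma> t w u \<in> Omega T"
 unfolding euler_path_def by (rule interp_in_Omega) auto

lemma interp_measurable:
 assumes "T > 0" "!!x. y x 0 = 0" "!!j. (%x. y x j) \<in> borel_measurable N"
 shows "(%x. interp T n (y x)) \<in> measurable N (paths T)"
proof (rule measurable_into_path_space)
 show "interp T n (y x) \<in> Omega T" for x using assms by (intro interp_in_Omega) auto
 show "(%x. interp T n (y x) r) \<in> borel_measurable N" if "0 <= r" "r <= T" for r
  using that assms(3) by (simp add: interp_def)
qed

lemma euler_coeff_measurable:
 assumes T: "T > 0" and \<sigma>: "continuous_adapted T T \<sigma>" and t: "0 <= t" "t <= T"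
  and Z: "Z \<in> measurable N (paths T)" and P: "P \<in> measurable N (paths T)"
 shows "(%x. euler_coeff T n \<sigma> t (Z x) m (P x)) \<in> borel_measurable N"
proof (cases "t + grid T n (Suc m) <= T")
 case True
 have "t + grid T n m <= T" using True grid_mono[of T m "Suc m" n] T by simp
 moreover have "0 <= t + grid T n m" using t grid_nonneg[of T n m] T by simp
 ultimately have "\<sigma> (t + grid T n m) \<in> borel_measurable (paths T)"
  by (intro continuous_adaptedD(1)[OF \<sigma>])
 from measurable_compose[OF concat_path_measurable[OF Z P, of "%_. t"] this] t
 show ?thesis using True by (simp add: euler_coeff_def shift_process_def)
qed (simp add: euler_coeff_def)

lemma euler_measurable:
 assumes T: "T > 0" and \<sigma>: "continuous_adapted T T \<sigma>" and t: "0 <= t" "t <= T"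
  and Z: "Z \<in> measurable N (paths T)"
  and u: "!!i. i < m ==> u i \<in> borel_measurable N"
 shows "(%x. euler T n (euler_coeff T n \<sigma> t (Z x)) (%i. u i x) m j) \<in> borel_measurable N"
 using u
proof (induction m arbitrary: j)
 case (Suc m)
 let ?c = "%x. euler_coeff T n \<sigma> t (Z x)"
 let ?E = "%x. euler T n (?c x) (%i. u i x) m"
 have IH: "(%x. ?E x j) \<in> borel_measurable N" for j using Suc by simp
 have c: "(%x. ?c x m (interp T n (?E x))) \<in> borel_measurable N"
  by (intro euler_coeff_measurable[OF T \<sigma> t Z] interp_measurable[OF T _ IH]) simp
 have um: "u m \<in> borel_measurable N" using Suc.prems by simp
 have "(%x. ?E x m + ?c x m (interp T n (?E x)) *v u m x) \<in> borel_measurable N"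
  by (intro borel_measurable_add IH borel_measurable_matrix_vector_mult c um)
 then show ?case using IH by (cases "j <= m") (simp_all del: euler.simps(1))
qed simp

lemma grid_floor:
 assumes "T > 0" "0 <= v"
 obtains j where "!!i. grid T n i <= v \<longleftrightarrow> i <= j"
proof (rule that)
 fix i
 have "grid T n i <= v \<longleftrightarrow> real i <= v * 2^n / T" using assms(1) by (simp add: grid_def field_simps)
 also have "... \<longleftrightarrow> i <= nat \<lfloor>v * 2^n / T\<rfloor>" using assms by (simp add: le_nat_iff le_floor_iff)
 finally show "grid T n i <= v \<longleftrightarrow> i <= nat \<lfloor>v * 2^n / T\<rfloor>" .
qed

text \<open>The two concatenations agree before \<open>t\<close>; between \<open>t\<close> and
  \<open>t'\<close>, and after \<open>t'\<close>, they differ by at most one oscillation of each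
  path.\<close>

lemma concat_path_shift_bound:
 fixes w z :: "('d::finite) path"
 assumes z: "z \<in> Omega T" and t: "0 <= t" "t <= t'" and r: "0 <= r" "r <= T" "t' <= T"
  and osc: "!!s s'. s \<in> {0..T} ==> s' \<in> {0..T} ==> \<bar>s - s'\<bar> <= t' - t ==> norm (w s - w s') <= a"
  and osc': "!!s s'. s \<in> {0..T} ==> s' \<in> {0..T} ==> \<bar>s - s'\<bar> <= t' - t ==> norm (z s - z s') <= b"
 shows "norm (concat_path T t' w z r - concat_path T t w z r) <= a + b"
proof -
 have ab: "0 <= a" "0 <= b" using osc[of 0 0] osc'[of 0 0] r t by auto
 consider "r <= t" | "t < r" "r <= t'" | "t' < r" using t by linarith
 then show ?thesis
 proof cases
  case 1
  then show ?thesis using ab t r by (simp add: concat_path_def)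
 next
  case 2
  have "norm (w r - w t) <= a" using 2 t r by (intro osc) auto
  moreover have "norm (z 0 - z (r - t)) <= b" using 2 t r by (intro osc') auto
  ultimately show ?thesis
   using 2 r t OmegaD(2)[OF z] norm_triangle_ineq[of "w r - w t" "- z (r - t)"]
   by (simp add: concat_path_def algebra_simps)
 next
  case 3
  have "norm (w t' - w t) <= a" using t r by (intro osc) auto
  moreover have "norm (z (r - t') - z (r - t)) <= b" using 3 t r by (intro osc') auto
  ultimately show ?thesis
   using 3 r t norm_triangle_ineq[of "w t' - w t" "z (r - t') - z (r - t)"]
   by (simp add: concat_path_def algebra_simps)
 qed
qed

section \<open>Stability and convergence of the Euler scheme\<close>

context brownian
begin

text \<open>The asymptotic form of \<open>transform_stability\<close>: integrands may exceed
  \<open>C\<close> times the running maximum by arbitrarily little, outside events of vanishing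
  outer probability.\<close>

lemma vanishing_transform:
 assumes r: "!!n. time_grid (r n) (N n)" and J: "!!n l. l < N n ==> J n l \<in> borel_measurable (G (r n l))"
  and C: "C \<ge> 0" and eta: "b > 0"
  and van: "!!c. c > 0 ==> vanishing M (%n. {x \<in> space M. \<exists>l<N n.
    C * runmax (%k. norm (transform (r n) (J n) k x)) l + c < norm (J n l x)})"
 shows "vanishing M (%n. {x \<in> space M. \<exists>k\<le>N n. b < norm (transform (r n) (J n) k x)})"
proof (rule vanishingI)
 fix d :: real assume rho: "d > 0"
 define K where "K = 8 * real CARD('d) * T * exp (8 * real CARD('d) * C^2 * T)"
 have K: "K \<ge> 0" using T_pos by (simp add: K_def)
 define c where "c = b * sqrt (d / (4 * (K + 1)))"
 have eps: "c > 0" using eta rho K by (simp add: c_def)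
 have Ke: "K * (c / b)^2 <= d / 4"
 proof -
  have "(c / b)^2 = d / (4 * (K + 1))" using eta rho K by (simp add: c_def power_mult_distrib)
  moreover have "K * (d / (4 * (K + 1))) <= d / 4" using K rho by (simp add: field_simps)
  ultimately show ?thesis by (simp only:)
 qed
 \<comment> \<open>The excess itself serves as error process. It is adapted, while the sets covering
   the exceptional events need not be.\<close>
 define e where "e n l x = norm (J n l x) - C * runmax (%k. norm (transform (r n) (J n) k x)) l" for n l x
 have eG: "e n l \<in> borel_measurable (G (r n l))" if l: "l < N n" for n l
 proof -
  have tr: "transform (r n) (J n) k \<in> borel_measurable (G (r n l))" if "k <= l" for k
   using measurable_G_mono[OF transform_G[OF r J] time_gridD(2)[OF r that]] that l by simp
  have "(%x. runmax (%k. norm (transform (r n) (J n) k x)) l) \<in> borel_measurable (G (r n l))"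
   by (rule runmax_measurable) (use tr in simp)
  then show ?thesis unfolding e_def[abs_def] using J[OF l] by simp
 qed
 have r2: "d / 2 > 0" using rho by simp
 obtain N0 where N0: "!!n. n \<ge> N0 ==> \<exists>A\<in>sets M. {x \<in> space M. \<exists>l<N n.
    C * runmax (%k. norm (transform (r n) (J n) k x)) l + c < norm (J n l x)} \<subseteq> A \<and> emeasure M A < ennreal (d/2)"
  by (rule vanishingD[OF van[OF eps] r2]) blast
 show "\<exists>N0. \<forall>n\<ge>N0. small M d {x \<in> space M. \<exists>k\<le>N n. b < norm (transform (r n) (J n) k x)}"
 proof (intro exI[of _ N0] allI impI)
  fix n assume "n \<ge> N0"
  then obtain A where A: "A \<in> sets M" "{x \<in> space M. \<exists>l<N n.
    C * runmax (%k. norm (transform (r n) (J n) k x)) l + c < norm (J n l x)} \<subseteq> A" "emeasure M A < ennreal (d/2)"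
   using N0 by blast
  let ?B = "{x \<in> space M. \<exists>k\<le>N n. b < norm (transform (r n) (J n) k x)}"
  have "{x \<in> space M. \<exists>k\<in>{..N n}. b < norm (transform (r n) (J n) k x)} \<in> sets M"
  proof (rule sets.sets_Collect_finite_Ex)
   fix l assume "l \<in> {..N n}"
   then have [measurable]: "transform (r n) (J n) l \<in> borel_measurable M"
    using measurable_G_M[OF transform_G[OF r J]] by simp
   show "{x \<in> space M. b < norm (transform (r n) (J n) l x)} \<in> sets M" by measurable
  qed simp
  then have B: "?B \<in> sets M" by (simp only: Bex_def atMost_iff)
  have "prob ?B <= prob {x \<in> space M. \<exists>l<N n. c < e n l x} + K * (c / b)^2"
   unfolding K_def by (rule transform_stability[OF r J eG _ C eps eta]) (simp_all add: e_def)
  also have "prob {x \<in> space M. \<exists>l<N n. c < e n l x} <= prob A"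
  proof (rule finite_measure_mono[OF _ A(1)])
   show "{x \<in> space M. \<exists>l<N n. c < e n l x} \<subseteq> A"
    using A(2) unfolding e_def by (auto simp: less_diff_eq add.commute)
  qed
  also have "prob A < d/2" using A(3) rho by (simp add: emeasure_eq_measure ennreal_less_iff)
  finally have "prob ?B < d" using Ke rho by simp
  then have "emeasure M ?B < ennreal d" using rho by (simp add: emeasure_eq_measure ennreal_less_iff)
  then show "small M d (?B)"
   using B by blast
 qed
qed

lemma strong_solutionD:
 assumes "strong_solution M W T S b X"
 shows "X \<in> measurable M (paths T)"
  "!!s. 0 <= s ==> s <= S ==> (%x. X x s) \<in> borel_measurable (G s)"
  "stoch_integral (*v) M G S W (%r x. b r (X x)) (%s x. X x s)"
  "!!x s. x \<in> space M ==> S <= s ==> s <= T ==> X x s = X x S"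
  "!!x. x \<in> space M ==> X x \<in> Omega T"
proof -
 note * = assms[unfolded strong_solution_def]
 show 1: "X \<in> measurable M (paths T)"
  "stoch_integral (*v) M G S W (%r x. b r (X x)) (%s x. X x s)"
  using * by blast+
 show "(%x. X x s) \<in> borel_measurable (G s)" if "0 <= s" "s <= S" for s
  using * that by simp
 have "\<forall>x\<in>space M. \<forall>s\<in>{S..T}. X x s = X x S" using * by blast
 then show "X x s = X x S" if "x \<in> space M" "S <= s" "s <= T" for x s
  using that by (meson atLeastAtMost_iff)
 show "X x \<in> Omega T" if "x \<in> space M" for x
  using measurable_space[OF 1(1) that] by simp
qed

lemma solution_adapted:
 assumes X: "strong_solution M W T S b X" and s: "s <= S"
 shows "X \<in> measurable (G s) (canonical_filtration T s)"
proof (rule measurable_into_path_space)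
 show "X x \<in> Omega T" if "x \<in> space (G s)" for x using strong_solutionD(5)[OF X] that by simp
 show "(%x. X x r) \<in> borel_measurable (G s)" if "0 <= r" "r <= s" "r <= T" for r
  by (rule measurable_G_mono[OF strong_solutionD(2)[OF X]]) (use that s in auto)
qed

lemma solution_coefficient:
 assumes X: "strong_solution M W T S b X" and S: "S <= T" and b: "continuous_adapted T S b"
 shows "!!s. 0 <= s ==> s <= S ==> (%x. b s (X x)) \<in> borel_measurable (G s)"
  "!!x. x \<in> space M ==> continuous_on {0..S} (%s. b s (X x))"
proof -
 show "(%x. b s (X x)) \<in> borel_measurable (G s)" if "0 <= s" "s <= S" for s
  by (rule measurable_compose[OF solution_adapted[OF X that(2)] continuous_adapted_measurable[OF b that S]])
 show "continuous_on {0..S} (%s. b s (X x))" if "x \<in> space M" for x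
  by (rule continuous_adaptedD(2)[OF b strong_solutionD(5)[OF X that]])
qed

lemma solution_oscillation:
 assumes X: "strong_solution M W T S b X" and c: "c > 0" "e > 0"
 shows "vanishing M (%n. {x \<in> space M. \<exists>r\<in>{0..T}. \<exists>r'\<in>{0..T}. \<bar>r - r'\<bar> <= c / 2^n \<and> e < norm (X x r - X x r')})"
proof (rule vanishing_oscillation[OF _ _ c])
 show "(%x. X x s) \<in> borel_measurable M" if "0 <= s" "s <= T" for s
  using measurable_compose[OF strong_solutionD(1)[OF X] coordinate_measurable[of s T T]] that by simp
 show "continuous_on {0..T} (X x)" if "x \<in> space M" for x
  using strong_solutionD(5)[OF X that] by (rule OmegaD)
qed

definition increments :: "nat => nat => nat => 'a => real ^ 'd" where
 "increments n j i x = (if j + i < 2^n then W (grid T n (Suc (j + i))) x - W (grid T n (j + i)) x else 0)"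

lemma increments_measurable: "increments n j i \<in> borel_measurable M"
proof (cases "j + i < 2^n")
 case True
 then have "(%x. W (grid T n (Suc (j + i))) x - W (grid T n (j + i)) x) \<in> borel_measurable M"
  using T_pos by (intro increment_measurable grid_nonneg grid_mono grid_le) auto
 then show ?thesis using True by (simp add: increments_def[abs_def])
qed (simp add: increments_def[abs_def])

lemma increments_G: 
 assumes "j + i < l"
 shows "increments n j i \<in> borel_measurable (G (grid T n l))"
proof (cases "j + i < 2^n")
 case True
 have "W (grid T n (Suc (j + i))) \<in> borel_measurable (G (grid T n l))" "W (grid T n (j + i)) \<in> borel_measurable (G (grid T n l))"
  using T_pos True assms by (auto intro!: W_G grid_nonneg grid_mono grid_le)
 then show ?thesis using True by (simp add: increments_def[abs_def])
qed (simp add: increments_def[abs_def])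

end

lemma vanishing_cover:
 assumes "vanishing M E" "!!n x. n \<ge> N0 ==> x \<in> space M ==> x \<notin> E n ==> \<not> P n x"
 shows "vanishing M (%n. {x \<in> space M. P n x})"
 by (rule vanishing_mono[OF assms(1), of N0]) (use assms(2) in blast)

text \<open>Rounding up, so that the rounded value of a stopping time is again a stopping time. As a
  left adjoint of \<open>grid T n\<close> it is used almost only through
  \<open>grid_index_le_iff\<close>.\<close>

definition grid_index :: "real => nat => real => nat" where
 "grid_index T n v = nat \<lceil>v * 2^n / T\<rceil>"

lemma grid_index_le_iff: "T > 0 ==> grid_index T n v <= l \<longleftrightarrow> v <= grid T n l"
 by (simp add: grid_index_def grid_def nat_le_iff ceiling_le_iff field_simps)

lemma grid_index_bounds:
 assumes "T > 0" "0 <= v"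
 shows "v <= grid T n (grid_index T n v)" "grid T n (grid_index T n v) <= v + T / 2^n"
proof -
 show "v <= grid T n (grid_index T n v)" using grid_index_le_iff[OF assms(1)] by blast
 show "grid T n (grid_index T n v) <= v + T / 2^n"
 proof (cases "grid_index T n v")
  case 0
  then show ?thesis using assms by simp
 next
  case (Suc m)
  then have "\<not> v <= grid T n m" using grid_index_le_iff[OF assms(1), of n v m] by simp
  then show ?thesis by (simp add: Suc grid_Suc)
 qed
qed

context brownian
begin

text \<open>The Euler scheme started at the grid index \<open>j\<close>, with coefficients that vanish from the grid index \<open>N\<close> on,
 is compared with a process \<open>Y\<close> whose increments over the grid are close to the Riemann sums of \<open>H\<close>. By the
 hypothesis \<open>coef\<close> the difference is a transform dominated by its own running maximum.\<close>

lemma euler_stability: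
 fixes c :: "nat => 'a => nat => 'd path => real ^ 'd ^ 'd"
 assumes N: "!!n. N n <= 2^n" and C: "C \<ge> 0" and eta: "b > 0"
  and E: "!!n x. E n x = euler T n (c n x) (%i. increments n (j n x) i x)"
  and J: "!!n l x. J n l x = (if j n x <= l then c n x (l - j n x) (interp T n (E n x (l - j n x))) - H n l x else 0)"
  and adapted: "!!n l. l < N n ==> J n l \<in> borel_measurable (G (grid T n l))"
  and Y0: "!!n x. x \<in> space M ==> Y n x 0 = 0"
  and stop: "!!n x i z. N n <= j n x + i ==> c n x i z = 0"
  and sums: "!!e. e > 0 ==> vanishing M (%n. {x \<in> space M. \<exists>k\<le>N n. j n x <= k \<and>
    e < norm (transform (grid T n) (%l x. if j n x <= l then H n l x else 0) k x - Y n x (grid T n (k - j n x)))})"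
  and coef: "!!e. e > 0 ==> vanishing M (%n. {x \<in> space M. \<exists>l<N n. \<exists>I\<in>Omega T. \<exists>a\<ge>0. j n x <= l \<and>
    (\<forall>s\<in>{0..grid T n (l - j n x)}. norm (I s - Y n x s) <= a) \<and> C * a + e < norm (c n x (l - j n x) I - H n l x)})"
  and osc: "!!e. e > 0 ==> vanishing M (%n. {x \<in> space M. \<exists>r\<in>{0..T}. \<exists>r'\<in>{0..T}. \<bar>r - r'\<bar> <= T / 2^n \<and> e < norm (Y n x r - Y n x r')})"
  and late: "!!e. e > 0 ==> vanishing M (%n. {x \<in> space M. \<exists>k\<le>2^n. N n < j n x + k \<and>
    e < norm (Y n x (grid T n k) - Y n x (grid T n (N n - j n x)))})"
 shows "vanishing M (%n. {x \<in> space M. \<exists>s\<in>{0..T}. b < norm (interp T n (E n x (2^n)) s - Y n x s)})"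
proof -
 define D where "D n = transform (grid T n) (J n)" for n
 define R where "R n = transform (grid T n) (%l x. if j n x <= l then H n l x else 0)" for n
 \<comment> \<open>The diagonal of the scheme is the error transform \<open>D\<close> plus the sum
   of \<open>H\<close> from index \<open>j\<close> on. The latter is close to \<open>Y\<close> by
   \<open>sums\<close>, so that only \<open>D\<close> has to be estimated.\<close>
 have diff: "j n x + m <= N n ==> E n x m m = D n (j n x + m) x + R n (j n x + m) x" for n x m
 proof (induction m)
  case 0
  have "D n (j n x) x = 0" "R n (j n x) x = 0"
   unfolding D_def R_def transform_def by (rule sum.neutral; simp add: J)+
  then show ?case by (simp add: E)
 next
  case (Suc m)
  then have "j n x + m < 2^n" using N[of n] by simp
  then show ?case
   using Suc unfolding D_def R_def by (simp add: E[of n x] J increments_def matrix_vector_mult_diff_rdistrib)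
 qed
 define Es where "Es e n = {x \<in> space M. \<exists>k\<le>N n. j n x <= k \<and> e < norm (R n k x - Y n x (grid T n (k - j n x)))}" for e n
 define Eo where "Eo e n = {x \<in> space M. \<exists>r\<in>{0..T}. \<exists>r'\<in>{0..T}. \<bar>r - r'\<bar> <= T / 2^n \<and> e < norm (Y n x r - Y n x r')}" for e n
 have vEs: "vanishing M (Es e)" and vEo: "vanishing M (Eo e)" if "e > 0" for e
  unfolding Es_def[abs_def] Eo_def[abs_def] R_def by (rule sums[OF that], rule osc[OF that])
 have close: "norm (E n x l i - Y n x (grid T n i)) <= norm (D n (j n x + i) x) + e"
  if "x \<in> space M" "x \<notin> Es e n" "i <= l" "j n x + i <= N n" for n x l i e
 proof -
  have "norm (R n (j n x + i) x - Y n x (grid T n i)) <= e" using that unfolding Es_def by (auto simp: not_less dest!: spec[of _ "j n x + i"])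
  moreover have eq: "E n x l i - Y n x (grid T n i) = D n (j n x + i) x + (R n (j n x + i) x - Y n x (grid T n i))"
   using diff[OF that(4)] by (simp add: E euler_past[OF that(3)])
  ultimately show ?thesis unfolding eq
   using norm_triangle_ineq[of "D n (j n x + i) x" "R n (j n x + i) x - Y n x (grid T n i)"] by linarith
 qed
 have near: "norm (interp T n (E n x l) s - Y n x s) <= a + e"
  if x: "x \<in> space M" "x \<notin> Eo e n" and s: "0 <= s" "s <= grid T n l" "l <= 2^n"
   and a: "!!i. i <= l ==> norm (E n x l i - Y n x (grid T n i)) <= a" for n x l s a e
 proof (rule interp_close_path[where f="Y n x", OF T_pos s a])
  fix r r' assume "0 <= r" "r <= grid T n l" "0 <= r'" "r' <= grid T n l" "\<bar>r - r'\<bar> <= T / 2^n"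
  moreover have "grid T n l <= T" using T_pos s by (intro grid_le) auto
  ultimately show "norm (Y n x r - Y n x r') <= e" using x by (auto simp: Eo_def not_less)
 qed
 have vD: "vanishing M (%n. {x \<in> space M. \<exists>k\<le>N n. b' < norm (D n k x)})" if "b' > 0" for b'
  unfolding D_def
 proof (rule vanishing_transform[OF _ adapted C that])
  show "time_grid (grid T n) (N n)" for n
   unfolding time_grid_def using T_pos grid_le[OF _ N[of n], of T] grid_mono[of T _ _ n] by simp
  fix e :: real assume e: "e > 0"
  \<comment> \<open>The interpolated scheme misses \<open>Y\<close> by the running maximum of
    \<open>D\<close> plus \<open>2 * d\<close>, one \<open>d\<close> from \<open>sums\<close> and
    one from oscillation. As \<open>2 * C * d <= e / 2\<close>, the other \<open>e / 2\<close> is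
    left for \<open>coef\<close>.\<close>
  define d where "d = e / (4 * (C + 1))"
  have d: "d > 0" "C * d <= e/4" using e C by (simp_all add: d_def field_simps)
  have e2: "e/2 > 0" using e by simp
  show "vanishing M (%n. {x \<in> space M. \<exists>l<N n. C * runmax (%k. norm (transform (grid T n) (J n) k x)) l + e < norm (J n l x)})"
  proof (rule vanishing_cover[OF vanishing_Un[OF vanishing_Un[OF vEs[OF d(1)] vEo[OF d(1)]] coef[OF e2]], of 0], rule notI, elim exE conjE)
   fix n x l assume x: "x \<in> space M" and l: "l < N n" "C * runmax (%k. norm (transform (grid T n) (J n) k x)) l + e < norm (J n l x)"
    and nx: "x \<notin> Es d n \<union> Eo d n \<union> {x \<in> space M. \<exists>l<N n. \<exists>I\<in>Omega T. \<exists>a\<ge>0. j n x <= l \<and>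
    (\<forall>s\<in>{0..grid T n (l - j n x)}. norm (I s - Y n x s) <= a) \<and> C * a + e/2 < norm (c n x (l - j n x) I - H n l x)}"
   define m where "m = runmax (%k. norm (D n k x)) l"
   have m_ge: "norm (D n k x) <= m" if "k <= l" for k unfolding m_def by (rule runmax_ge[OF that])
   have m0: "0 <= m" using m_ge[of 0] norm_ge_zero[of "D n 0 x"] by linarith
   have l2: "C * m + e < norm (J n l x)" using l(2) by (simp add: m_def D_def)
   have "0 <= C * m" using C m0 by simp
   then have jl: "j n x <= l" using l2 e by (rule_tac ccontr) (simp add: J)
   define i where "i = l - j n x"
   define I where "I = interp T n (E n x i)"
   have i: "j n x + i = l" "i <= 2^n" using jl l N[of n] by (auto simp: i_def)
   have IO: "I \<in> Omega T" unfolding I_def by (rule interp_in_Omega[OF T_pos]) (simp add: E)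
   have IY: "norm (I s - Y n x s) <= (m + d) + d" if "s \<in> {0..grid T n i}" for s
    unfolding I_def
   proof (rule near)
    fix k assume k: "k <= i"
    have "norm (E n x i k - Y n x (grid T n k)) <= norm (D n (j n x + k) x) + d" by (rule close) (use x nx k i l in auto)
    also have "norm (D n (j n x + k) x) <= m" by (rule m_ge) (use k i in simp)
    finally show "norm (E n x i k - Y n x (grid T n k)) <= m + d" by simp
   qed (use x nx that i in auto)
   have "norm (c n x i I - H n l x) <= C * ((m + d) + d) + e/2"
   proof (rule ccontr)
    assume "\<not> ?thesis"
    then have "x \<in> {x \<in> space M. \<exists>l<N n. \<exists>I\<in>Omega T. \<exists>a\<ge>0. j n x <= l \<and>
     (\<forall>s\<in>{0..grid T n (l - j n x)}. norm (I s - Y n x s) <= a) \<and> C * a + e/2 < norm (c n x (l - j n x) I - H n l x)}"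
     using x l(1) jl m0 d(1) IY unfolding i_def
     by (intro CollectI conjI exI[of _ l] bexI[OF _ IO] exI[of _ "(m + d) + d"]) auto
    then show False using nx by blast
   qed
   moreover have "J n l x = c n x i I - H n l x" using jl by (simp add: J i_def I_def)
   ultimately have "norm (J n l x) <= C * ((m + d) + d) + e/2" by simp
   then show False using l2 d(2) by (simp add: algebra_simps)
  qed
 qed
 have h: "b/8 > 0" using eta by simp
 show ?thesis
 proof (rule vanishing_cover[OF vanishing_Un[OF vanishing_Un[OF vEs[OF h] vEo[OF h]] vanishing_Un[OF vD[OF h] late[OF h]]], of 0])
  fix n x assume x: "x \<in> space M"
   and nx: "x \<notin> (Es (b/8) n \<union> Eo (b/8) n) \<union> ({x \<in> space M. \<exists>k\<le>N n. b/8 < norm (D n k x)} \<union> {x \<in> space M. \<exists>k\<le>2^n. N n < j n x + k \<and>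
    b/8 < norm (Y n x (grid T n k) - Y n x (grid T n (N n - j n x)))})"
  have cl: "norm (E n x (2^n) k - Y n x (grid T n k)) <= b/4" if "j n x + k <= N n" for k
  proof -
   have "norm (E n x (2^n) k - Y n x (grid T n k)) <= norm (D n (j n x + k) x) + b/8"
    by (rule close) (use x nx that N[of n] in auto)
   moreover have "norm (D n (j n x + k) x) <= b/8" using nx x that by (auto simp: not_less)
   ultimately show ?thesis by simp
  qed
  have all: "norm (E n x (2^n) k - Y n x (grid T n k)) <= 3 * b/8" if k: "k <= 2^n" for k
  proof (cases "j n x + k <= N n")
   case True
   then show ?thesis using cl eta by fastforce
  next
   case False
   \<comment> \<open>From index \<open>N n\<close> on the scheme stands still, and
     \<open>late\<close> says that \<open>Y\<close> hardly moves. If the start index already exceeds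
     \<open>N n\<close>, truncated subtraction gives \<open>m = 0\<close>, where scheme and
     \<open>Y\<close> both vanish.\<close>
   define m where "m = N n - j n x"
   have m: "m <= k" "m <= 2^n" using False N[of n] by (auto simp: m_def)
   have "E n x k k = E n x m m" unfolding E by (rule euler_const_after) (use stop m in "auto simp: m_def")
   then have eq: "E n x (2^n) k = E n x (2^n) m" by (simp add: E euler_past[OF k] euler_past[OF m(2)])
   have 1: "norm (Y n x (grid T n k) - Y n x (grid T n m)) <= b/8" using nx x k False by (auto simp: not_less m_def)
   have 2: "norm (E n x (2^n) m - Y n x (grid T n m)) <= b/4"
   proof (cases "j n x <= N n")
    case True
    then show ?thesis by (intro cl) (simp add: m_def)
   next
    case False
    then show ?thesis using eta Y0[OF x, of n] by (simp add: m_def E)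
   qed
   show ?thesis
    using 1 2 norm_triangle_ineq4[of "E n x (2^n) m - Y n x (grid T n m)" "Y n x (grid T n k) - Y n x (grid T n m)"] by (simp add: eq)
  qed
  have "norm (interp T n (E n x (2^n)) s - Y n x s) <= 3 * b/8 + b/8" if "s \<in> {0..T}" for s
   by (rule near) (use x nx that all in auto)
  then show "\<not> (\<exists>s\<in>{0..T}. b < norm (interp T n (E n x (2^n)) s - Y n x s))" using eta by force
 qed
qed

lemma euler_converges:
 fixes \<sigma> :: "real => 'd path => real ^ 'd ^ 'd"
 assumes \<sigma>: "admissible_coeff T \<sigma>" and t: "0 <= t"
  and tn: "!!n. t <= tn n" "!!n. tn n <= T" "!!n. tn n <= t + T / 2^n"
  and w: "w \<in> Omega T" "w' \<in> Omega T" "!!r. 0 <= r ==> r <= t ==> w r = w' r"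
  and X: "strong_solution M W T (T - t) (shift_process T t w' \<sigma>) X"
  and eta: "h > 0"
 shows "vanishing M (%n. {x \<in> space M. \<exists>s\<in>{0..T}.
  h < norm (euler_path T n \<sigma> (tn n) w (%i. increments n 0 i x) s - X x s)})"
proof -
 define S where "S = T - t"
 have tT: "t <= T" using tn(1,2)[of 0] by simp
 have S: "0 <= S" "S <= T" using t tT by (auto simp: S_def)
 have ca: "continuous_adapted T T \<sigma>" by (rule admissible_continuous_adapted[OF T_pos \<sigma>])
 obtain C where C: "C \<ge> 0"
  "!!t w w' a. 0 <= t ==> t <= T ==> w \<in> Omega T ==> w' \<in> Omega T ==>
   (!!s. 0 <= s ==> s <= t ==> norm (w s - w' s) <= a) ==> norm (\<sigma> t w - \<sigma> t w') <= C * a"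
  using admissible_coeffD[OF \<sigma>] by blast
 define b where "b = shift_process T t w' \<sigma>"
 have X: "strong_solution M W T S b X" using X by (simp add: S_def b_def)
 have cb: "continuous_adapted T S b" unfolding S_def b_def by (rule continuous_adapted_shift[OF ca t tT w(2)])
 have XO: "X x \<in> Omega T" if "x \<in> space M" for x using strong_solutionD(5)[OF X that] .
 have b_eq: "b s z = \<sigma> (t + s) (concat_path T t w z)" for s z
  unfolding b_def shift_process_def using concat_path_cong[of t w w' T z] w(3) t by simp
 define H where "H s x = b s (X x)" for s x
 have HG: "!!s. 0 <= s ==> s <= S ==> H s \<in> borel_measurable (G s)"
  and Hc: "!!x. x \<in> space M ==> continuous_on {0..S} (%s. H s x)"
  unfolding H_def[abs_def] using solution_coefficient[OF X S(2) cb] by simp_all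
 have int: "stoch_integral (*v) M G S W H (%s x. X x s)" using strong_solutionD(3)[OF X] by (simp add: H_def[abs_def])
 have "\<exists>j. \<forall>i. grid T n i <= T - tn n \<longleftrightarrow> i <= j" for n
  using grid_floor[OF T_pos, of "T - tn n" n] tn(2)[of n] by (metis diff_ge_0_iff_ge)
 then obtain N where N: "!!n i. grid T n i <= T - tn n \<longleftrightarrow> i <= N n" by metis
 have N2: "N n <= 2^n" for n
  using N[of n "N n"] tn(1)[of n] t grid_le_iff[OF T_pos, of n "N n" "2^n"] by simp
 have NS: "grid T n i <= S" if "i <= N n" for n i using that N[of n i] tn(1)[of n] by (simp add: S_def)
 have g0: "0 <= grid T n i" for n i using T_pos by (simp add: grid_nonneg)
 define Eb where "Eb c e n = {x \<in> space M. \<exists>r\<in>{0..T}. \<exists>r'\<in>{0..T}. \<bar>r - r'\<bar> <= c / 2^n \<and> e < norm (X x r - X x r')}" for c e n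
 define Ec where "Ec e n = {x \<in> space M. \<exists>r\<in>{0..S}. \<exists>r'\<in>{0..S}. \<bar>r - r'\<bar> <= T / 2^n \<and> e < norm (H r x - H r' x)}" for e n
 have vEb: "vanishing M (Eb c e)" if "c > 0" "e > 0" for c e
  unfolding Eb_def[abs_def] by (rule solution_oscillation[OF X that])
 have vEc: "vanishing M (Ec e)" if "e > 0" for e
  unfolding Ec_def[abs_def] using measurable_G_M[OF HG] Hc T_pos that by (intro vanishing_oscillation) auto
 define c where "c n = euler_coeff T n \<sigma> (tn n) w" for n
 define E where "E n x = euler T n (c n) (%i. increments n 0 i x)" for n x
 have "vanishing M (%n. {x \<in> space M. \<exists>s\<in>{0..T}. h < norm (interp T n (E n x (2^n)) s - X x s)})"
 proof (rule euler_stability[where N=N and c="%n x. c n" and j="%n x. 0" and H="%n l. H (grid T n l)" and Y="%n. X", OF N2 C(1) eta E_def refl])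
  show "(%x. if 0 <= l then c n (l - 0) (interp T n (E n x (l - 0))) - H (grid T n l) x else 0) \<in> borel_measurable (G (grid T n l))"
   if l: "l < N n" for n l
  proof -
   have "(%x. E n x l i) \<in> borel_measurable (G (grid T n l))" for i
    unfolding E_def c_def
    by (rule euler_measurable[OF T_pos ca, where Z="%_. w"]) (use t tn w in "auto intro!: increments_G intro: order_trans")
   then have "(%x. c n l (interp T n (E n x l))) \<in> borel_measurable (G (grid T n l))"
    unfolding c_def
    by (intro euler_coeff_measurable[OF T_pos ca, where Z="%_. w"] interp_measurable[OF T_pos])
     (use t tn w in "auto simp: E_def intro: order_trans")
   then show ?thesis using HG[OF g0 NS, of l n] l by simp
  qed
  show "X x 0 = 0" if "x \<in> space M" for x using OmegaD(2)[OF XO[OF that]] .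
  show "c n i z = 0" if "N n <= 0 + i" for n i z
   using N[of n "Suc i"] that by (simp add: c_def euler_coeff_def)
  fix e :: real assume e: "e > 0"
  show "vanishing M (%n. {x \<in> space M. \<exists>k\<le>N n. 0 <= k \<and>
    e < norm (transform (grid T n) (%l x. if 0 <= l then H (grid T n l) x else 0) k x - X x (grid T n (k - 0)))})"
  proof (rule vanishing_cover[OF riemann_converges[OF S HG Hc int e], of 0])
   fix n x assume x: "x \<in> space M" "x \<notin> {x \<in> space M. \<exists>k. grid T n k <= S \<and> e < norm (riemann S H n k x - X x (grid T n k))}"
   have "transform (grid T n) (%l x. if 0 <= l then H (grid T n l) x else 0) k x = riemann S H n k x" if "k <= N n" for k
    unfolding riemann_def transform_def by (rule sum.cong) (use that NS in auto)
   then show "\<not> (\<exists>k\<le>N n. 0 <= k \<and>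
    e < norm (transform (grid T n) (%l x. if 0 <= l then H (grid T n l) x else 0) k x - X x (grid T n (k - 0))))" using x NS by (auto simp del: le0)
  qed
  show "vanishing M (%n. {x \<in> space M. \<exists>r\<in>{0..T}. \<exists>r'\<in>{0..T}. \<bar>r - r'\<bar> <= T / 2^n \<and> e < norm (X x r - X x r')})"
   by (rule solution_oscillation[OF X T_pos e])
  show "vanishing M (%n. {x \<in> space M. \<exists>k\<le>2^n. N n < 0 + k \<and> e < norm (X x (grid T n k) - X x (grid T n (N n - 0)))})"
  \<comment> \<open>Two meshes: \<open>N n\<close> is determined by \<open>tn n\<close>, which lies
    up to one mesh after \<open>t\<close>, and rounding to the grid loses another.\<close>
  proof (rule vanishing_cover[OF vEb[of "2 * T", OF _ e], of 0])
   fix n x assume x: "x \<in> space M" "x \<notin> Eb (2 * T) e n"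
   have "norm (X x (grid T n k) - X x (grid T n (N n))) <= e" if k: "k <= 2^n" "N n < k" for k
   proof -
    define v where "v = min (grid T n k) S"
    have gk: "grid T n k <= T" using k T_pos by (intro grid_le) auto
    have Xv: "X x (grid T n k) = X x v" using strong_solutionD(4)[OF X x(1), of "grid T n k"] gk by (simp add: v_def min_def)
    have "grid T n (N n) <= v" unfolding v_def using k T_pos NS[of "N n" n] by (auto intro: grid_mono)
    moreover have "v <= grid T n (N n) + 2 * T / 2^n"
     using N[of n "Suc (N n)"] tn(3)[of n] by (simp add: v_def S_def grid_Suc min_def)
    ultimately have "\<bar>v - grid T n (N n)\<bar> <= 2 * T / 2^n" "v \<in> {0..T}" "grid T n (N n) \<in> {0..T}"
     using S g0 NS[of "N n" n] by (auto simp: v_def)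
    then show ?thesis using x unfolding Xv Eb_def by (auto simp: not_less)
   qed
   then show "\<not> (\<exists>k\<le>2^n. N n < 0 + k \<and> e < norm (X x (grid T n k) - X x (grid T n (N n - 0))))" by fastforce
  qed (use T_pos in simp)
  define d where "d = e / (4 * (C + 1))"
  have d: "d > 0" "C * d <= e/4" using e C(1) by (simp_all add: d_def field_simps)
  obtain \<delta> where \<delta>: "\<delta> > 0" "!!r r'. r \<in> {0..T} ==> r' \<in> {0..T} ==> \<bar>r - r'\<bar> <= \<delta> ==> norm (w r - w r') < d"
   using modulus_of_continuity[OF OmegaD(1)[OF w(1)] d(1)] by blast
  have "\<forall>\<^sub>F n in sequentially. T / 2^n < \<delta>" by (rule order_tendstoD(2)[OF mesh_tendsto_0 \<delta>(1)])
  then obtain N0 where N0: "!!n. n \<ge> N0 ==> T / 2^n < \<delta>" unfolding eventually_sequentially by blast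
  have e2: "e/2 > 0" using e by simp
  show "vanishing M (%n. {x \<in> space M. \<exists>l<N n. \<exists>I\<in>Omega T. \<exists>a\<ge>0. 0 <= l \<and>
    (\<forall>s\<in>{0..grid T n (l - 0)}. norm (I s - X x s) <= a) \<and> C * a + e < norm (c n (l - 0) I - H (grid T n l) x)})"
  proof (rule vanishing_cover[OF vanishing_Un[OF vEb[OF T_pos d(1)] vEc[OF e2]], of N0], intro notI, elim exE bexE conjE)
   fix n x l I a assume n: "n \<ge> N0" and x: "x \<in> space M" "x \<notin> Eb T d n \<union> Ec (e/2) n" and l: "l < N n" and IO: "I \<in> Omega T"
    and a: "a \<ge> 0" "\<forall>s\<in>{0..grid T n (l - 0)}. norm (I s - X x s) <= a" and gt: "C * a + e < norm (c n (l - 0) I - H (grid T n l) x)"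
   define p where "p = grid T n l"
   have p: "0 <= p" "p <= T" "tn n + p <= T" "tn n + grid T n (Suc l) <= T"
    using g0[of n l] N[of n l] N[of n "Suc l"] l tn(1)[of n] t by (auto simp: p_def)
   have tnp: "0 <= tn n + p" and tn0: "0 <= tn n" using t tn(1)[of n] p by auto
   have oscX: "norm (X x r - X x r') <= d" if "r \<in> {0..T}" "r' \<in> {0..T}" "\<bar>r - r'\<bar> <= T / 2^n" for r r'
    using x that by (auto simp: Eb_def not_less)
   have oscw: "norm (w r - w r') <= d" if "r \<in> {0..T}" "r' \<in> {0..T}" "\<bar>r - r'\<bar> <= T / 2^n" for r r'
    using \<delta>(2)[of r r'] that N0[OF n] by simp
   \<comment> \<open>Three comparisons follow: replacing the path \<open>I\<close> by the solution,
     moving the starting time from \<open>tn n\<close> back to \<open>t\<close>, and regularity in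
     time of the coefficient along the solution.\<close>
   define \<Sigma> where "\<Sigma> z = \<sigma> (tn n + p) z" for z
   have 0: "c n l I = \<Sigma> (concat_path T (tn n) w I)"
    using p(4) by (simp add: c_def euler_coeff_def shift_process_def p_def \<Sigma>_def)
   have 1: "norm (\<Sigma> (concat_path T (tn n) w I) - \<Sigma> (concat_path T (tn n) w (X x))) <= C * a"
    unfolding \<Sigma>_def
    by (rule C(2)[OF tnp p(3) concat_path_in_Omega concat_path_in_Omega])
     (use tn0 tn(2) w IO XO[OF x(1)] a p in "auto simp: concat_path_def p_def")
   have 2: "norm (\<Sigma> (concat_path T (tn n) w (X x)) - \<Sigma> (concat_path T t w (X x))) <= C * (d + d)"
    unfolding \<Sigma>_def
   proof (rule C(2)[OF tnp p(3) concat_path_in_Omega concat_path_in_Omega])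
    fix s assume s: "0 <= s" "s <= tn n + p"
    show "norm (concat_path T (tn n) w (X x) s - concat_path T t w (X x) s) <= d + d"
     by (rule concat_path_shift_bound[OF XO[OF x(1)] t tn(1)])
      (use s p tn(2) tn(3)[of n] in "auto intro!: oscw oscX intro: order_trans")
   qed (use tn0 tn(2) w t tT XO[OF x(1)] in auto)
   have "tn n - t + p \<in> {0..S}" "p \<in> {0..S}" "\<bar>tn n - t + p - p\<bar> <= T / 2^n"
    using p tn(1)[of n] tn(3)[of n] by (auto simp: S_def)
   then have "norm (H (tn n - t + p) x - H p x) <= e/2" using x unfolding Ec_def by (auto simp: not_less)
   moreover have "\<Sigma> (concat_path T t w (X x)) = H (tn n - t + p) x" by (simp add: H_def b_eq algebra_simps \<Sigma>_def)
   ultimately have 3: "norm (\<Sigma> (concat_path T t w (X x)) - H p x) <= e/2" by simp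
   have "norm (c n l I - H p x) <= norm (\<Sigma> (concat_path T (tn n) w I) - \<Sigma> (concat_path T (tn n) w (X x)))
    + norm (\<Sigma> (concat_path T (tn n) w (X x)) - \<Sigma> (concat_path T t w (X x))) + norm (\<Sigma> (concat_path T t w (X x)) - H p x)"
    unfolding 0 by norm
   also have "... <= C * a + C * (d + d) + e/2" by (intro add_mono 1 2 3)
   finally show False using gt d(2) by (simp add: p_def algebra_simps)
  qed
 qed
 then show ?thesis by (simp add: E_def c_def euler_path_def)
qed

text \<open>The restarted scheme is compared with the original solution on the same probability
  space: by the flow property, the original coefficient is the restarted coefficient evaluated at
  the tail. The stability argument thus covers a random starting index.\<close>

lemma euler_restart_converges:
 fixes \<sigma> :: "real => 'd path => real ^ 'd ^ 'd"
 assumes \<sigma>: "admissible_coeff T \<sigma>" and t: "0 <= t" "t <= T" and w: "w \<in> Omega T"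
  and X: "strong_solution M W T (T - t) (shift_process T t w \<sigma>) X"
  and U: "U \<in> stopping_times T" "!!z. z \<in> Omega T ==> U z <= T - t"
  and eta: "h > 0"
 defines "j \<equiv> %n x. grid_index T n (U (X x))"
 defines "Hn \<equiv> %n x. min (grid T n (j n x)) (T - t)"
 shows "vanishing M (%n. {x \<in> space M. \<exists>s\<in>{0..T}.
  h < norm (euler_path T n \<sigma> (t + Hn n x) (concat_path T t w (X x)) (%i. increments n (j n x) i x) s
   - tail T (Hn n x) (X x) s)})"
proof -
 define S where "S = T - t"
 have S: "0 <= S" "S <= T" using t by (auto simp: S_def)
 have ca: "continuous_adapted T T \<sigma>" by (rule admissible_continuous_adapted[OF T_pos \<sigma>])
 obtain C where C: "C \<ge> 0"
  "!!t w w' a. 0 <= t ==> t <= T ==> w \<in> Omega T ==> w' \<in> Omega T ==>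
   (!!s. 0 <= s ==> s <= t ==> norm (w s - w' s) <= a) ==> norm (\<sigma> t w - \<sigma> t w') <= C * a"
  using admissible_coeffD[OF \<sigma>] by blast
 define b where "b = shift_process T t w \<sigma>"
 have X: "strong_solution M W T S b X" using X by (simp add: S_def b_def)
 have cb: "continuous_adapted T S b" unfolding S_def b_def by (rule continuous_adapted_shift[OF ca t w])
 have XO: "X x \<in> Omega T" if "x \<in> space M" for x using strong_solutionD(5)[OF X that] .
 define Y where "Y x = concat_path T t w (X x)" for x
 have YO: "Y x \<in> Omega T" if "x \<in> space M" for x
  unfolding Y_def using XO[OF that] w t by (intro concat_path_in_Omega)
 define H where "H s x = b s (X x)" for s x
 have HG: "!!s. 0 <= s ==> s <= S ==> H s \<in> borel_measurable (G s)"
  and Hc: "!!x. x \<in> space M ==> continuous_on {0..S} (%s. H s x)"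
  unfolding H_def[abs_def] using solution_coefficient[OF X S(2) cb] by simp_all
 have int: "stoch_integral (*v) M G S W H (%s x. X x s)" using strong_solutionD(3)[OF X] by (simp add: H_def[abs_def])
 have "\<exists>j. \<forall>i. grid T n i <= S \<longleftrightarrow> i <= j" for n
  using grid_floor[OF T_pos S(1), of n] by metis
 then obtain N where N: "!!n i. grid T n i <= S \<longleftrightarrow> i <= N n" by metis
 have N2: "N n <= 2^n" for n
  using N[of n "N n"] S grid_le_iff[OF T_pos, of n "N n" "2^n"] by simp
 have g0: "0 <= grid T n i" for n i using T_pos by (simp add: grid_nonneg)
 have Hn: "0 <= Hn n x" "Hn n x <= S" "t + Hn n x <= T" "Hn n x <= T" for n x
  using g0 S t by (auto simp: Hn_def S_def)
 have Ug: "Hn n x = (if j n x <= N n then grid T n (j n x) else S)" for n x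
  using N[of n "j n x"] by (auto simp: Hn_def S_def)
 define c where "c n x = euler_coeff T n \<sigma> (t + Hn n x) (Y x)" for n x
 define E where "E n x = euler T n (c n x) (%i. increments n (j n x) i x)" for n x
 define V where "V n x = tail T (Hn n x) (X x)" for n x
 have V_eq: "V n x r = X x (min (Hn n x + r) T) - X x (Hn n x)" if "r \<in> {0..T}" for n x r
  using that by (simp add: V_def tail_def)
 define Eb where "Eb e n = {x \<in> space M. \<exists>r\<in>{0..T}. \<exists>r'\<in>{0..T}. \<bar>r - r'\<bar> <= T / 2^n \<and> e < norm (X x r - X x r')}" for e n
 have vEb: "vanishing M (Eb e)" if "e > 0" for e
  unfolding Eb_def[abs_def] by (rule solution_oscillation[OF X T_pos that])
 have osc: "norm (X x r - X x r') <= e"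
  if "x \<in> space M" "x \<notin> Eb e n" "r \<in> {0..T}" "r' \<in> {0..T}" "\<bar>r - r'\<bar> <= T / 2^n" for x n r r' e
  using that by (auto simp: Eb_def not_less)
 have "vanishing M (%n. {x \<in> space M. \<exists>s\<in>{0..T}. h < norm (interp T n (E n x (2^n)) s - V n x s)})"
 proof (rule euler_stability[where N=N and c=c and j=j and H="%n l. H (grid T n l)" and Y=V, OF N2 C(1) eta E_def refl])
  show "(%x. if j n x <= l then c n x (l - j n x) (interp T n (E n x (l - j n x))) - H (grid T n l) x else 0) \<in> borel_measurable (G (grid T n l))"
   (is "?J \<in> _") if l: "l < N n" for n l
  proof -
   have gl: "grid T n l <= S" using l N[of n l] by simp
   define e where "e i x = euler T n (euler_coeff T n \<sigma> (t + grid T n i) (Y x)) (%m. increments n i m x)" for i x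
   define K where "K i x = euler_coeff T n \<sigma> (t + grid T n i) (Y x) (l - i) (interp T n (e i x (l - i)))" for i x
   \<comment> \<open>Case distinction on the value \<open>i\<close> of the random index. For each
     \<open>i\<close> the starting time is deterministic, and the event \<open>j n x = i\<close>
     with \<open>i <= l\<close> is known at time \<open>grid T n l\<close>.\<close>
   have J_eq: "?J x = (\<Sum>i\<le>l. if j n x = i then K i x - H (grid T n l) x else 0)" for x
    using l by (subst sum.delta') (auto simp: K_def e_def E_def c_def Ug)
   have "(%x. if j n x = i then K i x - H (grid T n l) x else 0) \<in> borel_measurable (G (grid T n l))" if i: "i <= l" for i
   proof -
    have gi: "grid T n i <= grid T n l" "grid T n i <= S" using i gl T_pos grid_mono[of T i l n] by auto
    have le: "{x \<in> space M. j n x <= m} \<in> sets (G (grid T n l))" if "m <= l" for m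
    proof -
     have gm: "grid T n m <= grid T n l" using that T_pos by (intro grid_mono) auto
     have "X -` {z \<in> Omega T. U z <= grid T n m} \<inter> space (G (grid T n m)) \<in> sets (G (grid T n m))"
      by (rule measurable_sets[OF solution_adapted[OF X] stopping_timesD(4)[OF U(1)]]) (use gm gl in simp)
     also have "X -` {z \<in> Omega T. U z <= grid T n m} \<inter> space (G (grid T n m)) = {x \<in> space M. j n x <= m}"
      using XO by (auto simp: j_def grid_index_le_iff[OF T_pos])
     finally show ?thesis using G_mono[OF gm] by blast
    qed
    have ev: "{x \<in> space M. j n x = i} \<in> sets (G (grid T n l))"
    proof (cases i)
     case 0
     then show ?thesis using le[of 0] by simp
    next
     case (Suc i')
     have "{x \<in> space M. j n x = i} = {x \<in> space M. j n x <= i} - {x \<in> space M. j n x <= i'}" by (auto simp: Suc)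
     then show ?thesis using le[of i] le[of i'] i Suc by auto
    qed
    \<comment> \<open>Only the path up to \<open>grid T n i\<close> enters the restarted
      coefficients; freezing it there makes their measurability visible.\<close>
    define Z where "Z x = concat_path T t w (freeze T (grid T n i) (X x))" for x
    have cong: "euler_coeff T n \<sigma> (t + grid T n i) (Y x) = euler_coeff T n \<sigma> (t + grid T n i) (Z x)" for x
     unfolding Y_def Z_def
     by (rule euler_coeff_cong) (use t gi g0 S in "auto simp: concat_path_def freeze_def restrict_def")
    have ti: "0 <= t + grid T n i" "t + grid T n i <= T" using t gi g0 by (auto simp: S_def)
    have "(%x. freeze T (grid T n i) (X x)) \<in> measurable (G (grid T n l)) (paths T)"
     by (rule measurable_G_mono[OF measurable_compose[OF solution_adapted[OF X gi(2)] freeze_adapted[OF g0]] gi(1)])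
    then have Zm: "Z \<in> measurable (G (grid T n l)) (paths T)"
     unfolding Z_def[abs_def] using t w by (intro concat_path_measurable) auto
    have em: "(%x. e i x (l - i) m) \<in> borel_measurable (G (grid T n l))" for m
     unfolding e_def cong by (rule euler_measurable[OF T_pos ca ti Zm]) (use i in "auto intro!: increments_G")
    have "K i \<in> borel_measurable (G (grid T n l))"
     unfolding K_def[abs_def] cong
     by (intro euler_coeff_measurable[OF T_pos ca ti Zm] interp_measurable[OF T_pos _ em]) (simp add: e_def)
    then show ?thesis using ev HG[OF g0 gl] by (intro measurable_If) auto
   qed
   then show ?thesis unfolding J_eq by (intro borel_measurable_sum) simp
  qed
  show "V n x 0 = 0" if "x \<in> space M" for n x using V_eq[of 0 n x] T_pos Hn(4)[of n x] by simp
  show "c n x i z = 0" if "N n <= j n x + i" for n x i z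
  proof -
   have "S < Hn n x + grid T n (Suc i)"
    using that N[of n "j n x + Suc i"] grid_add[of T n "j n x" "Suc i"] T_pos by (auto simp: Ug grid_def)
   then show ?thesis by (simp add: c_def euler_coeff_def S_def)
  qed
  fix e :: real assume e: "e > 0"
  have e2: "e/2 > 0" using e by simp
  have vEa: "vanishing M (%n. {x \<in> space M. \<exists>k. grid T n k <= S \<and> e < norm (riemann S H n k x - X x (grid T n k))})" if "e > 0" for e
   by (rule riemann_converges[OF S HG Hc int that])
  show "vanishing M (%n. {x \<in> space M. \<exists>k\<le>N n. j n x <= k \<and>
    e < norm (transform (grid T n) (%l x. if j n x <= l then H (grid T n l) x else 0) k x - V n x (grid T n (k - j n x)))})"
  proof (rule vanishing_cover[OF vEa[OF e2], of 0], intro notI, elim exE conjE)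
   fix n x k assume x: "x \<in> space M" and nx: "x \<notin> {x \<in> space M. \<exists>k. grid T n k <= S \<and> e/2 < norm (riemann S H n k x - X x (grid T n k))}"
    and k: "k <= N n" "j n x <= k" and gt: "e < norm (transform (grid T n) (%l x. if j n x <= l then H (grid T n l) x else 0) k x - V n x (grid T n (k - j n x)))"
   define r where "r i = riemann S H n i x - X x (grid T n i)" for i
   have r: "norm (r i) <= e/2" if "i <= N n" for i using nx x that N by (auto simp: r_def not_less)
   have "transform (grid T n) (%l x. if j n x <= l then H (grid T n l) x else 0) k x = riemann S H n k x - riemann S H n (j n x) x"
    using k(2,1)
   proof (induction k rule: dec_induct)
    case base
    show ?case unfolding transform_def by simp
   next
    case (step i)
    then show ?case using N[of n "Suc i"] by (simp add: riemann_def)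
   qed
   moreover have "V n x (grid T n (k - j n x)) = X x (grid T n k) - X x (grid T n (j n x))"
   proof -
    have "grid T n (j n x) + grid T n (k - j n x) = grid T n k" using k(2) by (simp flip: grid_add)
    moreover have "grid T n k <= T" using N[of n k] k S by simp
    ultimately show ?thesis using V_eq[of "grid T n (k - j n x)" n x] k g0[of n "j n x"] g0[of n "k - j n x"] by (simp add: Ug)
   qed
   ultimately have "transform (grid T n) (%l x. if j n x <= l then H (grid T n l) x else 0) k x - V n x (grid T n (k - j n x)) = r k - r (j n x)"
    by (simp add: r_def)
   then show False using gt norm_triangle_ineq4[of "r k" "r (j n x)"] r[of k] r[of "j n x"] k by simp
  qed
  show "vanishing M (%n. {x \<in> space M. \<exists>r\<in>{0..T}. \<exists>r'\<in>{0..T}. \<bar>r - r'\<bar> <= T / 2^n \<and> e < norm (V n x r - V n x r')})"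
  proof (rule vanishing_cover[OF vEb[OF e], of 0], intro notI, elim bexE conjE)
   fix n x r r' assume x: "x \<in> space M" "x \<notin> Eb e n" and r: "r \<in> {0..T}" "r' \<in> {0..T}" "\<bar>r - r'\<bar> <= T / 2^n" "e < norm (V n x r - V n x r')"
   have "norm (X x (min (Hn n x + r) T) - X x (min (Hn n x + r') T)) <= e"
    by (rule osc[OF x]) (use r Hn(1)[of n x] in auto)
   then show False using r by (simp add: V_eq)
  qed
  show "vanishing M (%n. {x \<in> space M. \<exists>k\<le>2^n. N n < j n x + k \<and> e < norm (V n x (grid T n k) - V n x (grid T n (N n - j n x)))})"
  proof (rule vanishing_cover[OF vEb[OF e], of 0], intro notI, elim exE conjE)
   fix n x k assume x: "x \<in> space M" "x \<notin> Eb e n" and k: "k <= 2^n" "N n < j n x + k"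
    and gt: "e < norm (V n x (grid T n k) - V n x (grid T n (N n - j n x)))"
   define v where "v i = min (min (Hn n x + grid T n i) T) S" for i
   have gT: "grid T n i \<in> {0..T}" if "i <= 2^n" for i using that T_pos g0 by (auto intro: grid_le)
   have vr: "v i \<in> {0..T}" for i using S Hn(1)[of n x] g0[of n i] T_pos by (simp add: v_def)
   have V: "V n x (grid T n i) = X x (v i) - X x (Hn n x)" if "i <= 2^n" for i
    using V_eq[OF gT[OF that], of n x] strong_solutionD(4)[OF X x(1), of "min (Hn n x + grid T n i) T"] by (simp add: v_def min_def)
   have m: "N n - j n x <= 2^n" using N2[of n] by simp
   have g: "S < grid T n (Suc (N n))" using N[of n "Suc (N n)"] by simp
   have "\<bar>v k - v (N n - j n x)\<bar> <= T / 2^n"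
   proof (cases "j n x <= N n")
    case True
    have a: "grid T n (j n x) + grid T n (N n - j n x) = grid T n (N n)" using True by (simp flip: grid_add)
    have "grid T n (Suc (N n)) <= grid T n (j n x) + grid T n k"
     unfolding grid_add[symmetric] using k T_pos by (intro grid_mono) auto
    then have "v k = S" using g True S by (simp add: v_def Ug)
    moreover have "v (N n - j n x) = grid T n (N n)" using a True N[of n "N n"] S by (simp add: v_def Ug)
    ultimately show ?thesis using g N[of n "N n"] by (simp add: grid_Suc)
   next
    case False
    then show ?thesis using g0 S T_pos by (simp add: v_def Ug)
   qed
   then have "norm (X x (v k) - X x (v (N n - j n x))) <= e"
    by (rule osc[OF x vr vr])
   then show False using gt by (simp add: V[OF k(1)] V[OF m])
  qed
  show "vanishing M (%n. {x \<in> space M. \<exists>l<N n. \<exists>I\<in>Omega T. \<exists>a\<ge>0. j n x <= l \<and>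
    (\<forall>s\<in>{0..grid T n (l - j n x)}. norm (I s - V n x s) <= a) \<and> C * a + e < norm (c n x (l - j n x) I - H (grid T n l) x)})"
  proof (rule vanishing_cover[OF vEb[OF e], of 0], intro notI, elim exE bexE conjE)
   fix n x l I a assume x: "x \<in> space M" "x \<notin> Eb e n" and l: "l < N n" "j n x <= l" and IO: "I \<in> Omega T"
    and a: "a \<ge> 0" "\<forall>s\<in>{0..grid T n (l - j n x)}. norm (I s - V n x s) <= a" and gt: "C * a + e < norm (c n x (l - j n x) I - H (grid T n l) x)"
   define v where "v = grid T n (j n x)"
   define q where "q = grid T n (l - j n x)"
   have Uv: "Hn n x = v" using l by (simp add: Ug v_def)
   have vq: "v + q = grid T n l" "v + grid T n (Suc (l - j n x)) = grid T n (Suc l)" using l by (simp_all add: v_def q_def flip: grid_add)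
   have tv: "0 <= v" "0 <= q" "v <= T" "0 <= t + v" "t + v <= T" "t + v + q <= T" "t + v + grid T n (Suc (l - j n x)) <= T"
    using vq N[of n l] N[of n "Suc l"] l t g0[of n "j n x"] g0[of n "l - j n x"] by (auto simp: v_def q_def S_def)
   have "V n x = tail T v (X x)" by (simp add: V_def Uv)
   have KI: "c n x (l - j n x) I = \<sigma> (t + v + q) (concat_path T (t + v) (Y x) I)"
    using tv(7) by (simp add: c_def Uv euler_coeff_def shift_process_def q_def)
   \<comment> \<open>The tail glued back to the path is the path itself, so \<open>H\<close> is the
     restarted coefficient at \<open>V n x\<close> and the Lipschitz bound compares \<open>I\<close>
     with \<open>V n x\<close>.\<close>
   have "concat_path T (t + v) (Y x) (V n x) = concat_path T t w (concat_path T v (X x) (tail T v (X x)))"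
    unfolding Y_def V_def Uv using concat_path_assoc[OF t(1) tv(1,5) XO[OF x(1)]] by simp
   also have "... = concat_path T t w (X x)" using concat_path_tail[OF tv(1,3) XO[OF x(1)]] by simp
   finally have HI: "H (grid T n l) x = \<sigma> (t + v + q) (concat_path T (t + v) (Y x) (V n x))"
    by (simp add: H_def b_def shift_process_def vq(1)[symmetric] add.assoc)
   have "norm (c n x (l - j n x) I - H (grid T n l) x) <= C * a"
    unfolding KI HI
    by (rule C(2)[OF _ tv(6) concat_path_in_Omega concat_path_in_Omega])
     (use tv IO YO[OF x(1)] tail_in_Omega[OF tv(1,3) XO[OF x(1)]] a in "auto simp: concat_path_def V_def Uv q_def[symmetric]")
   then show False using gt e by simp
  qed
 qed
 then show ?thesis by (simp add: E_def c_def euler_path_def Y_def V_def)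
qed

end

section \<open>The strong Markov property\<close>

lemma measurable_fun_upd_pair:
 "(%p. (fst (fst p), (snd (fst p))(m := snd p))) \<in>
  measurable ((N \<Otimes>\<^sub>M borel) \<Otimes>\<^sub>M borel) (N \<Otimes>\<^sub>M (borel :: (nat => 'b::second_countable_topology) measure))"
proof (rule measurable_Pair)
 show "(%p. (snd (fst p))(m := snd p)) \<in> borel_measurable ((N \<Otimes>\<^sub>M (borel :: (nat => 'b) measure)) \<Otimes>\<^sub>M (borel :: 'b measure))"
 proof (rule measurable_coordinatewise_then_product)
  fix i
  show "(%p. ((snd (fst p))(m := snd p)) i) \<in> borel_measurable ((N \<Otimes>\<^sub>M (borel :: (nat => 'b) measure)) \<Otimes>\<^sub>M (borel :: 'b measure))"
  proof (cases "i = m")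
   case False
   have "(%p. (snd (fst p)) i) \<in> borel_measurable ((N \<Otimes>\<^sub>M (borel :: (nat => 'b) measure)) \<Otimes>\<^sub>M (borel :: 'b measure))"
    by (rule measurable_compose[OF _ measurable_product_coordinates]) simp
   then show ?thesis using False by simp
  qed simp
 qed
qed simp

context brownian
begin

text \<open>Independence makes the joint law of \<open>Y\<close> and the increment a product, so
  Fubini's theorem integrates out the increment with \<open>Y\<close> held fixed.\<close>

lemma increment_freezing:
 assumes st: "0 <= s" "s < t" "t <= T" and Y: "Y \<in> measurable (G s) N"
  and F: "F \<in> borel_measurable (N \<Otimes>\<^sub>M borel)"
 shows "(\<integral>\<^sup>+x. F (Y x, W t x - W s x) \<partial>M) = (\<integral>\<^sup>+x. \<integral>\<^sup>+w. F (Y x, w) \<partial>distr M borel (%x. W t x - W s x) \<partial>M)"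
proof -
 let ?D = "%x. W t x - W s x"
 have D: "?D \<in> borel_measurable M" using increment_measurable st by simp
 have YM: "Y \<in> measurable M N" by (rule measurable_G_M[OF Y])
 interpret DN: prob_space "distr M N Y" by (rule prob_space_distr[OF YM])
 interpret DD: prob_space "distr M borel ?D" by (rule prob_space_distr[OF D])
 have YD: "(%x. (Y x, ?D x)) \<in> measurable M (N \<Otimes>\<^sub>M borel)" using YM D by simp
 have eq: "distr M N Y \<Otimes>\<^sub>M distr M borel ?D = distr M (N \<Otimes>\<^sub>M borel) (%x. (Y x, ?D x))"
 proof (rule pair_measure_eqI)
  fix A B assume A: "A \<in> sets (distr M N Y)" and B: "B \<in> sets (distr M borel ?D)"
  have AG: "Y -` A \<inter> space M \<in> sets (G s)" using measurable_sets[OF Y, of A] A by simp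
  have "emeasure (distr M (N \<Otimes>\<^sub>M borel) (%x. (Y x, ?D x))) (A \<times> B) = emeasure M ((%x. (Y x, ?D x)) -` (A \<times> B) \<inter> space M)"
   by (rule emeasure_distr[OF YD]) (use A B in auto)
  also have "(%x. (Y x, ?D x)) -` (A \<times> B) \<inter> space M = (Y -` A \<inter> space M) \<inter> (?D -` B \<inter> space M)" by auto
  also have "emeasure M ... = ennreal (prob (Y -` A \<inter> space M) * prob (?D -` B \<inter> space M))"
   using increment_indep_sets[OF st AG, of B] B by (simp add: emeasure_eq_measure)
  also have "... = emeasure (distr M N Y) A * emeasure (distr M borel ?D) B"
   using A B YM D by (simp add: emeasure_distr emeasure_eq_measure ennreal_mult)
  finally show "emeasure (distr M N Y) A * emeasure (distr M borel ?D) B = emeasure (distr M (N \<Otimes>\<^sub>M borel) (%x. (Y x, ?D x))) (A \<times> B)" by simp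
 qed (auto intro: DN.sigma_finite_measure_axioms DD.sigma_finite_measure_axioms cong: sets_pair_measure_cong)
 have F': "F \<in> borel_measurable (distr M N Y \<Otimes>\<^sub>M distr M borel ?D)"
  using F by (simp cong: measurable_cong_sets sets_pair_measure_cong)
 have "(\<integral>\<^sup>+x. F (Y x, ?D x) \<partial>M) = integral\<^sup>N (distr M N Y \<Otimes>\<^sub>M distr M borel ?D) F"
  unfolding eq by (rule nn_integral_distr[OF YD, symmetric]) (use F in simp)
 also have "... = (\<integral>\<^sup>+y. \<integral>\<^sup>+w. F (y, w) \<partial>distr M borel ?D \<partial>distr M N Y)"
  by (rule DD.nn_integral_fst[OF F', symmetric])
 also have "... = (\<integral>\<^sup>+x. \<integral>\<^sup>+w. F (Y x, w) \<partial>distr M borel ?D \<partial>M)"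
 proof (rule nn_integral_distr[OF YM])
  show "(%y. \<integral>\<^sup>+w. F (y, w) \<partial>distr M borel ?D) \<in> borel_measurable (distr M N Y)"
   using F' by (intro DD.borel_measurable_nn_integral) (simp add: case_prod_unfold)
 qed
 finally show ?thesis .
qed

text \<open>Finitely many increments padded by zeros into one random sequence, so that a single
  value space serves for all lengths \<open>m\<close>.\<close>

definition incr :: "nat => nat => nat => 'a => nat => real ^ 'd" where
 "incr n j m x = (%i. if i < m then W (grid T n (Suc (j + i))) x - W (grid T n (j + i)) x else 0)"

lemma incr_G:
 assumes "j + m <= 2^n"
 shows "incr n j m \<in> borel_measurable (G (grid T n (j + m)))"
proof (rule measurable_coordinatewise_then_product)
 fix i
 show "(%x. incr n j m x i) \<in> borel_measurable (G (grid T n (j + m)))"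
 proof (cases "i < m")
  case True
  have "W (grid T n (Suc (j + i))) \<in> borel_measurable (G (grid T n (j + m)))" "W (grid T n (j + i)) \<in> borel_measurable (G (grid T n (j + m)))"
   using T_pos True assms by (auto intro!: W_G grid_nonneg grid_mono grid_le)
  then show ?thesis using True by (simp add: incr_def)
 qed (simp add: incr_def)
qed

lemma incr_Suc: "incr n j (Suc m) x = (incr n j m x)(m := W (grid T n (Suc (j + m))) x - W (grid T n (j + m)) x)"
 by (auto simp: incr_def)

text \<open>Induction on \<open>m\<close>: the last increment is integrated out by
  \<open>increment_freezing\<close>, the induction hypothesis moves the first \<open>m\<close> to
  the start of the grid, and equality of laws for equal step lengths puts the last one back.\<close>

lemma increments_restart:
 assumes "j + m <= 2^n" and Z: "Z \<in> measurable (G (grid T n j)) N" and "F \<in> borel_measurable (N \<Otimes>\<^sub>M borel)"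
 shows "(\<integral>\<^sup>+x. F (Z x, incr n j m x) \<partial>M) = (\<integral>\<^sup>+x. \<integral>\<^sup>+y. F (Z x, incr n 0 m y) \<partial>M \<partial>M)"
 using assms(1,3)
proof (induction m arbitrary: F)
 case 0
 then show ?case by (simp add: incr_def emeasure_space_1)
next
 case (Suc m)
 note F = Suc.prems(2)
 have jm: "j + m <= 2^n" using Suc.prems by simp
 have st: "0 <= grid T n (i + m)" "grid T n (i + m) < grid T n (Suc (i + m))" "grid T n (Suc (i + m)) <= T" if "i <= j" for i
  using T_pos Suc.prems(1) that by (auto simp: grid_nonneg grid_less_iff intro!: grid_le)
 let ?D = "%i x. W (grid T n (Suc (i + m))) x - W (grid T n (i + m)) x"
 have law: "distr M borel (?D j) = distr M borel (?D 0)"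
  by (rule increment_law[OF st[OF order_refl] st[of 0]]) (simp_all add: grid_Suc)
 define \<Phi> where "\<Phi> = (%p. F (fst (fst p), (snd (fst p))(m := snd p)))"
 have \<Phi>: "\<Phi> \<in> borel_measurable ((N \<Otimes>\<^sub>M borel) \<Otimes>\<^sub>M borel)"
  unfolding \<Phi>_def by (rule measurable_compose[OF measurable_fun_upd_pair F])
 have \<Phi>z: "(%p. \<Phi> ((z, fst p), snd p)) \<in> borel_measurable (borel \<Otimes>\<^sub>M borel)" if "z \<in> space N" for z
  by (rule measurable_compose[OF _ \<Phi>]) (use that in simp)
 interpret DD: prob_space "distr M borel (?D j)"
  by (rule prob_space_distr[OF increment_measurable]) (use st[OF order_refl] in auto)
 have ZM: "z \<in> space M ==> Z z \<in> space N" for z using measurable_space[OF Z] by simp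
 have Y: "(%x. (Z x, incr n j m x)) \<in> measurable (G (grid T n (j + m))) (N \<Otimes>\<^sub>M borel)"
  by (intro measurable_Pair measurable_G_mono[OF Z] incr_G[OF jm] grid_mono) (use T_pos in auto)
 have Y0: "incr n 0 m \<in> measurable (G (grid T n (0 + m))) borel" using incr_G[of 0 m n] jm by simp
 have "(\<integral>\<^sup>+x. F (Z x, incr n j (Suc m) x) \<partial>M) = (\<integral>\<^sup>+x. \<Phi> ((Z x, incr n j m x), ?D j x) \<partial>M)"
  by (simp add: \<Phi>_def incr_Suc)
 also have "... = (\<integral>\<^sup>+x. \<integral>\<^sup>+w. \<Phi> ((Z x, incr n j m x), w) \<partial>distr M borel (?D j) \<partial>M)"
  by (rule increment_freezing[OF st[OF order_refl] Y \<Phi>])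
 also have "... = (\<integral>\<^sup>+x. \<integral>\<^sup>+y. \<integral>\<^sup>+w. \<Phi> ((Z x, incr n 0 m y), w) \<partial>distr M borel (?D j) \<partial>M \<partial>M)"
 proof (rule Suc.IH[OF jm, of "%p. \<integral>\<^sup>+w. \<Phi> (p, w) \<partial>distr M borel (?D j)"])
  have "\<Phi> \<in> borel_measurable ((N \<Otimes>\<^sub>M borel) \<Otimes>\<^sub>M distr M borel (?D j))"
   using \<Phi> by (simp cong: measurable_cong_sets sets_pair_measure_cong)
  then show "(%p. \<integral>\<^sup>+w. \<Phi> (p, w) \<partial>distr M borel (?D j)) \<in> borel_measurable (N \<Otimes>\<^sub>M borel)"
   by (intro DD.borel_measurable_nn_integral) (simp add: case_prod_unfold)
 qed
 also have "... = (\<integral>\<^sup>+x. \<integral>\<^sup>+y. \<Phi> ((Z x, incr n 0 m y), ?D 0 y) \<partial>M \<partial>M)"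
  unfolding law
 proof (rule nn_integral_cong)
  fix x assume "x \<in> space M"
  from increment_freezing[OF st[of 0] Y0 \<Phi>z[OF ZM[OF this]]]
  show "(\<integral>\<^sup>+y. \<integral>\<^sup>+w. \<Phi> ((Z x, incr n 0 m y), w) \<partial>distr M borel (?D 0) \<partial>M) = (\<integral>\<^sup>+y. \<Phi> ((Z x, incr n 0 m y), ?D 0 y) \<partial>M)"
   by simp
 qed
 also have "... = (\<integral>\<^sup>+x. \<integral>\<^sup>+y. F (Z x, incr n 0 (Suc m) y) \<partial>M \<partial>M)"
  by (simp add: \<Phi>_def incr_Suc)
 finally show ?case .
qed

lemma incr_measurable: "incr n j m \<in> borel_measurable M" if "j + m <= 2^n"
 by (rule measurable_G_M[OF incr_G[OF that]])

end

lemma euler_cong_increments: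
 assumes "!!i. i < m ==> u i = u' i \<or> (\<forall>z. c i z = 0)"
 shows "euler T n c u m = euler T n c u' m"
 using assms
proof (induction m)
 case (Suc m)
 have IH: "euler T n c u m = euler T n c u' m" using Suc by simp
 have "c m (interp T n (euler T n c u' m)) *v u m = c m (interp T n (euler T n c u' m)) *v u' m"
  using Suc.prems[of m] by auto
 then show ?case by (simp only: euler.simps IH)
qed simp

lemma euler_path_measurable:
 assumes T: "T > 0" and \<sigma>: "continuous_adapted T T \<sigma>" and t: "0 <= t" "t <= T"
  and Z: "Z \<in> measurable N (paths T)" and u: "u \<in> borel_measurable N"
 shows "(%x. euler_path T n \<sigma> t (Z x) (u x)) \<in> measurable N (paths T)"
proof -
 have "(%x. euler T n (euler_coeff T n \<sigma> t (Z x)) (u x) (2^n) j) \<in> borel_measurable N" for j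
  using euler_measurable[OF T \<sigma> t Z, of "2^n" "%i x. u x i"] measurable_product_then_coordinatewise[OF u] by simp
 then show ?thesis unfolding euler_path_def by (intro interp_measurable[OF T]) simp
qed

text \<open>Test functionals that respect uniform estimates between paths, yet are rich enough to
  reach the indicators of closed cylinders as pointwise limits.\<close>

definition lipschitz_functional :: "real => (('d::finite) path => real) => bool" where
 "lipschitz_functional T F \<longleftrightarrow> (\<forall>w\<in>Omega T. 0 <= F w \<and> F w <= 1) \<and>
  (\<exists>L>0. \<forall>w\<in>Omega T. \<forall>w'\<in>Omega T. \<forall>a. (\<forall>s\<in>{0..T}. norm (w s - w' s) <= a) \<longrightarrow> \<bar>F w - F w'\<bar> <= L * a)"

lemma lipschitz_functionalD:
 assumes "lipschitz_functional T F"
 obtains L where "L > 0" "!!w w' a. w \<in> Omega T ==> w' \<in> Omega T ==> (!!s. 0 <= s ==> s <= T ==> norm (w s - w' s) <= a) ==> \<bar>F w - F w'\<bar> <= L * a"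
 using assms unfolding lipschitz_functional_def by (metis atLeastAtMost_iff)

lemma lipschitz_functional_range:
 "lipschitz_functional T F ==> w \<in> Omega T ==> 0 <= F w \<and> F w <= 1"
 by (simp add: lipschitz_functional_def)

lemma lipschitz_functional_measurable:
 fixes F :: "('d::finite) path => real"
 assumes T: "T > 0" and F: "lipschitz_functional T F"
 shows "F \<in> borel_measurable (paths T)"
proof -
 obtain L where L: "L > 0" "!!w w' a. w \<in> Omega T ==> w' \<in> Omega T ==> (!!s. 0 <= s ==> s <= T ==> norm (w s - w' s) <= a) ==> \<bar>F w - F w'\<bar> <= L * a"
  by (rule lipschitz_functionalD[OF F]) blast
 show ?thesis
 proof (rule path_continuous_measurable[OF T])
  fix w :: "'d path" and e :: real assume w: "w \<in> Omega T" and e: "e > 0"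
  show "\<exists>d>0. \<forall>w'\<in>Omega T. (\<forall>r\<in>{0..T}. norm (w r - w' r) < d) \<longrightarrow> dist (F w) (F w') < e"
  proof (intro exI[of _ "e / (2 * L)"] conjI ballI impI)
   fix w' :: "'d path" assume w': "w' \<in> Omega T" "\<forall>r\<in>{0..T}. norm (w r - w' r) < e / (2 * L)"
   have "\<bar>F w - F w'\<bar> <= L * (e / (2 * L))" by (rule L(2)[OF w w'(1)]) (use w'(2) in "auto intro: less_imp_le")
   also have "... < e" using L(1) e by simp
   finally show "dist (F w) (F w') < e" by (simp add: dist_real_def)
  qed (use L e in simp)
 qed (use T in auto)
qed

lemma lipschitz_functional_vanishing:
 assumes F: "lipschitz_functional T F"
  and YZ: "!!n x. x \<in> space M ==> Y n x \<in> Omega T" "!!n x. x \<in> space M ==> Z n x \<in> Omega T"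
  and van: "!!b. b > 0 ==> vanishing M (%n. {x \<in> space M. \<exists>s\<in>{0..T}. b < norm (Y n x s - Z n x s)})"
  and eps: "e > 0"
 shows "vanishing M (%n. {x \<in> space M. e < \<bar>F (Y n x) - F (Z n x)\<bar>})"
proof -
 obtain L where L: "L > 0" "!!w w' a. w \<in> Omega T ==> w' \<in> Omega T ==> (!!s. 0 <= s ==> s <= T ==> norm (w s - w' s) <= a) ==> \<bar>F w - F w'\<bar> <= L * a"
  by (rule lipschitz_functionalD[OF F]) blast
 show ?thesis
 proof (rule vanishing_mono[OF van[of "e / L"]])
  show "e / L > 0" using L eps by simp
  fix n :: nat assume "n \<ge> 0"
  show "{x \<in> space M. e < \<bar>F (Y n x) - F (Z n x)\<bar>} \<subseteq> {x \<in> space M. \<exists>s\<in>{0..T}. e / L < norm (Y n x s - Z n x s)}"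
  proof (rule subsetI, rule ccontr)
   fix x assume x: "x \<in> {x \<in> space M. e < \<bar>F (Y n x) - F (Z n x)\<bar>}"
    and nx: "x \<notin> {x \<in> space M. \<exists>s\<in>{0..T}. e / L < norm (Y n x s - Z n x s)}"
   have "\<bar>F (Y n x) - F (Z n x)\<bar> <= L * (e / L)"
    by (rule L(2)) (use x nx YZ in "auto simp: not_less")
   then show False using x L(1) by simp
  qed
 qed
qed

text \<open>A single Brownian motion drives the solutions from all starting points. Their dependence
  on \<open>(t, w)\<close> is arbitrary; measurable dependence of the laws on the starting path has
  to be derived.\<close>

locale path_sde = brownian M T W for M :: "'a measure" and T :: real and W :: "real => 'a => real ^ ('d::finite)" +
 fixes \<sigma> :: "real => 'd path => real ^ 'd ^ 'd" and X :: "real => 'd path => 'a => 'd path"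
 assumes coeff: "admissible_coeff T \<sigma>"
  and solution: "!!t w. t \<in> {0..T} ==> w \<in> Omega T ==>
     strong_solution M W T (T - t) (shift_process T t w \<sigma>) (X t w)"
begin

lemma coeff_ca: "continuous_adapted T T \<sigma>"
 by (rule admissible_continuous_adapted[OF T_pos coeff])

definition law :: "real => 'd path => 'd path measure" where
 "law t w = distr M (paths T) (X t w)"

lemma X_measurable: "0 <= t ==> t <= T ==> w \<in> Omega T ==> X t w \<in> measurable M (paths T)"
 using strong_solutionD(1)[OF solution, of t w] by simp

lemma X_in_Omega: "0 <= t ==> t <= T ==> w \<in> Omega T ==> x \<in> space M ==> X t w x \<in> Omega T"
 using strong_solutionD(5)[OF solution, of t w] by simp

lemma sets_law [simp]: "sets (law t w) = sets (paths T)"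
 by (simp add: law_def)

lemma space_law [simp]: "space (law t w) = Omega T"
 by (simp add: law_def)

lemma prob_space_law: "0 <= t ==> t <= T ==> w \<in> Omega T ==> prob_space (law t w)"
 unfolding law_def by (rule prob_space_distr[OF X_measurable])

lemma integral_law:
 fixes f :: "'d path => real"
 assumes "0 <= t" "t <= T" "w \<in> Omega T" "f \<in> borel_measurable (paths T)"
 shows "integral\<^sup>L (law t w) f = expectation (%x. f (X t w x))"
 unfolding law_def by (rule integral_distr[OF X_measurable assms(4)]) (use assms in auto)

text \<open>Bounded convergence turns approximation in probability into convergence of laws. The
  scheme is fed with the increments from the start of the grid, whatever the starting time.\<close>

lemma euler_law_converges:
 assumes t: "0 <= t" and tn: "!!n. t <= tn n" "!!n. tn n <= T" "!!n. tn n <= t + T / 2^n"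
  and w: "w \<in> Omega T" "w' \<in> Omega T" "!!r. 0 <= r ==> r <= t ==> w r = w' r"
  and F: "lipschitz_functional T F"
 shows "(%n. expectation (%x. F (euler_path T n \<sigma> (tn n) w (incr n 0 (2^n) x)))) \<longlonglongrightarrow> integral\<^sup>L (law t w') F"
proof -
 have tT: "t <= T" using tn(1,2)[of 0] by simp
 note Fm = lipschitz_functional_measurable[OF T_pos F]
 have inc: "(%i. increments n 0 i x) = incr n 0 (2^n) x" for n x by (auto simp: incr_def increments_def)
 have eO: "euler_path T n \<sigma> (tn n) w u \<in> Omega T" for n u by (rule euler_path_in_Omega[OF T_pos])
 have XO: "X t w' x \<in> Omega T" if "x \<in> space M" for x by (rule X_in_Omega[OF t tT w(2) that])
 have "(%n. expectation (%x. F (euler_path T n \<sigma> (tn n) w (incr n 0 (2^n) x)))) \<longlonglongrightarrow> expectation (%x. F (X t w' x))"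
 proof (rule bounded_convergence_in_probability[where K=1])
  fix n
  have "0 <= tn n" using t tn(1)[of n] by simp
  then show "(%x. F (euler_path T n \<sigma> (tn n) w (incr n 0 (2^n) x))) \<in> borel_measurable M"
   using incr_measurable[of 0 "2^n" n] w(1) tn(2)
   by (intro measurable_compose[OF euler_path_measurable[OF T_pos coeff_ca] Fm]) auto
  show "\<bar>F (euler_path T n \<sigma> (tn n) w (incr n 0 (2^n) x))\<bar> <= 1" for x
   using lipschitz_functional_range[OF F eO] by (simp add: abs_le_iff)
 next
  show "(%x. F (X t w' x)) \<in> borel_measurable M" by (rule measurable_compose[OF X_measurable[OF t tT w(2)] Fm])
  show "\<bar>F (X t w' x)\<bar> <= 1" if "x \<in> space M" for x
   using lipschitz_functional_range[OF F XO[OF that]] by simp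
  fix e :: real assume "e > 0"
  then show "vanishing M (%n. {x \<in> space M. e < \<bar>F (euler_path T n \<sigma> (tn n) w (incr n 0 (2^n) x)) - F (X t w' x)\<bar>})"
  proof (intro lipschitz_functional_vanishing[OF F, where Y="%n x. euler_path T n \<sigma> (tn n) w (incr n 0 (2^n) x)" and Z="%n. X t w'"] eO XO)
   fix b :: real assume "b > 0"
   from euler_converges[OF coeff t tn w solution this] t tT w(2)
   show "vanishing M (%n. {x \<in> space M. \<exists>s\<in>{0..T}. b < norm (euler_path T n \<sigma> (tn n) w (incr n 0 (2^n) x) s - X t w' x s)})"
    by (simp add: inc)
  qed
 qed
 then show ?thesis using integral_law[OF t tT w(2) Fm] by simp
qed

end

locale path_sde_at = path_sde M T W \<sigma> X
 for M :: "'a measure" and T :: real and W :: "real => 'a => real ^ ('d::finite)"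
  and \<sigma> :: "real => 'd path => real ^ 'd ^ 'd" and X :: "real => 'd path => 'a => 'd path" +
 fixes t :: real and w :: "'d path"
 assumes t: "0 <= t" "t <= T" and w: "w \<in> Omega T"
begin

abbreviation S :: real where "S \<equiv> T - t"
abbreviation X0 :: "'a => 'd path" where "X0 \<equiv> X t w"
abbreviation P0 :: "'d path measure" where "P0 \<equiv> law t w"

lemma X0_solution: "strong_solution M W T S (shift_process T t w \<sigma>) X0"
 using solution t w by simp

lemma X0_measurable: "X0 \<in> measurable M (paths T)"
 by (rule X_measurable[OF t w])

lemma X0_Omega: "x \<in> space M ==> X0 x \<in> Omega T"
 by (rule X_in_Omega[OF t w])

end

section \<open>Restart at a stopping time\<close>

locale path_sde_stopped = path_sde_at +
 fixes U :: "'b path => real"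
 assumes st: "U \<in> stopping_times T" and le_S: "!!z. z \<in> Omega T ==> U z <= T - t"
begin

lemma U_range: "z \<in> Omega T ==> 0 <= U z" "z \<in> Omega T ==> U z <= S" "z \<in> Omega T ==> U z <= T"
 using stopping_timesD(2)[OF st] le_S by auto

lemma U_measurable: "U \<in> borel_measurable (paths T)"
 by (rule stopping_timesD(1)[OF st])

definition frozen :: "'b path => 'b path" where "frozen z = freeze T (U z) z"

definition \<kappa> :: "'b path => 'b path measure" where
 "\<kappa> z = law (t + U z) (concat_path T t w (frozen z))"

abbreviation "past x \<equiv> frozen (X0 x)"
abbreviation "future x \<equiv> tail T (U (X0 x)) (X0 x)"
abbreviation "kern x \<equiv> \<kappa> (X0 x)"

lemma frozen_Omega: "z \<in> Omega T ==> frozen z \<in> Omega T"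
 unfolding frozen_def by (rule freeze_in_Omega[OF U_range(1)])

lemma frozen_eq: "z \<in> Omega T ==> 0 <= r ==> r <= U z ==> frozen z r = z r"
 using U_range[of z] by (simp add: frozen_def freeze_def)

lemma U_freeze: "z \<in> Omega T ==> U z <= v ==> U (freeze T v z) = U z"
proof (rule stopping_timesD(3)[OF st])
 assume z: "z \<in> Omega T" "U z <= v"
 then show "freeze T v z \<in> Omega T" using U_range(1)[OF z(1)] by (intro freeze_in_Omega) auto
 show "z r = freeze T v z r" if "0 <= r" "r <= U z" for r
 proof -
  have "min v r = r" using that z by simp
  then show ?thesis using that z U_range(3)[OF z(1)] by (simp add: freeze_def)
 qed
qed

lemma U_frozen: "z \<in> Omega T ==> U (frozen z) = U z"
 unfolding frozen_def by (rule U_freeze) auto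

lemma frozen_freeze: "z \<in> Omega T ==> U z <= v ==> frozen (freeze T v z) = frozen z"
proof -
 assume z: "z \<in> Omega T" "U z <= v"
 have "freeze T (U z) (freeze T v z) = freeze T (U z) z"
  using z(2) U_range[OF z(1)] by (intro ext) (auto simp: freeze_def restrict_def min_def)
 then show ?thesis by (simp add: frozen_def U_freeze[OF z])
qed

lemma frozen_frozen: "z \<in> Omega T ==> frozen (frozen z) = frozen z"
 using frozen_freeze[of z "U z"] by (simp add: frozen_def)

lemma frozen_measurable: "frozen \<in> measurable (paths T) (paths T)"
 unfolding frozen_def[abs_def] by (rule freeze_measurable[OF _ U_measurable]) (use U_range in auto)

definition idx :: "nat => 'b path => nat" where "idx n z = grid_index T n (U z)"
abbreviation "index n x \<equiv> idx n (X0 x)"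
definition gtime :: "nat => nat => real" where "gtime n i = min (grid T n i) S"

lemma idx_measurable: "idx n \<in> measurable (paths T) (count_space UNIV)"
proof -
 note [measurable] = U_measurable
 show ?thesis unfolding idx_def[abs_def] grid_index_def by measurable
qed

lemma idx_le: "z \<in> Omega T ==> idx n z <= 2^n"
 using grid_index_le_iff[OF T_pos, of n "U z" "2^n"] U_range by (simp add: idx_def)

lemma gtime_range: "0 <= gtime n i" "gtime n i <= S" "0 <= t + gtime n i" "t + gtime n i <= T"
 using t grid_nonneg[of T n i] T_pos by (auto simp: gtime_def)

lemma gtime_idx:
 assumes z: "z \<in> Omega T"
 shows "U z <= gtime n (idx n z)" "gtime n (idx n z) <= U z + T / 2^n"
 using grid_index_bounds[OF T_pos U_range(1)[OF z], of n] U_range[OF z] by (auto simp: gtime_def idx_def)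

text \<open>Whether the rounded index equals \<open>i\<close> is decided by the path up to
  \<open>gtime n i\<close>, by Galmarino's test for \<open>U\<close>.\<close>

lemma idx_freeze:
 assumes z: "z \<in> Omega T"
 shows "idx n (freeze T (gtime n i) z) = i \<longleftrightarrow> idx n z = i" "idx n z = i ==> frozen (freeze T (gtime n i) z) = frozen z"
proof -
 have fz: "freeze T (gtime n i) z \<in> Omega T" by (rule freeze_in_Omega[OF gtime_range(1) z])
 have i_le: "U z <= gtime n i" if "idx n z = i" using gtime_idx(1)[OF z, of n] that by simp
 show "idx n z = i ==> frozen (freeze T (gtime n i) z) = frozen z"
  by (rule frozen_freeze[OF z i_le])
 show "idx n (freeze T (gtime n i) z) = i \<longleftrightarrow> idx n z = i"
 proof (cases "U z <= gtime n i")
  case True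
  then show ?thesis using U_freeze[OF z True] by (simp add: idx_def)
 next
  case False
  have "\<not> U (freeze T (gtime n i) z) <= gtime n i"
  proof
   assume le: "U (freeze T (gtime n i) z) <= gtime n i"
   have "U z = U (freeze T (gtime n i) z)"
    by (rule stopping_timesD(3)[OF st fz z]) (use le gtime_range[of n i] t in "auto simp: freeze_def")
   then show False using le False by simp
  qed
  then have "\<not> U (freeze T (gtime n i) z) <= gtime n (idx n (freeze T (gtime n i) z)) \<or> idx n (freeze T (gtime n i) z) \<noteq> i" by auto
  then have "idx n (freeze T (gtime n i) z) \<noteq> i" using gtime_idx(1)[OF fz] by blast
  moreover have "idx n z \<noteq> i" using False i_le by blast
  ultimately show ?thesis by simp
 qed
qed

definition restarted :: "nat => nat => 'b path => (nat => real ^ 'b) => 'b path" where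
 "restarted n i z u = euler_path T n \<sigma> (t + gtime n i) (concat_path T t w z) u"

abbreviation "restart n x \<equiv> restarted n (index n x) (X0 x)"

lemma restarted_Omega: "restarted n i z u \<in> Omega T"
 unfolding restarted_def by (rule euler_path_in_Omega[OF T_pos])

lemma restarted_measurable:
 assumes "Z \<in> measurable N (paths T)" "u \<in> borel_measurable N"
 shows "(%x. restarted n i (Z x) (u x)) \<in> measurable N (paths T)"
 unfolding restarted_def
 by (rule euler_path_measurable[OF T_pos coeff_ca gtime_range(3,4) concat_path_measurable assms(2)])
  (use assms t w in auto)

lemma restarted_freeze: "z \<in> Omega T ==> restarted n i (freeze T (gtime n i) z) u = restarted n i z u"
proof -
 assume z: "z \<in> Omega T"
 have "euler_coeff T n \<sigma> (t + gtime n i) (concat_path T t w (freeze T (gtime n i) z))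
   = euler_coeff T n \<sigma> (t + gtime n i) (concat_path T t w z)"
  by (rule euler_coeff_cong) (use gtime_range[of n i] t in "auto simp: concat_path_def freeze_def restrict_def")
 then show ?thesis by (simp add: restarted_def euler_path_def)
qed

text \<open>Other increments are multiplied by zero coefficients: a restart at
  \<open>gtime n i\<close> leaves at most \<open>2^n - i\<close> steps before
  \<open>T\<close>.\<close>

lemma restarted_cong:
 assumes "!!k. i + k < 2^n ==> u k = u' k"
 shows "restarted n i z u = restarted n i z u'"
proof -
 have "euler T n (euler_coeff T n \<sigma> (t + gtime n i) (concat_path T t w z)) u (2^n)
   = euler T n (euler_coeff T n \<sigma> (t + gtime n i) (concat_path T t w z)) u' (2^n)"
 proof (rule euler_cong_increments)
  fix k :: nat
  show "u k = u' k \<or> (\<forall>v. euler_coeff T n \<sigma> (t + gtime n i) (concat_path T t w z) k v = 0)"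
  proof (cases "i + k < 2^n")
   case False
   have "T < t + gtime n i + grid T n (Suc k)"
   proof (cases "grid T n i <= S")
    case True
    have "grid T n (2^n) < grid T n (i + Suc k)" using False by (subst grid_less_iff[OF T_pos]) simp
    then have "T < grid T n i + grid T n (Suc k)" by (simp add: grid_add[of T n i "Suc k", symmetric])
    moreover have "gtime n i = grid T n i" using True by (simp add: gtime_def)
    ultimately show ?thesis using t by simp
   next
    case False
    have "0 < grid T n (Suc k)" using T_pos by (simp add: grid_def)
    then show ?thesis using False by (simp add: gtime_def)
   qed
   then show ?thesis by (simp add: euler_coeff_def)
  qed (use assms in simp)
 qed
 then show ?thesis by (simp add: restarted_def euler_path_def)
qed

text \<open>The strong Markov property of the scheme. Once split by the value \<open>i\<close> of
  the rounded index, everything before the restart is measurable at \<open>grid T n i\<close>, and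
  \<open>increments_restart\<close> exchanges the later increments for an independent copy, carried
  by the second variable \<open>y\<close>.\<close>

lemma restart_identity:
 fixes f :: "'b path => ennreal" and F :: "'b path => ennreal"
 assumes f: "f \<in> borel_measurable (paths T)" and F: "F \<in> borel_measurable (paths T)"
 shows "(\<integral>\<^sup>+x. f (past x) * F (restart n x (%k. increments n (index n x) k x)) \<partial>M)
  = (\<integral>\<^sup>+x. f (past x) * (\<integral>\<^sup>+y. F (restart n x (incr n 0 (2^n) y)) \<partial>M) \<partial>M)"
proof -
 define Z where "Z i x = freeze T (gtime n i) (X0 x)" for i x
 define E where "E i = (%(z, u). (if idx n z = i then f (frozen z) * F (restarted n i z u) else 0))" for i
 let ?A = "%i x. E i (Z i x, incr n i (2^n - i) x)" and ?B = "%i x y. E i (Z i x, incr n 0 (2^n) y)"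
 let ?F = "%x y. F (restart n x (incr n 0 (2^n) y))" and ?N = "paths T \<Otimes>\<^sub>M (borel :: (nat => real ^ 'b) measure)"
 have idx_set: "{z \<in> Omega T. idx n z = i} \<in> sets (paths T)" for i
  using measurable_sets[OF idx_measurable, of "{i}" n] by (simp add: vimage_def Int_def conj_commute)
 have Em: "E i \<in> borel_measurable ?N" for i
  unfolding E_def split_beta
 proof (rule measurable_If)
  show "(%p. f (frozen (fst p)) * F (restarted n i (fst p) (snd p))) \<in> borel_measurable ?N"
  proof (rule borel_measurable_times_ennreal)
   show "(%p. f (frozen (fst p))) \<in> borel_measurable ?N"
    by (rule measurable_compose[OF measurable_compose[OF measurable_fst frozen_measurable] f])
   show "(%p. F (restarted n i (fst p) (snd p))) \<in> borel_measurable ?N"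
    by (rule measurable_compose[OF restarted_measurable F]) auto
  qed
  have "{p \<in> space ?N. idx n (fst p) = i}
   = fst -` {z \<in> Omega T. idx n z = i} \<inter> space ?N"
   by (auto simp: space_pair_measure)
  also have "... \<in> sets ?N"
   by (rule measurable_sets[OF measurable_fst idx_set])
  finally show "{p \<in> space ?N. idx n (fst p) = i} \<in> sets ?N" .
 qed simp
 have ZM: "Z i \<in> measurable M (paths T)" for i
  unfolding Z_def[abs_def] by (rule freeze_measurable[OF X0_measurable]) (use gtime_range in auto)
 have EZ: "E i (Z i x, u) = (if index n x = i then f (past x) * F (restarted n i (X0 x) u) else 0)"
  if "x \<in> space M" for i x u
  using idx_freeze[OF X0_Omega[OF that], of n i] restarted_freeze[OF X0_Omega[OF that], of n i u]
  by (simp add: E_def Z_def)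
 have main: "(\<integral>\<^sup>+x. ?A i x \<partial>M) = (\<integral>\<^sup>+x. \<integral>\<^sup>+y. ?B i x y \<partial>M \<partial>M)"
  if i: "i <= 2^n" for i
 \<comment> \<open>A grid time not beyond \<open>S\<close> equals \<open>gtime n i\<close>;
   otherwise all coefficients vanish and the scheme does not depend on the increments.\<close>
 proof (cases "grid T n i <= S")
  case True
  have ZG: "Z i \<in> measurable (G (grid T n i)) (paths T)"
  proof -
   have gt: "gtime n i = grid T n i" using True by (simp add: gtime_def)
   show ?thesis
    unfolding Z_def[abs_def] gt
    by (rule measurable_compose[OF solution_adapted[OF X0_solution True] freeze_adapted])
     (use gtime_range(1)[of n i] gt in simp)
  qed
  have cut: "restarted n i z (incr n 0 (2^n - i) y) = restarted n i z (incr n 0 (2^n) y)" for z y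
   by (rule restarted_cong) (auto simp: incr_def)
  have "(\<integral>\<^sup>+x. ?A i x \<partial>M) = (\<integral>\<^sup>+x. \<integral>\<^sup>+y. E i (Z i x, incr n 0 (2^n - i) y) \<partial>M \<partial>M)"
   by (rule increments_restart[OF _ ZG Em]) (use i in simp)
  moreover have "E i (z, incr n 0 (2^n - i) y) = E i (z, incr n 0 (2^n) y)" for z y
   unfolding E_def prod.case cut by (rule refl)
  ultimately show ?thesis by (simp only:)
 next
  case False
  have const: "restarted n i z u = restarted n i z u'" for z u u'
  proof -
   have "euler_coeff T n \<sigma> (t + gtime n i) (concat_path T t w z) k v = 0" for k v
   proof -
    have "0 < grid T n (Suc k)" using T_pos by (simp add: grid_def)
    then show ?thesis using False by (simp add: euler_coeff_def gtime_def)
   qed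
   then have "euler T n (euler_coeff T n \<sigma> (t + gtime n i) (concat_path T t w z)) u (2^n)
    = euler T n (euler_coeff T n \<sigma> (t + gtime n i) (concat_path T t w z)) u' (2^n)"
    by (intro euler_cong_increments) auto
   then show ?thesis by (simp add: restarted_def euler_path_def)
  qed
  have c: "E i (z, u) = E i (z, %_. 0)" for z u
   unfolding E_def prod.case const[of z u "%_. 0"] by (rule refl)
  show ?thesis
   unfolding c[of _ "incr n i (2^n - i) _"] c[of _ "incr n 0 (2^n) _"] by (simp add: emeasure_space_1)
 qed
 have sum1: "f (past x) * F (restart n x (%k. increments n (index n x) k x))
  = (\<Sum>i\<le>2^n. ?A i x)" if x: "x \<in> space M" for x
 proof -
  have "(\<Sum>i\<le>2^n. ?A i x) = f (past x) * F (restart n x (incr n (index n x) (2^n - index n x) x))"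
   using idx_le[OF X0_Omega[OF x], of n] by (simp add: EZ[OF x])
  also have "restart n x (incr n (index n x) (2^n - index n x) x) = restart n x (%k. increments n (index n x) k x)"
   by (rule restarted_cong) (auto simp: incr_def increments_def)
  finally show ?thesis by simp
 qed
 have sum2: "f (past x) * (\<integral>\<^sup>+y. ?F x y \<partial>M)
  = (\<Sum>i\<le>2^n. \<integral>\<^sup>+y. ?B i x y \<partial>M)" if x: "x \<in> space M" for x
 proof -
  have "(\<Sum>i\<le>2^n. \<integral>\<^sup>+y. ?B i x y \<partial>M)
   = (\<Sum>i\<le>2^n. if i = index n x then (\<integral>\<^sup>+y. f (past x) * ?F x y \<partial>M) else 0)"
   by (intro sum.cong) (auto simp: EZ[OF x])
  also have "... = (\<integral>\<^sup>+y. f (past x) * ?F x y \<partial>M)"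
   using idx_le[OF X0_Omega[OF x], of n] by simp
  also have "... = f (past x) * (\<integral>\<^sup>+y. ?F x y \<partial>M)"
  proof (rule nn_integral_cmult)
   show "(%y. ?F x y) \<in> borel_measurable M"
    by (rule measurable_compose[OF restarted_measurable F]) (use X0_Omega[OF x] incr_measurable[of 0 "2^n" n] in auto)
  qed
  finally show ?thesis by simp
 qed
 have m1: "(%x. ?A i x) \<in> borel_measurable M" if "i <= 2^n" for i
  by (rule measurable_compose[OF _ Em]) (use ZM incr_measurable[of i "2^n - i" n] that in auto)
 have m2: "(%x. \<integral>\<^sup>+y. ?B i x y \<partial>M) \<in> borel_measurable M" for i
 proof (rule borel_measurable_nn_integral)
  show "(%(x, y). ?B i x y) \<in> borel_measurable (M \<Otimes>\<^sub>M M)"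
   unfolding split_beta
   by (rule measurable_compose[OF _ Em])
    (intro measurable_Pair measurable_compose[OF measurable_fst ZM] measurable_compose[OF measurable_snd incr_measurable], simp)
 qed
 have "(\<integral>\<^sup>+x. f (past x) * F (restart n x (%k. increments n (index n x) k x)) \<partial>M)
  = (\<integral>\<^sup>+x. (\<Sum>i\<le>2^n. ?A i x) \<partial>M)"
  by (intro nn_integral_cong sum1)
 also have "... = (\<Sum>i\<le>2^n. \<integral>\<^sup>+x. ?A i x \<partial>M)"
  by (intro nn_integral_sum m1) auto
 also have "... = (\<Sum>i\<le>2^n. \<integral>\<^sup>+x. \<integral>\<^sup>+y. ?B i x y \<partial>M \<partial>M)"
  by (intro sum.cong main) auto
 also have "... = (\<integral>\<^sup>+x. (\<Sum>i\<le>2^n. \<integral>\<^sup>+y. ?B i x y \<partial>M) \<partial>M)"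
  by (rule nn_integral_sum[symmetric]) (rule m2)
 also have "... = (\<integral>\<^sup>+x. f (past x) * (\<integral>\<^sup>+y. ?F x y \<partial>M) \<partial>M)"
  by (intro nn_integral_cong sum2[symmetric])
 finally show ?thesis .
qed

end

section \<open>From Lipschitz functionals to cylinder sets\<close>

text \<open>The constraints are closed because the indicator of a closed set is a limit of Lipschitz
  functions of the distance. The family is stable under intersection and generates, as uniqueness of
  measures demands.\<close>

definition cylinders :: "real => ('d::finite) path set set" where
 "cylinders T = {{z \<in> Omega T. \<forall>s\<in>I. z s \<in> C s} | I C. finite I \<and> I \<subseteq> {0..T} \<and> (\<forall>s. closed (C s))}"

lemma cylinder_in_sets:
 assumes "A \<in> cylinders T" shows "A \<in> sets (paths T)"
proof -
 obtain I C where A: "A = {z \<in> Omega T. \<forall>s\<in>I. z s \<in> C s}" "finite I" "I \<subseteq> {0..T}" "!!s. closed (C s)"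
  using assms by (auto simp: cylinders_def)
 have "{z \<in> space (paths T). \<forall>s\<in>I. z s \<in> C s} \<in> sets (paths T)"
 proof (rule sets.sets_Collect_finite_All[OF _ A(2)])
  fix s assume "s \<in> I"
  then have "(%z. z s) \<in> borel_measurable (paths T)" using A(3) by (intro coordinate_measurable) auto
  from measurable_sets[OF this borel_closed[OF A(4)[of s]]]
  show "{z \<in> space (paths T). z s \<in> C s} \<in> sets (paths T)"
   by (simp add: vimage_def Int_def conj_commute)
 qed
 then show ?thesis by (simp add: A(1))
qed

lemma cylinders_Pow: "cylinders T \<subseteq> Pow (Omega T)"
 by (auto simp: cylinders_def)

lemma Omega_in_cylinders: "Omega T \<in> cylinders T"
 unfolding cylinders_def by (rule CollectI, intro exI[of _ "{}"] exI[of _ "%_. UNIV"]) auto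

lemma Int_stable_cylinders: "Int_stable (cylinders T)"
proof (rule Int_stableI)
 fix A B :: "'d::finite path set" assume A: "A \<in> cylinders T" and B: "B \<in> cylinders T"
 obtain I C where A: "A = {z \<in> Omega T. \<forall>s\<in>I. z s \<in> C s}" "finite I" "I \<subseteq> {0..T}" "!!s. closed (C s)"
  using A by (auto simp: cylinders_def)
 obtain I' C' where B: "B = {z \<in> Omega T. \<forall>s\<in>I'. z s \<in> C' s}" "finite I'" "I' \<subseteq> {0..T}" "!!s. closed (C' s)"
  using B by (auto simp: cylinders_def)
 define D where "D s = (if s \<in> I then C s else UNIV) \<inter> (if s \<in> I' then C' s else UNIV)" for s
 have "A \<inter> B = {z \<in> Omega T. \<forall>s\<in>I \<union> I'. z s \<in> D s}" unfolding A(1) B(1) D_def by auto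
 moreover have "closed (D s)" for s unfolding D_def using A(4) B(4) by auto
 ultimately show "A \<inter> B \<in> cylinders T"
  unfolding cylinders_def using A(2,3) B(2,3) by (intro CollectI exI[of _ "I \<union> I'"] exI[of _ D]) auto
qed

lemma sets_cylinders: "sets (paths T) = sigma_sets (Omega T) (cylinders T :: ('d::finite) path set set)"
proof
 let ?N = "sigma (Omega T) (cylinders T :: 'd path set set)"
 have sN: "sets ?N = sigma_sets (Omega T) (cylinders T)" by (rule sets_measure_of[OF cylinders_Pow])
 have spN: "space ?N = Omega T" by (rule space_measure_of[OF cylinders_Pow])
 have "(%z. z) \<in> measurable ?N (paths T)"
 proof (rule measurable_into_path_space)
  fix r assume r: "0 <= r" "r <= T"
  show "(%z. z r) \<in> borel_measurable ?N"
  proof (rule borel_measurableI)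
   fix U :: "(real ^ 'd) set" assume U: "open U"
   have "{z \<in> Omega T. \<forall>s\<in>{r}. z s \<in> - U} \<in> cylinders T"
    unfolding cylinders_def using r U by (intro CollectI exI[of _ "{r}"] exI[of _ "%_. - U"]) (auto simp: closed_def)
   then have "{z \<in> Omega T. z r \<in> - U} \<in> sets ?N" unfolding sN by (intro sigma_sets.Basic) simp
   from sets.compl_sets[OF this] show "(%z. z r) -` U \<inter> space ?N \<in> sets ?N"
    unfolding spN by (rule back_subst[where P="%A. A \<in> sets ?N"]) auto
  qed
 qed (simp add: spN)
 then show "sets (paths T) \<subseteq> sigma_sets (Omega T) (cylinders T :: 'd path set set)"
  unfolding sN[symmetric] using measurable_sets[of "%z. z" ?N "paths T"] sets.sets_into_space[of _ "paths T"] spN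
  by (fastforce simp: vimage_def Int_absorb2)
 show "sigma_sets (Omega T) (cylinders T :: 'd path set set) \<subseteq> sets (paths T)"
  using sets.sigma_sets_subset[of "cylinders T" "paths T"] cylinder_in_sets by auto
qed

text \<open>\<open>infdist\<close> to the empty set is 0 by convention; with the value 1 instead,
  the distance to a closed set vanishes exactly on the set.\<close>

definition closed_dist :: "'a::metric_space set => 'a => real" where
 "closed_dist C x = (if C = {} then 1 else infdist x C)"

lemma closed_dist_nonneg: "0 <= closed_dist C x"
 by (simp add: closed_dist_def infdist_nonneg)

lemma closed_dist_eq_0_iff: "closed C ==> closed_dist C x = 0 \<longleftrightarrow> x \<in> C"
 using in_closed_iff_infdist_zero[of C x] by (auto simp: closed_dist_def)

lemma closed_dist_lipschitz: "\<bar>closed_dist C x - closed_dist C y\<bar> <= dist x y"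
 by (simp add: closed_dist_def infdist_triangle_abs)

text \<open>The functionals \<open>max 0 (1 - m * c)\<close> with \<open>c\<close> the sum of the
  distances at the finitely many constrained times: \<open>c\<close> is Lipschitz in the path and
  vanishes exactly on the cylinder.\<close>

lemma cylinder_approximation:
 fixes A :: "('d::finite) path set"
 assumes T: "T \<ge> 0" and "A \<in> cylinders T"
 obtains F where "!!m::nat. lipschitz_functional T (F m)" "!!z. z \<in> Omega T ==> (%m. F m z) \<longlonglongrightarrow> indicator A z"
proof -
 obtain I C where A: "A = {z \<in> Omega T. \<forall>s\<in>I. z s \<in> C s}" "finite I" "I \<subseteq> {0..T}" "!!s. closed (C s)"
  using assms(2) by (auto simp: cylinders_def)
 define c where "c z = (\<Sum>s\<in>I. closed_dist (C s) (z s))" for z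
 have c0: "0 <= c z" for z unfolding c_def by (intro sum_nonneg closed_dist_nonneg)
 define F where "F m z = max 0 (1 - real m * c z)" for m z
 have cL: "\<bar>c w - c w'\<bar> <= real (card I) * a" if "\<forall>s\<in>{0..T}. norm (w s - w' s) <= a" for w w' a
 proof -
  have "\<bar>c w - c w'\<bar> <= (\<Sum>s\<in>I. \<bar>closed_dist (C s) (w s) - closed_dist (C s) (w' s)\<bar>)"
   unfolding c_def sum_subtractf[symmetric] by (rule sum_abs)
  also have "... <= (\<Sum>s\<in>I. a)"
   using that A(3) by (intro sum_mono order_trans[OF closed_dist_lipschitz]) (auto simp: dist_norm)
  finally show ?thesis by simp
 qed
 show thesis
 proof (rule that)
  show "lipschitz_functional T (F m)" for m
   unfolding lipschitz_functional_def
  proof (intro conjI ballI exI[of _ "real m * real (card I) + 1"] allI impI)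
   show "0 <= F m w" "F m w <= 1" for w using c0 by (auto simp: F_def)
   fix w w' :: "'d path" and a assume w: "w \<in> Omega T" and a: "\<forall>s\<in>{0..T}. norm (w s - w' s) <= a"
   have a0: "0 <= a" using a T by (meson atLeastAtMost_iff norm_ge_zero order_refl order_trans)
   have "\<bar>F m w - F m w'\<bar> <= \<bar>real m * c w - real m * c w'\<bar>" by (simp add: F_def max_def abs_if)
   also have "... = real m * \<bar>c w - c w'\<bar>" by (simp add: right_diff_distrib[symmetric] abs_mult)
   also have "... <= real m * (real (card I) * a)" by (intro mult_left_mono cL a) simp
   also have "... <= (real m * real (card I) + 1) * a" using a0 by (simp add: distrib_right)
   finally show "\<bar>F m w - F m w'\<bar> <= (real m * real (card I) + 1) * a" .
  qed (simp add: add_nonneg_pos)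
  fix z :: "'d path" assume z: "z \<in> Omega T"
  show "(%m. F m z) \<longlonglongrightarrow> indicator A z"
  proof (cases "z \<in> A")
   case True
   then have "c z = 0" unfolding c_def A(1) by (intro sum.neutral) (simp add: closed_dist_eq_0_iff A(4))
   then show ?thesis using True by (simp add: F_def)
  next
   case False
   then obtain s where s: "s \<in> I" "z s \<notin> C s" using z by (auto simp: A(1))
   have "closed_dist (C s) (z s) <= c z"
    unfolding c_def by (rule member_le_sum[OF s(1)]) (auto simp: closed_dist_nonneg A(2))
   moreover have "closed_dist (C s) (z s) > 0"
    using closed_dist_eq_0_iff[OF A(4)[of s], of "z s"] s closed_dist_nonneg[of "C s" "z s"] by linarith
   ultimately have cz: "c z > 0" by linarith
   obtain N :: nat where N: "1 / c z <= real N" using real_arch_simple by blast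
   have "F m z = 0" if "m \<ge> N" for m
   proof -
    have "1 / c z <= real m" using N that by linarith
    then show ?thesis using cz by (simp add: F_def divide_le_eq)
   qed
   then have "\<forall>\<^sub>F m in sequentially. F m z = indicator A z" using False by (auto simp: eventually_sequentially)
   then show ?thesis by (rule tendsto_eventually)
  qed
 qed
qed

context path_sde_stopped
begin

lemma \<kappa>_prob: "z \<in> Omega T ==> prob_space (\<kappa> z)"
 unfolding \<kappa>_def using U_range[of z] t w frozen_Omega[of z]
 by (intro prob_space_law concat_path_in_Omega) auto

lemma sets_\<kappa> [simp]: "sets (\<kappa> z) = sets (paths T)" and space_\<kappa> [simp]: "space (\<kappa> z) = Omega T"
 by (simp_all add: \<kappa>_def)

lemma \<kappa>_frozen: "z \<in> Omega T ==> \<kappa> (frozen z) = \<kappa> z"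
 by (simp add: \<kappa>_def U_frozen frozen_frozen)

definition approx_kernel :: "nat => ('b path => real) => 'b path => real" where
 "approx_kernel n F z = expectation (%y. F (restarted n (idx n z) z (incr n 0 (2^n) y)))"

lemma approx_kernel_measurable:
 assumes F: "lipschitz_functional T F"
 shows "approx_kernel n F \<in> borel_measurable (paths T)"
 unfolding approx_kernel_def[abs_def]
proof (rule measurable_compose_countable[OF _ idx_measurable])
 fix i
 show "(%z. expectation (%y. F (restarted n i z (incr n 0 (2^n) y)))) \<in> borel_measurable (paths T)"
 proof (rule borel_measurable_lebesgue_integral)
  show "(%(z, y). F (restarted n i z (incr n 0 (2^n) y))) \<in> borel_measurable (paths T \<Otimes>\<^sub>M M)"
   unfolding split_beta
   by (rule measurable_compose[OF restarted_measurable lipschitz_functional_measurable[OF T_pos F]])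
    (auto intro: measurable_compose[OF measurable_snd incr_measurable])
 qed
qed

lemma approx_kernel_converges:
 assumes F: "lipschitz_functional T F" and z: "z \<in> Omega T"
 shows "(%n. approx_kernel n F z) \<longlonglongrightarrow> integral\<^sup>L (\<kappa> z) F"
 unfolding approx_kernel_def restarted_def \<kappa>_def
proof (rule euler_law_converges[OF _ _ _ _ _ _ _ F])
 show "0 <= t + U z" using t U_range[OF z] by simp
 show "t + U z <= t + gtime n (idx n z)" "t + gtime n (idx n z) <= T" "t + gtime n (idx n z) <= t + U z + T / 2^n" for n
  using gtime_idx[OF z, of n] gtime_range(4)[of n "idx n z"] by auto
 show "concat_path T t w z \<in> Omega T" "concat_path T t w (frozen z) \<in> Omega T"
  using t w z frozen_Omega[OF z] by (auto intro!: concat_path_in_Omega)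
 show "concat_path T t w z r = concat_path T t w (frozen z) r" if "0 <= r" "r <= t + U z" for r
  using that t frozen_eq[OF z, of "r - t"] by (auto simp: concat_path_def restrict_def)
qed

text \<open>Measurability of \<kappa> in the observed path originates here, from a pointwise limit
  of the explicit kernels of the scheme.\<close>

lemma kernel_functional_measurable:
 assumes F: "lipschitz_functional T F"
 shows "(%z. integral\<^sup>L (\<kappa> z) F) \<in> borel_measurable (paths T)"
 by (rule borel_measurable_LIMSEQ_metric[OF approx_kernel_measurable[OF F]])
  (use approx_kernel_converges[OF F] in simp)

lemma expectation_range:
 assumes "!!x. x \<in> space M ==> 0 <= f x \<and> f x <= (1::real)" "f \<in> borel_measurable M"
 shows "0 <= expectation f \<and> expectation f <= 1" "(\<integral>\<^sup>+x. ennreal (f x) \<partial>M) = ennreal (expectation f)"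
proof -
 have i: "integrable M f" by (rule integrable_const_bound[of _ 1]) (use assms in auto)
 have "expectation f <= expectation (%_. 1)" by (rule integral_mono[OF i]) (use assms in auto)
 then show "0 <= expectation f \<and> expectation f <= 1"
  using assms by (simp add: prob_space integral_nonneg_AE)
 show "(\<integral>\<^sup>+x. ennreal (f x) \<partial>M) = ennreal (expectation f)"
  by (rule nn_integral_eq_integral[OF i]) (use assms in auto)
qed

text \<open>\<open>restart_identity\<close> is passed to the limit on both sides: on the left the
  restarted scheme approaches the tail of the solution in probability, on the right its laws
  converge to \<kappa> for every path.\<close>

lemma strong_markov_functional:
 assumes F: "lipschitz_functional T F" and A: "A \<in> sets (paths T)"
 shows "expectation (%x. indicator A (past x) * F (future x))
  = expectation (%x. indicator A (past x) * integral\<^sup>L (kern x) F)"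
proof -
 let ?i = "%x. indicator A (past x)" and ?k = "%n x. approx_kernel n F (X0 x)"
 note Fm = lipschitz_functional_measurable[OF T_pos F]
 define Y where "Y n x = restart n x (%k. increments n (index n x) k x)" for n x
 have fX: "(%x. past x) \<in> measurable M (paths T)"
  by (rule measurable_compose[OF X0_measurable frozen_measurable])
 have Am [measurable]: "(%x. indicator A (past x) :: real) \<in> borel_measurable M"
  by (rule measurable_compose[OF fX]) (use A in simp)
 have iX: "(%x. index n x) \<in> measurable M (count_space UNIV)" for n
  by (rule measurable_compose[OF X0_measurable idx_measurable])
 have incm: "(%x k. increments n i k x) \<in> borel_measurable M" for n i
  by (rule measurable_coordinatewise_then_product) (rule increments_measurable)
 have Ym: "(%x. F (Y n x)) \<in> borel_measurable M" for n
  unfolding Y_def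
  by (rule measurable_compose_countable[OF _ iX])
   (rule measurable_compose[OF restarted_measurable[OF X0_measurable incm] Fm])
 have tm: "(%x. future x) \<in> measurable M (paths T)"
  by (rule tail_measurable[OF X0_measurable measurable_compose[OF X0_measurable U_measurable]])
   (use U_range X0_Omega in auto)
 have tO: "future x \<in> Omega T" if "x \<in> space M" for x
  using measurable_space[OF tm that] by simp
 have F01: "0 <= F z \<and> F z <= 1" if "z \<in> Omega T" for z by (rule lipschitz_functional_range[OF F that])
 have YO: "Y n x \<in> Omega T" for n x unfolding Y_def by (rule restarted_Omega)
 have km: "(%x. ?k n x) \<in> borel_measurable M" for n
  by (rule measurable_compose[OF X0_measurable approx_kernel_measurable[OF F]])
 have rm: "(%y. F (restarted n i z (incr n 0 (2^n) y))) \<in> borel_measurable M" if "z \<in> Omega T" for n i z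
  by (rule measurable_compose[OF restarted_measurable Fm]) (use that incr_measurable[of 0 "2^n" n] in auto)
 have k01: "0 <= approx_kernel n F z \<and> approx_kernel n F z <= 1" if "z \<in> Omega T" for n z
  unfolding approx_kernel_def by (rule expectation_range(1)[OF _ rm[OF that]]) (rule F01[OF restarted_Omega])
 have eq: "expectation (%x. indicator A (past x) * F (Y n x)) = expectation (%x. indicator A (past x) * ?k n x)" for n
 proof -
  have "(\<integral>\<^sup>+x. indicator A (past x) * ennreal (F (Y n x)) \<partial>M)
   = (\<integral>\<^sup>+x. indicator A (past x) * (\<integral>\<^sup>+y. ennreal (F (restart n x (incr n 0 (2^n) y))) \<partial>M) \<partial>M)"
   unfolding Y_def by (rule restart_identity) (use A Fm in auto)
  also have "... = (\<integral>\<^sup>+x. indicator A (past x) * ennreal (?k n x) \<partial>M)"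
  proof (intro nn_integral_cong arg_cong2[where f="(*)"] refl)
   fix x assume "x \<in> space M"
   then show "(\<integral>\<^sup>+y. ennreal (F (restart n x (incr n 0 (2^n) y))) \<partial>M) = ennreal (?k n x)"
    unfolding approx_kernel_def by (intro expectation_range(2) rm X0_Omega F01 restarted_Omega)
  qed
  finally have "(\<integral>\<^sup>+x. ennreal (indicator A (past x) * F (Y n x)) \<partial>M) = (\<integral>\<^sup>+x. ennreal (indicator A (past x) * ?k n x) \<partial>M)"
   by (simp add: ennreal_mult' ennreal_indicator)
  moreover have "(\<integral>\<^sup>+x. ennreal (indicator A (past x) * F (Y n x)) \<partial>M) = ennreal (expectation (%x. indicator A (past x) * F (Y n x)))"
   by (rule expectation_range(2)) (use Am Ym F01[OF YO] in "auto simp: indicator_def")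
  moreover have "(\<integral>\<^sup>+x. ennreal (indicator A (past x) * ?k n x) \<partial>M) = ennreal (expectation (%x. indicator A (past x) * ?k n x))"
   by (rule expectation_range(2)) (use Am km k01[OF X0_Omega] in "auto simp: indicator_def")
  moreover have "0 <= expectation (%x. indicator A (past x) * F (Y n x))"
   by (intro Bochner_Integration.integral_nonneg) (use F01[OF YO] in "auto simp: indicator_def")
  moreover have "0 <= expectation (%x. indicator A (past x) * ?k n x)"
   by (intro integral_nonneg_AE AE_I2) (use k01[OF X0_Omega] in "auto simp: indicator_def")
  ultimately show ?thesis by simp
 qed
 have lim1: "(%n. expectation (%x. indicator A (past x) * F (Y n x))) \<longlonglongrightarrow> expectation (%x. indicator A (past x) * F (future x))"
 proof (rule bounded_convergence_in_probability[where K=1])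
  show "(%x. indicator A (past x) * F (Y n x)) \<in> borel_measurable M" for n using Am Ym by simp
  show "(%x. indicator A (past x) * F (future x)) \<in> borel_measurable M"
   using Am measurable_compose[OF tm Fm] by simp
  show "\<bar>indicator A (past x) * F (Y n x)\<bar> <= 1" for n x using F01[OF YO, of n x] by (simp add: indicator_def)
  show "\<bar>indicator A (past x) * F (future x)\<bar> <= 1" if "x \<in> space M" for x
   using F01[OF tO[OF that]] by (simp add: indicator_def)
  fix e :: real assume eps: "e > 0"
  have v: "vanishing M (%n. {x \<in> space M. e < \<bar>F (Y n x) - F (future x)\<bar>})"
  proof (rule lipschitz_functional_vanishing[OF F, where Y=Y and Z="%n x. future x", OF YO tO _ eps])
   fix b :: real assume eta: "b > 0"
   \<comment> \<open>\<open>E\<close> compares the scheme with the tail from the rounded time;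
     \<open>B\<close> accounts for the rounding, which changes the tail at two places. The budget is
     \<open>b/2 + b/4 + b/4\<close>.\<close>
   define E where "E n = {x \<in> space M. \<exists>s\<in>{0..T}. b/2 < norm (Y n x s - tail T (gtime n (index n x)) (X0 x) s)}" for n
   define B where "B n = {x \<in> space M. \<exists>r\<in>{0..T}. \<exists>r'\<in>{0..T}. \<bar>r - r'\<bar> <= T / 2^n \<and> b/4 < norm (X0 x r - X0 x r')}" for n
   have eta2: "b / 2 > 0" using eta by simp
   have vE: "vanishing M E"
    unfolding E_def[abs_def] Y_def restarted_def gtime_def idx_def
    by (rule euler_restart_converges[OF coeff t w X0_solution st le_S eta2])
   have vB: "vanishing M B" unfolding B_def[abs_def] by (rule solution_oscillation[OF X0_solution T_pos]) (use eta in simp)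
   show "vanishing M (%n. {x \<in> space M. \<exists>s\<in>{0..T}. b < norm (Y n x s - future x s)})"
   proof (rule vanishing_mono[OF vanishing_Un[OF vE vB]])
    fix n :: nat assume "n \<ge> 0"
    show "{x \<in> space M. \<exists>s\<in>{0..T}. b < norm (Y n x s - future x s)} \<subseteq> E n \<union> B n"
    proof (rule subsetI, rule ccontr)
     fix x assume x0: "x \<in> {x \<in> space M. \<exists>s\<in>{0..T}. b < norm (Y n x s - future x s)}" and nx: "x \<notin> E n \<union> B n"
     then obtain s where x: "x \<in> space M" and s: "s \<in> {0..T}" "b < norm (Y n x s - future x s)" by blast
     define g where "g = gtime n (index n x)"
     have g: "U (X0 x) <= g" "g <= U (X0 x) + T / 2^n" "0 <= g" "g <= T"
      using gtime_idx[OF X0_Omega[OF x], of n] gtime_range[of n "index n x"] t by (auto simp: g_def)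
     have U: "0 <= U (X0 x)" "U (X0 x) <= T" using U_range[OF X0_Omega[OF x]] by auto
     have osc: "norm (X0 x r - X0 x r') <= b/4" if "r \<in> {0..T}" "r' \<in> {0..T}" "\<bar>r - r'\<bar> <= T / 2^n" for r r'
      using nx x that by (auto simp: B_def not_less)
     have 1: "norm (Y n x s - tail T g (X0 x) s) <= b/2" using nx x s by (auto simp: E_def g_def not_less)
     have 2: "norm (X0 x (min (g + s) T) - X0 x (min (U (X0 x) + s) T)) <= b/4" using g U s by (intro osc) auto
     have 3: "norm (X0 x g - X0 x (U (X0 x))) <= b/4" using g U by (intro osc) auto
     have "Y n x s - future x s = (Y n x s - tail T g (X0 x) s) + ((X0 x (min (g + s) T) - X0 x (min (U (X0 x) + s) T)) - (X0 x g - X0 x (U (X0 x))))"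
      using s by (simp add: tail_def)
     then have "norm (Y n x s - future x s) <= norm (Y n x s - tail T g (X0 x) s) + (norm (X0 x (min (g + s) T) - X0 x (min (U (X0 x) + s) T)) + norm (X0 x g - X0 x (U (X0 x))))"
      by (simp only: order_trans[OF norm_triangle_ineq add_left_mono[OF norm_triangle_ineq4]])
     then show False using 1 2 3 s(2) by simp
    qed
   qed
  qed
  show "vanishing M (%n. {x \<in> space M. e < \<bar>indicator A (past x) * F (Y n x) - indicator A (past x) * F (future x)\<bar>})"
   by (rule vanishing_mono[OF v]) (use eps in "auto simp: indicator_def split: if_splits")
 qed
 have lim2: "(%n. expectation (%x. indicator A (past x) * ?k n x)) \<longlonglongrightarrow> expectation (%x. indicator A (past x) * integral\<^sup>L (kern x) F)"
 proof (rule integral_dominated_convergence[where w="%_. 1"])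
  show "(%x. indicator A (past x) * integral\<^sup>L (kern x) F) \<in> borel_measurable M"
   using Am measurable_compose[OF X0_measurable kernel_functional_measurable[OF F]] by simp
  show "(%x. indicator A (past x) * ?k n x) \<in> borel_measurable M" for n using Am km by simp
  show "AE x in M. (%n. indicator A (past x) * ?k n x) \<longlonglongrightarrow> indicator A (past x) * integral\<^sup>L (kern x) F"
   by (intro AE_I2 tendsto_mult tendsto_const approx_kernel_converges[OF F] X0_Omega)
  show "AE x in M. norm (indicator A (past x) * ?k n x) <= 1" for n
   by (intro AE_I2) (use k01[OF X0_Omega] in "auto simp: indicator_def")
 qed simp
 show ?thesis using LIMSEQ_unique[OF lim1] lim2 unfolding eq by blast
qed

end

context path_sde_stopped
begin

lemma kernel_indicator:
 assumes B: "B \<in> cylinders T"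
 shows "(%z. measure (\<kappa> z) B) \<in> borel_measurable (paths T)"
  and "A \<in> sets (paths T) ==>
   prob {x \<in> space M. past x \<in> A \<and> future x \<in> B}
    = expectation (%x. indicator A (past x) * measure (kern x) B)"
proof -
 obtain F where F: "!!m::nat. lipschitz_functional T (F m)" "!!z. z \<in> Omega T ==> (%m. F m z) \<longlonglongrightarrow> indicator B z"
  by (rule cylinder_approximation[OF less_imp_le[OF T_pos] B]) blast
 note Fm = lipschitz_functional_measurable[OF T_pos F(1)]
 have Bs: "B \<in> sets (paths T)" by (rule cylinder_in_sets[OF B])
 have BO: "B \<subseteq> Omega T" using sets.sets_into_space[OF Bs] by simp
 have F01: "0 <= F m z \<and> F m z <= 1" if "z \<in> Omega T" for m z by (rule lipschitz_functional_range[OF F(1) that])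
 have lim: "(%m. integral\<^sup>L (\<kappa> z) (F m)) \<longlonglongrightarrow> measure (\<kappa> z) B" if z: "z \<in> Omega T" for z
 proof -
  interpret K: prob_space "\<kappa> z" by (rule \<kappa>_prob[OF z])
  have "(%m. integral\<^sup>L (\<kappa> z) (F m)) \<longlonglongrightarrow> integral\<^sup>L (\<kappa> z) (indicator B)"
  proof (rule integral_dominated_convergence[where w="%_. 1"])
   show "F m \<in> borel_measurable (\<kappa> z)" for m using Fm by (simp cong: measurable_cong_sets)
   have "B \<in> sets (\<kappa> z)" using Bs by simp
   then show "(indicator B :: _ => real) \<in> borel_measurable (\<kappa> z)" by (rule borel_measurable_indicator)
   show "AE x in \<kappa> z. (%m. F m x) \<longlonglongrightarrow> indicator B x" by (intro AE_I2 F(2)) simp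
   show "AE x in \<kappa> z. norm (F m x) <= 1" for m by (intro AE_I2) (use F01 in auto)
  qed simp
  then show ?thesis using Bs BO by (simp add: Int_absorb2)
 qed
 have le1: "measure (\<kappa> z) C <= 1" if "z \<in> Omega T" for z C
  by (rule prob_space.prob_le_1[OF \<kappa>_prob[OF that]])
 have int01: "0 <= integral\<^sup>L (\<kappa> z) (F m) \<and> integral\<^sup>L (\<kappa> z) (F m) <= 1" if z: "z \<in> Omega T" for m z
 proof -
  interpret K: prob_space "\<kappa> z" by (rule \<kappa>_prob[OF z])
  have i: "integrable (\<kappa> z) (F m)"
   by (rule K.integrable_const_bound[of _ 1]) (use F01 Fm in "auto cong: measurable_cong_sets")
  have "integral\<^sup>L (\<kappa> z) (F m) <= integral\<^sup>L (\<kappa> z) (%_. 1)"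
   by (rule integral_mono[OF i]) (use F01 in auto)
  moreover have "measure (\<kappa> z) (Omega T) = 1" using K.prob_space by simp
  moreover have "0 <= integral\<^sup>L (\<kappa> z) (F m)" by (intro integral_nonneg_AE AE_I2) (use F01 in simp)
  ultimately show ?thesis by simp
 qed
 show km: "(%z. measure (\<kappa> z) B) \<in> borel_measurable (paths T)"
  by (rule borel_measurable_LIMSEQ_metric[OF kernel_functional_measurable[OF F(1)]]) (use lim in simp)
 assume A: "A \<in> sets (paths T)"
 have fX: "(%x. past x) \<in> measurable M (paths T)"
  by (rule measurable_compose[OF X0_measurable frozen_measurable])
 have Am [measurable]: "(%x. indicator A (past x) :: real) \<in> borel_measurable M"
  by (rule measurable_compose[OF fX]) (use A in simp)
 have tm: "(%x. future x) \<in> measurable M (paths T)"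
  by (rule tail_measurable[OF X0_measurable measurable_compose[OF X0_measurable U_measurable]])
   (use U_range X0_Omega in auto)
 have tO: "future x \<in> Omega T" if "x \<in> space M" for x
  using measurable_space[OF tm that] by simp
 have lim1: "(%m. expectation (%x. indicator A (past x) * F m (future x)))
  \<longlonglongrightarrow> expectation (%x. indicator A (past x) * indicator B (future x))"
 proof (rule integral_dominated_convergence[where w="%_. 1"])
  show "(%x. indicator A (past x) * indicator B (future x) :: real) \<in> borel_measurable M"
   by (intro borel_measurable_times Am measurable_compose[OF tm]) (use Bs in simp)
  show "(%x. indicator A (past x) * F m (future x)) \<in> borel_measurable M" for m
   by (intro borel_measurable_times Am measurable_compose[OF tm Fm])
  show "AE x in M. (%m. indicator A (past x) * F m (future x)) \<longlonglongrightarrow> indicator A (past x) * indicator B (future x)"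
   by (intro AE_I2 tendsto_mult tendsto_const F(2) tO)
  show "AE x in M. norm (indicator A (past x) * F m (future x)) <= 1" for m
   by (intro AE_I2) (use F01[OF tO] in "auto simp: indicator_def")
 qed simp
 have lim2: "(%m. expectation (%x. indicator A (past x) * integral\<^sup>L (kern x) (F m)))
  \<longlonglongrightarrow> expectation (%x. indicator A (past x) * measure (kern x) B)"
 proof (rule integral_dominated_convergence[where w="%_. 1"])
  show "(%x. indicator A (past x) * measure (kern x) B) \<in> borel_measurable M"
   by (intro borel_measurable_times Am measurable_compose[OF X0_measurable km])
  show "(%x. indicator A (past x) * integral\<^sup>L (kern x) (F m)) \<in> borel_measurable M" for m
   by (intro borel_measurable_times Am measurable_compose[OF X0_measurable kernel_functional_measurable[OF F(1)]])
  show "AE x in M. (%m. indicator A (past x) * integral\<^sup>L (kern x) (F m)) \<longlonglongrightarrow> indicator A (past x) * measure (kern x) B"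
   by (intro AE_I2 tendsto_mult tendsto_const lim X0_Omega)
  show "AE x in M. norm (indicator A (past x) * integral\<^sup>L (kern x) (F m)) <= 1" for m
   by (intro AE_I2) (use int01[OF X0_Omega] in "auto simp: indicator_def")
 qed simp
 have "expectation (%x. (indicator A (past x) :: real) * indicator B (future x)) = expectation (%x. indicator A (past x) * measure (kern x) B)"
  by (rule LIMSEQ_unique[OF lim1]) (use lim2 strong_markov_functional[OF F(1) A] in simp)
 moreover have "expectation (%x. (indicator A (past x) :: real) * indicator B (future x))
  = prob {x \<in> space M. past x \<in> A \<and> future x \<in> B}"
 proof -
  have "expectation (%x. (indicator A (past x) :: real) * indicator B (future x))
   = expectation (indicat_real {x \<in> space M. past x \<in> A \<and> future x \<in> B})"
   by (rule Bochner_Integration.integral_cong) (auto simp: indicator_def)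
  then show ?thesis by (simp add: Int_def conj_commute conj_left_commute)
 qed
 ultimately show "prob {x \<in> space M. past x \<in> A \<and> future x \<in> B}
    = expectation (%x. indicator A (past x) * measure (kern x) B)" by simp
qed

lemma \<kappa>_kernel: "\<kappa> \<in> measurable (paths T) (prob_algebra (paths T))"
proof (rule measurable_prob_algebra_generated[OF sets_cylinders Int_stable_cylinders cylinders_Pow])
 fix z :: "'b path" assume z: "z \<in> space (paths T)"
 show "prob_space (\<kappa> z)" by (rule \<kappa>_prob) (use z in simp)
next
 fix A :: "'b path set" assume A: "A \<in> cylinders T"
 have "(%z. ennreal (measure (\<kappa> z) A)) \<in> borel_measurable (paths T)"
  using kernel_indicator(1)[OF A] by simp
 then show "(%z. emeasure (\<kappa> z) A) \<in> borel_measurable (paths T)"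
 proof (rule measurable_cong[THEN iffD1, rotated])
  fix z :: "'b path" assume "z \<in> space (paths T)"
  then interpret K: prob_space "\<kappa> z" by (intro \<kappa>_prob) simp
  show "ennreal (measure (\<kappa> z) A) = emeasure (\<kappa> z) A" by (simp add: K.emeasure_eq_measure)
 qed
qed simp

text \<open>The joint law of past and future and the mixture of the kernels agree on rectangles
  whose second factor is a cylinder, by \<open>kernel_indicator\<close>; these rectangles generate
  the product and are stable under intersection.\<close>

theorem strong_markov:
 fixes g :: "'b path \<times> 'b path => ennreal"
 assumes g: "g \<in> borel_measurable (paths T \<Otimes>\<^sub>M paths T)"
 shows "(\<integral>\<^sup>+x. g (past x, future x) \<partial>M) = (\<integral>\<^sup>+x. \<integral>\<^sup>+z'. g (past x, z') \<partial>kern x \<partial>M)"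
proof -
 let ?F = "paths T :: 'b path measure"
 let ?FF = "?F \<Otimes>\<^sub>M ?F" and ?O = "Omega T \<times> (Omega T :: 'b path set)"
 define Y where "Y x = (past x, future x)" for x
 have fX: "(%x. past x) \<in> measurable M ?F"
  by (rule measurable_compose[OF X0_measurable frozen_measurable])
 have tm: "(%x. future x) \<in> measurable M ?F"
  by (rule tail_measurable[OF X0_measurable measurable_compose[OF X0_measurable U_measurable]])
   (use U_range X0_Omega in auto)
 have Ym: "Y \<in> measurable M ?FF" unfolding Y_def[abs_def] using fX tm by (rule measurable_Pair)
 define K where "K x = distr (kern x) ?FF (%z'. (past x, z'))" for x
 have \<kappa>s: "\<kappa> \<in> measurable ?F (subprob_algebra ?F)" by (rule measurable_prob_algebraD[OF \<kappa>_kernel])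
 have \<kappa>X: "(%x. kern x) \<in> measurable M (subprob_algebra ?F)"
  by (rule measurable_compose[OF X0_measurable \<kappa>s])
 have Km: "K \<in> measurable M (subprob_algebra ?FF)"
  unfolding K_def[abs_def]
 proof (rule measurable_distr2[OF _ \<kappa>X])
  show "(%(x, z'). (past x, z')) \<in> measurable (M \<Otimes>\<^sub>M ?F) ?FF"
   unfolding split_beta by (intro measurable_Pair measurable_compose[OF measurable_fst fX] measurable_snd)
 qed
 have pairm: "(%z'. (past x, z')) \<in> measurable (kern x) ?FF" if "x \<in> space M" for x
 proof -
  have "past x \<in> space ?F" using frozen_Omega[OF X0_Omega[OF that]] by simp
  then have "(%z'. (past x, z')) \<in> measurable ?F ?FF" by simp
  then show ?thesis by (simp cong: measurable_cong_sets)
 qed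
 have ne: "space M \<noteq> {}" by (rule not_empty)
 define E where "E = {A \<times> B | A B. A \<in> sets ?F \<and> B \<in> (cylinders T :: 'b path set set)}"
 have gen: "sets ?FF = sigma_sets (?O) E"
 proof -
  have cov: "\<exists>E\<subseteq>\<E>. countable E \<and> Omega T = \<Union>E" if "Omega T \<in> \<E>" for \<E> :: "'b path set set"
   by (rule exI[of _ "{Omega T}"]) (use that in simp)
  have F1: "sets ?F = sets (sigma (Omega T) (sets ?F))"
   using sets.space_closed[of ?F] sets.sigma_sets_eq[of ?F] by (simp add: sets_measure_of)
  have F2: "sets ?F = sets (sigma (Omega T) (cylinders T))"
   by (simp add: sets_cylinders sets_measure_of[OF cylinders_Pow])
  have "sets ?FF = sets (sigma (Omega T) (sets ?F) \<Otimes>\<^sub>M sigma (Omega T) (cylinders T))"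
   by (rule sets_pair_measure_cong[OF F1 F2])
  also have "... = sets (sigma (?O) E)"
   unfolding E_def
  proof (rule arg_cong[where f=sets], rule sigma_prod)
   show "\<exists>E\<subseteq>sets ?F. countable E \<and> Omega T = \<Union>E" by (rule cov) (use sets.top[of ?F] in simp)
   show "sets ?F \<subseteq> Pow (Omega T)" using sets.space_closed[of ?F] by simp
   show "\<exists>E\<subseteq>(cylinders T :: 'b path set set). countable E \<and> Omega T = \<Union>E" by (intro cov Omega_in_cylinders)
   show "(cylinders T :: 'b path set set) \<subseteq> Pow (Omega T)" by (rule cylinders_Pow)
  qed
  also have "... = sigma_sets (?O) E"
  proof -
   have "E \<subseteq> Pow (?O)"
    unfolding E_def using sets.sets_into_space[of _ ?F] cylinders_Pow by fastforce
   then show ?thesis by (simp add: sets_measure_of)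
  qed
  finally show ?thesis .
 qed
 have eq: "distr M ?FF Y = M \<bind> K"
 proof (rule measure_eqI_generator_eq[of E "?O"])
  show "Int_stable E"
  proof (rule Int_stableI)
   fix a b assume "a \<in> E" "b \<in> E"
   then obtain A B A' B' where "a = A \<times> B" "b = A' \<times> B'" "A \<in> sets ?F" "A' \<in> sets ?F" "B \<in> cylinders T" "B' \<in> cylinders T"
    unfolding E_def by blast
   then show "a \<inter> b \<in> E"
    unfolding E_def using Int_stableD[OF Int_stable_cylinders, of B T B'] by (auto simp: Times_Int_Times)
  qed
  show "E \<subseteq> Pow (?O)"
   unfolding E_def using sets.sets_into_space[of _ ?F] cylinders_Pow by fastforce
  show "sets (distr M ?FF Y) = sigma_sets (?O) E" using gen by simp
  have "sets (M \<bind> K) = sets ?FF" by (rule sets_bind[OF _ ne]) (simp add: K_def)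
  then show "sets (M \<bind> K) = sigma_sets (?O) E" using gen by simp
  show "range (%_::nat. ?O) \<subseteq> E"
   unfolding E_def using sets.top[of ?F] Omega_in_cylinders[of T] by auto
  interpret D: prob_space "distr M ?FF Y" by (rule prob_space_distr[OF Ym])
  show "emeasure (distr M ?FF Y) (?O) \<noteq> \<infinity>" by simp
  fix C assume "C \<in> E"
  then obtain A B where C: "C = A \<times> B" "A \<in> sets ?F" "B \<in> cylinders T" unfolding E_def by blast
  have Bs: "B \<in> sets ?F" by (rule cylinder_in_sets[OF C(3)])
  have Cs: "C \<in> sets ?FF" unfolding C(1) using C(2) Bs by simp
  have "emeasure (distr M ?FF Y) C = ennreal (prob {x \<in> space M. past x \<in> A \<and> future x \<in> B})"
  proof -
   have "Y -` C \<inter> space M = {x \<in> space M. past x \<in> A \<and> future x \<in> B}"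
    unfolding C(1) Y_def by auto
   then show ?thesis using emeasure_distr[OF Ym Cs] by (simp add: emeasure_eq_measure)
  qed
  also have "... = ennreal (expectation (%x. indicator A (past x) * measure (kern x) B))"
   using kernel_indicator(2)[OF C(3,2)] by simp
  also have "... = (\<integral>\<^sup>+x. ennreal (indicator A (past x) * measure (kern x) B) \<partial>M)"
  proof (rule expectation_range(2)[symmetric])
   have Am: "(%x. indicator A (past x) :: real) \<in> borel_measurable M"
    by (rule measurable_compose[OF fX]) (use C(2) in simp)
   show "(%x. indicator A (past x) * measure (kern x) B) \<in> borel_measurable M"
    by (intro borel_measurable_times Am measurable_compose[OF X0_measurable kernel_indicator(1)[OF C(3)]])
   show "0 <= indicator A (past x) * measure (kern x) B \<and> indicator A (past x) * measure (kern x) B <= 1" if "x \<in> space M" for x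
    using prob_space.prob_le_1[OF \<kappa>_prob[OF X0_Omega[OF that]], of B] by (simp add: indicator_def)
  qed
  also have "... = (\<integral>\<^sup>+x. emeasure (K x) C \<partial>M)"
  proof (rule nn_integral_cong)
   fix x assume x: "x \<in> space M"
   interpret KX: prob_space "kern x" by (rule \<kappa>_prob[OF X0_Omega[OF x]])
   have "emeasure (K x) C = emeasure (kern x) ((%z'. (past x, z')) -` C \<inter> space (kern x))"
    unfolding K_def by (rule emeasure_distr[OF pairm[OF x] Cs])
   also have "(%z'. (past x, z')) -` C \<inter> space (kern x) = (if past x \<in> A then B else {})"
    using sets.sets_into_space[OF Bs] by (auto simp: C(1))
   finally show "ennreal (indicator A (past x) * measure (kern x) B) = emeasure (K x) C"
    by (simp add: KX.emeasure_eq_measure indicator_def)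
  qed
  also have "... = emeasure (M \<bind> K) C" by (rule emeasure_bind[OF ne Km Cs, symmetric])
  finally show "emeasure (distr M ?FF Y) C = emeasure (M \<bind> K) C" .
 qed auto
 have "(\<integral>\<^sup>+x. g (Y x) \<partial>M) = integral\<^sup>N (distr M ?FF Y) g"
  by (rule nn_integral_distr[OF Ym, symmetric]) (use g in simp)
 also have "... = (\<integral>\<^sup>+x. integral\<^sup>N (K x) g \<partial>M)"
  unfolding eq by (rule nn_integral_bind[OF g Km])
 also have "... = (\<integral>\<^sup>+x. \<integral>\<^sup>+z'. g (past x, z') \<partial>kern x \<partial>M)"
  unfolding K_def by (intro nn_integral_cong nn_integral_distr[OF pairm]) (use g in auto)
 finally show ?thesis by (simp add: Y_def)
qed

end

section \<open>A countable dense family of stopping times\<close>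

lemma stopping_times_min:
 assumes "\<sigma> \<in> stopping_times T" "R \<in> stopping_times T"
 shows "(%z. min (\<sigma> z) (R z)) \<in> stopping_times T"
proof (rule stopping_timesI)
 show "(%z. min (\<sigma> z) (R z)) \<in> borel_measurable (paths T)"
  using stopping_timesD(1)[OF assms(1)] stopping_timesD(1)[OF assms(2)] by simp
 show "0 <= min (\<sigma> z) (R z) \<and> min (\<sigma> z) (R z) <= T" if "z \<in> Omega T" for z
  using stopping_timesD(2)[OF assms(1) that] stopping_timesD(2)[OF assms(2) that] by auto
 have *: "min (\<sigma> z') (R z') = min (\<sigma> z) (R z)"
  if z: "z \<in> Omega T" "z' \<in> Omega T" "!!r. 0 <= r ==> r <= \<sigma> z ==> z r = z' r" "\<sigma> z <= R z"
   and st: "\<sigma> \<in> stopping_times T" "R \<in> stopping_times T" for z z' \<sigma> R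
 proof -
  have 1: "\<sigma> z' = \<sigma> z" by (rule stopping_timesD(3)[OF st(1) z(1,2,3)])
  have "\<sigma> z <= R z'"
  proof (rule ccontr)
   assume "\<not> \<sigma> z <= R z'"
   then have "R z = R z'"
    by (intro stopping_timesD(3)[OF st(2) z(2,1)]) (use z(3) in auto)
   then show False using `\<not> \<sigma> z <= R z'` z(4) by simp
  qed
  then show ?thesis using 1 z(4) by simp
 qed
 fix z z' :: "'a path" assume z: "z \<in> Omega T" "z' \<in> Omega T" and eq: "!!r. 0 <= r ==> r <= min (\<sigma> z) (R z) ==> z r = z' r"
 show "min (\<sigma> z') (R z') = min (\<sigma> z) (R z)"
 proof (cases "\<sigma> z <= R z")
  case True
  then show ?thesis using *[OF z _ True assms] eq by simp
 next
  case False
  then have "min (R z') (\<sigma> z') = min (R z) (\<sigma> z)" using eq by (intro *[OF z _ _ assms(2,1)]) auto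
  then show ?thesis by (simp add: min.commute)
 qed
qed

lemma stopping_times_const: "0 <= c ==> c <= T ==> (%_. c) \<in> stopping_times T"
 by (rule stopping_timesI) auto

text \<open>Countably many events, one rational time and one basic open set each; they generate
  because paths are continuous.\<close>

definition rational_cylinders :: "real => ('d::finite) path set set" where
 "rational_cylinders T = insert {} ((%(q, U). {z \<in> Omega T. z q \<in> U}) ` ((fractions \<inter> {0..T}) \<times> (SOME B. countable B \<and> topological_basis B)))"

primrec algebra_stage :: "real => nat => ('d::finite) path set set" where
 "algebra_stage T 0 = rational_cylinders T"
| "algebra_stage T (Suc n) = algebra_stage T n \<union> (%A. Omega T - A) ` algebra_stage T n
  \<union> (%(A, B). A \<union> B) ` (algebra_stage T n \<times> algebra_stage T n)"

definition countable_algebra :: "real => ('d::finite) path set set" where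
 "countable_algebra T = (\<Union>n. algebra_stage T n)"

lemma some_basis:
 "countable (SOME B :: 'a::second_countable_topology set set. countable B \<and> topological_basis B)"
 "topological_basis (SOME B :: 'a set set. countable B \<and> topological_basis B)"
proof -
 have "\<exists>B :: 'a set set. countable B \<and> topological_basis B" by (rule ex_countable_basis)
 from someI_ex[OF this]
 show "countable (SOME B :: 'a set set. countable B \<and> topological_basis B)"
  "topological_basis (SOME B :: 'a set set. countable B \<and> topological_basis B)" by (rule conjunct1, rule conjunct2)
qed

lemma countable_countable_algebra: "countable (countable_algebra T)"
proof -
 have "countable (algebra_stage T n)" for n
 proof (induction n)
  case 0
  show ?case
   unfolding algebra_stage.simps rational_cylinders_def
   by (intro countable_insert countable_image countable_SIGMA some_basis(1) countable_Int1 countable_fractions)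
 next
  case (Suc n)
  then show ?case unfolding algebra_stage.simps by (intro countable_Un countable_image countable_SIGMA)
 qed
 then show ?thesis unfolding countable_algebra_def by (intro countable_UN countableI_type)
qed

lemma countable_algebra_closed:
 fixes A B :: "('d::finite) path set"
 shows "({} :: 'd path set) \<in> countable_algebra T"
  and "A \<in> countable_algebra T ==> Omega T - A \<in> countable_algebra T"
  and "A \<in> countable_algebra T ==> B \<in> countable_algebra T ==> A \<union> B \<in> countable_algebra T"
proof -
 have "({} :: 'd path set) \<in> algebra_stage T 0" by (simp add: rational_cylinders_def)
 then show "({} :: 'd path set) \<in> countable_algebra T" unfolding countable_algebra_def by blast
 show "Omega T - A \<in> countable_algebra T" if A: "A \<in> countable_algebra T"
 proof -
  obtain n where "A \<in> algebra_stage T n" using A unfolding countable_algebra_def by blast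
  then have "Omega T - A \<in> algebra_stage T (Suc n)" by simp
  then show ?thesis unfolding countable_algebra_def by blast
 qed
 have mono: "algebra_stage T m \<subseteq> (algebra_stage T n :: 'd path set set)" if "m <= n" for m n
  using that by (induction n rule: dec_induct) auto
 show "A \<union> B \<in> countable_algebra T" if AB: "A \<in> countable_algebra T" "B \<in> countable_algebra T"
 proof -
  obtain m n where "A \<in> algebra_stage T m" "B \<in> algebra_stage T n" using AB unfolding countable_algebra_def by blast
  then have "A \<in> algebra_stage T (max m n)" "B \<in> algebra_stage T (max m n)"
   using mono[of m "max m n"] mono[of n "max m n"] by auto
  then have "A \<union> B \<in> algebra_stage T (Suc (max m n))" unfolding algebra_stage.simps by blast
  then show ?thesis unfolding countable_algebra_def by blast
 qed
qed

lemma rational_cylinders_sets: "rational_cylinders T \<subseteq> sets (paths T)"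
proof
 fix A :: "'a path set" assume "A \<in> rational_cylinders T"
 then consider "A = {}" | q U where "A = {z \<in> Omega T. z q \<in> U}" "q \<in> {0..T}" "U \<in> (SOME B. countable B \<and> topological_basis B)"
  unfolding rational_cylinders_def by auto
 then show "A \<in> sets (paths T)"
 proof cases
  case 2
  have "open U" using topological_basis_open[OF some_basis(2) 2(3)] .
  then have "(%z. z q) -` U \<inter> space (paths T) \<in> sets (paths T)"
   using 2(2) by (intro measurable_sets[OF coordinate_measurable]) auto
  then show ?thesis by (simp add: 2(1) vimage_def Int_def conj_commute)
 qed simp
qed

lemma countable_algebra_sets: "countable_algebra T \<subseteq> sets (paths T)"
proof -
 have "algebra_stage T n \<subseteq> sets (paths T)" for n
 proof (induction n)
  case 0
  show ?case using rational_cylinders_sets by simp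
 next
  case (Suc n)
  then show ?case using sets.compl_sets[of _ "paths T"] by auto
 qed
 then show ?thesis unfolding countable_algebra_def by blast
qed

lemma sets_rational_cylinders:
 "sets (paths T) = sigma_sets (Omega T) (rational_cylinders T :: ('d::finite) path set set)"
proof
 let ?N = "sigma (Omega T) (rational_cylinders T :: 'd path set set)"
 have P: "(rational_cylinders T :: 'd path set set) \<subseteq> Pow (Omega T)" unfolding rational_cylinders_def by auto
 have sN: "sets ?N = sigma_sets (Omega T) (rational_cylinders T)" by (rule sets_measure_of[OF P])
 have spN: "space ?N = Omega T" by (rule space_measure_of[OF P])
 define B :: "(real ^ 'd) set set" where "B = (SOME B. countable B \<and> topological_basis B)"
 have B: "countable B" "topological_basis B" unfolding B_def by (rule some_basis)+
 have qm: "(%z. z q) \<in> borel_measurable ?N" if q: "q \<in> fractions" "0 <= q" "q <= T" for q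
 proof (rule borel_measurableI)
  fix U :: "(real ^ 'd) set" assume U: "open U"
  obtain B' where B': "B' \<subseteq> B" "\<Union>B' = U" using B(2) U unfolding topological_basis_def by blast
  have "{z \<in> Omega T. z q \<in> V} \<in> sets ?N" if "V \<in> B'" for V
   unfolding sN
  proof (rule sigma_sets.Basic)
   show "{z \<in> Omega T. z q \<in> V} \<in> rational_cylinders T"
    unfolding rational_cylinders_def B_def[symmetric]
    by (rule insertI2, rule image_eqI[of _ _ "(q, V)"]) (use q that B' in auto)
  qed
  then have "(\<Union>V\<in>B'. {z \<in> Omega T. z q \<in> V}) \<in> sets ?N"
   using countable_subset[OF B'(1) B(1)] by (intro sets.countable_UN'') auto
  moreover have "(\<Union>V\<in>B'. {z \<in> Omega T. z q \<in> V}) = (%z. z q) -` U \<inter> space ?N"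
   unfolding spN B'(2)[symmetric] by auto
  ultimately show "(%z. z q) -` U \<inter> space ?N \<in> sets ?N" by simp
 qed
 have "(%z. z) \<in> measurable ?N (paths T)"
 proof (rule measurable_into_path_space)
  fix r assume r: "0 <= r" "r <= T"
  have "\<exists>q. q \<in> fractions \<and> 0 <= q \<and> q <= r \<and> r - q < 1 / real (Suc n)" for n
   by (rule fractions_dense[OF r(1), of "1 / real (Suc n)"]) auto
  then obtain q where q: "!!n. q n \<in> fractions" "!!n. 0 <= q n" "!!n. q n <= r" "!!n. r - q n < 1 / real (Suc n)" by metis
  have "q \<longlonglongrightarrow> r"
  proof (rule tendsto_sandwich)
   show "\<forall>\<^sub>F n in sequentially. r - 1 / real (Suc n) <= q n" using q(4) by (intro always_eventually allI) (simp add: algebra_simps less_imp_le)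
   show "\<forall>\<^sub>F n in sequentially. q n <= r" using q(3) by simp
   show "(%n. r - 1 / real (Suc n)) \<longlonglongrightarrow> r"
    using tendsto_diff[OF tendsto_const LIMSEQ_inverse_real_of_nat, of r] by (simp add: inverse_eq_divide)
  qed simp
  show "(%z. z r) \<in> borel_measurable ?N"
  proof (rule borel_measurable_LIMSEQ_metric[of "%n z. z (q n)"])
   show "(%z. z (q n)) \<in> borel_measurable ?N" for n by (rule qm) (use q r order_trans in blast)+
   fix z assume "z \<in> space ?N"
   then have "z \<in> Omega T" by (simp add: spN)
   then show "(%n. z (q n)) \<longlonglongrightarrow> z r"
    by (intro continuous_on_tendsto_compose[OF OmegaD(1) `q \<longlonglongrightarrow> r`])
     (use q r in "auto intro!: always_eventually intro: order_trans")
  qed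
 qed (simp add: spN)
 then show "sets (paths T) \<subseteq> sigma_sets (Omega T) (rational_cylinders T :: 'd path set set)"
  unfolding sN[symmetric] using measurable_sets[of "%z. z" ?N "paths T"] sets.sets_into_space[of _ "paths T"] spN
  by (fastforce simp: vimage_def Int_absorb2)
 show "sigma_sets (Omega T) (rational_cylinders T :: 'd path set set) \<subseteq> sets (paths T)"
  using sets.sigma_sets_subset[OF rational_cylinders_sets] by simp
qed

text \<open>The events approximated in measure by the algebra form a sigma-algebra. A countable
  union is first cut to finitely many events, each of which is then approximated with a share of the
  error.\<close>

lemma countable_algebra_dense:
 fixes P :: "('d::finite) path measure"
 assumes P: "finite_measure P" "sets P = sets (paths T)"
  and A: "A \<in> sets (paths T)"
 shows "e > 0 ==> \<exists>A'\<in>countable_algebra T. measure P ((A - A') \<union> (A' - A)) < e"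
 using A unfolding sets_rational_cylinders
proof (induction arbitrary: e rule: sigma_sets.induct)
 case (Basic a)
 have "a \<in> algebra_stage T 0" using Basic by simp
 then have "a \<in> countable_algebra T" unfolding countable_algebra_def by blast
 then show ?case using Basic by (intro bexI[of _ a]) auto
next
 case Empty
 then show ?case by (intro bexI[of _ "{}"] countable_algebra_closed) auto
next
 case (Compl a)
 then obtain A' where A': "A' \<in> countable_algebra T" "measure P ((a - A') \<union> (A' - a)) < e" by blast
 have "A' \<subseteq> Omega T" using countable_algebra_sets A'(1) sets.sets_into_space[of A' "paths T"] by auto
 moreover have "a \<subseteq> Omega T"
  using Compl.hyps sets.sets_into_space[of a "paths T"] unfolding sets_rational_cylinders[symmetric] by simp
 ultimately have "((Omega T - a) - (Omega T - A')) \<union> ((Omega T - A') - (Omega T - a)) = (a - A') \<union> (A' - a)" by blast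
 then show ?case using A' countable_algebra_closed(2)[OF A'(1)] by (intro bexI[of _ "Omega T - A'"]) auto
next
 case (Union a)
 interpret finite_measure P by fact
 have as: "a i \<in> sets P" for i using Union.hyps P(2) unfolding sets_rational_cylinders[symmetric] by simp
 have "(%n. measure P (\<Union>i<n. a i)) \<longlonglongrightarrow> measure P (\<Union>n. \<Union>i<n. a i)"
 proof (rule finite_Lim_measure_incseq)
  show "range (%n. \<Union>i<n. a i) \<subseteq> sets P" using as by auto
  show "incseq (%n. \<Union>i<n. a i)" unfolding incseq_def by (intro allI impI UN_mono) auto
 qed
 moreover have "(\<Union>n. \<Union>i<n. a i) = (\<Union>i. a i)" by blast
 ultimately have "(%n. measure P (\<Union>i. a i) - measure P (\<Union>i<n. a i)) \<longlonglongrightarrow> 0"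
  using tendsto_diff[OF tendsto_const, of "%n. measure P (\<Union>i<n. a i)" "measure P (\<Union>i. a i)" sequentially "measure P (\<Union>i. a i)"] by simp
 then have "\<forall>\<^sub>F n in sequentially. measure P (\<Union>i. a i) - measure P (\<Union>i<n. a i) < e/2"
  using Union.prems by (intro order_tendstoD(2)) auto
 then obtain n where n: "measure P (\<Union>i. a i) - measure P (\<Union>i<n. a i) < e/2" by (auto simp: eventually_sequentially)
 have n': "measure P ((\<Union>i. a i) - (\<Union>i<n. a i)) < e/2"
  using n as by (subst finite_measure_Diff) auto
 define d where "d = e / (2 * (real n + 1))"
 have d: "d > 0" using Union.prems by (simp add: d_def)
 have "\<forall>i. \<exists>A'. A' \<in> countable_algebra T \<and> measure P ((a i - A') \<union> (A' - a i)) < d"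
  using Union.IH[OF d] by blast
 from choice[OF this] obtain A' where A': "\<forall>i. A' i \<in> countable_algebra T \<and> measure P ((a i - A' i) \<union> (A' i - a i)) < d" ..
 have A's: "A' i \<in> sets P" for i using A' countable_algebra_sets P(2) by blast
 define D where "D = (\<Union>i<n. A' i)"
 have DA: "D \<in> countable_algebra T"
  unfolding D_def
 proof (induction n)
  case (Suc n)
  then show ?case using A' countable_algebra_closed(3)[of "A' n" T "\<Union>i<n. A' i"] by (simp add: lessThan_Suc)
 qed (simp add: countable_algebra_closed)
 have "measure P (((\<Union>i. a i) - D) \<union> (D - (\<Union>i. a i))) <= measure P (((\<Union>i. a i) - (\<Union>i<n. a i)) \<union> (\<Union>i<n. (a i - A' i) \<union> (A' i - a i)))"
 proof (rule finite_measure_mono)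
  show "((\<Union>i. a i) - D) \<union> (D - (\<Union>i. a i)) \<subseteq> ((\<Union>i. a i) - (\<Union>i<n. a i)) \<union> (\<Union>i<n. (a i - A' i) \<union> (A' i - a i))"
   unfolding D_def by blast
  show "((\<Union>i. a i) - (\<Union>i<n. a i)) \<union> (\<Union>i<n. (a i - A' i) \<union> (A' i - a i)) \<in> sets P"
   using as A's by (intro sets.Un sets.Diff sets.countable_UN' sets.finite_UN) auto
 qed
 also have "... <= measure P ((\<Union>i. a i) - (\<Union>i<n. a i)) + measure P (\<Union>i<n. (a i - A' i) \<union> (A' i - a i))"
  using as A's by (intro measure_Un_le sets.Diff sets.countable_UN' sets.finite_UN sets.Un) auto
 also have "measure P (\<Union>i<n. (a i - A' i) \<union> (A' i - a i)) <= (\<Sum>i<n. measure P ((a i - A' i) \<union> (A' i - a i)))"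
  using as A's by (intro finite_measure_subadditive_finite) auto
 also have "... <= (\<Sum>i<n. d)" using A' by (intro sum_mono less_imp_le) auto
 also have "(\<Sum>i<n. d) <= e/2"
 proof -
  have "real n * d <= (real n + 1) * d" using d by simp
  also have "... = e/2" by (simp add: d_def field_simps)
  finally show ?thesis by simp
 qed
 finally have "measure P (((\<Union>i. a i) - D) \<union> (D - (\<Union>i. a i))) < e" using n' by simp
 then show ?case using DA by blast
qed

text \<open>Membership is tested on the path frozen at the grid time, which turns arbitrary events
  into events known at that time. Every finite list of events thus gives a stopping time, and lists
  from a countable algebra give countably many. The default is the last index
  \<open>2^m\<close>.\<close>

definition hitting_index :: "real => nat => ('d::finite) path set list => 'd path => nat" where
 "hitting_index T m As z = (LEAST j. j = 2^m \<or> (j < length As \<and> freeze T (grid T m j) z \<in> As ! j))"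

definition grid_times :: "real => (('d::finite) path => real) set" where
 "grid_times T = (%(m, As) z. grid T m (hitting_index T m As z)) ` (UNIV \<times> lists (countable_algebra T))"

lemma countable_grid_times: "countable (grid_times T)"
 unfolding grid_times_def by (intro countable_image countable_SIGMA countable_lists countable_countable_algebra) simp

lemma hitting_index_le: "hitting_index T m As z <= 2^m"
 unfolding hitting_index_def by (rule Least_le) simp

lemma grid_times_stopping:
 assumes T: "T > 0" and "d \<in> grid_times T"
 shows "d \<in> stopping_times T"
proof -
 obtain m As where d: "d = (%z. grid T m (hitting_index T m As z))" and As: "As \<in> lists (countable_algebra T)"
  using assms(2) unfolding grid_times_def by auto
 have As': "As ! j \<in> sets (paths T)" if "j < length As" for j
 proof (rule subsetD[OF countable_algebra_sets])
  have "As ! j \<in> set As" using that by (rule nth_mem)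
  then show "As ! j \<in> countable_algebra T" using As by (simp add: in_lists_conv_set)
 qed
 show ?thesis
  unfolding d
 proof (rule stopping_timesI)
  have "(%z. hitting_index T m As z) \<in> measurable (paths T) (count_space UNIV)"
   unfolding hitting_index_def
  proof (rule measurable_Least)
   fix j
   show "Measurable.pred (paths T) (%z. j = 2^m \<or> (j < length As \<and> freeze T (grid T m j) z \<in> As ! j))"
   proof (cases "j < length As")
    case True
    have "(%z. freeze T (grid T m j) z) \<in> measurable (paths T) (paths T)"
     by (rule freeze_measurable) (use T in "auto simp: grid_nonneg")
    from pred_sets2[OF As'[OF True] this] show ?thesis using True by simp
   qed simp
  qed
  then show "(%z. grid T m (hitting_index T m As z)) \<in> borel_measurable (paths T)"
   by (rule measurable_compose) simp
  show "0 <= grid T m (hitting_index T m As z) \<and> grid T m (hitting_index T m As z) <= T" for z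
   using grid_nonneg[of T m "hitting_index T m As z"] grid_le[OF _ hitting_index_le[of T m As z], of T] T by simp
  fix z z' :: "'a path" assume z: "z \<in> Omega T" "z' \<in> Omega T"
   and eq: "!!r. 0 <= r ==> r <= grid T m (hitting_index T m As z) ==> z r = z' r"
  have fr: "freeze T (grid T m j) z' = freeze T (grid T m j) z" if "j <= hitting_index T m As z" for j
  proof (rule ext)
   fix r
   have "z (min (grid T m j) r) = z' (min (grid T m j) r)" if "0 <= r"
    using that `j <= _` grid_nonneg[of T m j] grid_mono[of T j "hitting_index T m As z" m] T by (intro eq) auto
   then show "freeze T (grid T m j) z' r = freeze T (grid T m j) z r" by (simp add: freeze_def restrict_def)
  qed
  define Q where "Q j z \<longleftrightarrow> j = 2^m \<or> (j < length As \<and> freeze T (grid T m j) z \<in> As ! j)" for j z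
  have h: "hitting_index T m As z = (LEAST j. Q j z)" for z by (simp add: hitting_index_def Q_def)
  have Qfr: "Q j z' \<longleftrightarrow> Q j z" if "j <= hitting_index T m As z" for j using fr[OF that] by (simp add: Q_def)
  have ex: "Q (2^m) z" for z by (simp add: Q_def)
  have "Q (hitting_index T m As z) z" unfolding h by (rule LeastI[where P="%j. Q j z"]) (rule ex)
  then have 1: "Q (hitting_index T m As z) z'" using Qfr by blast
  have "hitting_index T m As z' = hitting_index T m As z"
   unfolding h[of z']
  proof (rule Least_equality[where P="%j. Q j z'", OF 1])
   fix j assume j: "Q j z'"
   show "hitting_index T m As z <= j"
   proof (rule ccontr)
    assume "\<not> hitting_index T m As z <= j"
    then have "Q j z" using Qfr[of j] j by simp
    then have "(LEAST j. Q j z) <= j" by (rule Least_le[where P="%j. Q j z"])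
    then show False using `\<not> _ <= j` by (simp add: h)
   qed
  qed
  then show "grid T m (hitting_index T m As z') = grid T m (hitting_index T m As z)" by simp
 qed
qed

text \<open>The events \<open>R z <= grid T m j\<close> are replaced by members of the algebra; off
  the union of the errors, the first hit is the rounded value of \<open>R\<close>.\<close>

lemma grid_times_approximate:
 fixes P :: "('d::finite) path measure"
 assumes T: "T > 0" and P: "finite_measure P" "sets P = sets (paths T)"
  and R: "R \<in> stopping_times T" and e: "e > 0"
 obtains d A where "d \<in> grid_times T" "A \<in> sets P" "measure P A < e"
  "!!z. z \<in> Omega T ==> z \<notin> A ==> d z = grid T m (grid_index T m (R z))"
proof -
 interpret finite_measure P by fact
 define c where "c = e / 2^m"
 have c: "c > 0" using e by (simp add: c_def)
 define B where "B j = {z \<in> Omega T. R z <= grid T m j}" for j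
 have Bs: "B j \<in> sets (paths T)" for j
  unfolding B_def using subsetD[OF canonical_filtration_le stopping_timesD(4)[OF R]] .
 have fm: "freeze T (grid T m j) \<in> measurable P (paths T)" for j
 proof -
  have "(%z. freeze T (grid T m j) z) \<in> measurable (paths T) (paths T)"
   by (rule freeze_measurable) (use T in "auto simp: grid_nonneg")
  then show ?thesis using P(2) by (simp cong: measurable_cong_sets)
 qed
 have spP: "space P = Omega T" using sets_eq_imp_space_eq[OF P(2)] by simp
 have "\<exists>A'\<in>countable_algebra T. measure (distr P (paths T) (freeze T (grid T m j))) ((B j - A') \<union> (A' - B j)) < c" for j
  by (rule countable_algebra_dense[OF finite_measure_distr[OF fm] _ Bs c]) simp
 then obtain A' where A': "!!j. A' j \<in> countable_algebra T"
  "!!j. measure (distr P (paths T) (freeze T (grid T m j))) ((B j - A' j) \<union> (A' j - B j)) < c" by metis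
 have A's: "A' j \<in> sets (paths T)" for j using A'(1) countable_algebra_sets by blast
 define E where "E j = {z \<in> Omega T. freeze T (grid T m j) z \<in> (B j - A' j) \<union> (A' j - B j)}" for j
 have E: "E j \<in> sets P" "measure P (E j) < c" for j
 proof -
  have C: "(B j - A' j) \<union> (A' j - B j) \<in> sets (paths T)" using Bs A's by auto
  have eq: "E j = freeze T (grid T m j) -` ((B j - A' j) \<union> (A' j - B j)) \<inter> space P" unfolding E_def spP by auto
  show "E j \<in> sets P" unfolding eq by (rule measurable_sets[OF fm C])
  show "measure P (E j) < c" using A'(2)[of j] measure_distr[OF fm C] unfolding eq by simp
 qed
 define As where "As = map A' [0..<2^m]"
 define A where "A = (\<Union>j<2^m. E j)"
 show thesis
 proof (rule that[of "%z. grid T m (hitting_index T m As z)" A])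
  have "As \<in> lists (countable_algebra T)" unfolding As_def using A'(1) by auto
  then show "(%z. grid T m (hitting_index T m As z)) \<in> grid_times T" unfolding grid_times_def by auto
  show "A \<in> sets P" unfolding A_def using E(1) by auto
  have "measure P A <= (\<Sum>j<2^m. measure P (E j))"
   unfolding A_def using E(1) by (intro finite_measure_subadditive_finite) auto
  also have "... < (\<Sum>j<(2::nat)^m. c)" using E(2) by (intro sum_strict_mono) (auto simp: lessThan_empty_iff)
  also have "... = e" by (simp add: c_def)
  finally show "measure P A < e" .
  fix z assume z: "z \<in> Omega T" "z \<notin> A"
  have iff: "(j = 2^m \<or> (j < length As \<and> freeze T (grid T m j) z \<in> As ! j)) \<longleftrightarrow> (j = 2^m \<or> (j < 2^m \<and> grid_index T m (R z) <= j))" for j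
  proof (cases "j < 2^m")
   case True
   have fz: "freeze T (grid T m j) z \<in> Omega T" using z T by (intro freeze_in_Omega grid_nonneg) auto
   have gT: "grid T m j <= T" using True T by (intro grid_le) auto
   have "freeze T (grid T m j) z \<in> B j \<longleftrightarrow> z \<in> B j"
    using galmarino_sets[of "B j" T "grid T m j" "freeze T (grid T m j) z" z] stopping_timesD(4)[OF R, of "grid T m j"] fz z
    by (auto simp: B_def freeze_def)
   moreover have "freeze T (grid T m j) z \<in> A' j \<longleftrightarrow> freeze T (grid T m j) z \<in> B j"
    using z True unfolding A_def E_def by blast
   ultimately have "freeze T (grid T m j) z \<in> A' j \<longleftrightarrow> R z <= grid T m j" using z by (simp add: B_def)
   then show ?thesis using True grid_index_le_iff[OF T] by (simp add: As_def)
  qed (simp add: As_def)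
  have "R z <= grid T m (2^m)" using stopping_timesD(2)[OF R z(1)] by simp
  then have le: "grid_index T m (R z) <= 2^m" using grid_index_le_iff[OF T] by blast
  have "hitting_index T m As z = grid_index T m (R z)"
   unfolding hitting_index_def iff by (rule Least_equality) (use le in auto)
  then show "grid T m (hitting_index T m As z) = grid T m (grid_index T m (R z))" by simp
 qed
qed

lemma stopping_times_ceiling:
 assumes T: "T > 0" and R: "R \<in> stopping_times T"
 shows "(%z. grid T m (grid_index T m (R z))) \<in> stopping_times T"
proof (rule stopping_timesI)
 note [measurable] = stopping_timesD(1)[OF R]
 have le: "grid_index T m (R z) <= 2^m" if "z \<in> Omega T" for z
  using grid_index_le_iff[OF T, of m "R z" "2^m"] stopping_timesD(2)[OF R that] by simp
 have "(%z. grid_index T m (R z)) \<in> measurable (paths T) (count_space UNIV)"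
  unfolding grid_index_def by measurable
 then show "(%z. grid T m (grid_index T m (R z))) \<in> borel_measurable (paths T)"
  by (rule measurable_compose) simp
 show "0 <= grid T m (grid_index T m (R z)) \<and> grid T m (grid_index T m (R z)) <= T" if "z \<in> Omega T" for z
  using grid_nonneg[of T m "grid_index T m (R z)"] grid_le[OF _ le[OF that], of T] T by simp
 fix z z' :: "'a path" assume z: "z \<in> Omega T" "z' \<in> Omega T"
  and eq: "!!r. 0 <= r ==> r <= grid T m (grid_index T m (R z)) ==> z r = z' r"
 have "R z <= grid T m (grid_index T m (R z))" using grid_index_le_iff[OF T, of m "R z"] by blast
 then have "R z' = R z" by (intro stopping_timesD(3)[OF R z]) (use eq in auto)
 then show "grid T m (grid_index T m (R z')) = grid T m (grid_index T m (R z))" by simp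
qed

text \<open>A strict inequality survives two small changes: rounding \<open>R\<close> up, whose
  effect tends to zero by \<open>L2_limit\<close>, and replacing the rounded time by a grid time
  equal to it off a small event. Both times are capped by \<open>h\<close>.\<close>

lemma grid_times_optimal:
 fixes P :: "('d::finite) path measure" and Y :: "real => 'd path => real"
 assumes T: "T > 0" and P: "prob_space P" "sets P = sets (paths T)"
  and Y: "continuous_adapted T S Y"
  and K: "!!R. R \<in> stopping_times T ==> (!!z. z \<in> Omega T ==> R z <= S) ==>
    integrable P (%z. (Y (R z) z)^2) \<and> (\<integral>z. (Y (R z) z)^2 \<partial>P) <= K"
  and R: "R \<in> stopping_times T" and h: "h \<in> stopping_times T"
  and le: "!!z. z \<in> Omega T ==> R z <= h z" "!!z. z \<in> Omega T ==> h z <= S"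
  and y: "y < (\<integral>z. Y (R z) z \<partial>P)"
 obtains d where "d \<in> grid_times T" "y < (\<integral>z. Y (min (d z) (h z)) z \<partial>P)"
proof -
 interpret P: prob_space P by (rule P(1))
 have spP: "space P = Omega T" using sets_eq_imp_space_eq[OF P(2)] by simp
 have meas: "(%z. Y (f z) z) \<in> borel_measurable P" if "f \<in> stopping_times T" "!!z. z \<in> Omega T ==> f z <= S" for f
 proof -
  have "(%z. Y (f z) z) \<in> borel_measurable (paths T)"
   by (rule continuous_adapted_stopped_measurable[OF Y stopping_timesD(1)[OF that(1)]])
    (use stopping_timesD(2)[OF that(1)] that(2) in blast)
  then show ?thesis using P(2) by (simp cong: measurable_cong_sets)
 qed
 have K0: "0 <= K"
 proof -
  have "0 <= (\<integral>z. (Y (h z) z)^2 \<partial>P)" by (simp add: integral_nonneg)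
  also have "... <= K" using K[OF h le(2)] by blast
  finally show ?thesis .
 qed
 have int: "integrable P (%z. Y (f z) z)" if "f \<in> stopping_times T" "!!z. z \<in> Omega T ==> f z <= S" for f
  by (rule P.expectation_abs_split(1)[where A="space P" and e=0 and l=1]; use meas[OF that] K[OF that] in simp)
 define c where "c m z = min (grid T m (grid_index T m (R z))) (h z)" for m z
 have c: "c m \<in> stopping_times T" for m
  unfolding c_def[abs_def] by (rule stopping_times_min[OF stopping_times_ceiling[OF T R] h])
 have cS: "c m z <= S" if "z \<in> Omega T" for m z using le(2)[OF that] by (simp add: c_def)
 have RS: "R z <= S" if "z \<in> Omega T" for z using le(1,2)[OF that] by simp
 have "(%m. \<integral>z. 1 * Y (c m z) z \<partial>P) \<longlonglongrightarrow> (\<integral>z. 1 * Y (R z) z \<partial>P)"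
 proof (rule P.L2_limit(3)[where K=K and c=1])
  show "(%z. Y (c m z) z) \<in> borel_measurable P" for m by (rule meas[OF c cS])
  show "integrable P (%z. (Y (c m z) z)^2)" "(\<integral>z. (Y (c m z) z)^2 \<partial>P) <= K" for m using K[OF c cS] by blast+
  show "(%z. Y (R z) z) \<in> borel_measurable P" by (rule meas[OF R RS])
  fix e :: real assume "e > 0"
  have lim: "(%m. Y (c m z) z) \<longlonglongrightarrow> Y (R z) z" if z: "z \<in> space P" for z
  proof -
   have zO: "z \<in> Omega T" using z spP by simp
   have r: "0 <= R z" using stopping_timesD(2)[OF R zO] by simp
   have "(%m. c m z) \<longlonglongrightarrow> R z"
   proof (rule tendsto_sandwich)
    show "\<forall>\<^sub>F m in sequentially. R z <= c m z"
     using grid_index_bounds[OF T r] le(1)[OF zO] by (intro always_eventually allI) (auto simp: c_def)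
    show "\<forall>\<^sub>F m in sequentially. c m z <= R z + T / 2^m"
     using grid_index_bounds[OF T r] by (intro always_eventually allI) (auto simp: c_def min_le_iff_disj)
    show "(%m. R z + T / 2^m) \<longlonglongrightarrow> R z" using tendsto_add[OF tendsto_const mesh_tendsto_0, of "R z" T] by simp
   qed simp
   then show ?thesis
    by (intro continuous_on_tendsto_compose[OF continuous_adaptedD(2)[OF Y zO]])
     (use r RS[OF zO] cS[OF zO] stopping_timesD(2)[OF c zO] in "auto intro!: always_eventually")
  qed
  have "vanishing P (%m. {z \<in> space P. e < norm (Y (c m z) z - Y (R z) z)})"
   by (rule P.vanishing_pointwise[OF meas[OF c cS] meas[OF R RS] lim `e > 0`])
  then show "vanishing P (%m. {z \<in> space P. e < \<bar>Y (c m z) z - Y (R z) z\<bar>})" by simp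
 qed simp_all
 then have "(%m. \<integral>z. Y (c m z) z \<partial>P) \<longlonglongrightarrow> (\<integral>z. Y (R z) z \<partial>P)" by simp
 from order_tendstoD(1)[OF this y] obtain m where m: "y < (\<integral>z. Y (c m z) z \<partial>P)" by (auto simp: eventually_sequentially)
 define g where "g = (\<integral>z. Y (c m z) z \<partial>P) - y"
 \<comment> \<open>Gives \<open>l * (4 * K) <= g / 2\<close>, while the exceptional event
   contributes at most \<open>g / 4\<close>; the sum is below \<open>g\<close>.\<close>
 define l where "l = g / (8 * K + 8)"
 have g: "g > 0" and l: "l > 0" using m K0 by (auto simp: g_def l_def)
 obtain d A where d: "d \<in> grid_times T" "A \<in> sets P" "measure P A < g * l"
  "!!z. z \<in> Omega T ==> z \<notin> A ==> d z = grid T m (grid_index T m (R z))"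
  by (rule grid_times_approximate[OF T P.finite_measure_axioms P(2) R, of "g * l" m]) (use g l in "simp, blast")
 have dh: "(%z. min (d z) (h z)) \<in> stopping_times T" by (rule stopping_times_min[OF grid_times_stopping[OF T d(1)] h])
 have dS: "min (d z) (h z) <= S" if "z \<in> Omega T" for z using le(2)[OF that] by simp
 define D where "D z = Y (min (d z) (h z)) z - Y (c m z) z" for z
 have Dm: "D \<in> borel_measurable P" unfolding D_def[abs_def] using meas[OF dh dS] meas[OF c cS] by simp
 have b: "(D z)^2 <= 2 * (Y (min (d z) (h z)) z)^2 + 2 * (Y (c m z) z)^2" for z
  using sum_squares_bound[of "Y (min (d z) (h z)) z" "- Y (c m z) z"] by (simp add: D_def power2_diff)
 have i: "integrable P (%z. 2 * (Y (min (d z) (h z)) z)^2 + 2 * (Y (c m z) z)^2)" using K[OF dh dS] K[OF c cS] by simp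
 have D2: "integrable P (%z. (D z)^2)" by (rule Bochner_Integration.integrable_bound[OF i]) (use b Dm in auto)
 have "(\<integral>z. (D z)^2 \<partial>P) <= (\<integral>z. 2 * (Y (min (d z) (h z)) z)^2 + 2 * (Y (c m z) z)^2 \<partial>P)"
  by (rule integral_mono[OF D2 i]) (rule b)
 also have "... <= 4 * K" using K[OF dh dS] K[OF c cS[of _ m]] by simp
 finally have D2': "(\<integral>z. (D z)^2 \<partial>P) <= 4 * K" .
 have "(\<integral>z. \<bar>D z\<bar> \<partial>P) <= 0 + l * (\<integral>z. (D z)^2 \<partial>P) + measure P A / (4 * l)"
  by (rule P.expectation_abs_split(2)[OF Dm D2 d(2)]) (use d(4) l spP in "auto simp: D_def c_def")
 also have "... <= 0 + l * (4 * K) + g * l / (4 * l)"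
  using l d(3) D2' by (intro add_mono mult_left_mono divide_right_mono) auto
 also have "... < g"
 proof -
  have "l * (8 * K) <= l * (8 * K + 8)" using l by simp
  also have "... = g" using K0 by (simp add: l_def)
  finally show ?thesis using l g by simp
 qed
 finally have "(\<integral>z. \<bar>D z\<bar> \<partial>P) < g" .
 moreover have "\<bar>\<integral>z. D z \<partial>P\<bar> <= (\<integral>z. \<bar>D z\<bar> \<partial>P)" by simp
 moreover have "(\<integral>z. D z \<partial>P) = (\<integral>z. Y (min (d z) (h z)) z \<partial>P) - (\<integral>z. Y (c m z) z \<partial>P)"
  unfolding D_def using int[OF dh dS] int[OF c cS] by simp
 ultimately have "y < (\<integral>z. Y (min (d z) (h z)) z \<partial>P)" unfolding g_def by linarith
 with d(1) show thesis by (rule that)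
qed

section \<open>Operations on stopping times\<close>

text \<open>The last hypothesis says that membership in \<open>Q\<close> is known at time
  \<open>U\<close>, which makes the choice between stopping there and continuing admissible.\<close>

lemma stopping_times_if:
 assumes U: "U \<in> stopping_times T" and \<sigma>: "\<sigma> \<in> stopping_times T" and le: "!!z. z \<in> Omega T ==> U z <= \<sigma> z"
  and Q: "Q \<in> sets (paths T)"
  and na: "!!z z'. z \<in> Omega T ==> z' \<in> Omega T ==> (!!r. 0 <= r ==> r <= U z ==> z r = z' r) ==> z' \<in> Q \<longleftrightarrow> z \<in> Q"
 shows "(%z. if z \<in> Q then \<sigma> z else U z) \<in> stopping_times T"
proof (rule stopping_timesI)
 show "(%z. if z \<in> Q then \<sigma> z else U z) \<in> borel_measurable (paths T)"
  by (rule measurable_If_set[OF stopping_timesD(1)[OF \<sigma>] stopping_timesD(1)[OF U]]) (rule sets.Int[OF Q sets.top])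
 show "0 <= (if z \<in> Q then \<sigma> z else U z) \<and> (if z \<in> Q then \<sigma> z else U z) <= T" if "z \<in> Omega T" for z
  using stopping_timesD(2)[OF U that] stopping_timesD(2)[OF \<sigma> that] by simp
 fix z z' :: "'a path" assume z: "z \<in> Omega T" "z' \<in> Omega T"
  and eq: "!!r. 0 <= r ==> r <= (if z \<in> Q then \<sigma> z else U z) ==> z r = z' r"
 have iff: "z' \<in> Q \<longleftrightarrow> z \<in> Q" by (rule na[OF z]) (use eq le[OF z(1)] in auto)
 show "(if z' \<in> Q then \<sigma> z' else U z') = (if z \<in> Q then \<sigma> z else U z)"
 proof (cases "z \<in> Q")
  case True
  have "\<sigma> z' = \<sigma> z" by (rule stopping_timesD(3)[OF \<sigma> z]) (use eq True in simp)
  then show ?thesis using True iff by simp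
 next
  case False
  have "U z' = U z" by (rule stopping_timesD(3)[OF U z]) (use eq False in simp)
  then show ?thesis using False iff by simp
 qed
qed

lemma concat_path_before: "0 <= r ==> r <= s ==> s <= T ==> concat_path T s z z' r = z r"
 by (simp add: concat_path_def)

text \<open>The waiting time for \<open>R\<close> once \<open>z\<close> has been observed up to
  \<open>s\<close>. If \<open>R\<close> has not stopped by then, no continuation of \<open>z\<close>
  can change this, again by Galmarino's test.\<close>

lemma stopping_times_remaining:
 assumes R: "R \<in> stopping_times T" and z: "z \<in> Omega T" and s: "0 <= s" "s <= R z"
 shows "(%z'. R (concat_path T s z z') - s) \<in> stopping_times T"
  and "z' \<in> Omega T ==> s < R z ==> s < R (concat_path T s z z')"
  and "z' \<in> Omega T ==> s = R z ==> s = R (concat_path T s z z')"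
proof -
 have sT: "s <= T" using stopping_timesD(2)[OF R z] s by simp
 have cO: "concat_path T s z z' \<in> Omega T" if "z' \<in> Omega T" for z' by (rule concat_path_in_Omega[OF s(1) sT z that])
 have eq: "R z = R (concat_path T s z z')" if "z' \<in> Omega T" "R (concat_path T s z z') <= s" for z'
  by (rule stopping_timesD(3)[OF R cO[OF that(1)] z]) (use that(2) sT in "simp add: concat_path_before")
 show less: "s < R (concat_path T s z z')" if "z' \<in> Omega T" "s < R z" for z'
  using eq[OF that(1)] that(2) by linarith
 show "s = R (concat_path T s z z')" if "z' \<in> Omega T" "s = R z"
 proof -
  have "R (concat_path T s z z') = R z"
   by (rule stopping_timesD(3)[OF R z cO[OF that(1)]]) (use that(2) sT in "simp add: concat_path_before")
  then show ?thesis using that(2) by simp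
 qed
 have ge: "s <= R (concat_path T s z z')" if "z' \<in> Omega T" for z'
  using eq[OF that] s(2) by linarith
 show "(%z'. R (concat_path T s z z') - s) \<in> stopping_times T"
 proof (rule stopping_timesI)
  have "(%z'. concat_path T s z z') \<in> measurable (paths T) (paths T)"
   by (rule concat_path_measurable) (use z s sT in auto)
  from measurable_compose[OF this stopping_timesD(1)[OF R]]
  show "(%z'. R (concat_path T s z z') - s) \<in> borel_measurable (paths T)" by simp
  show "0 <= R (concat_path T s z z') - s \<and> R (concat_path T s z z') - s <= T" if "z' \<in> Omega T" for z'
   using ge[OF that] stopping_timesD(2)[OF R cO[OF that]] s by simp
  fix z1 z2 :: "'a path" assume z12: "z1 \<in> Omega T" "z2 \<in> Omega T"
   and e: "!!r. 0 <= r ==> r <= R (concat_path T s z z1) - s ==> z1 r = z2 r"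
  have "R (concat_path T s z z2) = R (concat_path T s z z1)"
  proof (rule stopping_timesD(3)[OF R cO[OF z12(1)] cO[OF z12(2)]])
   fix r assume "0 <= r" "r <= R (concat_path T s z z1)"
   then show "concat_path T s z z1 r = concat_path T s z z2 r" using e[of "r - s"] by (auto simp: concat_path_def restrict_def)
  qed
  then show "R (concat_path T s z z2) - s = R (concat_path T s z z1) - s" by simp
 qed
qed

text \<open>The rule \<open>d\<close> applied to the increments after \<open>U\<close>; the cap at
  \<open>T\<close> keeps the value in range.\<close>

lemma stopping_times_restart:
 assumes U: "U \<in> stopping_times T" and d: "d \<in> stopping_times T"
 shows "(%z. min (U z + d (tail T (U z) z)) T) \<in> stopping_times T"
proof (rule stopping_timesI)
 note [measurable] = stopping_timesD(1)[OF U]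
 have tO: "tail T (U z) z \<in> Omega T" if "z \<in> Omega T" for z
  using stopping_timesD(2)[OF U that] that by (intro tail_in_Omega) auto
 have "(%z. tail T (U z) z) \<in> measurable (paths T) (paths T)"
  by (rule tail_measurable) (use stopping_timesD(2)[OF U] in auto)
 from measurable_compose[OF this stopping_timesD(1)[OF d]]
 show "(%z. min (U z + d (tail T (U z) z)) T) \<in> borel_measurable (paths T)" by simp
 show "0 <= min (U z + d (tail T (U z) z)) T \<and> min (U z + d (tail T (U z) z)) T <= T" if "z \<in> Omega T" for z
  using stopping_timesD(2)[OF U that] stopping_timesD(2)[OF d tO[OF that]] by simp
 fix z z' :: "'a path" assume z: "z \<in> Omega T" "z' \<in> Omega T"
  and eq: "!!r. 0 <= r ==> r <= min (U z + d (tail T (U z) z)) T ==> z r = z' r"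
 note R = stopping_timesD(2)[OF U z(1)] stopping_timesD(2)[OF d tO[OF z(1)]]
 have Ueq: "U z' = U z" by (rule stopping_timesD(3)[OF U z]) (use eq R in auto)
 have "d (tail T (U z') z') = d (tail T (U z) z)"
 proof (rule stopping_timesD(3)[OF d tO[OF z(1)] tO[OF z(2)]])
  fix r assume r: "0 <= r" "r <= d (tail T (U z) z)"
  have "z (min (U z + r) T) = z' (min (U z + r) T)" "z (U z) = z' (U z)" by (rule eq; use r R in auto)+
  then show "tail T (U z) z r = tail T (U z') z' r" by (simp add: tail_def restrict_def Ueq)
 qed
 then show "min (U z' + d (tail T (U z') z')) T = min (U z + d (tail T (U z) z)) T" using Ueq by simp
qed

lemma kernel_integral_measurable:
 fixes f :: "'a => 'b => real"
 assumes f: "case_prod f \<in> borel_measurable (M \<Otimes>\<^sub>M N)" and L: "L \<in> measurable M (subprob_algebra N)"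
 shows "(%x. integral\<^sup>L (L x) (f x)) \<in> borel_measurable M"
proof -
 have "(%x. \<integral>r. r \<partial>distr (L x) borel (f x)) \<in> borel_measurable M"
  by (rule measurable_compose[OF measurable_distr2[OF f L] integral_measurable_subprob_algebra]) simp
 moreover have "(\<integral>r. r \<partial>distr (L x) borel (f x)) = integral\<^sup>L (L x) (f x)" if "x \<in> space M" for x
 proof -
  have "sets (L x) = sets N" using measurable_space[OF L that] by (simp add: space_subprob_algebra)
  then have "f x \<in> borel_measurable (L x)" using measurable_Pair2[OF f that] by (simp cong: measurable_cong_sets)
  then show ?thesis by (simp add: integral_distr)
 qed
 ultimately show ?thesis by (simp cong: measurable_cong)
qed

context path_sde_stopped
begin

text \<open>Positive and negative parts are treated by \<open>strong_markov\<close>. For paths in a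
  null set the inner integral may fail to exist and is then 0 by convention, which affects no
  expectation.\<close>

theorem strong_markov_integral:
 fixes g :: "'b path \<times> 'b path => real"
 assumes g[measurable]: "g \<in> borel_measurable (paths T \<Otimes>\<^sub>M paths T)"
  and int: "integrable M (%x. g (past x, future x))"
 shows "integrable M (%x. \<integral>z'. g (past x, z') \<partial>kern x)"
  and "expectation (%x. \<integral>z'. g (past x, z') \<partial>kern x) = expectation (%x. g (past x, future x))"
proof -
 let ?cf = "paths T"
 let ?J = "%x. (past x, future x)"
 let ?cc = "?cf \<Otimes>\<^sub>M ?cf"
 have sub: "\<kappa> \<in> measurable ?cf (subprob_algebra ?cf)" using \<kappa>_kernel by (simp add: measurable_prob_algebraD)
 have fX: "(%x. past x) \<in> measurable M ?cf" by (rule measurable_compose[OF X0_measurable frozen_measurable])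
 have kX: "(%x. kern x) \<in> measurable M (subprob_algebra ?cf)" by (rule measurable_compose[OF X0_measurable sub])
 have section_meas: "(%z'. h (frozen z, z')) \<in> borel_measurable (\<kappa> z')" if "h \<in> borel_measurable ?cc" "z \<in> Omega T" for z z' and h :: "'b path \<times> 'b path => real"
 proof -
  have "(%z'. h (frozen z, z')) \<in> borel_measurable ?cf"
   by (rule measurable_compose[OF measurable_Pair1' that(1)]) (use frozen_Omega[OF that(2)] in simp)
  then show ?thesis by (simp cong: measurable_cong_sets)
 qed
 define p where "p h x = (\<integral>\<^sup>+z'. ennreal (h (past x, z')) \<partial>kern x)" for h x
 have p_eq: "(\<integral>\<^sup>+x. p h x \<partial>M) = (\<integral>\<^sup>+x. ennreal (h (?J x)) \<partial>M)" if "h \<in> borel_measurable ?cc" for h :: "'b path \<times> 'b path => real"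
  using strong_markov[of "%y. ennreal (h y)"] that unfolding p_def by simp
 have pm: "p h \<in> borel_measurable M" if h[measurable]: "h \<in> borel_measurable ?cc" for h :: "'b path \<times> 'b path => real"
  unfolding p_def[abs_def]
 proof (rule nn_integral_measurable_subprob_algebra2[OF _ kX])
  have "(%(x, z'). (past x, z')) \<in> measurable (M \<Otimes>\<^sub>M ?cf) ?cc"
   unfolding case_prod_beta by (intro measurable_Pair measurable_compose[OF measurable_fst fX] measurable_snd)
  from measurable_compose[OF this h] show "(%(x, z'). ennreal (h (past x, z'))) \<in> borel_measurable (M \<Otimes>\<^sub>M ?cf)"
   by (simp add: case_prod_beta)
 qed
 have fin: "(\<integral>\<^sup>+x. p g x \<partial>M) < \<infinity>" "(\<integral>\<^sup>+x. p (%y. - g y) x \<partial>M) < \<infinity>"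
 proof -
  show "(\<integral>\<^sup>+x. p g x \<partial>M) < \<infinity>" using p_eq[OF g] real_integrable_def[THEN iffD1, OF int] by (simp add: top.not_eq_extremum)
  show "(\<integral>\<^sup>+x. p (%y. - g y) x \<partial>M) < \<infinity>" using p_eq[of "%y. - g y"] real_integrable_def[THEN iffD1, OF int] by (simp add: top.not_eq_extremum)
 qed
 have g': "(%y. - g y) \<in> borel_measurable ?cc" by simp
 have ae: "AE x in M. p g x \<noteq> \<infinity>" "AE x in M. p (%y. - g y) x \<noteq> \<infinity>"
  by (rule nn_integral_PInf_AE[OF pm[OF g]], use fin in simp) (rule nn_integral_PInf_AE[OF pm[OF g']], use fin in simp)
 have intp: "integrable M (%x. enn2real (p h x))" "expectation (%x. enn2real (p h x)) = enn2real (\<integral>\<^sup>+x. p h x \<partial>M)"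
  if "h \<in> borel_measurable ?cc" "(\<integral>\<^sup>+x. p h x \<partial>M) < \<infinity>" "AE x in M. p h x \<noteq> \<infinity>" for h
 proof -
  have e: "(\<integral>\<^sup>+x. ennreal (enn2real (p h x)) \<partial>M) = (\<integral>\<^sup>+x. p h x \<partial>M)"
   by (rule nn_integral_cong_AE) (use that(3) in "auto simp: ennreal_enn2real_if")
  have m: "(%x. enn2real (p h x)) \<in> borel_measurable M" using pm[OF that(1)] by simp
  show "integrable M (%x. enn2real (p h x))" by (rule integrableI_nonneg[OF m]) (use e that(2) in auto)
  show "expectation (%x. enn2real (p h x)) = enn2real (\<integral>\<^sup>+x. p h x \<partial>M)"
   by (subst integral_eq_nn_integral[OF m]) (simp_all add: e)
 qed
 have AEeq: "AE x in M. (\<integral>z'. g (past x, z') \<partial>kern x) = enn2real (p g x) - enn2real (p (%y. - g y) x)"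
 proof (rule AE_mp[OF AE_conjI[OF ae]], rule AE_I2, rule impI)
  fix x assume x: "x \<in> space M" and f: "p g x \<noteq> \<infinity> \<and> p (%y. - g y) x \<noteq> \<infinity>"
  have "integrable (kern x) (%z'. g (past x, z'))"
   unfolding real_integrable_def using section_meas[OF g X0_Omega[OF x]] f by (simp add: p_def)
  from real_lebesgue_integral_def[OF this]
  show "(\<integral>z'. g (past x, z') \<partial>kern x) = enn2real (p g x) - enn2real (p (%y. - g y) x)"
   by (simp add: p_def)
 qed
 have meas: "(%x. \<integral>z'. g (past x, z') \<partial>kern x) \<in> borel_measurable M"
 proof (rule kernel_integral_measurable[OF _ kX])
  have "(%(x, z'). (past x, z')) \<in> measurable (M \<Otimes>\<^sub>M ?cf) ?cc"
   unfolding case_prod_beta by (intro measurable_Pair measurable_compose[OF measurable_fst fX] measurable_snd)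
  from measurable_compose[OF this g] show "(%(x, z'). g (past x, z')) \<in> borel_measurable (M \<Otimes>\<^sub>M ?cf)"
   by (simp add: case_prod_beta)
 qed
 note i1 = intp[OF g fin(1) ae(1)] and i2 = intp[OF g' fin(2) ae(2)]
 show "integrable M (%x. \<integral>z'. g (past x, z') \<partial>kern x)"
  by (subst integrable_cong_AE[OF meas _ AEeq]) (use i1 i2 pm[OF g] pm[OF g'] in auto)
 have "expectation (%x. \<integral>z'. g (past x, z') \<partial>kern x) = expectation (%x. enn2real (p g x) - enn2real (p (%y. - g y) x))"
  by (rule integral_cong_AE[OF meas _ AEeq]) (use pm[OF g] pm[OF g'] in auto)
 also have "... = enn2real (\<integral>\<^sup>+x. p g x \<partial>M) - enn2real (\<integral>\<^sup>+x. p (%y. - g y) x \<partial>M)"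
  using i1 i2 by simp
 also have "... = expectation (%x. g (?J x))"
  by (subst real_lebesgue_integral_def[OF int]) (simp add: p_eq[OF g] p_eq[OF g'])
 finally show "expectation (%x. \<integral>z'. g (past x, z') \<partial>kern x) = expectation (%x. g (past x, future x))" .
qed

end

section \<open>Improving stopping times\<close>

context path_sde
begin

abbreviation stops :: "real => ('d path => real) set" where
 "stops t \<equiv> stopping_times_upto T (%_. T - t)"

abbreviation pos_stops :: "real => ('d path => real) set" where
 "pos_stops t \<equiv> pos_stopping_times_upto T (%_. T - t)"

abbreviation SV :: "real => 'd path => (real => 'd path => real) => ('d path => real) => 'd path => real" where
 "SV \<equiv> stopped_value T"

abbreviation EV :: "real => 'd path => (real => 'd path => real) => ('d path => real) => real" where
 "EV t w v R \<equiv> integral\<^sup>L (law t w) (SV t w v R)"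

text \<open>One bound for all stopping times at once: expectations of stopped values are then
  bounded, and continuous along convergent sequences of stopping times.\<close>

definition L2_bounded :: "(real => 'd path => real) => bool" where
 "L2_bounded v \<longleftrightarrow> (\<forall>t\<in>{0..T}. \<forall>w\<in>Omega T. \<exists>K. \<forall>R\<in>stops t.
  integrable (law t w) (%z. (SV t w v R z)^2) \<and> (\<integral>z. (SV t w v R z)^2 \<partial>law t w) <= K)"

lemma L2_boundedD:
 assumes "L2_bounded v" "0 <= t" "t <= T" "w \<in> Omega T"
 obtains K where "!!R. R \<in> stops t ==> integrable (law t w) (%z. (SV t w v R z)^2) \<and> (\<integral>z. (SV t w v R z)^2 \<partial>law t w) <= K"
 using assms unfolding L2_bounded_def by (meson atLeastAtMost_iff)

lemma stopped_value_measurable: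
 fixes v :: "real => 'd path => real"
 assumes v: "continuous_adapted T T v" and t: "0 <= t" "t <= T" "w \<in> Omega T" and R: "R \<in> stops t"
 shows "SV t w v R \<in> borel_measurable (law t w)"
proof -
 have "SV t w v R \<in> borel_measurable (paths T)"
  unfolding stopped_value_def[abs_def]
  by (rule continuous_adapted_stopped_measurable[OF continuous_adapted_shift[OF v t]])
   (use R stopping_timesD(1,2)[of R T] in "auto simp: stopping_times_upto_def")
 then show ?thesis by (simp cong: measurable_cong_sets)
qed

lemma stopped_value_integrable:
 assumes v: "continuous_adapted T T v" "L2_bounded v" and t: "0 <= t" "t <= T" "w \<in> Omega T" and R: "R \<in> stops t"
 shows "integrable (law t w) (SV t w v R)"
proof -
 interpret P: prob_space "law t w" by (rule prob_space_law[OF t])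
 have "integrable (law t w) (%z. (SV t w v R z)^2)" by (rule L2_boundedD[OF v(2) t]) (use R in blast)
 then show ?thesis by (rule P.expectation_abs_split(1)[OF stopped_value_measurable[OF v(1) t R] _ sets.top, of 0 1]) auto
qed

end

text \<open>\<open>V\<close> stands for the process, up to sign, plus \<open>c * s\<close>. The last
  assumption says that at no point before \<open>T\<close>, and within no positive horizon, stopping
  at once is optimal.\<close>

locale improvable = path_sde M T W \<sigma> X
 for M :: "'a measure" and T :: real and W :: "real => 'a => real ^ ('d::finite)"
  and \<sigma> :: "real => 'd path => real ^ 'd ^ 'd" and X :: "real => 'd path => 'a => 'd path" +
 fixes V :: "real => 'd path => real"
 assumes V: "continuous_adapted T T V"
  and V_L2: "L2_bounded V"
  and V_improve: "!!t w h. 0 <= t ==> t < T ==> w \<in> Omega T ==> h \<in> pos_stops t ==>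
    \<exists>R\<in>stopping_times_upto T h. V t w < EV t w V R"
begin

text \<open>Every path with \<open>U z < R z\<close> admits an improving rule after
  \<open>U\<close>, but the rule need not depend measurably on the path. As
  \<open>grid_times_optimal\<close> supplies rules from a countable family, a single rule
  \<open>d\<close> improves on an event that is not null; it is followed on that event only.\<close>

lemma improvement:
 assumes t: "0 <= t" "t <= T" and w: "w \<in> Omega T"
  and U: "U \<in> stopping_times T" and R: "R \<in> stopping_times T"
  and le: "!!z. z \<in> Omega T ==> U z <= R z" "!!z. z \<in> Omega T ==> R z <= T - t"
  and pos: "\<not> (AE z in law t w. U z = R z)"
 obtains U' where "U' \<in> stopping_times T" "!!z. z \<in> Omega T ==> U z <= U' z \<and> U' z <= R z"
  "EV t w V U < EV t w V U'"
proof -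
 let ?cf = "paths T :: 'd path measure"
 let ?cc = "?cf \<Otimes>\<^sub>M ?cf" and ?c = "%y. concat_path T (U (fst y)) (fst y) (snd y)"
 have US: "U z <= T - t" if "z \<in> Omega T" for z using le[OF that] by simp
 interpret path_sde_stopped M T W \<sigma> X t w U by unfold_locales (use t w U US in auto)
 interpret P: prob_space "law t w" by (rule prob_space_law[OF t w])
 define F where "F = shift_process T t w V"
 have F: "continuous_adapted T (T - t) F" unfolding F_def by (rule continuous_adapted_shift[OF V t w])
 have F_sv: "SV t w V p z = F (p z) z" for p z by (simp add: stopped_value_def F_def)
 have cO: "concat_path T (U z) z z' \<in> Omega T" if "z \<in> Omega T" "z' \<in> Omega T" for z z'
  using U_range[OF that(1)] that by (intro concat_path_in_Omega) auto
 have c_frozen: "concat_path T (U z) (frozen z) z' = concat_path T (U z) z z'" if "z \<in> Omega T" for z z'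
  by (rule concat_path_cong) (use frozen_eq[OF that] U_range[OF that] in auto)
 \<comment> \<open>Payoff when the path up to \<open>U\<close> is continued by \<open>z'\<close> and
   the rule \<open>d\<close>, capped by \<open>R\<close>, is applied to the continuation. Below,
   \<open>G d z\<close> is its conditional expectation given the past.\<close>
 define g where "g d z z' = F (min (U z + d z') (R (concat_path T (U z) z z'))) (concat_path T (U z) z z')"
  for d :: "'d path => real" and z z'
 have g_frozen: "g d (frozen z) = g d z" if "z \<in> Omega T" for d z
  by (rule ext) (simp add: g_def U_frozen[OF that] c_frozen[OF that])
 have g_meas: "case_prod (g d) \<in> borel_measurable ?cc" if d: "d \<in> stopping_times T" for d
 proof -
  have f: "fst \<in> measurable ?cc ?cf" and s: "snd \<in> measurable ?cc ?cf" by simp_all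
  have sp: "fst y \<in> Omega T" "snd y \<in> Omega T" if "y \<in> space ?cc" for y
   using that by (auto simp: space_pair_measure)
  have m1: "(%y. U (fst y)) \<in> borel_measurable ?cc" by (rule measurable_compose[OF f U_measurable])
  have m2: "(%y. d (snd y)) \<in> borel_measurable ?cc" by (rule measurable_compose[OF s stopping_timesD(1)[OF d]])
  have m3: "(%y. ?c y) \<in> measurable ?cc ?cf"
   by (rule concat_path_measurable[OF f s m1]) (use sp U_range in blast)
  have m4: "(%y. R (?c y)) \<in> borel_measurable ?cc"
   by (rule measurable_compose[OF m3 stopping_timesD(1)[OF R]])
  have "(%y. F (min (U (fst y) + d (snd y)) (R (?c y))) (?c y))
   \<in> borel_measurable ?cc"
  proof (rule measurable_at_random_time[where T="T - t" and f="%s y. F s (?c y)"])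
   show "(%y. F s (?c y)) \<in> borel_measurable ?cc" if "0 <= s" "s <= T - t" for s
    by (rule measurable_compose[OF m3 continuous_adaptedD(1)[OF F that]])
   show "continuous_on {0..T - t} (%s. F s (?c y))" if "y \<in> space ?cc" for y
    by (rule continuous_adaptedD(2)[OF F cO[OF sp[OF that]]])
   show "(%y. min (U (fst y) + d (snd y)) (R (?c y))) \<in> borel_measurable ?cc"
    using m1 m2 m4 by simp
   fix y assume "y \<in> space ?cc"
   note y = sp[OF this]
   show "0 <= min (U (fst y) + d (snd y)) (R (?c y)) \<and>
    min (U (fst y) + d (snd y)) (R (?c y)) <= T - t"
    using U_range[OF y(1)] stopping_timesD(2)[OF d y(2)] stopping_timesD(2)[OF R cO[OF y]] le(2)[OF cO[OF y]] by auto
  qed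
  then show ?thesis by (simp add: g_def case_prod_beta')
 qed
 have sub: "\<kappa> \<in> measurable ?cf (subprob_algebra ?cf)" using \<kappa>_kernel by (simp add: measurable_prob_algebraD)
 define G where "G d z = (\<integral>z'. g d z z' \<partial>\<kappa> z)" for d z
 have G_meas: "G d \<in> borel_measurable ?cf" if "d \<in> stopping_times T" for d
  unfolding G_def[abs_def] by (rule kernel_integral_measurable[OF g_meas[OF that] sub])
 have FU_meas: "(%z. F (U z) z) \<in> borel_measurable ?cf"
  by (rule continuous_adapted_stopped_measurable[OF F U_measurable]) (use U_range in blast)
 \<comment> \<open>The event on which continuing with \<open>d\<close> beats stopping at
   \<open>U\<close>; it is determined by the past, see \<open>Q_frozen\<close>.\<close>
 define Q where "Q d = {z \<in> Omega T. F (U z) z < G d z}" for d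
 have Q_sets: "Q d \<in> sets ?cf" if "d \<in> stopping_times T" for d
 proof -
  have "{z \<in> space ?cf. F (U z) z < G d z} \<in> sets ?cf"
   by (rule borel_measurable_less[OF FU_meas G_meas[OF that]])
  then show ?thesis by (simp add: Q_def)
 qed
 have FU_frozen: "F (U z) (frozen z) = F (U z) z" if "z \<in> Omega T" for z
  by (rule continuous_adaptedD(3)[OF F]) (use U_range[OF that] that frozen_Omega[OF that] frozen_eq[OF that] in auto)
 have Q_frozen: "frozen z \<in> Q d \<longleftrightarrow> z \<in> Q d" if "z \<in> Omega T" for z d
  using that FU_frozen[OF that] frozen_Omega[OF that] by (simp add: Q_def G_def U_frozen \<kappa>_frozen g_frozen)
 have cover: "\<exists>d\<in>grid_times T. z \<in> Q d" if z: "z \<in> Omega T" "U z < R z" for z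
 proof -
  define t1 where "t1 = t + U z"
  define w1 where "w1 = concat_path T t w (frozen z)"
  define h where "h z' = R (concat_path T (U z) z z') - U z" for z'
  have t1: "0 <= t1" "t1 < T" "t1 <= T" using t U_range[OF z(1)] z(2) le(2)[OF z(1)] by (auto simp: t1_def)
  have w1: "w1 \<in> Omega T" unfolding w1_def by (rule concat_path_in_Omega[OF t w frozen_Omega[OF z(1)]])
  have h: "h \<in> stopping_times T" unfolding h_def[abs_def]
   by (rule stopping_times_remaining(1)[OF R z(1)]) (use U_range[OF z(1)] z(2) in auto)
  have h0: "0 < h z'" if "z' \<in> Omega T" for z'
   using stopping_times_remaining(2)[OF R z(1) _ _ that z(2)] U_range[OF z(1)] z(2) by (simp add: h_def)
  have hS: "h z' <= T - t1" if "z' \<in> Omega T" for z' using le(2)[OF cO[OF z(1) that]] by (simp add: h_def t1_def)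
  have "h \<in> pos_stops t1" using h h0 hS by (simp add: pos_stopping_times_upto_def)
  from V_improve[OF t1(1,2) w1 this] obtain R1 where
   R1: "R1 \<in> stopping_times_upto T h" "V t1 w1 < EV t1 w1 V R1" by blast
  obtain K where K: "!!R. R \<in> stops t1 ==> integrable (law t1 w1) (%z. (SV t1 w1 V R z)^2)
    \<and> (\<integral>z. (SV t1 w1 V R z)^2 \<partial>law t1 w1) <= K" by (rule L2_boundedD[OF V_L2 t1(1,3) w1]) blast
  obtain d where d: "d \<in> grid_times T" "V t1 w1 < (\<integral>z'. shift_process T t1 w1 V (min (d z') (h z')) z' \<partial>law t1 w1)"
  proof (rule grid_times_optimal[OF T_pos prob_space_law[OF t1(1,3) w1] sets_law continuous_adapted_shift[OF V t1(1,3) w1]])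
   show "integrable (law t1 w1) (%z. (shift_process T t1 w1 V (p z) z)^2) \<and> (\<integral>z. (shift_process T t1 w1 V (p z) z)^2 \<partial>law t1 w1) <= K"
    if "p \<in> stopping_times T" "!!z. z \<in> Omega T ==> p z <= T - t1" for p
   proof -
    have "p \<in> stops t1" using that by (simp add: stopping_times_upto_def)
    from K[OF this] show ?thesis by (simp add: stopped_value_def)
   qed
   show "R1 \<in> stopping_times T" "!!z. z \<in> Omega T ==> R1 z <= h z" using R1(1) by (auto simp: stopping_times_upto_def)
   show "h \<in> stopping_times T" by (rule h)
   show "!!z. z \<in> Omega T ==> h z <= T - t1" by (rule hS)
   show "V t1 w1 < (\<integral>z. shift_process T t1 w1 V (R1 z) z \<partial>law t1 w1)" using R1(2) by (simp add: stopped_value_def[abs_def])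
  qed blast
  have "V t1 w1 = F (U z) z" unfolding FU_frozen[OF z(1), symmetric] by (simp add: F_def shift_process_def t1_def w1_def)
  moreover have "shift_process T t1 w1 V (min (d z') (h z')) z' = g d z z'" for z'
  proof -
   have "concat_path T t1 w1 z' = concat_path T t w (concat_path T (U z) (frozen z) z')"
    unfolding t1_def w1_def
    by (rule concat_path_assoc[symmetric]) (use t U_range[OF z(1)] frozen_Omega[OF z(1)] in auto)
   then show ?thesis
    by (simp add: shift_process_def g_def F_def c_frozen[OF z(1)] t1_def h_def min_def add.assoc)
  qed
  moreover have "law t1 w1 = \<kappa> z" by (simp add: \<kappa>_def t1_def w1_def)
  ultimately have "z \<in> Q d" using d(2) z(1) by (simp add: Q_def G_def)
  then show ?thesis using d(1) by blast
 qed
 obtain d where dg: "d \<in> grid_times T" and Qpos: "\<not> (AE z in law t w. z \<notin> Q d)"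
 proof -
  have "\<not> (\<forall>d\<in>grid_times T. AE z in law t w. z \<notin> Q d)"
  proof
   assume "\<forall>d\<in>grid_times T. AE z in law t w. z \<notin> Q d"
   then have "AE z in law t w. \<forall>d\<in>grid_times T. z \<notin> Q d" by (simp only: AE_ball_countable[OF countable_grid_times])
   then have "AE z in law t w. U z = R z"
   proof (rule AE_mp, intro AE_I2 impI)
    fix z assume "z \<in> space (law t w)" and nQ: "\<forall>d\<in>grid_times T. z \<notin> Q d"
    then have z: "z \<in> Omega T" by simp
    have "\<not> U z < R z" using cover[OF z] nQ by blast
    then show "U z = R z" using le(1)[OF z] by (simp add: order.order_iff_strict)
   qed
   then show False using pos by contradiction
  qed
  then show thesis using that by blast
 qed
 have d: "d \<in> stopping_times T" by (rule grid_times_stopping[OF T_pos dg])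
 let ?i = "%x. indicator (Q d) (X0 x) :: real" and ?v = "%x. SV t w V U (X0 x)" and ?SV = "SV t w V"
 define b where "b z = min (min (U z + d (tail T (U z) z)) T) (R z)" for z
 have b: "b \<in> stopping_times T"
  unfolding b_def[abs_def] by (rule stopping_times_min[OF stopping_times_restart[OF U d] R])
 have tO: "tail T (U z) z \<in> Omega T" if "z \<in> Omega T" for z using U_range[OF that] that by (intro tail_in_Omega) auto
 have b_range: "U z <= b z" "b z <= R z" "b z = min (U z + d (tail T (U z) z)) (R z)" if "z \<in> Omega T" for z
  using le[OF that] U_range[OF that] stopping_timesD(2)[OF d tO[OF that]] stopping_timesD(2)[OF R that] by (auto simp: b_def)
 define U' where "U' z = (if z \<in> Q d then b z else U z)" for z
 have U': "U' \<in> stopping_times T"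
  unfolding U'_def[abs_def]
 proof (rule stopping_times_if[OF U b b_range(1) Q_sets[OF d]])
  fix z z' :: "'d path" assume z: "z \<in> Omega T" "z' \<in> Omega T" and eq: "!!r. 0 <= r ==> r <= U z ==> z r = z' r"
  have "U z' = U z" by (rule stopping_timesD(3)[OF U z eq])
  then have "frozen z' = frozen z" using eq U_range[OF z(1)] by (auto simp: frozen_def freeze_def restrict_def)
  then show "z' \<in> Q d \<longleftrightarrow> z \<in> Q d" using Q_frozen[OF z(1), of d] Q_frozen[OF z(2), of d] by simp
 qed
 have U'_range: "U z <= U' z \<and> U' z <= R z" if "z \<in> Omega T" for z using b_range[OF that] le[OF that] by (simp add: U'_def)
 have up: "U \<in> stops t" "U' \<in> stops t"
 proof -
  show "U \<in> stops t" using U US by (simp add: stopping_times_upto_def)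
  have "U' z <= T - t" if "z \<in> Omega T" for z using U'_range[OF that] le(2)[OF that] by linarith
  then show "U' \<in> stops t" using U' by (simp add: stopping_times_upto_def)
 qed
 have sm: "?SV U \<in> borel_measurable ?cf" "?SV U' \<in> borel_measurable ?cf"
  using stopped_value_measurable[OF V t w up(1)] stopped_value_measurable[OF V t w up(2)] by (simp_all cong: measurable_cong_sets)
 note si = stopped_value_integrable[OF V V_L2 t w up(1)] stopped_value_integrable[OF V V_L2 t w up(2)]
 have toM: "integrable M (%x. f (X0 x)) \<and> expectation (%x. f (X0 x)) = integral\<^sup>L (law t w) f"
  if "f \<in> borel_measurable ?cf" "integrable (law t w) f" for f :: "'d path => real"
  using integral_law[OF t w that(1)] integrable_distr[OF X0_measurable, of f] that(2) by (simp add: law_def)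
 define f where "f y = indicator (Q d) (fst y) * g d (fst y) (snd y)" for y
 have f_meas: "f \<in> borel_measurable ?cc"
 proof -
  have "(%y. indicator (Q d) (fst y) :: real) \<in> borel_measurable ?cc"
   by (rule measurable_compose[OF measurable_fst]) (rule borel_measurable_indicator[OF Q_sets[OF d]])
  from borel_measurable_times[OF this g_meas[OF d]] show ?thesis by (simp add: f_def[abs_def] case_prod_beta')
 qed
 have f_eq: "f (past x, future x) = ?i x * ?SV U' (X0 x)" if "x \<in> space M" for x
 proof -
  have z: "X0 x \<in> Omega T" by (rule X0_Omega[OF that])
  have "concat_path T (U (X0 x)) (X0 x) (future x) = X0 x"
   using U_range[OF z] z by (intro concat_path_tail) auto
  then have "X0 x \<in> Q d ==> g d (X0 x) (future x) = F (U' (X0 x)) (X0 x)"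
   by (simp add: g_def U'_def b_range(3)[OF z])
  then show ?thesis using z by (simp add: f_def g_frozen Q_frozen F_sv indicator_def)
 qed
 \<comment> \<open>The conditional gain, nonnegative and positive exactly on \<open>Q d\<close>; a
   vanishing expectation would make \<open>Q d\<close> a null set.\<close>
 define D where "D z = indicator (Q d) z * (G d z - F (U z) z)" for z
 have i1: "integrable M (%x. ?i x * ?SV U' (X0 x))"
  "integrable M (%x. ?i x * ?v x)"
 proof -
  have "integrable (law t w) (%z. indicator (Q d) z * ?SV p z)" if "integrable (law t w) (?SV p)" for p
   using integrable_mult_indicator[OF _ that, of "Q d"] Q_sets[OF d] by simp
  from this[OF si(2)] this[OF si(1)]
  show "integrable M (%x. ?i x * ?SV U' (X0 x))"
   "integrable M (%x. ?i x * ?v x)"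
   using toM borel_measurable_times[OF borel_measurable_indicator[OF Q_sets[OF d]] sm(2)]
    borel_measurable_times[OF borel_measurable_indicator[OF Q_sets[OF d]] sm(1)] by blast+
 qed
 have fint: "integrable M (%x. f (past x, future x))"
  using i1(1) f_eq by (simp cong: Bochner_Integration.integrable_cong)
 note sM = strong_markov_integral[OF f_meas fint]
 have inner: "(\<integral>z'. f (past x, z') \<partial>kern x) = ?i x * G d (X0 x)" if "x \<in> space M" for x
  using X0_Omega[OF that] by (simp add: f_def g_frozen Q_frozen G_def indicator_def)
 have s1: "integrable M (%x. ?i x * G d (X0 x))"
  using sM(1) inner by (simp cong: Bochner_Integration.integrable_cong)
 have s2: "expectation (%x. ?i x * G d (X0 x)) = expectation (%x. ?i x * ?SV U' (X0 x))"
  using sM(2) inner f_eq by (simp cong: Bochner_Integration.integral_cong)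
 have DM: "D (X0 x) = ?i x * G d (X0 x) - ?i x * ?v x" for x
  by (simp add: D_def F_sv algebra_simps)
 have Dint: "integrable M (%x. D (X0 x))" unfolding DM using s1 i1(2) by simp
 have Dnn: "0 <= D z" for z by (simp add: D_def Q_def indicator_def)
 have "expectation (%x. D (X0 x)) \<noteq> 0"
 proof
  assume "expectation (%x. D (X0 x)) = 0"
  then have "AE x in M. D (X0 x) = 0" using integral_nonneg_eq_0_iff_AE[OF Dint] Dnn by simp
  then have "AE x in M. X0 x \<notin> Q d"
   by (rule AE_mp) (intro AE_I2 impI notI, auto simp: D_def Q_def)
  then have "AE z in law t w. z \<notin> Q d"
   unfolding law_def using AE_distr_iff[OF X0_measurable, of "%z. z \<notin> Q d"] sets.compl_sets[OF Q_sets[OF d]]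
   by (simp add: Diff_eq Collect_conj_eq Collect_neg_eq Int_commute set_diff_eq)
  then show False using Qpos by contradiction
 qed
 moreover have "0 <= expectation (%x. D (X0 x))" by (rule Bochner_Integration.integral_nonneg) (rule Dnn)
 ultimately have pos: "0 < expectation (%x. D (X0 x))" by simp
 have "expectation (%x. D (X0 x)) = expectation (%x. ?i x * ?SV U' (X0 x) - ?i x * ?v x)"
  unfolding DM using s1 s2 i1 by simp
 also have "... = expectation (%x. ?SV U' (X0 x) - ?v x)"
  by (rule Bochner_Integration.integral_cong) (auto simp: stopped_value_def U'_def indicator_def)
 also have "... = EV t w V U' - EV t w V U"
  using toM[OF sm(1) si(1)] toM[OF sm(2) si(2)] by simp
 finally have "EV t w V U < EV t w V U'" using pos by simp
 with U' U'_range show thesis by (rule that)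
qed

end

text \<open>A limit from below is safe in the raw filtration: all approximating values lie below the
  limit value, hence are determined by the path up to it.\<close>

lemma stopping_times_limit:
 assumes U: "!!n. U n \<in> stopping_times T" and lim: "!!z. z \<in> Omega T ==> (%n. U n z) \<longlonglongrightarrow> U' z"
  and le: "!!n z. z \<in> Omega T ==> U n z <= U' z"
 shows "U' \<in> stopping_times T"
proof (rule stopping_timesI)
 show "U' \<in> borel_measurable (paths T)"
  by (rule borel_measurable_LIMSEQ_metric[OF stopping_timesD(1)[OF U]]) (use lim in simp)
 show "0 <= U' z \<and> U' z <= T" if z: "z \<in> Omega T" for z
 proof
  show "0 <= U' z" using stopping_timesD(2)[OF U[of 0] z] le[OF z, of 0] by linarith
  show "U' z <= T" by (rule LIMSEQ_le_const2[OF lim[OF z]]) (use stopping_timesD(2)[OF U z] in blast)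
 qed
 fix z z' :: "'a path" assume z: "z \<in> Omega T" "z' \<in> Omega T" and eq: "!!r. 0 <= r ==> r <= U' z ==> z r = z' r"
 have "U n z' = U n z" for n
  by (rule stopping_timesD(3)[OF U z]) (use eq le[OF z(1)] order_trans in blast)
 then show "U' z' = U' z" using LIMSEQ_unique[OF lim[OF z(2)]] lim[OF z(1)] by simp
qed

context improvable
begin

theorem stopped_expectation_ge:
 assumes t: "0 <= t" "t <= T" and w: "w \<in> Omega T" and R: "R \<in> stops t"
 shows "V t w <= EV t w V R"
proof -
 interpret P: prob_space "law t w" by (rule prob_space_law[OF t w])
 define F where "F = shift_process T t w V"
 have F: "continuous_adapted T (T - t) F" unfolding F_def by (rule continuous_adapted_shift[OF V t w])
 have Rs: "R \<in> stopping_times T" "!!z. z \<in> Omega T ==> R z <= T - t" using R by (auto simp: stopping_times_upto_def)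
 define e where "e f = EV t w V f" for f
 \<comment> \<open>The competitors that remain after \<open>f\<close>: stopping times between
   \<open>f\<close> and \<open>R\<close>.\<close>
 define C where "C f = {f' \<in> stopping_times T. \<forall>z\<in>Omega T. f z <= f' z \<and> f' z <= R z}" for f :: "'d path => real"
 have C_upto: "f' \<in> stops t" if "f' \<in> C f" for f f'
  using that Rs(2) unfolding C_def stopping_times_upto_def by (auto intro: order_trans)
 obtain K where K: "!!R. R \<in> stops t ==> integrable (law t w) (%z. (SV t w V R z)^2)
   \<and> (\<integral>z. (SV t w V R z)^2 \<partial>law t w) <= K" by (rule L2_boundedD[OF V_L2 t w]) blast
 note m = stopped_value_measurable[OF V t w]
 have e_le: "e f <= K + 1" if f: "f \<in> stops t" for f
 proof -
  have "e f <= (\<integral>z. \<bar>SV t w V f z\<bar> \<partial>law t w)" unfolding e_def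
   by (rule order_trans[OF abs_ge_self integral_abs_bound])
  also have "... <= 0 + 1 * (\<integral>z. (SV t w V f z)^2 \<partial>law t w) + P.prob (space (law t w)) / (4 * 1)"
   by (rule P.expectation_abs_split(2)[OF m[OF f] conjunct1[OF K[OF f]] sets.top]) auto
  also have "... <= K + 1" using K[OF f] P.prob_space by simp
  finally show ?thesis .
 qed
 have C_self: "f \<in> C f" if "f \<in> C \<mu>" for f \<mu> using that by (simp add: C_def)
 \<comment> \<open>Greedy choice: within \<open>1 / Suc n\<close> of the supremum over the remaining
   competitors and without loss against \<open>f\<close>; if \<open>f\<close> attains the supremum
   it is kept.\<close>
 have step: "\<exists>f'\<in>C f. e f <= e f' \<and> (\<forall>f''\<in>C f. e f'' <= e f' + 1 / real (Suc n))" if f: "f \<in> C (%_. 0)" for f and n :: nat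
 proof -
  have bdd: "bdd_above (e ` C f)" using e_le[OF C_upto] by (intro bdd_aboveI2) auto
  define s where "s = (SUP f'\<in>C f. e f')"
  have s_ge: "e f' <= s" if "f' \<in> C f" for f' unfolding s_def by (rule cSUP_upper[OF that bdd])
  show ?thesis
  proof (cases "e f = s")
   case True
   have "e f'' <= e f + 1 / real (Suc n)" if "f'' \<in> C f" for f''
    using s_ge[OF that] True by (simp add: add_increasing2)
   then show ?thesis using C_self[OF f] by blast
  next
   case False
   then have "max (e f) (s - 1 / real (Suc n)) < s" using s_ge[OF C_self[OF f]] by simp
   then obtain f' where f': "f' \<in> C f" "max (e f) (s - 1 / real (Suc n)) < e f'"
    unfolding s_def using less_cSUP_iff[OF _ bdd] C_self[OF f] by blast
   have "e f'' <= e f' + 1 / real (Suc n)" if "f'' \<in> C f" for f'' using s_ge[OF that] f'(2) by simp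
   moreover have "e f <= e f'" using f'(2) by simp
   ultimately show ?thesis using f'(1) by blast
  qed
 qed
 have C_trans: "f'' \<in> C f" if "f' \<in> C f" "f'' \<in> C f'" for f f' f''
  using that unfolding C_def by (auto intro: order_trans)
 have zero: "(%_. 0) \<in> C (%_. 0)"
  using stopping_times_const[of 0 T] T_pos stopping_timesD(2)[OF Rs(1)] by (auto simp: C_def)
 have "\<exists>U. \<forall>n. (U n \<in> C (%_. 0) \<and> (n = 0 \<longrightarrow> U n = (%_. 0))) \<and>
  (U (Suc n) \<in> C (U n) \<and> e (U n) <= e (U (Suc n)) \<and> (\<forall>f''\<in>C (U n). e f'' <= e (U (Suc n)) + 1 / real (Suc n)))"
 proof (rule dependent_nat_choice)
  show "\<exists>x. x \<in> C (%_. 0) \<and> (0 = (0::nat) \<longrightarrow> x = (%_. 0))" using zero by blast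
  fix x and n :: nat assume "x \<in> C (%_. 0) \<and> (n = 0 \<longrightarrow> x = (%_. 0))"
  then have x: "x \<in> C (%_. 0)" ..
  from step[OF this, of n] obtain y where y: "y \<in> C x" "e x <= e y" "\<forall>f''\<in>C x. e f'' <= e y + 1 / real (Suc n)" by blast
  then show "\<exists>y. (y \<in> C (%_. 0) \<and> (Suc n = 0 \<longrightarrow> y = (%_. 0))) \<and> y \<in> C x \<and> e x <= e y \<and> (\<forall>f''\<in>C x. e f'' <= e y + 1 / real (Suc n))"
   using C_trans[OF x y(1)] by blast
 qed
 then obtain U where U: "\<forall>n. (U n \<in> C (%_. 0) \<and> (n = 0 \<longrightarrow> U n = (%_. 0))) \<and>
  (U (Suc n) \<in> C (U n) \<and> e (U n) <= e (U (Suc n)) \<and> (\<forall>f''\<in>C (U n). e f'' <= e (U (Suc n)) + 1 / real (Suc n)))" ..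
 have UC: "U n \<in> C (%_. 0)" and USuc: "U (Suc n) \<in> C (U n)" and e_mono: "e (U n) <= e (U (Suc n))"
  and near: "!!f''. f'' \<in> C (U n) ==> e f'' <= e (U (Suc n)) + 1 / real (Suc n)" for n
  using spec[OF U, of n] by (blast, blast, blast, blast)
 have U0: "U 0 = (%_. 0)" using spec[OF U, of 0] by blast
 have Us: "U n \<in> stopping_times T" for n using UC unfolding C_def by blast
 have UR: "U n z <= R z" "U n z <= U (Suc n) z" if "z \<in> Omega T" for n z
  using UC[of n] USuc[of n] that unfolding C_def by (blast, blast)
 define U' where "U' z = (SUP n. U n z)" for z
 have bdd: "bdd_above (range (%n. U n z))" if "z \<in> Omega T" for z
  using UR(1)[OF that] by (intro bdd_aboveI2)
 have lim: "(%n. U n z) \<longlonglongrightarrow> U' z" if "z \<in> Omega T" for z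
  unfolding U'_def by (rule LIMSEQ_incseq_SUP[OF bdd[OF that]]) (rule incseq_SucI, rule UR(2)[OF that])
 have le: "U n z <= U' z" if "z \<in> Omega T" for n z unfolding U'_def by (rule cSUP_upper[OF _ bdd[OF that]]) simp
 have U': "U' \<in> stopping_times T" by (rule stopping_times_limit[OF Us lim le])
 have U'R: "U' z <= R z" if "z \<in> Omega T" for z
  by (rule LIMSEQ_le_const2[OF lim[OF that]]) (use UR(1)[OF that] in blast)
 have U'C: "U' \<in> C (U n)" for n using U' le U'R by (simp add: C_def)
 have e_lim: "(%n. e (U n)) \<longlonglongrightarrow> e U'"
 proof -
  have "(%n. \<integral>z. 1 * SV t w V (U n) z \<partial>law t w) \<longlonglongrightarrow> (\<integral>z. 1 * SV t w V U' z \<partial>law t w)"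
  proof (rule P.L2_limit(3)[where K=K and c=1])
   fix r :: real assume "r > 0"
   have l: "(%n. SV t w V (U n) z) \<longlonglongrightarrow> SV t w V U' z" if "z \<in> space (law t w)" for z
   proof -
    have z: "z \<in> Omega T" using that by simp
    have "(%n. F (U n z) z) \<longlonglongrightarrow> F (U' z) z"
     by (rule continuous_on_tendsto_compose[OF continuous_adaptedD(2)[OF F z] lim[OF z]])
      (use U'R[OF z] UR(1)[OF z] Rs(2)[OF z] stopping_timesD(2)[OF U' z] stopping_timesD(2)[OF Us z] in
       "auto intro!: always_eventually intro: order_trans")
    then show ?thesis by (simp add: stopped_value_def F_def)
   qed
   have "vanishing (law t w) (%n. {z \<in> space (law t w). r < norm (SV t w V (U n) z - SV t w V U' z)})"
    by (rule P.vanishing_pointwise[OF m[OF C_upto[OF UC]] m[OF C_upto[OF U'C]] l `r > 0`])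
   then show "vanishing (law t w) (%n. {z \<in> space (law t w). r < \<bar>SV t w V (U n) z - SV t w V U' z\<bar>})"
    by simp
  qed (use m[OF C_upto[OF UC]] m[OF C_upto[OF U'C]] K[OF C_upto[OF UC]] in auto)
  then show ?thesis by (simp add: e_def)
 qed
 have "AE z in law t w. U' z = R z"
 proof (rule ccontr)
  assume "\<not> ?thesis"
  from improvement[OF t w U' Rs(1) U'R Rs(2) this] obtain f where f: "f \<in> stopping_times T"
   "!!z. z \<in> Omega T ==> U' z <= f z \<and> f z <= R z" "e U' < e f" unfolding e_def by blast
  \<comment> \<open>A competitor after the limit is a competitor at every stage, so it exceeds the
    value at stage \<open>Suc n\<close> by at most \<open>1 / Suc n\<close>, for every
    \<open>n\<close>.\<close>
  have "f \<in> C U'" using f by (simp add: C_def)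
  then have "e f <= e (U (Suc n)) + 1 / real (Suc n)" for n by (rule near[OF C_trans[OF U'C]])
  moreover have "(%n. e (U (Suc n)) + 1 / real (Suc n)) \<longlonglongrightarrow> e U' + 0"
   using tendsto_add[OF LIMSEQ_Suc[OF e_lim] LIMSEQ_inverse_real_of_nat] by (simp add: inverse_eq_divide)
  ultimately have "e f <= e U' + 0" by (intro LIMSEQ_le_const) auto
  then show False using f(3) by simp
 qed
 then have "AE z in law t w. SV t w V U' z = SV t w V R z"
  by (rule AE_mp) (simp add: stopped_value_def)
 then have "e U' = e R" unfolding e_def by (intro integral_cong_AE m[OF C_upto[OF U'C]] m[OF R])
 moreover have "e (U 0) <= e U'"
  using LIMSEQ_le_const[OF e_lim, of "e (U 0)"] incseqD[OF incseq_SucI[of "%n. e (U n)", OF e_mono]] by blast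
 moreover have "e (U 0) = V t w"
 proof -
  have "SV t w V (%_. 0) z = V t w" if "z \<in> space (law t w)" for z
  proof -
   have z: "z \<in> Omega T" using that by simp
   have "V t (concat_path T t w z) = V t w"
    by (rule continuous_adaptedD(3)[OF V t concat_path_in_Omega[OF t w z] w]) (use t in "simp add: concat_path_before")
   then show ?thesis by (simp add: stopped_value_def shift_process_def)
  qed
  then have "e (%_. 0) = (\<integral>z. V t w \<partial>law t w)" unfolding e_def by (rule Bochner_Integration.integral_cong[OF refl])
  then show ?thesis unfolding U0 by (simp add: P.prob_space[simplified])
 qed
 ultimately show ?thesis by (simp add: e_def)
qed

end

section \<open>Stopped stochastic integrals\<close>

lemma grid_index_mono: "T > 0 ==> mono (grid_index T n)"
proof (rule monoI)
 fix v w :: real assume "T > 0" "v <= w"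
 then show "grid_index T n v <= grid_index T n w"
  using grid_index_le_iff[of T n w "grid_index T n w"] grid_index_le_iff[of T n v "grid_index T n w"] by simp
qed

context path_sde_stopped
begin

text \<open>The Riemann sums converging to the solution are stopped at the first grid time after \<open>U\<close>, so that they
 only involve bounded coefficients.\<close>

theorem stopped_martingale:
 fixes y :: "'b path => real ^ 'b"
 assumes K: "!!z r. z \<in> Omega T ==> 0 <= r ==> r < U z ==> norm (shift_process T t w \<sigma> r z) <= K"
  and uv: "0 <= u" "u <= v" "v <= S"
  and y: "y \<in> borel_measurable (canonical_filtration T u)" "!!z. z \<in> Omega T ==> norm (y z) <= c"
 shows "integrable (law t w) (%z. inner (y z) (z (min v (U z)) - z (min u (U z))))"
  and "(\<integral>z. inner (y z) (z (min v (U z)) - z (min u (U z))) \<partial>law t w) = 0"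
proof -
 let ?\<Delta> = "%z. z (min v (U z)) - z (min u (U z))"
 have S: "0 <= S" "S <= T" using t by auto
 define H where "H r x = shift_process T t w \<sigma> r (X0 x)" for r x
 have bca: "continuous_adapted T S (shift_process T t w \<sigma>)" by (rule continuous_adapted_shift[OF coeff_ca t w])
 have HG: "H s \<in> borel_measurable (G s)" if "0 <= s" "s <= S" for s
  unfolding H_def[abs_def] by (rule solution_coefficient(1)[OF X0_solution S(2) bca that])
 have Hc: "continuous_on {0..S} (%s. H s x)" if "x \<in> space M" for x
  unfolding H_def by (rule solution_coefficient(2)[OF X0_solution S(2) bca that])
 have int: "stoch_integral (*v) M G S W H (%s x. X0 x s)" unfolding H_def[abs_def] by (rule strong_solutionD(3)[OF X0_solution])
 define K' where "K' = max K 0"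
 have K'0: "0 <= K'" by (simp add: K'_def)
 define c' where "c' = max c 0"
 have c'0: "0 <= c'" and yc: "norm (y z) <= c'" if "z \<in> Omega T" for z using y(2)[OF that] by (auto simp: c'_def)
 have c'0: "0 <= c'" by (simp add: c'_def)
 define j where "j n x = grid_index T n (U (X0 x))" for n x
 define a where "a n = grid_index T n u" for n
 define b where "b n = grid_index T n v" for n
 have UX: "0 <= U (X0 x)" "U (X0 x) <= S" if "x \<in> space M" for x using U_range[OF X0_Omega[OF that]] by auto
 have ab: "a n <= b n" for n unfolding a_def b_def by (rule monoD[OF grid_index_mono[OF T_pos] uv(2)])
 have b2: "b n <= 2^n" for n using grid_index_le_iff[OF T_pos, of n v "2^n"] uv S by (simp add: b_def)
 have ag: "u <= grid T n l" if "a n <= l" for n l using grid_index_le_iff[OF T_pos, of n u l] that by (simp add: a_def)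
 have bg: "grid T n l < v" if "l < b n" for n l using grid_index_le_iff[OF T_pos, of n v l] that unfolding b_def by linarith
 have j_iff: "l < j n x \<longleftrightarrow> grid T n l < U (X0 x)" for l n x using grid_index_le_iff[OF T_pos, of n "U (X0 x)" l] unfolding j_def by linarith
 \<comment> \<open>The cells kept start at or after \<open>u\<close> and strictly before
   \<open>U\<close>, and end within \<open>S\<close>. There the hypothesis bounds the coefficient,
   which need not be bounded along whole paths.\<close>
 define J where "J n l x = (if a n <= l \<and> l < j n x \<and> grid T n (Suc l) <= S then H (grid T n l) x else 0)" for n l x
 have g0: "0 <= grid T n l" for n l by (rule grid_nonneg) (use T_pos in simp)
 have gSuc: "grid T n l <= grid T n (Suc l)" for n l by (rule grid_mono) (use T_pos in auto)
 have JG: "J n l \<in> borel_measurable (G (grid T n l))" for n l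
 proof (cases "a n <= l \<and> grid T n (Suc l) <= S")
  case True
  then have gS: "grid T n l <= S" using gSuc[of n l] by simp
  have "{x \<in> space (G (grid T n l)). grid T n l < U (X0 x)} \<in> sets (G (grid T n l))"
  proof -
   have A: "{z \<in> Omega T. U z <= grid T n l} \<in> sets (canonical_filtration T (grid T n l))" by (rule stopping_timesD(4)[OF st])
   have "X0 -` (Omega T - {z \<in> Omega T. U z <= grid T n l}) \<inter> space (G (grid T n l)) \<in> sets (G (grid T n l))"
    by (rule measurable_sets[OF solution_adapted[OF X0_solution gS]])
     (use sets.compl_sets[OF A] in simp)
   moreover have "X0 -` (Omega T - {z \<in> Omega T. U z <= grid T n l}) \<inter> space (G (grid T n l)) = {x \<in> space (G (grid T n l)). grid T n l < U (X0 x)}"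
    using X0_Omega by auto
   ultimately show ?thesis by simp
  qed
  then have "(%x. if grid T n l < U (X0 x) then H (grid T n l) x else 0) \<in> borel_measurable (G (grid T n l))"
   by (intro measurable_If HG g0 gS) auto
  then show ?thesis using True by (simp add: J_def[abs_def] j_iff)
 next
  case False
  then have "J n l = (%x. 0)" by (auto simp: J_def fun_eq_iff)
  then show ?thesis by simp
 qed
 have JK: "norm (J n l x) <= K'" if "x \<in> space M" for n l x
  using K[OF X0_Omega[OF that] g0, of n l] K'0 by (auto simp: J_def H_def j_iff K'_def)
 have J2: "integrable M (%x. (norm (J n l x))^2)" "expectation (%x. (norm (J n l x))^2) <= K'^2" for n l
 proof -
  have m: "(%x. (norm (J n l x))^2) \<in> borel_measurable M" using measurable_G_M[OF JG] by simp
  have le: "(norm (J n l x))^2 <= K'^2" if "x \<in> space M" for x using JK[OF that] by (intro power_mono) auto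
  show i: "integrable M (%x. (norm (J n l x))^2)" by (rule integrable_const_bound[of _ "K'^2"]) (use le m in auto)
  have "expectation (%x. (norm (J n l x))^2) <= expectation (%x. K'^2)" by (rule integral_mono[OF i]) (use le in auto)
  then show "expectation (%x. (norm (J n l x))^2) <= K'^2" by (simp add: prob_space)
 qed
 have tg: "time_grid (grid T n) (b n)" for n
  using grid_le[OF _ b2] gSuc T_pos by (simp add: time_grid_def)
 define D where "D n = transform (grid T n) (J n) (b n)" for n
 have DM: "D n \<in> borel_measurable M" for n unfolding D_def by (rule measurable_G_M[OF transform_G[OF tg JG order_refl]])
 have D2: "integrable M (%x. (norm (D n x))^2)" "expectation (%x. (norm (D n x))^2) <= real CARD('b) * T * K'^2" for n
 proof -
  note L = transform_L2[OF tg JG J2(1) order_refl, of n]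
  show "integrable M (%x. (norm (D n x))^2)" using L unfolding D_def by blast
  have "expectation (%x. (norm (D n x))^2) <= (\<Sum>l<b n. real CARD('b) * (grid T n (Suc l) - grid T n l) * expectation (%x. (norm (J n l x))^2))"
   using L unfolding D_def by blast
  also have "... <= (\<Sum>l<b n. real CARD('b) * (grid T n (Suc l) - grid T n l) * K'^2)"
   using gSuc J2(2) by (intro sum_mono mult_left_mono) auto
  also have "... = real CARD('b) * grid T n (b n) * K'^2"
   by (simp add: sum_distrib_left[symmetric] sum_distrib_right[symmetric] sum_lessThan_telescope)
  also have "... <= real CARD('b) * T * K'^2" using grid_le[OF _ b2[of n], of T] T_pos by (intro mult_right_mono mult_left_mono) auto
  finally show "expectation (%x. (norm (D n x))^2) <= real CARD('b) * T * K'^2" .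
 qed
 \<comment> \<open>Stopping the transform amounts to a difference of Riemann sums at two random
   indices, to which \<open>riemann_converges\<close> applies because its estimate is uniform in the
   index.\<close>
 have D_riemann: "D n x = riemann S H n (min (b n) (j n x)) x - riemann S H n (min (a n) (j n x)) x" for n x
 proof -
  have "transform (grid T n) (J n) k x = riemann S H n (min k (j n x)) x - riemann S H n (min (min k (a n)) (j n x)) x" for k
  proof (induction k)
   case (Suc k)
   show ?case
   proof (cases "k < a n")
    case True
    then show ?thesis using Suc by (simp add: J_def min_def)
   next
    case False
    then have "min (Suc k) (a n) = min k (a n)" by simp
    moreover have "riemann S H n (min (Suc k) (j n x)) x = riemann S H n (min k (j n x)) x + J n k x *v (W (grid T n (Suc k)) x - W (grid T n k) x)"
     using False by (cases "k < j n x") (auto simp: J_def riemann_def min_def)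
    ultimately show ?thesis using Suc by simp
   qed
  qed (simp add: riemann_def)
  from this[of "b n"] show ?thesis using ab[of n] by (simp add: D_def min_absorb2)
 qed
 have yu: "(%x. y (X0 x)) \<in> borel_measurable (G u)"
  by (rule measurable_compose[OF solution_adapted[OF X0_solution] y(1)]) (use uv in simp)
 have yM: "(%x. y (X0 x)) \<in> borel_measurable M" by (rule measurable_G_M[OF yu])
 have E0: "expectation (%x. inner (y (X0 x)) (D n x)) = 0" for n
 proof -
  define q where "q l x = y (X0 x) v* J n l x" for l x
  have eq: "inner (y (X0 x)) (D n x) = (\<Sum>l<b n. inner (q l x) (W (grid T n (Suc l)) x - W (grid T n l) x))" for x
   unfolding D_def transform_def inner_sum_right q_def by (simp add: dot_lmul_matrix)
  have "integrable M (%x. inner (q l x) (W (grid T n (Suc l)) x - W (grid T n l) x)) \<and>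
   expectation (%x. inner (q l x) (W (grid T n (Suc l)) x - W (grid T n l) x)) = 0" if l: "l < b n" for l
  proof -
   have qG: "q l \<in> borel_measurable (G (grid T n l))"
   proof (cases "a n <= l")
    case True
    show ?thesis unfolding q_def[abs_def]
     by (intro borel_measurable_vector_matrix_mult JG measurable_G_mono[OF yu ag[OF True]])
   next
    case False
    then have "q l = (%x. 0)" by (auto simp: q_def J_def fun_eq_iff vector_matrix_mult_def zero_vec_def)
    then show ?thesis by simp
   qed
   have "norm (q l x) <= K' * c'" if "x \<in> space M" for x
   proof -
    have "norm (q l x) <= norm (J n l x) * norm (y (X0 x))" unfolding q_def by (rule norm_vector_matrix_mult_le)
    also have "... <= K' * c'" by (intro mult_mono JK yc X0_Omega that K'0) auto
    finally show ?thesis .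
   qed
   then have qi: "integrable M (q l)" using measurable_G_M[OF qG] by (intro integrable_const_bound[of _ "K' * c'"]) auto
   have "grid T n (Suc l) <= T" using l b2[of n] T_pos by (intro grid_le) auto
   from increment_orthogonal[OF g0 gSuc this qG qi] show ?thesis by blast
  qed
  then show ?thesis unfolding eq by (subst Bochner_Integration.integral_sum) auto
 qed
 define I where "I x = inner (y (X0 x)) (?\<Delta> (X0 x))" for x
 define g where "g z = inner (y z) (?\<Delta> z)" for z
 have gm: "g \<in> borel_measurable (paths T)"
 proof -
  have [measurable]: "y \<in> borel_measurable (paths T)" by (rule measurable_canonical_le[OF y(1)])
  have *: "(%z. z (min r (U z))) \<in> borel_measurable (paths T)" if "0 <= r" for r
  proof (rule path_at_random_time[of "%z. z" _ T])
   show "(%z. min r (U z)) \<in> borel_measurable (paths T)" using U_measurable by simp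
   show "0 <= min r (U x) \<and> min r (U x) <= T" if "x \<in> space (paths T)" for x
    using U_range[of x] that `0 <= r` by simp
  qed simp
  note [measurable] = *[of u] *[of v]
  have [measurable]: "(%z. z (min u (U z))) \<in> borel_measurable (paths T)"
   "(%z. z (min v (U z))) \<in> borel_measurable (paths T)" using *[of u] *[of v] uv by auto
  show ?thesis unfolding g_def[abs_def] by measurable
 qed
 have Ig: "I x = g (X0 x)" for x by (simp add: I_def g_def)
 have IM: "I \<in> borel_measurable M" unfolding Ig[abs_def] by (rule measurable_compose[OF X0_measurable gm])
 define Q where "Q n x = inner (y (X0 x)) (D n x)" for n x
 have QM: "Q n \<in> borel_measurable M" for n unfolding Q_def[abs_def] using yM DM by simp
 have Q_le: "(Q n x)^2 <= c'^2 * (norm (D n x))^2" if "x \<in> space M" for n x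
 proof -
  have "\<bar>Q n x\<bar> <= norm (y (X0 x)) * norm (D n x)" unfolding Q_def by (rule Cauchy_Schwarz_ineq2)
  also have "... <= c' * norm (D n x)" by (intro mult_right_mono yc X0_Omega that) auto
  finally have "\<bar>Q n x\<bar>^2 <= (c' * norm (D n x))^2" by (intro power_mono) auto
  then show ?thesis by (simp add: power_mult_distrib)
 qed
 have iQ: "integrable M (%x. c'^2 * (norm (D n x))^2)" for n using D2(1) by simp
 have Q2: "integrable M (%x. (Q n x)^2)" for n
  by (rule Bochner_Integration.integrable_bound[OF iQ]) (use Q_le QM in "auto intro!: AE_I2")
 have Q2': "expectation (%x. (Q n x)^2) <= c'^2 * (real CARD('b) * T * K'^2)" for n
 proof -
  have "expectation (%x. (Q n x)^2) <= expectation (%x. c'^2 * (norm (D n x))^2)" by (rule integral_mono[OF Q2 iQ Q_le])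
  also have "... <= c'^2 * (real CARD('b) * T * K'^2)" using D2(2)[of n] by (simp add: mult_left_mono)
  finally show ?thesis .
 qed
 have van: "vanishing M (%n. {x \<in> space M. e < \<bar>Q n x - I x\<bar>})" if eps: "e > 0" for e
 proof -
  define h where "h = e / (4 * (c' + 1))"
  have h: "h > 0" using eps c'0 by (simp add: h_def)
  define Ea where "Ea n = {x \<in> space M. \<exists>k. grid T n k <= S \<and> h < norm (riemann S H n k x - X0 x (grid T n k))}" for n
  define Eb where "Eb n = {x \<in> space M. \<exists>r\<in>{0..T}. \<exists>r'\<in>{0..T}. \<bar>r - r'\<bar> <= T / 2^n \<and> h < norm (X0 x r - X0 x r')}" for n
  have vE: "vanishing M (%n. Ea n \<union> Eb n)"
   unfolding Ea_def Eb_def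
   by (rule vanishing_Un[OF riemann_converges[OF S HG Hc int h] solution_oscillation[OF X0_solution T_pos h]])
  \<comment> \<open>The grid time above \<open>s\<close> may lie beyond \<open>S\<close>. The last
    cell is then absent from the Riemann sum, which equals the sum at the previous index.\<close>
  have close: "norm (riemann S H n (grid_index T n s) x - X0 x s) <= 2 * h"
   if x: "x \<in> space M" "x \<notin> Ea n \<union> Eb n" and s: "0 <= s" "s <= S" for n x s
  proof -
   define k where "k = grid_index T n s"
   note kb = grid_index_bounds[OF T_pos s(1), of n]
   have osc: "norm (X0 x r - X0 x s) <= h" if "0 <= r" "r <= T" "\<bar>r - s\<bar> <= T / 2^n" for r
   proof (rule ccontr)
    assume "\<not> ?thesis"
    then have "x \<in> Eb n" using x(1) that s S unfolding Eb_def by (intro CollectI conjI bexI[of _ r] bexI[of _ s]) auto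
    then show False using x(2) by blast
   qed
   have rie: "norm (riemann S H n l x - X0 x (grid T n l)) <= h" if "grid T n l <= S" for l
    using x that unfolding Ea_def by (auto simp: not_less)
   have tri: "norm (p - q) <= 2 * h" if "norm (p - m) <= h" "norm (m - q) <= h" for p q m :: "real ^ 'b"
    using norm_triangle_ineq[of "p - m" "m - q"] that by simp
   show ?thesis
   proof (cases "grid T n k <= S")
    case True
    show ?thesis unfolding k_def[symmetric]
     by (rule tri[OF rie[OF True] osc]) (use True S g0 kb in "auto simp: k_def")
   next
    case False
    then obtain l where l: "k = Suc l" using S by (cases k) auto
    have "riemann S H n k x = riemann S H n l x" using False by (simp add: l riemann_def)
    moreover have ls: "grid T n l < s" using grid_index_le_iff[OF T_pos, of n s l] l unfolding k_def by linarith
    moreover have "norm (riemann S H n l x - X0 x s) <= 2 * h"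
     by (rule tri[OF rie osc]) (use ls s S g0 kb l in "auto simp: k_def grid_Suc")
    ultimately show ?thesis by (simp add: k_def)
   qed
  qed
  show ?thesis
  proof (rule vanishing_mono[OF vE, of 0])
   fix n
   show "{x \<in> space M. e < \<bar>Q n x - I x\<bar>} \<subseteq> Ea n \<union> Eb n"
   proof (rule subsetI, rule ccontr)
    fix x assume "x \<in> {x \<in> space M. e < \<bar>Q n x - I x\<bar>}" and xE: "x \<notin> Ea n \<union> Eb n"
    then have x: "x \<in> space M" and gt: "e < \<bar>Q n x - I x\<bar>" by auto
    have mn: "min (grid_index T n s) (j n x) = grid_index T n (min s (U (X0 x)))" for s
     unfolding j_def by (rule min_of_mono[OF grid_index_mono[OF T_pos]])
    have cl: "norm (riemann S H n (min (grid_index T n s) (j n x)) x - X0 x (min s (U (X0 x)))) <= 2 * h" if "0 <= s" "s <= S" for s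
     unfolding mn by (rule close[OF x xE]) (use that UX[OF x] in auto)
    have "norm (D n x - (?\<Delta> (X0 x))) <= 2 * h + 2 * h"
    proof -
     have eq: "D n x - (?\<Delta> (X0 x))
      = (riemann S H n (min (b n) (j n x)) x - X0 x (min v (U (X0 x)))) - (riemann S H n (min (a n) (j n x)) x - X0 x (min u (U (X0 x))))"
      by (simp add: D_riemann)
     have "norm (riemann S H n (min (b n) (j n x)) x - X0 x (min v (U (X0 x)))) <= 2 * h"
      "norm (riemann S H n (min (a n) (j n x)) x - X0 x (min u (U (X0 x)))) <= 2 * h"
      unfolding a_def b_def by (rule cl; use uv in simp)+
     then show ?thesis unfolding eq by (intro order_trans[OF norm_triangle_ineq4 add_mono])
    qed
    then have nD: "norm (D n x - (?\<Delta> (X0 x))) <= 4 * h" by simp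
    have "\<bar>Q n x - I x\<bar> = \<bar>inner (y (X0 x)) (D n x - (?\<Delta> (X0 x)))\<bar>"
     by (simp add: Q_def I_def inner_diff_right)
    also have "... <= norm (y (X0 x)) * norm (D n x - (?\<Delta> (X0 x)))" by (rule Cauchy_Schwarz_ineq2)
    also have "... <= c' * (4 * h)" by (intro mult_mono yc X0_Omega x nD c'0) auto
    also have "... <= e" using eps c'0 by (simp add: h_def field_simps)
    finally show False using gt by simp
   qed
  qed
 qed
 note L = L2_limit[of Q, OF QM Q2 Q2' IM van]
 have "(%n. expectation (%x. 1 * Q n x)) \<longlonglongrightarrow> expectation (%x. 1 * I x)" by (rule L(3)[where c=1]) auto
 then have "expectation I = 0" using E0 LIMSEQ_unique[of "%n. 0::real"] by (simp add: Q_def)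
 moreover have Iint: "integrable M I" by (rule expectation_abs_split(1)[OF IM L(1) sets.top, of 0 1]) auto
 ultimately have "integral\<^sup>L (law t w) g = 0" using integral_law[OF t w gm] by (simp add: Ig[symmetric])
 then show "(\<integral>z. inner (y z) (?\<Delta> z) \<partial>law t w) = 0" by (simp add: g_def[abs_def])
 have "integrable (law t w) g" unfolding law_def using integrable_distr_eq[OF X0_measurable gm] Iint by (simp add: Ig[abs_def])
 then show "integrable (law t w) (%z. inner (y z) (?\<Delta> z))" by (simp add: g_def[abs_def])
qed

end

lemma vanishing_null: "N \<in> null_sets M ==> vanishing M (%n. N)"
 by (rule vanishingI) (auto simp: null_sets_def)

text \<open>Increments are discarded once a partial sum has exceeded \<open>b\<close>.\<close>

lemma stopped_sum_bound:
 fixes d :: "nat => real"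
 assumes d: "!!i. \<bar>d i\<bar> <= a" and b: "0 <= b"
 shows "\<bar>\<Sum>i<j. if \<forall>l\<le>i. \<bar>sum d {..<l}\<bar> <= b then d i else 0\<bar> <= b + a"
proof -
 let ?S = "%j. \<Sum>i<j. if \<forall>l\<le>i. \<bar>sum d {..<l}\<bar> <= b then d i else 0"
 have a: "0 <= a" using d[of 0] by linarith
 have "\<bar>?S j\<bar> <= b + a \<and> ((\<forall>l<j. \<bar>sum d {..<l}\<bar> <= b) \<longrightarrow> ?S j = sum d {..<j})"
 proof (induction j)
  case (Suc j)
  show ?case
  proof (cases "\<forall>l\<le>j. \<bar>sum d {..<l}\<bar> <= b")
   case True
   then have "?S j = sum d {..<j}" "\<bar>sum d {..<j}\<bar> <= b" using Suc by auto
   then show ?thesis using True d[of j] abs_triangle_ineq[of "sum d {..<j}" "d j"] by auto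
  next
   case False
   then show ?thesis using Suc by (auto simp: less_Suc_eq_le)
  qed
 qed (use a b in simp)
 then show ?thesis by blast
qed

context path_sde_stopped
begin

text \<open>The simple integrands approximating \<open>H\<close> need be neither bounded nor square
  integrable, so no martingale property can be read off directly. With integrands and partial sums
  truncated at \<open>K + 1\<close>, the stopped increments have mean zero by
  \<open>stopped_martingale\<close>; outside vanishing events the truncations do nothing, because
  \<open>H\<close> and \<open>I\<close> are bounded by \<open>K\<close> up to
  \<open>U\<close>.\<close>

theorem stopped_integral:
 fixes H :: "real => 'b path => real ^ 'b"
 assumes K: "!!z r. z \<in> Omega T ==> 0 <= r ==> r <= U z ==> norm (shift_process T t w \<sigma> r z) <= K"
   "!!z r. z \<in> Omega T ==> 0 <= r ==> r <= U z ==> norm (z r) <= K"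
   "!!z r. z \<in> Omega T ==> 0 <= r ==> r <= U z ==> norm (H r z) <= K"
  and int: "stoch_integral inner (law t w) (canonical_filtration T) S canonical_process H I"
  and bI: "AE z in law t w. \<forall>r. 0 <= r \<and> r <= U z \<longrightarrow> \<bar>I r z\<bar> <= K"
 shows "integrable (law t w) (%z. I (U z) z)" "(\<integral>z. I (U z) z \<partial>law t w) = 0"
proof -
 interpret P: prob_space "law t w" by (rule prob_space_law[OF t w])
 let ?cf = "paths T :: 'b path measure"
 have S: "0 <= S" "S <= T" using t by auto
 have K0: "0 <= K" using K(2)[of "\<lambda>r\<in>{0..T}. 0" 0] zero_in_Omega[of T] U_range(1)[of "\<lambda>r\<in>{0..T}. 0"] T_pos by auto
 obtain k p y where sp: "!!n. simple_predictable (canonical_filtration T) S (k n) (p n) (y n)"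
  and u1: "ucp_tendsto (law t w) {0<..S} (%n. simple_process (k n) (p n) (y n)) H"
  and u2: "ucp_tendsto (law t w) {0..S} (%n. simple_integral inner canonical_process (k n) (p n) (y n)) I"
  using int unfolding stoch_integral_def by blast
 have p: "p n 0 = 0" "p n (k n) = S" "\<forall>i<k n. p n i <= p n (Suc i)" "!!i. i < k n ==> y n i \<in> borel_measurable (canonical_filtration T (p n i))" for n
  using sp[of n] unfolding simple_predictable_def by auto
 have pr: "0 <= p n i" "p n i <= S" if "i <= k n" for n i
  using partition_mono[OF p(3) le0 that] partition_mono[OF p(3) that order_refl] p(1,2) by auto
 have Im: "(%z. I (U z) z) \<in> borel_measurable (law t w)"
 proof (rule measurable_at_random_time[where T=S and f=I])
  show "!!s. 0 <= s ==> s <= S ==> I s \<in> borel_measurable (law t w)" "!!x. x \<in> space (law t w) ==> continuous_on {0..S} (%s. I s x)"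
   using int unfolding stoch_integral_def by auto
  show "U \<in> borel_measurable (law t w)" using U_measurable by (simp cong: measurable_cong_sets)
  show "0 <= U x \<and> U x <= S" if "x \<in> space (law t w)" for x using U_range[of x] that by simp
 qed
 define N where "N n i z = z (min (p n i) (U z))" for n i and z :: "'b path"
 \<comment> \<open>The room of 1 above \<open>K\<close> suffices: off the exceptional event the
   simple process is within 1 of \<open>H\<close>, and its integral within \<open>g <= 1\<close> of
   \<open>I\<close>.\<close>
 define y' where "y' n i z = (if norm (y n i z) <= K + 1 then y n i z else 0)" for n i z
 define d where "d n i z = inner (y' n i z) (N n (Suc i) z - N n i z)" for n i z
 define ok where "ok n i z \<longleftrightarrow> (\<forall>l\<le>i. \<bar>\<Sum>i<l. d n i z\<bar> <= K + 1)" for n i z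
 define J where "J n z = (\<Sum>i<k n. if ok n i z then d n i z else 0)" for n z
 have Nm: "N n i \<in> borel_measurable (canonical_filtration T (p n i))" if i: "i <= k n" for n i
 proof (rule nonanticipative_measurable[OF _ pr(1)[OF i]])
  show "N n i \<in> borel_measurable ?cf"
   unfolding N_def
   by (rule path_at_random_time[of "%z. z" _ T]) (use U_measurable U_range pr(1)[OF i] in "auto simp: min_le_iff_disj")
  fix z z' :: "'b path" assume z: "z \<in> Omega T" "z' \<in> Omega T" and eq: "!!r. 0 <= r ==> r <= p n i ==> r <= T ==> z r = z' r"
  have "p n i <= T" using pr(2)[OF i] S by simp
  then have "min (p n i) (U z') = min (p n i) (U z)"
   using stopping_timesD(3)[OF stopping_times_min[OF stopping_times_const[OF pr(1)[OF i]] st] z] eq by simp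
  moreover have "z (min (p n i) (U z)) = z' (min (p n i) (U z))"
   by (rule eq) (use U_range[OF z(1)] pr(1)[OF i] in auto)
  ultimately show "N n i z = N n i z'" by (simp add: N_def)
 qed
 have mono: "f \<in> borel_measurable (canonical_filtration T (p n j))"
  if "f \<in> borel_measurable (canonical_filtration T (p n i))" "i <= j" "j <= k n" for n i j and f :: "'b path => real ^ 'b"
  using measurable_mono[OF order_refl refl sets_canonical_filtration_mono[OF partition_mono[OF p(3) that(2,3)]]] that(1) by auto
 have y'm: "y' n i \<in> borel_measurable (canonical_filtration T (p n i))" if "i < k n" for n i
  unfolding y'_def[abs_def] using p(4)[OF that] by measurable
 have dm: "d n i \<in> borel_measurable (canonical_filtration T (p n j))" if "i < j" "j <= k n" for n i j
  unfolding d_def[abs_def]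
  by (intro borel_measurable_inner borel_measurable_diff mono[OF y'm] mono[OF Nm]) (use that in auto)
 have okm: "Measurable.pred (canonical_filtration T (p n i)) (ok n i)" if "i <= k n" for n i
 proof -
  have "(%z. \<bar>\<Sum>i<l. d n i z\<bar>) \<in> borel_measurable (canonical_filtration T (p n i))" if "l \<in> {..i}" for l
   by (intro borel_measurable_abs borel_measurable_sum dm) (use that `i <= k n` in auto)
  then have "{z \<in> space (canonical_filtration T (p n i)). \<forall>l\<in>{..i}. \<bar>\<Sum>i<l. d n i z\<bar> <= K + 1} \<in> sets (canonical_filtration T (p n i))"
   by (intro sets.sets_Collect_finite_All borel_measurable_le borel_measurable_const) auto
  then show ?thesis unfolding pred_def ok_def by (simp only: Ball_def atMost_iff)
 qed
 have Nb: "norm (N n i z) <= K" if "i <= k n" "z \<in> Omega T" for n i z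
  unfolding N_def by (rule K(2)[OF that(2)]) (use U_range[OF that(2)] pr(1)[OF that(1)] in auto)
 define B where "B = (K + 1) + (K + 1) * (2 * K)"
 have Jb: "\<bar>J n z\<bar> <= B" if z: "z \<in> Omega T" for n z
 proof -
  define e where "e i = (if i < k n then d n i z else 0)" for i
  have "\<bar>e i\<bar> <= (K + 1) * (2 * K)" for i
  proof (cases "i < k n")
   case True
   have "\<bar>d n i z\<bar> <= norm (y' n i z) * norm (N n (Suc i) z - N n i z)" unfolding d_def by (rule Cauchy_Schwarz_ineq2)
   also have "... <= (K + 1) * (2 * K)"
    using Nb[of i n z] Nb[of "Suc i" n z] True z K0 norm_triangle_ineq4[of "N n (Suc i) z" "N n i z"]
    by (intro mult_mono) (auto simp: y'_def)
   finally show ?thesis using True by (simp add: e_def)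
  qed (use K0 in "simp add: e_def")
  from stopped_sum_bound[where d=e and b="K + 1" and j="k n", OF this]
  have "\<bar>\<Sum>i<k n. if \<forall>l\<le>i. \<bar>sum e {..<l}\<bar> <= K + 1 then e i else 0\<bar> <= B" using K0 by (simp add: B_def)
  moreover have "(\<Sum>i<l. e i) = (\<Sum>i<l. d n i z)" if "l <= k n" for l
   by (rule sum.cong) (use that in "auto simp: e_def")
  then have "(\<Sum>i<k n. if \<forall>l\<le>i. \<bar>sum e {..<l}\<bar> <= K + 1 then e i else 0) = J n z"
   unfolding J_def ok_def by (intro sum.cong) (auto simp: e_def)
  ultimately show ?thesis by simp
 qed
 have dE: "integrable (law t w) (%z. if ok n i z then d n i z else 0) \<and> (\<integral>z. (if ok n i z then d n i z else 0) \<partial>law t w) = 0"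
  if i: "i < k n" for n i
 proof -
  have eq: "(if ok n i z then d n i z else 0) = inner (if ok n i z then y' n i z else 0) (z (min (p n (Suc i)) (U z)) - z (min (p n i) (U z)))" for z
   by (simp add: d_def N_def)
  have m: "(%z. if ok n i z then y' n i z else 0) \<in> borel_measurable (canonical_filtration T (p n i))"
   using okm[of i n] y'm[OF i] i by (intro measurable_If) (auto simp: pred_def)
  show ?thesis
   unfolding eq
   by (rule conjI; rule stopped_martingale[where c="K + 1", OF K(1)[OF _ _ less_imp_le] pr(1) _ pr(2) m])
    (use i p(3) K0 in "auto simp: y'_def")
 qed
 have J0: "P.expectation (J n) = 0" for n unfolding J_def using dE by (subst Bochner_Integration.integral_sum) auto
 have Jm: "J n \<in> borel_measurable (law t w)" for n
  unfolding J_def[abs_def] by (intro borel_measurable_sum) (use dE borel_measurable_integrable in blast)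
 obtain Z where Z: "Z \<in> null_sets (law t w)" "{z \<in> space (law t w). \<not> (\<forall>r. 0 <= r \<and> r <= U z \<longrightarrow> \<bar>I r z\<bar> <= K)} \<subseteq> Z"
  using bI by (elim AE_E) (auto simp: null_sets_def)
 \<comment> \<open>Clipping makes the limit bounded everywhere and changes it on a null set
   only.\<close>
 define I' where "I' z = max (- K) (min K (I (U z) z))" for z
 have I'm: "I' \<in> borel_measurable (law t w)" unfolding I'_def[abs_def] using Im by measurable
 have I'_eq: "AE z in law t w. I' z = I (U z) z"
  using bI
 proof (rule AE_mp, intro AE_I2 impI)
  fix z assume "z \<in> space (law t w)" "\<forall>r. 0 <= r \<and> r <= U z \<longrightarrow> \<bar>I r z\<bar> <= K"
  then have "\<bar>I (U z) z\<bar> <= K" using U_range(1)[of z] by simp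
  then show "I' z = I (U z) z" by (simp add: I'_def abs_le_iff)
 qed
 have van: "vanishing (law t w) (%n. {z \<in> space (law t w). \<epsilon> < \<bar>J n z - I' z\<bar>})" if eps: "\<epsilon> > 0" for \<epsilon>
 proof -
  define g where "g = min \<epsilon> 1"
  have g: "g > 0" "g <= 1" "g <= \<epsilon>" using eps by (auto simp: g_def)
  note v = vanishing_Un[OF vanishing_null[OF Z(1)] vanishing_Un[OF vanishing_ucp[OF u1 zero_less_one P.finite_measure_axioms]
   vanishing_ucp[OF u2 g(1) P.finite_measure_axioms]]]
  show ?thesis
  proof (rule vanishing_cover[OF v, of 0])
   fix n z assume zs: "z \<in> space (law t w)"
    and nz: "z \<notin> Z \<union> ({x \<in> space (law t w). \<exists>s\<in>{0<..S}. 1 < norm (simple_process (k n) (p n) (y n) s x - H s x)} \<union>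
     {x \<in> space (law t w). \<exists>s\<in>{0..S}. g < norm (simple_integral inner canonical_process (k n) (p n) (y n) s x - I s x)})"
   then have z: "z \<in> Omega T" by simp
   have Ib: "\<bar>I r z\<bar> <= K" if "0 <= r" "r <= U z" for r using nz Z(2) zs that by blast
   have close: "\<bar>simple_integral inner canonical_process (k n) (p n) (y n) s z - I s z\<bar> <= g" if "s \<in> {0..S}" for s
    using nz zs that by (auto simp: not_less)
   have yeq: "inner (y n i z) (N n (Suc i) z - N n i z) = d n i z" if i: "i < k n" for i
   proof (cases "p n i < min (p n (Suc i)) (U z)")
    case True
    define r where "r = min (p n (Suc i)) (U z)"
    have r: "p n i < r" "r <= p n (Suc i)" "r <= U z" using True by (auto simp: r_def)
    have r0: "0 < r" "r <= S" using r pr(1)[of i n] i U_range[OF z] by auto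
    have "\<not> 1 < norm (simple_process (k n) (p n) (y n) r z - H r z)" using nz zs r0 by auto
    then have "norm (y n i z - H r z) <= 1" by (simp add: simple_process_eq[OF p(3) i r(1,2)])
    moreover have "norm (H r z) <= K" using K(3)[OF z _ r(3)] r0 by simp
    ultimately have "norm (y n i z) <= K + 1" using norm_triangle_ineq2[of "y n i z" "H r z"] by linarith
    then show ?thesis by (simp add: d_def y'_def)
   next
    case False
    moreover have "p n i <= p n (Suc i)" using p(3) i by blast
    ultimately have "min (p n (Suc i)) (U z) = min (p n i) (U z)" by (auto simp: min_def split: if_splits)
    then show ?thesis by (simp add: d_def N_def)
   qed
   have part: "(\<Sum>i<l. d n i z) = simple_integral inner canonical_process (k n) (p n) (y n) (min (p n l) (U z)) z" if l: "l <= k n" for l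
   proof -
    have "(\<Sum>i<l. d n i z) = (\<Sum>i<k n. if i < l then d n i z else 0)"
     using l by (intro sum.mono_neutral_cong_left) auto
    also have "... = simple_integral inner canonical_process (k n) (p n) (y n) (min (p n l) (U z)) z"
     unfolding simple_integral_def canonical_process_def
    proof (rule sum.cong[OF refl])
     fix i assume "i \<in> {..<k n}"
     then have i: "i < k n" by simp
     show "(if i < l then d n i z else 0) = inner (y n i z) (z (min (p n (Suc i)) (min (p n l) (U z))) - z (min (p n i) (min (p n l) (U z))))"
     proof (cases "i < l")
      case True
      then have "p n i <= p n l" "p n (Suc i) <= p n l" using partition_mono[OF p(3) _ l] by auto
      then show ?thesis using True yeq[OF i] by (simp add: N_def min.absorb1 flip: min.assoc)
     next
      case False
      then have "p n l <= p n i" "p n l <= p n (Suc i)" using partition_mono[OF p(3), of l] i by auto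
      then show ?thesis using False by (simp add: min.absorb2 flip: min.assoc)
     qed
    qed
    finally show ?thesis .
   qed
   have mem: "min (p n l) (U z) \<in> {0..S}" "0 <= min (p n l) (U z)" if "l <= k n" for l using pr[OF that] U_range[OF z] by auto
   have "ok n i z" if "i < k n" for i
    unfolding ok_def
   proof (intro allI impI)
    fix l assume "l <= i"
    then have l: "l <= k n" using that by simp
    show "\<bar>\<Sum>i<l. d n i z\<bar> <= K + 1"
     unfolding part[OF l] using close[OF mem(1)[OF l]] Ib[OF mem(2)[OF l]] g(2) by simp
   qed
   then have "J n z = (\<Sum>i<k n. d n i z)" unfolding J_def by (intro sum.cong) auto
   also have "... = simple_integral inner canonical_process (k n) (p n) (y n) (U z) z"
    using part[OF order_refl] p(2)[of n] U_range[OF z] by (simp add: min.absorb2)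
   finally have "\<bar>J n z - I (U z) z\<bar> <= g" using close[of "U z"] U_range[OF z] by simp
   moreover have "I' z = I (U z) z" using Ib[OF U_range(1)[OF z] order_refl] by (simp add: I'_def abs_le_iff)
   ultimately show "\<not> \<epsilon> < \<bar>J n z - I' z\<bar>" using g(3) by simp
  qed
 qed
 have I'b: "\<bar>I' z\<bar> <= K" for z using K0 by (simp add: I'_def abs_le_iff)
 have "0 <= (K + 1) * (2 * K)" using K0 by simp
 then have KB: "K <= B" by (simp add: B_def)
 have "(%n. P.expectation (J n)) \<longlonglongrightarrow> P.expectation I'"
  by (rule P.bounded_convergence_in_probability[OF Jm I'm _ order_trans[OF I'b KB] van]) (use Jb in simp)
 then have "P.expectation I' = 0" using J0 LIMSEQ_unique[of "%n. 0::real"] by simp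
 then show "(\<integral>z. I (U z) z \<partial>law t w) = 0" using integral_cong_AE[OF I'm Im I'_eq] by simp
 have "integrable (law t w) I'" by (rule P.integrable_const_bound[of _ K]) (use I'm I'b in auto)
 then show "integrable (law t w) (%z. I (U z) z)" using integrable_cong_AE[OF I'm Im I'_eq] by simp
qed

end

section \<open>Exit times and the sign of the drift\<close>

text \<open>The first time at which \<open>V\<close> reaches the level \<open>b\<close>, or
  \<open>S\<close>. Hitting a closed set by continuous paths gives a stopping time of the raw
  filtration; the start strictly below the level makes it positive.\<close>

lemma exit_time:
 fixes V :: "real => ('d::finite) path => real"
 assumes V: "continuous_adapted T S V" and S: "0 < S" "S <= T" and V0: "!!z. z \<in> Omega T ==> V 0 z < b"
 obtains R where "R \<in> stopping_times T" "!!z. z \<in> Omega T ==> 0 < R z \<and> R z <= S"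
  "!!z r. z \<in> Omega T ==> 0 <= r ==> r <= R z ==> V r z <= b"
proof -
 define A where "A z = {s \<in> {0..S}. b <= V s z} \<union> {S}" for z
 define R where "R z = Inf (A z)" for z
 have Vc: "continuous_on {0..S} (%s. V s z)" if "z \<in> Omega T" for z by (rule continuous_adaptedD(2)[OF V that])
 have bdd: "bdd_below (A z)" for z using S by (intro bdd_belowI[of _ 0]) (auto simp: A_def)
 have A_in: "R z \<in> A z" if z: "z \<in> Omega T" for z
  unfolding R_def
 proof (rule closed_contains_Inf[OF _ bdd])
  have "closed {s \<in> {0..S}. b <= V s z}"
   using continuous_on_closed_Collect_le[OF continuous_on_const Vc[OF z], of b] by simp
  then show "closed (A z)" unfolding A_def by (intro closed_Un closed_singleton)
 qed (simp add: A_def)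
 have A_le: "R z <= s" if "s \<in> A z" for z s unfolding R_def by (rule cInf_lower[OF that bdd])
 have range: "0 < R z \<and> R z <= S" if z: "z \<in> Omega T" for z
 proof
  show "R z <= S" by (rule A_le) (simp add: A_def)
  have "R z \<noteq> 0" using A_in[OF z] V0[OF z] S by (auto simp: A_def)
  then show "0 < R z" using A_in[OF z] S by (auto simp: A_def)
 qed
 have below: "V r z < b" if "z \<in> Omega T" "0 <= r" "r < R z" for r z
  using A_le[of r z] that range[OF that(1)] by (force simp: A_def)
 show thesis
 proof (rule that[of R])
  show "0 < R z \<and> R z <= S" if "z \<in> Omega T" for z by (rule range[OF that])
  show "V r z <= b" if z: "z \<in> Omega T" and r: "0 <= r" "r <= R z" for z r
  proof (cases "r < R z")
   case True
   then show ?thesis using below[OF z r(1)] by simp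
  next
   case False
   define q where "q n = R z - R z * inverse (real (Suc n))" for n
   have q: "0 <= q n" "q n < R z" for n using range[OF z] by (auto simp: q_def field_simps)
   have qS: "q n <= S" for n using q(2)[of n] range[OF z] by linarith
   have ql: "q \<longlonglongrightarrow> R z"
    unfolding q_def using tendsto_diff[OF tendsto_const tendsto_mult_left[OF LIMSEQ_inverse_real_of_nat, of "R z"], of "R z"] by simp
   have "(%n. V (q n) z) \<longlonglongrightarrow> V (R z) z"
    by (rule continuous_on_tendsto_compose[OF Vc[OF z] ql])
     (use q qS range[OF z] in "auto intro!: always_eventually")
   then have "V (R z) z <= b" by (rule LIMSEQ_le_const2) (use below[OF z q] less_imp_le in blast)
   then show ?thesis using False r by simp
  qed
  show "R \<in> stopping_times T"
  proof (rule stopping_timesI)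
   show "0 <= R z \<and> R z <= T" if "z \<in> Omega T" for z using range[OF that] S by simp
   fix z z' :: "'d path" assume z: "z \<in> Omega T" "z' \<in> Omega T" and eq: "!!r. 0 <= r ==> r <= R z ==> z r = z' r"
   have Veq: "V s z = V s z'" if "0 <= s" "s <= R z" for s
    by (rule continuous_adaptedD(3)[OF V that(1) _ z]) (use that range[OF z(1)] eq in auto)
   have iff: "s \<in> A z \<longleftrightarrow> s \<in> A z'" if "0 <= s" "s <= R z" for s using Veq[OF that] by (simp add: A_def)
   have "R z' <= R z" using iff[of "R z"] A_in[OF z(1)] range[OF z(1)] by (intro A_le) simp
   moreover have "R z <= R z'" using iff[of "R z'"] A_in[OF z(2)] range[OF z(2)] calculation by (intro A_le) simp
   ultimately show "R z' = R z" by simp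
  next
   show "R \<in> borel_measurable (paths T)"
    unfolding borel_measurable_iff_greater
   proof
    fix a :: real
    show "{z \<in> space (paths T). a < R z} \<in> sets (paths T)"
    proof (cases "0 <= a \<and> a < S")
     case False
     have "{z \<in> space (paths T). a < R z} = (if a < 0 then space (paths T) else {})"
      using range False by (force simp: not_less)
     also have "... \<in> sets (paths T)" by (cases "a < 0") (simp_all only: sets.top sets.empty_sets if_True if_False)
     finally show ?thesis .
    next
     case True
     then have a: "0 <= a" "a < S" by auto
     \<comment> \<open>Staying below \<open>b\<close> on the compact interval \<open>[0,a]\<close>
       means staying below by a fixed margin, and a margin can be checked at rational times: a
       countable description of the event.\<close>
     have iff: "a < R z \<longleftrightarrow> (\<exists>m::nat. \<forall>q\<in>fractions \<inter> {0..a}. V q z <= b - inverse (real (Suc m)))" if z: "z \<in> Omega T" for z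
     proof
      assume less: "a < R z"
      have ne: "{0..a} \<noteq> {}" and ca: "continuous_on {0..a} (%s. V s z)"
       using a continuous_on_subset[OF Vc[OF z], of "{0..a}"] by auto
      obtain x where x: "x \<in> {0..a}" "\<forall>y\<in>{0..a}. V y z <= V x z"
       using continuous_attains_sup[OF compact_Icc ne ca] by blast
      have "V x z < b" using below[OF z, of x] x(1) less by simp
      then obtain m where "inverse (real (Suc m)) < b - V x z" using reals_Archimedean[of "b - V x z"] by auto
      then have "V q z <= b - inverse (real (Suc m))" if "q \<in> fractions \<inter> {0..a}" for q using x(2) that by fastforce
      then show "\<exists>m::nat. \<forall>q\<in>fractions \<inter> {0..a}. V q z <= b - inverse (real (Suc m))" by blast
     next
      assume "\<exists>m::nat. \<forall>q\<in>fractions \<inter> {0..a}. V q z <= b - inverse (real (Suc m))"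
      then obtain m :: nat where m': "\<forall>q\<in>fractions \<inter> {0..a}. V q z <= b - inverse (real (Suc m))" ..
      have m: "V q z <= b - inverse (real (Suc m))" if "q \<in> fractions" "0 <= q" "q <= a" for q using m' that by simp
      show "a < R z"
      proof (rule ccontr)
       assume n: "\<not> a < R z"
       then have hit: "b <= V (R z) z" using A_in[OF z] a by (auto simp: A_def)
       have mem: "R z \<in> {0..S}" using range[OF z] by simp
       obtain d where d: "d > 0" "!!q. q \<in> {0..S} ==> dist q (R z) < d ==> dist (V q z) (V (R z) z) < inverse (real (Suc m))"
        using Vc[OF z] mem unfolding continuous_on_iff by (metis inverse_positive_iff_positive of_nat_0_less_iff zero_less_Suc)
       obtain q where q: "q \<in> fractions" "0 <= q" "q <= R z" "R z - q < d"
        by (rule fractions_dense[of "R z" d]) (use range[OF z] d(1) in auto)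
       have "dist (V q z) (V (R z) z) < inverse (real (Suc m))" using q mem by (intro d(2)) (auto simp: dist_real_def)
       moreover have "V q z <= b - inverse (real (Suc m))" using q n by (intro m) auto
       ultimately show False using hit by (simp add: dist_real_def)
      qed
     qed
     have "{z \<in> space (paths T). \<exists>m::nat. \<forall>q\<in>fractions \<inter> {0..a}. V q z <= b - inverse (real (Suc m))} \<in> sets (paths T)"
     proof (intro sets.sets_Collect_countable_Ex sets.sets_Collect_countable_All')
      show "{z \<in> space (paths T). V q z <= b - inverse (real (Suc m))} \<in> sets (paths T)"
       if "q \<in> fractions \<inter> {0..a}" for q m
       by (rule borel_measurable_le[OF continuous_adaptedD(1)[OF V] borel_measurable_const]) (use that a in auto)
      show "countable (fractions \<inter> {0..a})" by (intro countable_Int1 countable_fractions)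
     qed
     then show ?thesis using iff by (simp cong: conj_cong)
    qed
   qed
  qed
 qed
qed

lemma continuous_adapted_add:
 fixes f g :: "real => ('d::finite) path => real"
 assumes f: "continuous_adapted T S f" and g: "continuous_adapted T S g"
 shows "continuous_adapted T S (%s z. f s z + g s z)"
 unfolding continuous_adapted_def
proof (intro conjI ballI impI)
 show "(%z. f s z + g s z) \<in> borel_measurable (paths T)" if "s \<in> {0..S}" for s
  using continuous_adaptedD(1)[OF f, of s] continuous_adaptedD(1)[OF g, of s] that by simp
 show "continuous_on {0..S} (%s. f s z + g s z)" if "z \<in> Omega T" for z
  by (rule continuous_on_add[OF continuous_adaptedD(2)[OF f that] continuous_adaptedD(2)[OF g that]])
 show "f s z + g s z = f s z' + g s z'" if "s \<in> {0..S}" "z \<in> Omega T" "z' \<in> Omega T" "\<forall>r\<in>{0..s}. z r = z' r" for s z z'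
  using continuous_adaptedD(3)[OF f _ _ that(2,3)] continuous_adaptedD(3)[OF g _ _ that(2,3)] that(1,4) by simp
qed

lemma continuous_adapted_norm_diff:
 fixes f :: "real => ('d::finite) path => 'e::euclidean_space"
 assumes f: "continuous_adapted T S f"
 shows "continuous_adapted T S (%s z. norm (f s z - c))"
 unfolding continuous_adapted_def
proof (intro conjI ballI impI)
 show "(%z. norm (f s z - c)) \<in> borel_measurable (paths T)" if "s \<in> {0..S}" for s
  using continuous_adaptedD(1)[OF f, of s] that by simp
 show "continuous_on {0..S} (%s. norm (f s z - c))" if "z \<in> Omega T" for z
  by (intro continuous_on_norm continuous_on_diff continuous_on_const continuous_adaptedD(2)[OF f that])
 show "norm (f s z - c) = norm (f s z' - c)" if "s \<in> {0..S}" "z \<in> Omega T" "z' \<in> Omega T" "\<forall>r\<in>{0..s}. z r = z' r" for s z z'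
  using continuous_adaptedD(3)[OF f _ _ that(2,3)] that(1,4) by simp
qed

lemma continuous_adapted_id:
 assumes "S <= T"
 shows "continuous_adapted T S (%s (z :: ('d::finite) path). z s)"
 unfolding continuous_adapted_def
proof (intro conjI ballI impI)
 show "(%z :: 'd path. z s) \<in> borel_measurable (paths T)" if "s \<in> {0..S}" for s
  by (rule coordinate_measurable) (use that assms in auto)
 show "continuous_on {0..S} z" if "z \<in> Omega T" for z :: "'d path"
  by (rule continuous_on_subset[OF OmegaD(1)[OF that]]) (use assms in auto)
qed simp

lemma shift_process_0:
 assumes "continuous_adapted T T Y" "0 <= t" "t <= T" "w \<in> Omega T" "z \<in> Omega T"
 shows "shift_process T t w Y 0 z = Y t w"
 unfolding shift_process_def add_0_right
 by (rule continuous_adaptedD(3)[OF assms(1-3) concat_path_in_Omega[OF assms(2-5)] assms(4)])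
  (use assms in "simp add: concat_path_before")

context path_sde
begin

theorem drift_nonneg:
 assumes g: "g \<in> C0 T" and dec: "smooth_decomp T law g L Z" and t: "0 <= t" "t < T" and w: "w \<in> Omega T"
  and h: "h \<in> pos_stops t"
  and E: "!!R. R \<in> stopping_times_upto T h ==> integrable (law t w) (SV t w g R) \<and>
   g t w <= EV t w g R"
 shows "0 <= L t w"
proof (rule ccontr)
 assume neg: "\<not> 0 <= L t w"
 \<comment> \<open>Half the size of the drift: as long as the drift deviates from
   \<open>L t w = - 2 * y\<close> by at most \<open>y\<close>, it is at most
   \<open>- y\<close>.\<close>
 define y where "y = - L t w / 2"
 have y: "y > 0" using neg by (simp add: y_def)
 have tT: "t <= T" and tm: "t \<in> {0..T}" using t by auto
 interpret P: prob_space "law t w" by (rule prob_space_law[OF t(1) tT w])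
 have ca: "continuous_adapted T T L" "continuous_adapted T T Z" "continuous_adapted T T g"
  using dec g C0_continuous_adapted[OF T_pos] unfolding smooth_decomp_def by blast+
 define a where "a = shift_process T t w L"
 define b where "b = shift_process T t w Z"
 define s where "s = shift_process T t w \<sigma>"
 define f where "f = shift_process T t w g"
 have cas: "continuous_adapted T (T - t) a" "continuous_adapted T (T - t) b" "continuous_adapted T (T - t) s" "continuous_adapted T (T - t) f"
  unfolding a_def b_def s_def f_def by (rule continuous_adapted_shift[OF _ t(1) tT w], rule ca coeff_ca)+
 have z0: "a 0 z = L t w" "b 0 z = Z t w" "s 0 z = \<sigma> t w" "f 0 z = g t w" if "z \<in> Omega T" for z
  unfolding a_def b_def s_def f_def by (rule shift_process_0[OF _ t(1) tT w that], rule ca coeff_ca)+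
 \<comment> \<open>A sum of norms, so that one exit time bounds the path, the drift, the integrand,
   the coefficient and the process all at once.\<close>
 define V where "V r z = norm (z r) + norm (a r z - L t w) + norm (b r z - Z t w) + norm (s r z - \<sigma> t w) + norm (f r z - g t w)" for r z
 have V: "continuous_adapted T (T - t) V"
  unfolding V_def[abs_def] by (intro continuous_adapted_add continuous_adapted_norm_diff[where c=0, simplified] continuous_adapted_norm_diff cas continuous_adapted_id) (use t in simp)
 obtain R where R: "R \<in> stopping_times T" "!!z. z \<in> Omega T ==> 0 < R z \<and> R z <= T - t"
  "!!z r. z \<in> Omega T ==> 0 <= r ==> r <= R z ==> V r z <= y"
  by (rule exit_time[OF V, of y]) (use t y in "auto simp: V_def z0 OmegaD(2)")
 have hs: "h \<in> stopping_times T" "!!z. z \<in> Omega T ==> 0 < h z" using h by (auto simp: pos_stopping_times_upto_def)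
 define U where "U z = min (h z) (R z)" for z
 have U: "U \<in> stopping_times T" unfolding U_def[abs_def] by (rule stopping_times_min[OF hs(1) R(1)])
 have Upos: "0 < U z" and US: "U z <= T - t" and UR: "U z <= R z" if "z \<in> Omega T" for z
  using hs(2)[OF that] R(2)[OF that] by (auto simp: U_def)
 interpret path_sde_stopped M T W \<sigma> X t w U by unfold_locales (use t tT w U US in auto)
 have Vb: "norm (z r) <= y" "norm (a r z - L t w) <= y" "norm (b r z - Z t w) <= y" "norm (s r z - \<sigma> t w) <= y" "norm (f r z - g t w) <= y"
  if "z \<in> Omega T" "0 <= r" "r <= U z" for z r
 proof -
  have "V r z <= y" by (rule R(3)[OF that(1,2)]) (use that(3) UR[OF that(1)] in simp)
  then show "norm (z r) <= y" "norm (a r z - L t w) <= y" "norm (b r z - Z t w) <= y" "norm (s r z - \<sigma> t w) <= y" "norm (f r z - g t w) <= y"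
   unfolding V_def using norm_ge_zero[of "z r"] norm_ge_zero[of "a r z - L t w"] norm_ge_zero[of "b r z - Z t w"]
    norm_ge_zero[of "s r z - \<sigma> t w"] norm_ge_zero[of "f r z - g t w"] by linarith+
 qed
 \<comment> \<open>Bound for the integral of the drift; with the bound for the process it bounds the
   stochastic integral, as \<open>stopped_integral\<close> requires.\<close>
 define A where "A = (\<bar>L t w\<bar> + y) * T"
 define K where "K = y + norm (Z t w) + norm (\<sigma> t w) + A"
 have A0: "0 <= A" using y T_pos by (simp add: A_def)
 have "\<exists>I. stoch_integral inner (law t w) (canonical_filtration T) (T - t) canonical_process b I \<and>
    (AE z in law t w. \<forall>s\<in>{0..T - t}. shift_process T t w g s z - g t w = integral {0..s} (%r. a r z) + I s z)"
  using dec tm w unfolding smooth_decomp_def a_def b_def by blast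
 then obtain I where I: "stoch_integral inner (law t w) (canonical_filtration T) (T - t) canonical_process b I"
  and ae: "AE z in law t w. \<forall>s\<in>{0..T - t}. shift_process T t w g s z - g t w = integral {0..s} (%r. a r z) + I s z" by blast
 have K: "norm (shift_process T t w \<sigma> r z) <= K" "norm (z r) <= K" "norm (b r z) <= K" if "z \<in> Omega T" "0 <= r" "r <= U z" for z r
  using Vb[OF that] norm_triangle_ineq2[of "b r z" "Z t w"] norm_triangle_ineq2[of "s r z" "\<sigma> t w"]
   norm_ge_zero[of "Z t w"] norm_ge_zero[of "\<sigma> t w"] y A0 unfolding K_def s_def by linarith+
 have aint: "(%r. a r z) integrable_on {0..v}" if "z \<in> Omega T" "v <= T - t" for z v
  by (rule integrable_continuous_real, rule continuous_on_subset[OF continuous_adaptedD(2)[OF cas(1) that(1)]]) (use that(2) in auto)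
 have bI: "AE z in law t w. \<forall>r. 0 <= r \<and> r <= U z \<longrightarrow> \<bar>I r z\<bar> <= K"
  using ae
 proof (rule AE_mp, intro AE_I2 impI allI)
  fix z v assume "z \<in> space (law t w)" and e: "\<forall>s\<in>{0..T - t}. shift_process T t w g s z - g t w = integral {0..s} (%r. a r z) + I s z"
   and v: "0 <= v \<and> v <= U z"
  then have z: "z \<in> Omega T" and vS: "v <= T - t" using US[of z] by auto
  have "norm (integral {0..v} (%r. a r z)) <= integral {0..v} (%r. \<bar>L t w\<bar> + y)"
  proof (rule integral_norm_bound_integral[OF aint[OF z vS]])
   show "norm (a r z) <= \<bar>L t w\<bar> + y" if "r \<in> {0..v}" for r using Vb(2)[OF z, of r] that v by simp
  qed (rule integrable_continuous_real, rule continuous_on_const)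
  also have "... = (\<bar>L t w\<bar> + y) * v" using v by simp
  also have "... <= A" unfolding A_def using vS t y by (intro mult_left_mono) auto
  finally have "\<bar>integral {0..v} (%r. a r z)\<bar> <= A" by simp
  moreover have "\<bar>f v z - g t w\<bar> <= y" using Vb(5)[OF z, of v] v by simp
  moreover have "f v z - g t w = integral {0..v} (%r. a r z) + I v z" using bspec[OF e, of v] v vS by (simp add: f_def)
  ultimately show "\<bar>I v z\<bar> <= K" using norm_ge_zero[of "Z t w"] norm_ge_zero[of "\<sigma> t w"] unfolding K_def by linarith
 qed
 have SI: "integrable (law t w) (%z. I (U z) z)" "(\<integral>z. I (U z) z \<partial>law t w) = 0"
  by (rule stopped_integral[where K=K and H=b, OF _ _ _ I bI]; rule K; assumption)+
 have up: "U \<in> stopping_times_upto T h" using U by (simp add: stopping_times_upto_def U_def)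
 have Uint: "integrable (law t w) U"
 proof (rule P.integrable_const_bound[of _ "T - t"])
  show "U \<in> borel_measurable (law t w)" using U_measurable by (simp cong: measurable_cong_sets)
  show "AE z in law t w. norm (U z) <= T - t" using Upos US by (intro AE_I2) (simp add: less_imp_le)
 qed
 have "EV t w g U <= (\<integral>z. g t w - y * U z + I (U z) z \<partial>law t w)"
 proof (rule integral_mono_AE)
  show "integrable (law t w) (SV t w g U)" using E[OF up] by blast
  show "integrable (law t w) (%z. g t w - y * U z + I (U z) z)" using Uint SI(1) by simp
  show "AE z in law t w. SV t w g U z <= g t w - y * U z + I (U z) z"
   using ae
  proof (rule AE_mp, intro AE_I2 impI)
   fix z assume "z \<in> space (law t w)" and e: "\<forall>s\<in>{0..T - t}. shift_process T t w g s z - g t w = integral {0..s} (%r. a r z) + I s z"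
   then have z: "z \<in> Omega T" by simp
   have "integral {0..U z} (%r. a r z) <= integral {0..U z} (%r. - y)"
   proof (rule integral_le)
    show "(%r. a r z) integrable_on {0..U z}" by (rule aint[OF z US[OF z]])
    show "a r z <= - y" if "r \<in> {0..U z}" for r
     using Vb(2)[OF z, of r] that unfolding y_def by (simp add: abs_le_iff)
   qed (rule integrable_continuous_real, rule continuous_on_const)
   also have "... = - y * U z" using Upos[OF z] by simp
   finally show "SV t w g U z <= g t w - y * U z + I (U z) z"
    using bspec[OF e, of "U z"] Upos[OF z] US[OF z] by (simp add: stopped_value_def)
  qed
 qed
 also have "... = g t w - y * (\<integral>z. U z \<partial>law t w)"
  using Uint SI P.prob_space by simp
 finally have "y * (\<integral>z. U z \<partial>law t w) <= 0" using E[OF up] by linarith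
 then have "(\<integral>z. U z \<partial>law t w) <= 0" using y by (simp add: mult_le_0_iff)
 moreover have nn: "AE z in law t w. 0 <= U z" using Upos by (intro AE_I2) (simp add: less_imp_le)
 moreover have "0 <= (\<integral>z. U z \<partial>law t w)" by (rule integral_nonneg_AE[OF nn])
 ultimately have "AE z in law t w. U z = 0" using integral_nonneg_eq_0_iff_AE[OF Uint nn] by simp
 then have "AE z in law t w. False" 
 proof (rule AE_mp, intro AE_I2 impI)
  fix z assume "z \<in> space (law t w)" "U z = 0"
  then show False using Upos[of z] by simp
 qed
 then show False by (simp add: P.AE_const)
qed

end

section \<open>Test processes linear in time\<close>

lemma C0_const: "(%s z. a) \<in> C0 T"
 unfolding C0_def by (auto intro: exI[of _ 1])

lemma C0_sign: "\<bar>e\<bar> = 1 ==> u \<in> C0 T ==> (%s z. e *\<^sub>R u s z) \<in> C0 T"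
 unfolding C0_def by (simp flip: scaleR_diff_right)

lemma C0_add_const: "u \<in> C0 T ==> (%s z. u s z + a) \<in> C0 T"
 unfolding C0_def by simp

lemma path_norm_nonneg:
 assumes "0 <= T" "continuous_on {0..T} g"
 shows "0 <= path_norm T g"
proof -
 have "compact ((%s. norm (g s)) ` {0..T})" by (intro compact_continuous_image continuous_on_norm assms(2) compact_Icc)
 then have "bdd_above ((%s. norm (g s)) ` {0..T})" by (intro bounded_imp_bdd_above compact_imp_bounded)
 then have "norm (g 0) <= path_norm T g" unfolding path_norm_def using assms(1) by (intro cSUP_upper) auto
 then show ?thesis using norm_ge_zero[of "g 0"] by linarith
qed

lemma C0_time: "(%s z. c * s :: real) \<in> (C0 T :: (real => ('d::finite) path => real) set)"
 unfolding C0_def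
proof (intro CollectI ballI allI impI)
 fix t w and e :: real assume t: "t \<in> {0..T}" and w: "w \<in> (Omega T :: 'd path set)" and e: "e > 0"
 show "\<exists>d>0. \<forall>t'\<in>{0..T}. \<forall>w'\<in>Omega T. theta_dist T t w t' w' < d \<longrightarrow> norm (c * t - c * t') < e"
 proof (intro exI[of _ "e / (\<bar>c\<bar> + 1)"] conjI ballI impI)
  show "0 < e / (\<bar>c\<bar> + 1)" using e by simp
  fix t' w' assume t': "t' \<in> {0..T}" and w': "w' \<in> (Omega T :: 'd path set)" and d: "theta_dist T t w t' w' < e / (\<bar>c\<bar> + 1)"
  have "continuous_on {0..T} (%s. w (min t s) - w' (min t' s))"
   by (intro continuous_on_diff continuous_on_compose2[OF OmegaD(1)[OF w]] continuous_on_compose2[OF OmegaD(1)[OF w']]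
     continuous_on_min continuous_on_const continuous_on_id) (use t t' in auto)
  then have "\<bar>t - t'\<bar> <= theta_dist T t w t' w'"
   using path_norm_nonneg[of T "%s. w (min t s) - w' (min t' s)"] t by (simp add: theta_dist_def)
  then have "\<bar>t - t'\<bar> < e / (\<bar>c\<bar> + 1)" using d by simp
  then have "(\<bar>c\<bar> + 1) * \<bar>t - t'\<bar> < e" by (simp add: field_simps)
  moreover have "\<bar>c\<bar> * \<bar>t - t'\<bar> <= (\<bar>c\<bar> + 1) * \<bar>t - t'\<bar>" by (rule mult_right_mono) auto
  moreover have "norm (c * t - c * t') = \<bar>c\<bar> * \<bar>t - t'\<bar>" by (simp add: abs_mult flip: right_diff_distrib)
  ultimately show "norm (c * t - c * t') < e" by linarith
 qed
qed

lemma ucp_tendsto_cong: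
 assumes "ucp_tendsto M J Y Y0" "!!n s x. s \<in> J ==> x \<in> space M ==> norm (Y' n s x - Y0' s x) = norm (Y n s x - Y0 s x)"
 shows "ucp_tendsto M J Y' Y0'"
proof -
 have "{x \<in> space M. \<exists>s\<in>J. e < norm (Y' n s x - Y0' s x)} = {x \<in> space M. \<exists>s\<in>J. e < norm (Y n s x - Y0 s x)}" for n e
  using assms(2) by auto
 then show ?thesis using assms(1) unfolding ucp_tendsto_def by simp
qed

lemma ucp_tendsto_refl: "ucp_tendsto M J (%n. Y) Y"
 unfolding ucp_tendsto_def by (auto intro!: exI[of _ "%_. {}"])

lemma stoch_integral_sign:
 fixes B H :: "real => 'a => 'e::euclidean_space"
 assumes "stoch_integral inner M F S B H I" and e: "\<bar>e\<bar> = 1"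
 shows "stoch_integral inner M F S B (%s x. e *\<^sub>R H s x) (%s x. e * I s x)"
proof -
 obtain k p y where sp: "!!n. simple_predictable F S (k n) (p n) (y n)"
  and u1: "ucp_tendsto M {0<..S} (%n. simple_process (k n) (p n) (y n)) H"
  and u2: "ucp_tendsto M {0..S} (%n. simple_integral inner B (k n) (p n) (y n)) I"
  using assms unfolding stoch_integral_def by blast
 define y' where "y' n i x = e *\<^sub>R y n i x" for n i x
 have p1: "simple_process (k n) (p n) (y' n) s x = e *\<^sub>R simple_process (k n) (p n) (y n) s x" for n s x
  unfolding simple_process_def scaleR_sum_right y'_def by (rule sum.cong) auto
 have p2: "simple_integral inner B (k n) (p n) (y' n) s x = e * simple_integral inner B (k n) (p n) (y n) s x" for n s x
  unfolding simple_integral_def sum_distrib_left y'_def by (rule sum.cong) auto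
 have "simple_predictable F S (k n) (p n) (y' n)" for n using sp[of n] unfolding simple_predictable_def y'_def[abs_def] by auto
 moreover have "ucp_tendsto M {0<..S} (%n. simple_process (k n) (p n) (y' n)) (%s x. e *\<^sub>R H s x)"
  by (rule ucp_tendsto_cong[OF u1]) (simp add: p1 e flip: scaleR_diff_right)
 moreover have "ucp_tendsto M {0..S} (%n. simple_integral inner B (k n) (p n) (y' n)) (%s x. e * I s x)"
  by (rule ucp_tendsto_cong[OF u2]) (simp add: p2 abs_mult e flip: right_diff_distrib)
 moreover have "\<forall>s\<in>{0..S}. (%x. e * I s x) \<in> borel_measurable M" "\<forall>x\<in>space M. continuous_on {0..S} (%s. e * I s x)"
  using assms unfolding stoch_integral_def by (auto intro: continuous_on_mult_left)
 ultimately show ?thesis unfolding stoch_integral_def by (intro conjI exI[of _ k] exI[of _ p] exI[of _ y'] allI)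
qed

lemma stoch_integral_zero:
 assumes "0 <= S"
 shows "stoch_integral inner M F S B (%s x. 0 :: 'e::euclidean_space) (%s x. 0 :: real)"
 unfolding stoch_integral_def
 by (intro conjI exI[of _ "%_. 1"] exI[of _ "%_ i. if i = 0 then 0 else S"] exI[of _ "%_ _ _. 0"])
  (use assms in "simp_all add: simple_predictable_def simple_process_def[abs_def] simple_integral_def[abs_def] ucp_tendsto_refl")

lemma smooth_decomp_sign:
 fixes P :: "('d::finite) law_family"
 assumes dec: "smooth_decomp T P f L Z" and e: "\<bar>e\<bar> = 1"
 shows "smooth_decomp T P (%s z. e * f s z) (%s z. e * L s z) (%s z. e *\<^sub>R Z s z)"
 unfolding smooth_decomp_def
proof (intro conjI ballI)
 show "(%s z. e * L s z) \<in> C0 T" "(%s z. e *\<^sub>R Z s z) \<in> C0 T"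
  using dec C0_sign[OF e, of L] C0_sign[OF e, of Z] unfolding smooth_decomp_def by simp_all
 fix t and w :: "'d path" assume t: "t \<in> {0..T}" and w: "w \<in> Omega T"
 from dec t w obtain I where I: "stoch_integral inner (P t w) (canonical_filtration T) (T - t) canonical_process (shift_process T t w Z) I"
  and ae: "AE z in P t w. \<forall>s\<in>{0..T - t}. shift_process T t w f s z - f t w = integral {0..s} (%r. shift_process T t w L r z) + I s z"
  unfolding smooth_decomp_def by blast
 have "AE z in P t w. \<forall>s\<in>{0..T - t}. shift_process T t w (%s z. e * f s z) s z - e * f t w
    = integral {0..s} (%r. shift_process T t w (%s z. e * L s z) r z) + e * I s z"
  using ae
 proof (rule AE_mp, intro AE_I2 impI ballI)
  fix z s assume "\<forall>s\<in>{0..T - t}. shift_process T t w f s z - f t w = integral {0..s} (%r. shift_process T t w L r z) + I s z" "s \<in> {0..T - t}"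
  then have "e * (shift_process T t w f s z - f t w) = e * (integral {0..s} (%r. shift_process T t w L r z) + I s z)" by simp
  then show "shift_process T t w (%s z. e * f s z) s z - e * f t w = integral {0..s} (%r. shift_process T t w (%s z. e * L s z) r z) + e * I s z"
   by (simp add: shift_process_def right_diff_distrib distrib_left)
 qed
 with stoch_integral_sign[OF I e]
 show "\<exists>I. stoch_integral inner (P t w) (canonical_filtration T) (T - t) canonical_process (shift_process T t w (%s z. e *\<^sub>R Z s z)) I \<and>
   (AE z in P t w. \<forall>s\<in>{0..T - t}. shift_process T t w (%s z. e * f s z) s z - e * f t w
    = integral {0..s} (%r. shift_process T t w (%s z. e * L s z) r z) + I s z)"
  by (intro exI[of _ "%s z. e * I s z"]) (simp add: shift_process_def[abs_def])
qed

lemma smooth_decomp_add_time: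
 fixes P :: "('d::finite) law_family"
 assumes T: "T > 0" and P: "!!t w. t \<in> {0..T} ==> w \<in> Omega T ==> space (P t w) = Omega T"
  and dec: "smooth_decomp T P f D Z"
 shows "smooth_decomp T P (%s z. f s z + c * s) (%s z. D s z + c) Z"
 unfolding smooth_decomp_def
proof (intro conjI ballI)
 show L: "(%s z. D s z + c) \<in> C0 T" "Z \<in> C0 T" using dec C0_add_const unfolding smooth_decomp_def by blast+
 have D: "continuous_adapted T T D" by (rule C0_continuous_adapted[OF T]) (use dec in "simp add: smooth_decomp_def")
 fix t and w :: "'d path" assume t: "t \<in> {0..T}" and w: "w \<in> Omega T"
 from dec t w obtain I where I: "stoch_integral inner (P t w) (canonical_filtration T) (T - t) canonical_process (shift_process T t w Z) I"
  and ae: "AE w' in P t w. \<forall>s\<in>{0..T - t}. shift_process T t w f s w' - f t w = integral {0..s} (%r. shift_process T t w D r w') + I s w'"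
  unfolding smooth_decomp_def by blast
 show "\<exists>I. stoch_integral inner (P t w) (canonical_filtration T) (T - t) canonical_process (shift_process T t w Z) I \<and>
   (AE w' in P t w. \<forall>s\<in>{0..T - t}. shift_process T t w (%s z. f s z + c * s) s w' - (f t w + c * t)
    = integral {0..s} (%r. shift_process T t w (%s z. D s z + c) r w') + I s w')"
 proof (intro exI conjI, rule I)
  show "AE w' in P t w. \<forall>s\<in>{0..T - t}. shift_process T t w (%s z. f s z + c * s) s w' - (f t w + c * t)
    = integral {0..s} (%r. shift_process T t w (%s z. D s z + c) r w') + I s w'"
   using ae
  proof (rule AE_mp, intro AE_I2 impI ballI)
   fix z s assume z: "z \<in> space (P t w)" and e: "\<forall>s\<in>{0..T - t}. shift_process T t w f s z - f t w = integral {0..s} (%r. shift_process T t w D r z) + I s z"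
    and s: "s \<in> {0..T - t}"
   have "(%r. shift_process T t w D r z) integrable_on {0..s}"
    by (rule integrable_continuous_real, rule continuous_on_subset[OF continuous_adaptedD(2)[OF continuous_adapted_shift[OF D _ _ w]]])
     (use t s z P[OF t w] in auto)
   then have "integral {0..s} (%r. shift_process T t w (%s z. D s z + c) r z) = integral {0..s} (%r. shift_process T t w D r z) + c * s"
    using s unfolding shift_process_def by (subst Henstock_Kurzweil_Integration.integral_add) (auto intro: integrable_continuous_real)
   then show "shift_process T t w (%s z. f s z + c * s) s z - (f t w + c * t)
    = integral {0..s} (%r. shift_process T t w (%s z. D s z + c) r z) + I s z"
    using bspec[OF e s] by (simp add: shift_process_def algebra_simps)
  qed
 qed
qed

context path_sde
begin

lemma smooth_decomp_time: "smooth_decomp T law (%s z. c * s) (%s z. c) (%s z. 0)"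
proof -
 have "smooth_decomp T law (%s z. 0) (%s z. 0) (%s z. 0)"
  unfolding smooth_decomp_def
 proof (intro conjI ballI C0_const)
  fix t :: real and w :: "'d path" assume "t \<in> {0..T}"
  then show "\<exists>I. stoch_integral inner (law t w) (canonical_filtration T) (T - t) canonical_process (shift_process T t w (%s z. 0)) I \<and>
   (AE w' in law t w. \<forall>s\<in>{0..T - t}. shift_process T t w (%s z. 0) s w' - 0 = integral {0..s} (%r. shift_process T t w (%s z. 0) r w') + I s w')"
   using stoch_integral_zero[of "T - t"] by (intro exI[of _ "%s z. 0"]) (simp add: shift_process_def[abs_def])
 qed
 from smooth_decomp_add_time[OF T_pos _ this, of c] show ?thesis by simp
qed

lemma heat_op_decomp: "f \<in> C12 T law ==> \<exists>Z. smooth_decomp T law f (heat_op T law f) Z"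
 unfolding heat_op_def by (rule someI_ex[where P="%L. \<exists>Z. smooth_decomp T law f L Z"]) (simp add: C12_def)

lemma time_C12: "(%s z. c * s) \<in> C12 T law"
 unfolding C12_def using C0_time smooth_decomp_time by blast

text \<open>All stopped expectations of the zero process are equal, so \<open>drift_nonneg\<close>
  applies to any decomposition of it. Applied with both signs this yields uniqueness of the
  drift.\<close>

lemma zero_drift:
 assumes dec: "smooth_decomp T law (%s z. 0) L Z" and t: "0 <= t" "t < T" and w: "w \<in> Omega T"
 shows "0 <= L t w"
proof (rule drift_nonneg[OF C0_const dec t w])
 show "(%_. T - t) \<in> pos_stopping_times_upto T (%_. T - t)"
  using stopping_times_const[of "T - t" T] t by (simp add: pos_stopping_times_upto_def)
qed (simp add: stopped_value_def[abs_def] shift_process_def)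

text \<open>\<open>heat_op\<close> is an arbitrary choice among possible drifts, so its value has to
  be forced: removing \<open>c * s\<close> leaves a decomposition of the zero process, to which
  \<open>zero_drift\<close> is applied with both signs.\<close>

lemma heat_op_time:
 assumes t: "0 <= t" "t < T" and w: "w \<in> Omega T"
 shows "heat_op T law (%s z. c * s) t w = c"
proof -
 obtain Z where Z: "smooth_decomp T law (%s z. c * s) (heat_op T law (%s z. c * s)) Z" using heat_op_decomp[OF time_C12] by blast
 have sp: "space (law t w) = Omega T" for t w by simp
 have "c <= heat_op T law (%s z. c * s) t w"
  using zero_drift[OF smooth_decomp_add_time[OF T_pos sp Z, of "- c", simplified] t w] by simp
 moreover have "heat_op T law (%s z. c * s) t w <= c"
  using zero_drift[OF smooth_decomp_add_time[OF T_pos sp smooth_decomp_sign[OF Z, of "- 1"], of c, simplified] t w] by simp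
 ultimately show ?thesis by simp
qed

end

lemma continuous_adapted_add_time:
 fixes v :: "real => ('d::finite) path => real"
 assumes v: "continuous_adapted T S v"
 shows "continuous_adapted T S (%s z. v s z + c * s)"
 unfolding continuous_adapted_def
proof (intro conjI ballI impI)
 show "(%z. v t z + c * t) \<in> borel_measurable (paths T)" if "t \<in> {0..S}" for t
  using continuous_adaptedD(1)[OF v, of t] that by simp
 show "continuous_on {0..S} (%t. v t z + c * t)" if "z \<in> Omega T" for z
  by (rule continuous_on_add[OF continuous_adaptedD(2)[OF v that] continuous_on_mult_left[OF continuous_on_id]])
 show "v t z + c * t = v t z' + c * t" if "t \<in> {0..S}" "z \<in> Omega T" "z' \<in> Omega T" "\<forall>r\<in>{0..t}. z r = z' r" for t z z'
  using continuous_adaptedD(3)[OF v _ _ that(2,3)] that(1,4) by simp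
qed

section \<open>Second moments and the two equivalences\<close>

context path_sde
begin

lemma C02_L2_bounded:
 assumes u: "u \<in> C02 T law"
 shows "L2_bounded u"
 unfolding L2_bounded_def
proof (intro ballI)
 fix t and w :: "'d path" assume tT: "t \<in> {0..T}" and w: "w \<in> Omega T"
 then have t: "0 <= t" "t <= T" by auto
 let ?s = "%R z. (SV t w u R z)^2"
 have "u \<in> C0 T" using u by (simp add: C02_def)
 then have ca: "continuous_adapted T T u" by (rule C0_continuous_adapted[OF T_pos])
 define L where "L = (\<integral>\<^sup>+ z. (SUP s\<in>{0..T - t}. ennreal (\<bar>shift_process T t w u s z\<bar>^2)) \<partial>law t w)"
 have L: "L < \<infinity>" using u tT w unfolding C02_def L_def by blast
 have "integrable (law t w) (%z. ?s R z) \<and> (\<integral>z. ?s R z \<partial>law t w) <= enn2real L"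
  if R: "R \<in> stops t" for R
 proof -
  have m: "(%z. ?s R z) \<in> borel_measurable (law t w)"
   using stopped_value_measurable[OF ca t w R] by simp
  have le: "(\<integral>\<^sup>+ z. ennreal (?s R z) \<partial>law t w) <= L"
   unfolding L_def
  proof (rule nn_integral_mono)
   fix z assume "z \<in> space (law t w)"
   then have "R z \<in> {0..T - t}" using R stopping_timesD(2)[of R T z] by (simp add: stopping_times_upto_def)
   then show "ennreal (?s R z) <= (SUP s\<in>{0..T - t}. ennreal (\<bar>shift_process T t w u s z\<bar>^2))"
    by (intro SUP_upper2[of "R z"]) (simp_all add: stopped_value_def)
  qed
  have i: "integrable (law t w) (%z. ?s R z)"
   by (rule integrableI_nonneg[OF m]) (use le L in auto)
  have "(\<integral>z. ?s R z \<partial>law t w) = enn2real (\<integral>\<^sup>+ z. ennreal (?s R z) \<partial>law t w)"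
   by (rule integral_eq_nn_integral[OF m]) simp
  also have "... <= enn2real L" using le L by (intro enn2real_mono) auto
  finally show ?thesis using i by blast
 qed
 then show "\<exists>K. \<forall>R\<in>stops t.
   integrable (law t w) (%z. ?s R z) \<and> (\<integral>z. ?s R z \<partial>law t w) <= K" by blast
qed

lemma L2_bounded_sign: "\<bar>e\<bar> = 1 ==> L2_bounded v ==> L2_bounded (%s z. e * v s z)"
 unfolding L2_bounded_def stopped_value_def shift_process_def by (simp add: power_mult_distrib power2_eq_1_iff abs_if split: if_splits)

lemma stopped_value_add_time: "SV t w (%s z. v s z + c * s) R z = SV t w v R z + c * (t + R z)"
 by (simp add: stopped_value_def shift_process_def)

lemma L2_bounded_add_time:
 assumes v: "continuous_adapted T T v" "L2_bounded v"
 shows "L2_bounded (%s z. v s z + c * s)"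
 unfolding L2_bounded_def
proof (intro ballI)
 let ?v = "%s z. v s z + c * s"
 fix t and w :: "'d path" assume tT: "t \<in> {0..T}" and w: "w \<in> Omega T"
 then have t: "0 <= t" "t <= T" by auto
 interpret P: prob_space "law t w" by (rule prob_space_law[OF t w])
 obtain K where K: "!!R. R \<in> stops t ==>
   integrable (law t w) (%z. (SV t w v R z)^2) \<and> (\<integral>z. (SV t w v R z)^2 \<partial>law t w) <= K"
  using v(2) tT w unfolding L2_bounded_def by blast
 have "integrable (law t w) (%z. (SV t w ?v R z)^2) \<and>
   (\<integral>z. (SV t w ?v R z)^2 \<partial>law t w) <= 2 * K + 2 * (c * T)^2"
  if R: "R \<in> stops t" for R
 proof -
  have Rm: "R \<in> borel_measurable (law t w)"
   using R stopping_timesD(1)[of R T] by (simp add: stopping_times_upto_def cong: measurable_cong_sets)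
  have m: "SV t w ?v R \<in> borel_measurable (law t w)"
   unfolding stopped_value_add_time[abs_def] using stopped_value_measurable[OF v(1) t w R] Rm by simp
  have le: "(SV t w ?v R z)^2 <= 2 * (SV t w v R z)^2 + 2 * (c * T)^2"
   if z: "z \<in> space (law t w)" for z
  proof -
   have r: "0 <= R z" "R z <= T - t" using R z stopping_timesD(2)[of R T z] by (auto simp: stopping_times_upto_def)
   have "(a + b)^2 <= 2 * a^2 + 2 * b^2" for a b :: real using sum_squares_bound[of a b] by (simp add: power2_sum)
   then have "(SV t w ?v R z)^2 <= 2 * (SV t w v R z)^2 + 2 * (c * (t + R z))^2"
    unfolding stopped_value_add_time .
   also have "(c * (t + R z))^2 <= (c * T)^2"
    unfolding power_mult_distrib using r t by (intro mult_left_mono power_mono) auto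
   finally show ?thesis by simp
  qed
  have i: "integrable (law t w) (%z. 2 * (SV t w v R z)^2 + 2 * (c * T)^2)" using K[OF R] by simp
  have j: "integrable (law t w) (%z. (SV t w ?v R z)^2)"
   by (rule Bochner_Integration.integrable_bound[OF i]) (use m le in "auto intro!: AE_I2")
  have "(\<integral>z. (SV t w ?v R z)^2 \<partial>law t w) <= (\<integral>z. 2 * (SV t w v R z)^2 + 2 * (c * T)^2 \<partial>law t w)"
   by (rule integral_mono[OF j i le])
  also have "... <= 2 * K + 2 * (c * T)^2" using K[OF R] P.prob_space by simp
  finally show ?thesis using j by blast
 qed
 then show "\<exists>K. \<forall>R\<in>stops t.
   integrable (law t w) (%z. (SV t w ?v R z)^2) \<and>
   (\<integral>z. (SV t w ?v R z)^2 \<partial>law t w) <= K" by blast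
qed

text \<open>For each \<open>c > 0\<close> the process with slope \<open>c\<close> fits the locale
  \<open>improvable\<close>. The slope contributes at most \<open>c * T\<close> to the resulting
  inequality and is then removed.\<close>

theorem submartingale_criterion:
 assumes v: "continuous_adapted T T v" "L2_bounded v"
  and improve: "!!c t w h. c > 0 ==> 0 <= t ==> t < T ==> w \<in> Omega T ==> h \<in> pos_stops t ==>
    \<exists>R\<in>stopping_times_upto T h. v t w + c * t < EV t w (%s z. v s z + c * s) R"
  and t: "0 <= t" "t <= T" and w: "w \<in> Omega T" and R: "R \<in> stops t"
 shows "v t w <= EV t w v R"
proof -
 let ?v = "%c s z. v s z + c * s"
 interpret P: prob_space "law t w" by (rule prob_space_law[OF t w])
 have Rm: "R \<in> borel_measurable (law t w)"
  using R stopping_timesD(1)[of R T] by (simp add: stopping_times_upto_def cong: measurable_cong_sets)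
 have Rr: "0 <= R z" "R z <= T - t" if "z \<in> space (law t w)" for z
  using R that stopping_timesD(2)[of R T z] by (auto simp: stopping_times_upto_def)
 have Ri: "integrable (law t w) R"
  by (rule P.integrable_const_bound[of _ "T - t"]) (use Rm Rr in "auto intro!: AE_I2")
 have RE: "(\<integral>z. R z \<partial>law t w) <= T"
  using P.integral_le_const[OF Ri, of T] Rr t by (force intro!: AE_I2)
 have bound: "v t w <= EV t w v R + c * T" if c: "c > 0" for c
 proof -
  have Vca: "continuous_adapted T T (?v c)"
   by (rule continuous_adapted_add_time[OF v(1)])
  have "improvable M T W \<sigma> X (?v c)"
  proof (unfold_locales)
   show "continuous_adapted T T (?v c)" by (rule Vca)
   show "L2_bounded (?v c)" by (rule L2_bounded_add_time[OF v])
   show "\<exists>R\<in>stopping_times_upto T h. v t w + c * t < EV t w (?v c) R"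
    if "0 <= t" "t < T" "w \<in> Omega T" "h \<in> pos_stops t" for t w h
    by (rule improve[OF c that])
  qed
  from improvable.stopped_expectation_ge[OF this t w R]
  have "v t w + c * t <= (\<integral>z. SV t w v R z + c * (t + R z) \<partial>law t w)" unfolding stopped_value_add_time .
  also have "... = EV t w v R + c * t + c * (\<integral>z. R z \<partial>law t w)"
   using stopped_value_integrable[OF v t w R] Ri P.prob_space by (simp add: distrib_left)
  also have "... <= EV t w v R + c * t + c * T"
   using RE c by (intro add_left_mono mult_left_mono) auto
  finally show ?thesis by simp
 qed
 show ?thesis
 proof (rule field_le_epsilon)
  fix e :: real assume e: "e > 0"
  show "v t w <= EV t w v R + e" using bound[of "e / T"] e T_pos by simp
 qed
qed

lemma zero_stopping_upto:
 assumes "h \<in> stopping_times T"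
 shows "(%_. 0) \<in> stopping_times_upto T h"
 using stopping_times_const[of 0 T] stopping_timesD(2)[OF assms] T_pos by (simp add: stopping_times_upto_def)

lemma stopped_value_zero:
 fixes D :: "real => 'd path => real"
 assumes D: "continuous_adapted T T D" and t: "0 <= t" "t <= T" "w \<in> Omega T"
 shows "EV t w D (%_. 0) = D t w"
proof -
 interpret P: prob_space "law t w" by (rule prob_space_law[OF t])
 have "EV t w D (%_. 0) = (\<integral>z. D t w \<partial>law t w)"
  by (rule Bochner_Integration.integral_cong) (simp_all add: stopped_value_def shift_process_0[OF D t])
 then show ?thesis using P.prob_space by simp
qed

lemma upto_trans: "R \<in> stopping_times_upto T h ==> h \<in> pos_stops t ==> R \<in> stops t"
 unfolding stopping_times_upto_def pos_stopping_times_upto_def by (auto intro: order_trans)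

text \<open>Both equivalences at once: \<open>e = 1\<close> for subsolutions, \<open>e = -1\<close> for supersolutions. In one direction
 \<open>e f = e (f - u) + e u\<close> is no larger than its stopped expectations; in the other the test process is linear in time.\<close>

theorem martingale_iff_viscosity:
 assumes u: "u \<in> C02 T law" and e: "\<bar>e\<bar> = 1"
 shows "(\<forall>t\<in>{0..T}. \<forall>w\<in>Omega T. \<forall>R\<in>stops t. integrable (law t w) (SV t w u R) \<and> e * u t w <= e * EV t w u R) \<longleftrightarrow>
  (\<forall>t\<in>{0..<T}. \<forall>w\<in>Omega T. \<forall>f\<in>C12 T law. \<forall>h\<in>pos_stops t.
   (\<forall>R\<in>stopping_times_upto T h. integrable (law t w) (SV t w (%s z. f s z - u s z) R)) \<and>
   (\<exists>R\<in>stopping_times_upto T h. f t w - u t w = EV t w (%s z. f s z - u s z) R) \<and>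
   (\<forall>R\<in>stopping_times_upto T h. e * (f t w - u t w) <= e * EV t w (%s z. f s z - u s z) R)
   \<longrightarrow> 0 <= e * heat_op T law f t w)" (is "?mart \<longleftrightarrow> ?visc")
proof (intro iffI ballI impI)
 have u0: "u \<in> C0 T" using u by (simp add: C02_def)
 let ?D = "%f s z. f s z - u s z"
 have ee: "e = 1 \<or> e = -1" using e by linarith
 {
  fix t w f h assume m: ?mart and tT: "t \<in> {0..<T}" and w: "w \<in> Omega T" and C: "f \<in> C12 T law" and h: "h \<in> pos_stops t"
   and D: "(\<forall>R\<in>stopping_times_upto T h. integrable (law t w) (SV t w (?D f) R)) \<and>
    (\<exists>R\<in>stopping_times_upto T h. f t w - u t w = EV t w (?D f) R) \<and>
    (\<forall>R\<in>stopping_times_upto T h. e * (f t w - u t w) <= e * EV t w (?D f) R)"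
  have t: "0 <= t" "t < T" "t \<in> {0..T}" using tT by auto
  obtain Z where dec: "smooth_decomp T law f (heat_op T law f) Z" using heat_op_decomp[OF C] by blast
  have C0: "(%s z. e * f s z) \<in> C0 T" using C0_sign[OF e, of f] C by (simp add: C12_def)
  show "0 <= e * heat_op T law f t w"
  proof (rule drift_nonneg[OF C0 smooth_decomp_sign[OF dec e] t(1,2) w h])
   fix R assume R: "R \<in> stopping_times_upto T h"
   have d: "integrable (law t w) (SV t w (?D f) R)" "e * (f t w - u t w) <= e * EV t w (?D f) R"
    using D R by blast+
   have s: "integrable (law t w) (SV t w u R)" "e * u t w <= e * EV t w u R"
    using m t(3) w upto_trans[OF R h] by blast+
   have eq: "SV t w (%s z. e * f s z) R = (%z. e * (SV t w (?D f) R z + SV t w u R z))"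
    by (simp add: stopped_value_def shift_process_def fun_eq_iff)
   show "integrable (law t w) (SV t w (%s z. e * f s z) R) \<and> e * f t w <= EV t w (%s z. e * f s z) R"
    unfolding eq using d s by (simp add: distrib_left right_diff_distrib)
  qed
 next
  fix t and w :: "'d path" and R assume vis: ?visc and tT: "t \<in> {0..T}" and w: "w \<in> Omega T" and R: "R \<in> stops t"
  define v where "v s z = e * u s z" for s z
  have uca: "continuous_adapted T T u" by (rule C0_continuous_adapted[OF T_pos u0])
  have ca: "continuous_adapted T T v" using C0_continuous_adapted[OF T_pos C0_sign[OF e u0]] by (simp add: v_def[abs_def])
  have L2: "L2_bounded v" unfolding v_def[abs_def] by (rule L2_bounded_sign[OF e C02_L2_bounded[OF u]])
  have improve: "\<exists>R\<in>stopping_times_upto T h. v t w + c * t < EV t w (%s z. v s z + c * s) R"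
   if c: "c > 0" and t: "0 <= t" "t < T" and w: "w \<in> Omega T" and h: "h \<in> pos_stops t" for c t w h
  proof (rule ccontr)
   assume no: "\<not> ?thesis"
   have tT: "t <= T" and t': "t \<in> {0..<T}" using t by auto
   \<comment> \<open>If nothing improves on stopping at once, then \<open>?f\<close> is a test
     process: \<open>?f - u\<close> is \<open>- e\<close> times \<open>?V\<close>, because
     \<open>e * e = 1\<close>. Its signed drift \<open>e * (- e * c) = - c\<close> is negative,
     against the viscosity inequality.\<close>
   let ?f = "%s z. (- e * c) * s" and ?V = "%s z. v s z + c * s"
   have Vca: "continuous_adapted T T ?V" by (rule continuous_adapted_add_time[OF ca])
   have hs: "h \<in> stopping_times T" using h by (simp add: pos_stopping_times_upto_def)
   have D: "SV t w (?D ?f) R = (%z. - e * SV t w ?V R z)" for R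
    using ee by (auto simp: stopped_value_def shift_process_def v_def algebra_simps)
   have Dt: "?f t w - u t w = - e * ?V t w" using ee by (auto simp: v_def)
   have i: "integrable (law t w) (SV t w (?D ?f) R)" if "R \<in> stopping_times_upto T h" for R
    unfolding D by (intro integrable_mult_right stopped_value_integrable[OF Vca L2_bounded_add_time[OF ca L2] t(1) tT w upto_trans[OF that h]])
   have ez: "e * (- e * x) = - x" for x using ee by auto
   have "0 <= e * heat_op T law ?f t w"
   proof (rule vis[rule_format, OF t' w time_C12 h], intro conjI ballI i)
    show "\<exists>R\<in>stopping_times_upto T h. ?f t w - u t w = EV t w (?D ?f) R"
     unfolding D Dt using stopped_value_zero[OF Vca t(1) tT w] by (intro bexI[OF _ zero_stopping_upto[OF hs]]) simp
    show "e * (?f t w - u t w) <= e * EV t w (?D ?f) R" if "R \<in> stopping_times_upto T h" for R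
     unfolding D Dt integral_mult_right_zero ez neg_le_iff_le using no that by (simp add: not_less)
   qed
   then show False using heat_op_time[OF t w, of "- e * c"] c ee by auto
  qed
  have t: "0 <= t" "t <= T" using tT by auto
  have i: "integrable (law t w) (SV t w u R)" by (rule stopped_value_integrable[OF uca C02_L2_bounded[OF u] t w R])
  have "v t w <= EV t w v R" by (rule submartingale_criterion[OF ca L2 improve t w R])
  moreover have "SV t w v R = (%z. e * SV t w u R z)" by (simp add: stopped_value_def shift_process_def fun_eq_iff v_def)
  ultimately show "integrable (law t w) (SV t w u R) \<and> e * u t w <= e * EV t w u R" using i by (simp add: v_def)
 }
qed

end

theorem theorem4p10:
  fixes T :: real
    and \<sigma> :: "real \<Rightarrow> ('d::finite) path \<Rightarrow> real ^ 'd ^ 'd"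
    and M :: "'a measure"
    and W :: "real \<Rightarrow> 'a \<Rightarrow> real ^ 'd"
    and X :: "real \<Rightarrow> 'd path \<Rightarrow> 'a \<Rightarrow> 'd path"
    and P :: "real \<Rightarrow> 'd path \<Rightarrow> 'd path measure"
    and u :: "real \<Rightarrow> 'd path \<Rightarrow> real"
  assumes "T > 0"
    and "admissible_coeff T \<sigma>"
    and "brownian_motion M T W"
    and "\<And>t \<omega>. t \<in> {0..T} \<Longrightarrow> \<omega> \<in> Omega T \<Longrightarrow>
           strong_solution M W T (T - t) (shift_process T t \<omega> \<sigma>) (X t \<omega>)"
    and "P = (\<lambda>t \<omega>. distr M (canonical_filtration T T) (X t \<omega>))"
    and "u \<in> C02 T P"
  shows "(pathwise_submartingale T P u \<longleftrightarrow> viscosity_subsolution T P u) \<and>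
         (pathwise_supermartingale T P u \<longleftrightarrow> viscosity_supersolution T P u)"
proof -
 interpret prob_space M using assms(3) by (simp add: brownian_motion_def)
 interpret path_sde M T W \<sigma> X by unfold_locales (use assms in auto)
 have "P = law" unfolding assms(5) by (intro ext) (simp add: law_def)
 then have u: "u \<in> C02 T law" and P: "P = law" using assms(6) by auto
 have u0: "u \<in> C0 T" using u by (simp add: C02_def)
 \<comment> \<open>The existential horizon in the test sets becomes universal once it stands in a
   premise, which is the form of \<open>martingale_iff_viscosity\<close>.\<close>
 have *: "(\<forall>f\<in>{f \<in> A. \<exists>h\<in>H. Q f h}. R f) \<longleftrightarrow> (\<forall>f\<in>A. \<forall>h\<in>H. Q f h \<longrightarrow> R f)" for A H Q and R :: "_ => bool"
  by blast
 show ?thesis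
  unfolding P pathwise_submartingale_def pathwise_supermartingale_def viscosity_subsolution_def viscosity_supersolution_def
   lower_tests_def upper_tests_def Let_def *
  using martingale_iff_viscosity[OF u, of 1] martingale_iff_viscosity[OF u, of "- 1"] u0
  by (simp only: abs_one abs_minus_cancel mult_1 mult_minus_left neg_le_iff_le neg_le_0_iff_le neg_0_le_iff_le simp_thms)
qed

end
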